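(* Let $\mathbf{S}$ be a symmetric monoidal category, let $\mathbf{B}$ be a braided monoidal category and let $G$ be a group. There are equivalences of categories (1) $\mathbf{Alg}\left(\mathbb{D}\otimes\mathbb{P}\otimes\mathbb{G},\mathbf{S}\right)\simeq \mathbf{GMon}(\mathbf{S})$; (2) $\mathbf{Alg}\left(\mathbb{D}\otimes\mathbb{B}\otimes\mathbb{G},\mathbf{B}\right)\simeq \mathbf{GMon}(\mathbf{B})$; (3) $\mathbf{Alg}\left((\mathbb{D}\otimes\mathbb{P}\otimes\mathbb{G})^{op},\mathbf{S}\right)\simeq \mathbf{GComon}(\mathbf{S})$ and (4) $\mathbf{Alg}\left((\mathbb{D}\otimes\mathbb{B}\otimes\mathbb{G})^{op},\mathbf{B}\right)\simeq \mathbf{GComon}(\mathbf{B})$.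
   Context: For $n\geq 1$, $\underline{n}=\{1,\dots,n\}$, and $\underline{0}=\emptyset$. A PROP (resp. PROB) is a symmetric (resp. braided) strict monoidal category whose objects are the sets $\underline{n}$, $n\ge 0$, with tensor product of objects given by addition. For a PROP (resp. PROB) $T$ and a symmetric (resp. braided) monoidal category $\mathbf{C}$, $\mathbf{Alg}(T,\mathbf{C})$ is the category of symmetric (resp. braided) strict monoidal functors $T\to\mathbf{C}$ and natural transformations. $\mathbf{Mon}(\mathbf{C})$ and $\mathbf{Comon}(\mathbf{C})$ are the categories of monoids and comonoids in $\mathbf{C}$. Regarding $G$ as a one-object category, $\mathbf{GMon}(\mathbf{C})=\mathrm{Fun}(G,\mathbf{Mon}(\mathbf{C}))$ and $\mathbf{GComon}(\mathbf{C})=\mathrm{Fun}(G,\mathbf{Comon}(\mathbf{C}))$. $\mathbb{D}$ is the strict monoidal category of the sets $\underline{n}$ and order-preserving maps (tensor product: ordinal sum). Let $J_n$ be the symmetric group $\Sigma_n$ (for $\mathbb{P}$) or the braid group $B_n$ (for $\mathbb{B}$). An element of $G^n\rtimes J_n$ is regarded as an element $j\in J_n$ with a label $x_i\in G$ on the strand starting at position $i$; multiplication composes in $J_n$ and multiplies labels along strands, $(y;j')(x;j)=\big((y_{\sigma(i)}x_i)_i;\,j'j\big)$ where $\sigma$ is the underlying permutation of $j$. The category $\mathbb{D}\otimes\mathbb{J}\otimes\mathbb{G}$ ($\mathbb{J}=\mathbb{P}$ or $\mathbb{B}$) has objects $\underline{n}$, and its morphisms $\underline{n}\to\underline{m}$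 are pairs $(\phi,g)$ with $\phi\in\mathrm{Hom}_{\mathbb{D}}(\underline{n},\underline{m})$ and $g\in G^n\rtimes J_n$ (think "$\phi\circ g$"). Composition is $(\phi_2,g_2)\circ(\phi_1,g_1)=\big(\phi_2\circ (g_2)_\star(\phi_1),\ \phi_1^\star(g_2)\, g_1\big)$, where for $\phi\in\mathrm{Hom}_{\mathbb{D}}(\underline{n},\underline{m})$ and $g=(x;j)\in G^m\rtimes J_m$ with underlying permutation $\sigma$: $g_\star(\phi):\underline{n}\to\underline{m}$ is the order-preserving map whose fibre over $\sigma(i)$ has $|\phi^{-1}(i)|$ elements, and $\phi^\star(g)\in G^n\rtimes J_n$ is obtained from $g$ by replacing its $i$-th strand by $|\phi^{-1}(i)|$ parallel strands (deleting it if this number is $0$), each carrying the label $x_i$. (For permutations: $\phi^\star(\sigma)$ is the unique permutation which is order-preserving on each fibre of $\phi$ and satisfies $\sigma\circ\phi=\sigma_\star(\phi)\circ\phi^\star(\sigma)$.) The tensor product is juxtaposition, and the symmetry (resp. braiding) is that of $\mathbb{P}$ (resp. $\mathbb{B}$), given by the block permutations (resp. block braids) with trivial labels. The opposite category carries the inherited symmetric (resp. braided) monoidal structure.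
   Formalization: Morphisms of algebras are monoidal natural transformations (with plain ones the claim fails); for general S, B, functors in Alg preserve tensor up to coherent isomorphism; for strict S, B the claim is also proved with strict monoidal functors. *)

theory Defs
  imports "HOL-Algebra.Group" "HOL-Combinatorics.Permutations" "HOL-Library.FuncSet"
begin

section \<open>Categories, functors and equivalences\<close>

record ('o, 'm) cat =
  Ob :: "'o set"
  Ar :: "'m set"
  Dom :: "'m \<Rightarrow> 'o"
  Cod :: "'m \<Rightarrow> 'o"
  Id :: "'o \<Rightarrow> 'm"
  Cmp :: "'m \<Rightarrow> 'm \<Rightarrow> 'm" (infixl "\<cdot>\<index>" 65)

definition hom_set :: "('o, 'm, 'z) cat_scheme \<Rightarrow> 'o \<Rightarrow> 'o \<Rightarrow> 'm set" where
  "hom_set C a b = {f \<in> Ar C. Dom C f = a \<and> Cod C f = b}"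

locale category =
  fixes C :: "('o, 'm, 'z) cat_scheme" (structure)
  assumes Dom_Ob: "f \<in> Ar C \<Longrightarrow> Dom C f \<in> Ob C"
    and Cod_Ob: "f \<in> Ar C \<Longrightarrow> Cod C f \<in> Ob C"
    and Id_hom: "a \<in> Ob C \<Longrightarrow> Id C a \<in> hom_set C a a"
    and Cmp_hom: "f \<in> hom_set C a b \<Longrightarrow> g \<in> hom_set C b c \<Longrightarrow> g \<cdot> f \<in> hom_set C a c"
    and Cmp_Id: "f \<in> hom_set C a b \<Longrightarrow> f \<cdot> Id C a = f"
    and Id_Cmp: "f \<in> hom_set C a b \<Longrightarrow> Id C b \<cdot> f = f"
    and Cmp_assoc: "f \<in> hom_set C a b \<Longrightarrow> g \<in> hom_set C b c \<Longrightarrow> h \<in> hom_set C c d \<Longrightarrow>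
      h \<cdot> (g \<cdot> f) = (h \<cdot> g) \<cdot> f"

definition inverse_arrows :: "('o, 'm, 'z) cat_scheme \<Rightarrow> 'm \<Rightarrow> 'm \<Rightarrow> bool" where
  "inverse_arrows C f g \<longleftrightarrow> f \<in> Ar C \<and> g \<in> hom_set C (Cod C f) (Dom C f) \<and>
     g \<cdot>\<^bsub>C\<^esub> f = Id C (Dom C f) \<and> f \<cdot>\<^bsub>C\<^esub> g = Id C (Cod C f)"

definition iso_set :: "('o, 'm, 'z) cat_scheme \<Rightarrow> 'o \<Rightarrow> 'o \<Rightarrow> 'm set" where
  "iso_set C a b = {f \<in> hom_set C a b. \<exists>g. inverse_arrows C f g}"

definition inv_ar :: "('o, 'm, 'z) cat_scheme \<Rightarrow> 'm \<Rightarrow> 'm" where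
  "inv_ar C f = (THE g. inverse_arrows C f g)"

record ('o, 'm, 'p, 'n) cfunctor =
  omap :: "'o \<Rightarrow> 'p"
  amap :: "'m \<Rightarrow> 'n"

definition is_functor ::
  "('o, 'm, 'x) cat_scheme \<Rightarrow> ('p, 'n, 'y) cat_scheme \<Rightarrow>
   ('o, 'm, 'p, 'n, 'z) cfunctor_scheme \<Rightarrow> bool" where
  "is_functor A B F \<longleftrightarrow>
     (\<forall>a\<in>Ob A. omap F a \<in> Ob B) \<and>
     (\<forall>f\<in>Ar A. amap F f \<in> hom_set B (omap F (Dom A f)) (omap F (Cod A f))) \<and>
     (\<forall>a\<in>Ob A. amap F (Id A a) = Id B (omap F a)) \<and>
     (\<forall>f\<in>Ar A. \<forall>g\<in>Ar A. Cod A f = Dom A g \<longrightarrow>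
        amap F (g \<cdot>\<^bsub>A\<^esub> f) = amap F g \<cdot>\<^bsub>B\<^esub> amap F f)"

text \<open>HOL functions are total.  Where functors and natural transformations are themselves the
  elements of a category, their values outside the carriers are fixed to be \<open>undefined\<close>, so that
  HOL equality is equality of functors and of transformations.\<close>

definition extensional_functor ::
  "('o, 'm, 'x) cat_scheme \<Rightarrow> ('o, 'm, 'p, 'n, 'z) cfunctor_scheme \<Rightarrow> bool" where
  "extensional_functor A F \<longleftrightarrow> omap F \<in> extensional (Ob A) \<and> amap F \<in> extensional (Ar A)"

definition natural_transformation ::
  "('o, 'm, 'x) cat_scheme \<Rightarrow> ('p, 'n, 'y) cat_scheme \<Rightarrow>
   ('o, 'm, 'p, 'n, 'z) cfunctor_scheme \<Rightarrow> ('o, 'm, 'p, 'n, 'w) cfunctor_scheme \<Rightarrow>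
   ('o \<Rightarrow> 'n) \<Rightarrow> bool" where
  "natural_transformation A B F F' \<alpha> \<longleftrightarrow>
     (\<forall>a\<in>Ob A. \<alpha> a \<in> hom_set B (omap F a) (omap F' a)) \<and>
     (\<forall>f\<in>Ar A. \<alpha> (Cod A f) \<cdot>\<^bsub>B\<^esub> amap F f = amap F' f \<cdot>\<^bsub>B\<^esub> \<alpha> (Dom A f))"

definition natural_isomorphism ::
  "('o, 'm, 'x) cat_scheme \<Rightarrow> ('p, 'n, 'y) cat_scheme \<Rightarrow>
   ('o, 'm, 'p, 'n, 'z) cfunctor_scheme \<Rightarrow> ('o, 'm, 'p, 'n, 'w) cfunctor_scheme \<Rightarrow>
   ('o \<Rightarrow> 'n) \<Rightarrow> bool" where
  "natural_isomorphism A B F F' \<alpha> \<longleftrightarrow> natural_transformation A B F F' \<alpha> \<and>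
     (\<forall>a\<in>Ob A. \<alpha> a \<in> iso_set B (omap F a) (omap F' a))"

definition id_functor :: "('o, 'm, 'o, 'm) cfunctor" where
  "id_functor = \<lparr>omap = \<lambda>a. a, amap = \<lambda>f. f\<rparr>"

definition comp_functor ::
  "('p, 'n, 'q, 'r) cfunctor \<Rightarrow> ('o, 'm, 'p, 'n) cfunctor \<Rightarrow> ('o, 'm, 'q, 'r) cfunctor" where
  "comp_functor K F = \<lparr>omap = omap K \<circ> omap F, amap = amap K \<circ> amap F\<rparr>"

definition equivalent_categories ::
  "('o, 'm, 'x) cat_scheme \<Rightarrow> ('p, 'n, 'y) cat_scheme \<Rightarrow> bool" where
  "equivalent_categories A B \<longleftrightarrow> category A \<and> category B \<and>
     (\<exists>(F :: ('o, 'm, 'p, 'n) cfunctor) (K :: ('p, 'n, 'o, 'm) cfunctor) \<eta> \<epsilon>.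
        is_functor A B F \<and> is_functor B A K \<and>
        natural_isomorphism A A id_functor (comp_functor K F) \<eta> \<and>
        natural_isomorphism B B (comp_functor F K) id_functor \<epsilon>)"

definition functor_category ::
  "('o, 'm, 'x) cat_scheme \<Rightarrow> ('p, 'n, 'y) cat_scheme \<Rightarrow>
   (('o, 'm, 'p, 'n) cfunctor,
    ('o, 'm, 'p, 'n) cfunctor \<times> ('o, 'm, 'p, 'n) cfunctor \<times> ('o \<Rightarrow> 'n)) cat" where
  "functor_category A B =
    (let Fs = {F. is_functor A B F \<and> extensional_functor A F} in
     \<lparr>Ob = Fs,
      Ar = {(F, F', \<alpha>). F \<in> Fs \<and> F' \<in> Fs \<and> \<alpha> \<in> extensional (Ob A) \<and>
              natural_transformation A B F F' \<alpha>},
      Dom = (\<lambda>(F, F', \<alpha>). F),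
      Cod = (\<lambda>(F, F', \<alpha>). F'),
      Id = (\<lambda>F. (F, F, \<lambda>a\<in>Ob A. Id B (omap F a))),
      Cmp = (\<lambda>(F', F'', \<beta>) (F, _, \<alpha>). (F, F'', \<lambda>a\<in>Ob A. \<beta> a \<cdot>\<^bsub>B\<^esub> \<alpha> a))\<rparr>)"

definition one_object_category :: "('g, 'x) monoid_scheme \<Rightarrow> (unit, 'g) cat" where
  "one_object_category G =
     \<lparr>Ob = {()}, Ar = carrier G, Dom = (\<lambda>_. ()), Cod = (\<lambda>_. ()),
      Id = (\<lambda>_. \<one>\<^bsub>G\<^esub>), Cmp = (\<lambda>g h. g \<otimes>\<^bsub>G\<^esub> h)\<rparr>"


section \<open>Monoidal, braided and symmetric categories\<close>

record ('o, 'm) bmoncat = "('o, 'm) cat" +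
  Tob :: "'o \<Rightarrow> 'o \<Rightarrow> 'o" (infixr "\<odot>\<index>" 70)
  Tar :: "'m \<Rightarrow> 'm \<Rightarrow> 'm" (infixr "\<star>\<index>" 70)
  Unit :: "'o"
  Assoc :: "'o \<Rightarrow> 'o \<Rightarrow> 'o \<Rightarrow> 'm"
  LUnit :: "'o \<Rightarrow> 'm"
  RUnit :: "'o \<Rightarrow> 'm"
  Braid :: "'o \<Rightarrow> 'o \<Rightarrow> 'm"

locale monoidal_category = category C for C :: "('o, 'm, 'z) bmoncat_scheme" (structure) +
  assumes Unit_Ob: "Unit C \<in> Ob C"
    and Tob_Ob: "a \<in> Ob C \<Longrightarrow> b \<in> Ob C \<Longrightarrow> a \<odot> b \<in> Ob C"
    and Tar_hom: "f \<in> hom_set C a b \<Longrightarrow> f' \<in> hom_set C a' b' \<Longrightarrow>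
      f \<star> f' \<in> hom_set C (a \<odot> a') (b \<odot> b')"
    and Tar_Id: "a \<in> Ob C \<Longrightarrow> b \<in> Ob C \<Longrightarrow> Id C a \<star> Id C b = Id C (a \<odot> b)"
    and interchange: "f \<in> hom_set C a b \<Longrightarrow> g \<in> hom_set C b c \<Longrightarrow>
      f' \<in> hom_set C a' b' \<Longrightarrow> g' \<in> hom_set C b' c' \<Longrightarrow>
      (g \<cdot> f) \<star> (g' \<cdot> f') = (g \<star> g') \<cdot> (f \<star> f')"
    and Assoc_iso: "a \<in> Ob C \<Longrightarrow> b \<in> Ob C \<Longrightarrow> c \<in> Ob C \<Longrightarrow>
      Assoc C a b c \<in> iso_set C ((a \<odot> b) \<odot> c) (a \<odot> (b \<odot> c))"
    and Assoc_natural: "f \<in> hom_set C a a' \<Longrightarrow> g \<in> hom_set C b b' \<Longrightarrow> h \<in> hom_set C c c' \<Longrightarrow>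
      Assoc C a' b' c' \<cdot> ((f \<star> g) \<star> h) = (f \<star> (g \<star> h)) \<cdot> Assoc C a b c"
    and LUnit_iso: "a \<in> Ob C \<Longrightarrow> LUnit C a \<in> iso_set C (Unit C \<odot> a) a"
    and LUnit_natural: "f \<in> hom_set C a b \<Longrightarrow>
      LUnit C b \<cdot> (Id C (Unit C) \<star> f) = f \<cdot> LUnit C a"
    and RUnit_iso: "a \<in> Ob C \<Longrightarrow> RUnit C a \<in> iso_set C (a \<odot> Unit C) a"
    and RUnit_natural: "f \<in> hom_set C a b \<Longrightarrow>
      RUnit C b \<cdot> (f \<star> Id C (Unit C)) = f \<cdot> RUnit C a"
    and pentagon: "a \<in> Ob C \<Longrightarrow> b \<in> Ob C \<Longrightarrow> c \<in> Ob C \<Longrightarrow> d \<in> Ob C \<Longrightarrow>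
      Assoc C a b (c \<odot> d) \<cdot> Assoc C (a \<odot> b) c d =
      (Id C a \<star> Assoc C b c d) \<cdot> Assoc C a (b \<odot> c) d \<cdot> (Assoc C a b c \<star> Id C d)"
    and triangle: "a \<in> Ob C \<Longrightarrow> b \<in> Ob C \<Longrightarrow>
      (Id C a \<star> LUnit C b) \<cdot> Assoc C a (Unit C) b = RUnit C a \<star> Id C b"

locale braided_monoidal_category = monoidal_category +
  assumes Braid_iso: "a \<in> Ob C \<Longrightarrow> b \<in> Ob C \<Longrightarrow> Braid C a b \<in> iso_set C (a \<odot> b) (b \<odot> a)"
    and Braid_natural: "f \<in> hom_set C a a' \<Longrightarrow> g \<in> hom_set C b b' \<Longrightarrow>
      Braid C a' b' \<cdot> (f \<star> g) = (g \<star> f) \<cdot> Braid C a b"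
    and hexagon1: "a \<in> Ob C \<Longrightarrow> b \<in> Ob C \<Longrightarrow> c \<in> Ob C \<Longrightarrow>
      Assoc C b c a \<cdot> Braid C a (b \<odot> c) \<cdot> Assoc C a b c =
      (Id C b \<star> Braid C a c) \<cdot> Assoc C b a c \<cdot> (Braid C a b \<star> Id C c)"
    and hexagon2: "a \<in> Ob C \<Longrightarrow> b \<in> Ob C \<Longrightarrow> c \<in> Ob C \<Longrightarrow>
      inv_ar C (Assoc C c a b) \<cdot> Braid C (a \<odot> b) c \<cdot> inv_ar C (Assoc C a b c) =
      (Braid C a c \<star> Id C b) \<cdot> inv_ar C (Assoc C a c b) \<cdot> (Id C a \<star> Braid C b c)"

locale symmetric_monoidal_category = braided_monoidal_category +
  assumes symmetry: "a \<in> Ob C \<Longrightarrow> b \<in> Ob C \<Longrightarrow> Braid C b a \<cdot> Braid C a b = Id C (a \<odot> b)"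

definition strict_monoidal :: "('o, 'm, 'z) bmoncat_scheme \<Rightarrow> bool" where
  "strict_monoidal C \<longleftrightarrow>
     (\<forall>a\<in>Ob C. \<forall>b\<in>Ob C. \<forall>c\<in>Ob C. (a \<odot>\<^bsub>C\<^esub> b) \<odot>\<^bsub>C\<^esub> c = a \<odot>\<^bsub>C\<^esub> (b \<odot>\<^bsub>C\<^esub> c) \<and>
        Assoc C a b c = Id C (a \<odot>\<^bsub>C\<^esub> (b \<odot>\<^bsub>C\<^esub> c))) \<and>
     (\<forall>a\<in>Ob C. Unit C \<odot>\<^bsub>C\<^esub> a = a \<and> a \<odot>\<^bsub>C\<^esub> Unit C = a \<and>
        LUnit C a = Id C a \<and> RUnit C a = Id C a)"

text \<open>The opposite keeps the tensor product and inverts all structure isomorphisms; in particular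
  the braiding of the opposite at \<open>(a, b)\<close>, which has to be an arrow \<open>b \<odot> a \<rightarrow> a \<odot> b\<close> of \<open>C\<close>,
  is the inverse of the braiding of \<open>C\<close> at \<open>(a, b)\<close>.\<close>

definition op_cat :: "('o, 'm) bmoncat \<Rightarrow> ('o, 'm) bmoncat" where
  "op_cat C =
     \<lparr>Ob = Ob C, Ar = Ar C, Dom = Cod C, Cod = Dom C, Id = Id C,
      Cmp = (\<lambda>g f. f \<cdot>\<^bsub>C\<^esub> g),
      Tob = Tob C, Tar = Tar C, Unit = Unit C,
      Assoc = (\<lambda>a b c. inv_ar C (Assoc C a b c)),
      LUnit = (\<lambda>a. inv_ar C (LUnit C a)),
      RUnit = (\<lambda>a. inv_ar C (RUnit C a)),
      Braid = (\<lambda>a b. inv_ar C (Braid C a b))\<rparr>"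


section \<open>Braided monoidal functors and algebras\<close>

record ('o, 'm, 'p, 'n) mfunctor = "('o, 'm, 'p, 'n) cfunctor" +
  fmult :: "'o \<times> 'o \<Rightarrow> 'n"
  funit :: "'n"

definition braided_monoidal_functor ::
  "('o, 'm) bmoncat \<Rightarrow> ('p, 'n) bmoncat \<Rightarrow> ('o, 'm, 'p, 'n) mfunctor \<Rightarrow> bool" where
  "braided_monoidal_functor A B F \<longleftrightarrow> is_functor A B F \<and>
     funit F \<in> iso_set B (Unit B) (omap F (Unit A)) \<and>
     (\<forall>a\<in>Ob A. \<forall>b\<in>Ob A.
        fmult F (a, b) \<in> iso_set B (omap F a \<odot>\<^bsub>B\<^esub> omap F b) (omap F (a \<odot>\<^bsub>A\<^esub> b))) \<and>
     (\<forall>f\<in>Ar A. \<forall>g\<in>Ar A.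
        fmult F (Cod A f, Cod A g) \<cdot>\<^bsub>B\<^esub> (amap F f \<star>\<^bsub>B\<^esub> amap F g) =
        amap F (f \<star>\<^bsub>A\<^esub> g) \<cdot>\<^bsub>B\<^esub> fmult F (Dom A f, Dom A g)) \<and>
     (\<forall>a\<in>Ob A. \<forall>b\<in>Ob A. \<forall>c\<in>Ob A.
        fmult F (a, b \<odot>\<^bsub>A\<^esub> c) \<cdot>\<^bsub>B\<^esub> (Id B (omap F a) \<star>\<^bsub>B\<^esub> fmult F (b, c)) \<cdot>\<^bsub>B\<^esub>
          Assoc B (omap F a) (omap F b) (omap F c) =
        amap F (Assoc A a b c) \<cdot>\<^bsub>B\<^esub> fmult F (a \<odot>\<^bsub>A\<^esub> b, c) \<cdot>\<^bsub>B\<^esub>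
          (fmult F (a, b) \<star>\<^bsub>B\<^esub> Id B (omap F c))) \<and>
     (\<forall>a\<in>Ob A.
        amap F (LUnit A a) \<cdot>\<^bsub>B\<^esub> fmult F (Unit A, a) \<cdot>\<^bsub>B\<^esub> (funit F \<star>\<^bsub>B\<^esub> Id B (omap F a)) =
        LUnit B (omap F a)) \<and>
     (\<forall>a\<in>Ob A.
        amap F (RUnit A a) \<cdot>\<^bsub>B\<^esub> fmult F (a, Unit A) \<cdot>\<^bsub>B\<^esub> (Id B (omap F a) \<star>\<^bsub>B\<^esub> funit F) =
        RUnit B (omap F a)) \<and>
     (\<forall>a\<in>Ob A. \<forall>b\<in>Ob A.
        fmult F (b, a) \<cdot>\<^bsub>B\<^esub> Braid B (omap F a) (omap F b) =
        amap F (Braid A a b) \<cdot>\<^bsub>B\<^esub> fmult F (a, b))"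

definition strict_functor ::
  "('o, 'm) bmoncat \<Rightarrow> ('p, 'n) bmoncat \<Rightarrow> ('o, 'm, 'p, 'n) mfunctor \<Rightarrow> bool" where
  "strict_functor A B F \<longleftrightarrow>
     omap F (Unit A) = Unit B \<and> funit F = Id B (Unit B) \<and>
     (\<forall>a\<in>Ob A. \<forall>b\<in>Ob A. omap F (a \<odot>\<^bsub>A\<^esub> b) = omap F a \<odot>\<^bsub>B\<^esub> omap F b \<and>
        fmult F (a, b) = Id B (omap F a \<odot>\<^bsub>B\<^esub> omap F b))"

definition monoidal_transformation ::
  "('o, 'm) bmoncat \<Rightarrow> ('p, 'n) bmoncat \<Rightarrow>
   ('o, 'm, 'p, 'n) mfunctor \<Rightarrow> ('o, 'm, 'p, 'n) mfunctor \<Rightarrow> ('o \<Rightarrow> 'n) \<Rightarrow> bool" where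
  "monoidal_transformation A B F F' \<alpha> \<longleftrightarrow> natural_transformation A B F F' \<alpha> \<and>
     \<alpha> (Unit A) \<cdot>\<^bsub>B\<^esub> funit F = funit F' \<and>
     (\<forall>a\<in>Ob A. \<forall>b\<in>Ob A.
        \<alpha> (a \<odot>\<^bsub>A\<^esub> b) \<cdot>\<^bsub>B\<^esub> fmult F (a, b) = fmult F' (a, b) \<cdot>\<^bsub>B\<^esub> (\<alpha> a \<star>\<^bsub>B\<^esub> \<alpha> b))"

text \<open>\<open>Alg_on P T C\<close>: braided monoidal functors \<open>T \<rightarrow> C\<close> satisfying \<open>P\<close> and monoidal natural
  transformations.  A symmetric monoidal functor is a braided monoidal functor between symmetric
  monoidal categories, so the same definition serves PROPs and PROBs.\<close>

definition Alg_on ::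
  "(('o, 'm, 'p, 'n) mfunctor \<Rightarrow> bool) \<Rightarrow> ('o, 'm) bmoncat \<Rightarrow> ('p, 'n) bmoncat \<Rightarrow>
   (('o, 'm, 'p, 'n) mfunctor,
    ('o, 'm, 'p, 'n) mfunctor \<times> ('o, 'm, 'p, 'n) mfunctor \<times> ('o \<Rightarrow> 'n)) cat" where
  "Alg_on P T C =
    (let Fs = {F. braided_monoidal_functor T C F \<and> P F \<and> extensional_functor T F \<and>
                  fmult F \<in> extensional (Ob T \<times> Ob T)} in
     \<lparr>Ob = Fs,
      Ar = {(F, F', \<alpha>). F \<in> Fs \<and> F' \<in> Fs \<and> \<alpha> \<in> extensional (Ob T) \<and>
              monoidal_transformation T C F F' \<alpha>},
      Dom = (\<lambda>(F, F', \<alpha>). F),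
      Cod = (\<lambda>(F, F', \<alpha>). F'),
      Id = (\<lambda>F. (F, F, \<lambda>a\<in>Ob T. Id C (omap F a))),
      Cmp = (\<lambda>(F', F'', \<beta>) (F, _, \<alpha>). (F, F'', \<lambda>a\<in>Ob T. \<beta> a \<cdot>\<^bsub>C\<^esub> \<alpha> a))\<rparr>)"

text \<open>A monoidal category \<open>C\<close> need not contain any object \<open>x\<close> with \<open>Unit C \<odot> x = x\<close>, in which case
  there is no strict monoidal functor from a PROP to \<open>C\<close> at all.  Functors preserving the
  structure on the nose are therefore the right notion of algebra for strict \<open>C\<close>
  (\<open>strict_Alg\<close>); for arbitrary \<open>C\<close> the structure is preserved up to specified coherent
  isomorphism (\<open>Alg\<close>).\<close>

definition Alg where
  "Alg T C = Alg_on (\<lambda>F. True) T C"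

definition strict_Alg where
  "strict_Alg T C = Alg_on (strict_functor T C) T C"


section \<open>Monoids and comonoids with an action of a group\<close>

definition is_monoid :: "('o, 'm) bmoncat \<Rightarrow> 'o \<times> 'm \<times> 'm \<Rightarrow> bool" where
  "is_monoid C = (\<lambda>(x, \<mu>, \<eta>). x \<in> Ob C \<and>
     \<mu> \<in> hom_set C (x \<odot>\<^bsub>C\<^esub> x) x \<and> \<eta> \<in> hom_set C (Unit C) x \<and>
     \<mu> \<cdot>\<^bsub>C\<^esub> (\<mu> \<star>\<^bsub>C\<^esub> Id C x) = \<mu> \<cdot>\<^bsub>C\<^esub> (Id C x \<star>\<^bsub>C\<^esub> \<mu>) \<cdot>\<^bsub>C\<^esub> Assoc C x x x \<and>
     \<mu> \<cdot>\<^bsub>C\<^esub> (\<eta> \<star>\<^bsub>C\<^esub> Id C x) = LUnit C x \<and>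
     \<mu> \<cdot>\<^bsub>C\<^esub> (Id C x \<star>\<^bsub>C\<^esub> \<eta>) = RUnit C x)"

definition Mon ::
  "('o, 'm) bmoncat \<Rightarrow> ('o \<times> 'm \<times> 'm, ('o \<times> 'm \<times> 'm) \<times> ('o \<times> 'm \<times> 'm) \<times> 'm) cat" where
  "Mon C =
     \<lparr>Ob = {M. is_monoid C M},
      Ar = {((x, \<mu>, \<eta>), (x', \<mu>', \<eta>'), f) | x \<mu> \<eta> x' \<mu>' \<eta>' f.
              is_monoid C (x, \<mu>, \<eta>) \<and> is_monoid C (x', \<mu>', \<eta>') \<and> f \<in> hom_set C x x' \<and>
              f \<cdot>\<^bsub>C\<^esub> \<mu> = \<mu>' \<cdot>\<^bsub>C\<^esub> (f \<star>\<^bsub>C\<^esub> f) \<and> f \<cdot>\<^bsub>C\<^esub> \<eta> = \<eta>'},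
      Dom = (\<lambda>(M, M', f). M),
      Cod = (\<lambda>(M, M', f). M'),
      Id = (\<lambda>M. (M, M, Id C (fst M))),
      Cmp = (\<lambda>(M', M'', g) (M, _, f). (M, M'', g \<cdot>\<^bsub>C\<^esub> f))\<rparr>"

definition is_comonoid :: "('o, 'm) bmoncat \<Rightarrow> 'o \<times> 'm \<times> 'm \<Rightarrow> bool" where
  "is_comonoid C = (\<lambda>(x, \<delta>, \<epsilon>). x \<in> Ob C \<and>
     \<delta> \<in> hom_set C x (x \<odot>\<^bsub>C\<^esub> x) \<and> \<epsilon> \<in> hom_set C x (Unit C) \<and>
     Assoc C x x x \<cdot>\<^bsub>C\<^esub> (\<delta> \<star>\<^bsub>C\<^esub> Id C x) \<cdot>\<^bsub>C\<^esub> \<delta> = (Id C x \<star>\<^bsub>C\<^esub> \<delta>) \<cdot>\<^bsub>C\<^esub> \<delta> \<and>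
     LUnit C x \<cdot>\<^bsub>C\<^esub> (\<epsilon> \<star>\<^bsub>C\<^esub> Id C x) \<cdot>\<^bsub>C\<^esub> \<delta> = Id C x \<and>
     RUnit C x \<cdot>\<^bsub>C\<^esub> (Id C x \<star>\<^bsub>C\<^esub> \<epsilon>) \<cdot>\<^bsub>C\<^esub> \<delta> = Id C x)"

definition Comon ::
  "('o, 'm) bmoncat \<Rightarrow> ('o \<times> 'm \<times> 'm, ('o \<times> 'm \<times> 'm) \<times> ('o \<times> 'm \<times> 'm) \<times> 'm) cat" where
  "Comon C =
     \<lparr>Ob = {M. is_comonoid C M},
      Ar = {((x, \<delta>, \<epsilon>), (x', \<delta>', \<epsilon>'), f) | x \<delta> \<epsilon> x' \<delta>' \<epsilon>' f.
              is_comonoid C (x, \<delta>, \<epsilon>) \<and> is_comonoid C (x', \<delta>', \<epsilon>') \<and> f \<in> hom_set C x x' \<and>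
              \<delta>' \<cdot>\<^bsub>C\<^esub> f = (f \<star>\<^bsub>C\<^esub> f) \<cdot>\<^bsub>C\<^esub> \<delta> \<and> \<epsilon>' \<cdot>\<^bsub>C\<^esub> f = \<epsilon>},
      Dom = (\<lambda>(M, M', f). M),
      Cod = (\<lambda>(M, M', f). M'),
      Id = (\<lambda>M. (M, M, Id C (fst M))),
      Cmp = (\<lambda>(M', M'', g) (M, _, f). (M, M'', g \<cdot>\<^bsub>C\<^esub> f))\<rparr>"

definition GMon where
  "GMon G C = functor_category (one_object_category G) (Mon C)"

definition GComon where
  "GComon G C = functor_category (one_object_category G) (Comon C)"


section \<open>Order-preserving maps and the two families of strand groups\<close>

text \<open>The object \<open>n\<close> of a PROP or PROB is encoded by the natural number \<open>n\<close>; its underlying set is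
  \<open>{1..n}\<close>.\<close>

definition D_hom :: "nat \<Rightarrow> nat \<Rightarrow> (nat \<Rightarrow> nat) set" where
  "D_hom n m = {\<phi> \<in> {1..n} \<rightarrow>\<^sub>E {1..m}. mono_on {1..n} \<phi>}"

definition fibre_card :: "nat \<Rightarrow> (nat \<Rightarrow> nat) \<Rightarrow> nat \<Rightarrow> nat" where
  "fibre_card n \<phi> i = card {k \<in> {1..n}. \<phi> k = i}"

text \<open>\<open>push n m \<sigma> \<phi>\<close> is \<open>g\<^sub>\<star>(\<phi>)\<close> for \<open>g\<close> with underlying permutation \<open>\<sigma>\<close> of \<open>{1..m}\<close>.\<close>

definition push :: "nat \<Rightarrow> nat \<Rightarrow> (nat \<Rightarrow> nat) \<Rightarrow> (nat \<Rightarrow> nat) \<Rightarrow> (nat \<Rightarrow> nat)" where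
  "push n m \<sigma> \<phi> =
     (THE \<psi>. \<psi> \<in> D_hom n m \<and> (\<forall>i\<in>{1..m}. fibre_card n \<psi> (\<sigma> i) = fibre_card n \<phi> i))"

text \<open>A family of groups \<open>J\<^sub>n\<close> over the symmetric groups.  \<open>jmul J n j' j\<close> is \<open>j'\<close> after \<open>j\<close>;
  \<open>cable J n m \<phi> j\<close> is \<open>\<phi>\<^sup>\<star>(j) \<in> J\<^sub>n\<close> for \<open>\<phi>\<close> from \<open>{1..n}\<close> to \<open>{1..m}\<close> and \<open>j \<in> J\<^sub>m\<close>;
  \<open>juxt J n m\<close> is juxtaposition of \<open>J\<^sub>n\<close> and \<open>J\<^sub>m\<close>; \<open>block J n m \<in> J\<^sub>n\<^sub>+\<^sub>m\<close> moves the first \<open>n\<close>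
  strands past the last \<open>m\<close>.\<close>

record 'j strands =
  elts :: "nat \<Rightarrow> 'j set"
  jone :: "nat \<Rightarrow> 'j"
  jmul :: "nat \<Rightarrow> 'j \<Rightarrow> 'j \<Rightarrow> 'j"
  jperm :: "'j \<Rightarrow> nat \<Rightarrow> nat"
  cable :: "nat \<Rightarrow> nat \<Rightarrow> (nat \<Rightarrow> nat) \<Rightarrow> 'j \<Rightarrow> 'j"
  juxt :: "nat \<Rightarrow> nat \<Rightarrow> 'j \<Rightarrow> 'j \<Rightarrow> 'j"
  block :: "nat \<Rightarrow> nat \<Rightarrow> 'j"

subsection \<open>Symmetric groups\<close>

definition perm_cable :: "nat \<Rightarrow> nat \<Rightarrow> (nat \<Rightarrow> nat) \<Rightarrow> (nat \<Rightarrow> nat) \<Rightarrow> (nat \<Rightarrow> nat)" where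
  "perm_cable n m \<phi> \<sigma> =
     (THE \<tau>. \<tau> permutes {1..n} \<and>
        (\<forall>i\<in>{1..n}. \<forall>k\<in>{1..n}. \<phi> i = \<phi> k \<and> i < k \<longrightarrow> \<tau> i < \<tau> k) \<and>
        (\<forall>i\<in>{1..n}. \<sigma> (\<phi> i) = push n m \<sigma> \<phi> (\<tau> i)))"

definition perm_strands :: "(nat \<Rightarrow> nat) strands" where
  "perm_strands =
     \<lparr>elts = (\<lambda>n. {\<sigma>. \<sigma> permutes {1..n}}),
      jone = (\<lambda>n. id),
      jmul = (\<lambda>n \<sigma> \<tau>. \<sigma> \<circ> \<tau>),
      jperm = (\<lambda>\<sigma>. \<sigma>),
      cable = perm_cable,
      juxt = (\<lambda>n m \<sigma> \<tau> i. if i \<le> n then \<sigma> i else n + \<tau> (i - n)),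
      block = (\<lambda>n m i. if 1 \<le> i \<and> i \<le> n then m + i
                        else if n < i \<and> i \<le> n + m then i - n else i)\<rparr>"

subsection \<open>Braid groups\<close>

text \<open>Artin's presentation.  The letter \<open>(i, True)\<close> is the generator \<open>\<sigma>\<^sub>i\<close> and \<open>(i, False)\<close> its
  inverse.  As for composition of maps, the rightmost letter of a word acts first.\<close>

type_synonym bword = "(nat \<times> bool) list"

definition bwords :: "nat \<Rightarrow> bword set" where
  "bwords n = {w. fst ` set w \<subseteq> {1..<n}}"

inductive artin :: "bword \<Rightarrow> bword \<Rightarrow> bool" where
  cancel: "artin [(i, e), (i, \<not> e)] []"
| far: "i + 2 \<le> k \<Longrightarrow> artin [(i, True), (k, True)] [(k, True), (i, True)]"
| braid: "artin [(i, True), (Suc i, True), (i, True)] [(Suc i, True), (i, True), (Suc i, True)]"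

inductive braid_eq :: "nat \<Rightarrow> bword \<Rightarrow> bword \<Rightarrow> bool" for n where
  step: "artin r s \<Longrightarrow> u @ r @ v \<in> bwords n \<Longrightarrow> u @ s @ v \<in> bwords n \<Longrightarrow>
    braid_eq n (u @ r @ v) (u @ s @ v)"
| refl: "w \<in> bwords n \<Longrightarrow> braid_eq n w w"
| sym: "braid_eq n v w \<Longrightarrow> braid_eq n w v"
| trans: "braid_eq n u v \<Longrightarrow> braid_eq n v w \<Longrightarrow> braid_eq n u w"

definition bclass :: "nat \<Rightarrow> bword \<Rightarrow> bword set" where
  "bclass n w = {v. braid_eq n w v}"

text \<open>All operations on braids below respect \<open>braid_eq\<close>, so the choice of \<open>brep\<close> is immaterial.\<close>

definition brep :: "bword set \<Rightarrow> bword" where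
  "brep b = (SOME w. w \<in> b)"

fun word_perm :: "bword \<Rightarrow> nat \<Rightarrow> nat" where
  "word_perm [] = id"
| "word_perm ((i, e) # w) = transpose i (Suc i) \<circ> word_perm w"

definition word_inv :: "bword \<Rightarrow> bword" where
  "word_inv w = rev (map (\<lambda>(i, e). (i, \<not> e)) w)"

definition word_shift :: "nat \<Rightarrow> bword \<Rightarrow> bword" where
  "word_shift d w = map (\<lambda>(i, e). (d + i, e)) w"

text \<open>The block braid \<open>a + b \<rightarrow> b + a\<close>: strand \<open>a\<close> moves over the last \<open>b\<close> strands by
  \<open>\<sigma>\<^bsub>a+b-1\<^esub> \<cdots> \<sigma>\<^bsub>a+1\<^esub> \<sigma>\<^sub>a\<close>, then strand \<open>a - 1\<close>, and so on; strand \<open>1\<close> moves last.\<close>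

definition block_word :: "nat \<Rightarrow> nat \<Rightarrow> bword" where
  "block_word a b = concat (map (\<lambda>i. map (\<lambda>k. (k, True)) (rev [i..<i + b])) [1..<Suc a])"

text \<open>\<open>cable_word c w\<close> replaces the strand of \<open>w\<close> starting at position \<open>i\<close> by \<open>c i\<close> parallel
  strands.  Just before the letter \<open>(i, e)\<close> acts, the bundle in position \<open>p\<close> has width \<open>d p\<close>, and
  the two bundles in positions \<open>i\<close> and \<open>i + 1\<close> cross.\<close>

fun cable_word :: "(nat \<Rightarrow> nat) \<Rightarrow> bword \<Rightarrow> bword" where
  "cable_word c [] = []"
| "cable_word c ((i, e) # w) =
     (let d = (\<lambda>p. c (inv_into UNIV (word_perm w) p)) in
      word_shift (\<Sum>p = 1..<i. d p)
        (if e then block_word (d i) (d (Suc i)) else word_inv (block_word (d (Suc i)) (d i)))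
      @ cable_word c w)"

definition braid_strands :: "bword set strands" where
  "braid_strands =
     \<lparr>elts = (\<lambda>n. bclass n ` bwords n),
      jone = (\<lambda>n. bclass n []),
      jmul = (\<lambda>n b' b. bclass n (brep b' @ brep b)),
      jperm = (\<lambda>b. word_perm (brep b)),
      cable = (\<lambda>n m \<phi> b. bclass n (cable_word (fibre_card n \<phi>) (brep b))),
      juxt = (\<lambda>n m b b'. bclass (n + m) (brep b @ word_shift n (brep b'))),
      block = (\<lambda>n m. bclass (n + m) (block_word n m))\<rparr>"


section \<open>The categories of G-labelled strands and order-preserving maps\<close>

text \<open>An element \<open>(x; j)\<close> of the semidirect product of \<open>G\<^sup>n\<close> and \<open>J\<^sub>n\<close> is a pair.\<close>

definition lab_elts :: "'j strands \<Rightarrow> ('g, 'x) monoid_scheme \<Rightarrow> nat \<Rightarrow> ((nat \<Rightarrow> 'g) \<times> 'j) set" where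
  "lab_elts J G n = ({1..n} \<rightarrow>\<^sub>E carrier G) \<times> elts J n"

definition lab_one :: "'j strands \<Rightarrow> ('g, 'x) monoid_scheme \<Rightarrow> nat \<Rightarrow> (nat \<Rightarrow> 'g) \<times> 'j" where
  "lab_one J G n = (\<lambda>i\<in>{1..n}. \<one>\<^bsub>G\<^esub>, jone J n)"

definition lab_mul ::
  "'j strands \<Rightarrow> ('g, 'x) monoid_scheme \<Rightarrow> nat \<Rightarrow>
   (nat \<Rightarrow> 'g) \<times> 'j \<Rightarrow> (nat \<Rightarrow> 'g) \<times> 'j \<Rightarrow> (nat \<Rightarrow> 'g) \<times> 'j" where
  "lab_mul J G n = (\<lambda>(y, j') (x, j).
     (\<lambda>i\<in>{1..n}. y (jperm J j i) \<otimes>\<^bsub>G\<^esub> x i, jmul J n j' j))"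

definition lab_push ::
  "'j strands \<Rightarrow> nat \<Rightarrow> nat \<Rightarrow> (nat \<Rightarrow> 'g) \<times> 'j \<Rightarrow> (nat \<Rightarrow> nat) \<Rightarrow> (nat \<Rightarrow> nat)" where
  "lab_push J n m = (\<lambda>(x, j) \<phi>. push n m (jperm J j) \<phi>)"

definition lab_pull ::
  "'j strands \<Rightarrow> nat \<Rightarrow> nat \<Rightarrow> (nat \<Rightarrow> nat) \<Rightarrow> (nat \<Rightarrow> 'g) \<times> 'j \<Rightarrow> (nat \<Rightarrow> 'g) \<times> 'j" where
  "lab_pull J n m \<phi> = (\<lambda>(x, j). (\<lambda>i\<in>{1..n}. x (\<phi> i), cable J n m \<phi> j))"

text \<open>An arrow \<open>n \<rightarrow> m\<close> is \<open>(n, m, \<phi>, g)\<close>.\<close>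

definition DJG ::
  "'j strands \<Rightarrow> ('g, 'x) monoid_scheme \<Rightarrow>
   (nat, nat \<times> nat \<times> (nat \<Rightarrow> nat) \<times> (nat \<Rightarrow> 'g) \<times> 'j) bmoncat" where
  "DJG J G =
    (let ident = (\<lambda>n. (n, n, \<lambda>i\<in>{1..n}. i, lab_one J G n)) in
     \<lparr>Ob = UNIV,
      Ar = {(n, m, \<phi>, g). \<phi> \<in> D_hom n m \<and> g \<in> lab_elts J G n},
      Dom = (\<lambda>(n, m, \<phi>, g). n),
      Cod = (\<lambda>(n, m, \<phi>, g). m),
      Id = ident,
      Cmp = (\<lambda>(m, l, \<phi>\<^sub>2, g\<^sub>2) (n, _, \<phi>\<^sub>1, g\<^sub>1).
        (n, l, \<lambda>i\<in>{1..n}. \<phi>\<^sub>2 (lab_push J n m g\<^sub>2 \<phi>\<^sub>1 i),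
         lab_mul J G n (lab_pull J n m \<phi>\<^sub>1 g\<^sub>2) g\<^sub>1)),
      Tob = (+),
      Tar = (\<lambda>(n, m, \<phi>, x, j) (n', m', \<phi>', x', j').
        (n + n', m + m',
         \<lambda>i\<in>{1..n + n'}. if i \<le> n then \<phi> i else m + \<phi>' (i - n),
         \<lambda>i\<in>{1..n + n'}. if i \<le> n then x i else x' (i - n),
         juxt J n n' j j')),
      Unit = 0,
      Assoc = (\<lambda>a b c. ident (a + b + c)),
      LUnit = ident,
      RUnit = ident,
      Braid = (\<lambda>a b.
        (a + b, b + a, \<lambda>i\<in>{1..a + b}. i, \<lambda>i\<in>{1..a + b}. \<one>\<^bsub>G\<^esub>, block J a b))\<rparr>)"

abbreviation "DPG \<equiv> DJG perm_strands"
abbreviation "DBG \<equiv> DJG braid_strands"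

end

theory Submission
  imports Defs
begin

text \<open>An arrow of \<open>\<D> \<otimes> \<J> \<otimes> \<G>\<close> is given by fibre cardinalities, a word in the braid generators and
  labels.  An algebra restricts to a monoid with \<open>G\<close>-action on the image of \<open>1\<close>, and since the
  category is generated by the multiplication, the unit, the group elements and the crossings, an
  algebra transformation is the same as a homomorphism of such monoids.

  Conversely, let \<open>x\<close> carry a monoid with \<open>G\<close>-action.  The tensor powers of \<open>x\<close>, with the bracketings
  absorbed into the hom-sets, form a strict braided category with objects the natural numbers.  There
  an arrow is sent to the group action, followed by the braid action, followed by the multiplications
  along the fibres.  Naturality of the braiding says that multiplications slide along braids at the
  price of cabling them, which is functoriality; the value does not depend on the braid word by the
  Artin relations, and in the symmetric case because Coxeter's relations present the symmetric group.

  For the opposite category, pass to the opposite of the target; there a comonoid is a monoid, with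
  left and right actions exchanged by inverting the group elements.\<close>

section \<open>Isomorphisms and equivalences\<close>

text \<open>Permutations are functions and braids are classes of words, and their operations involve
  definite descriptions or chosen representatives. Both families are therefore treated as quotients
  of braid words, and a monotone map is replaced by its fibre cardinalities, which determine it.
  Composition then becomes an explicit formula, the same for arrows and for their images.

  The target need not be strict, and only the tensor powers of one object are strictified. Starting
  these powers from the unit gives \<open>Unit C \<odot> x\<close> in degree one, so a monoid is
  first carried along the left unitor, and the construction recovers it up to isomorphism only.

  In the opposite, the structure isomorphisms of an algebra become their inverses and
  transformations change direction. The opposite of the target reverses once more, so in the end
  homomorphisms of comonoids keep their direction.

  The versions for strict and for arbitrary targets differ by a predicate on functors, which has to
  hold for the algebras built on tensor powers and to be compatible with the passage to
  opposites.\<close>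

definition isom :: "('o, 'm, 'z) cat_scheme \<Rightarrow> 'm \<Rightarrow> bool" where
  "isom C f \<longleftrightarrow> (\<exists>g. inverse_arrows C f g)"

lemma in_hom_set: "f \<in> hom_set C a b \<longleftrightarrow> f \<in> Ar C \<and> Dom C f = a \<and> Cod C f = b"
  by (auto simp: hom_set_def)

lemma in_iso_set: "f \<in> iso_set C a b \<longleftrightarrow> isom C f \<and> Dom C f = a \<and> Cod C f = b"
  by (auto simp: iso_set_def isom_def inverse_arrows_def in_hom_set)

lemma isom_Ar [simp]: "isom C f \<Longrightarrow> f \<in> Ar C"
  by (auto simp: isom_def inverse_arrows_def)

context category
begin

lemma Dom_Ob' [simp]: "f \<in> Ar C \<Longrightarrow> Dom C f \<in> Ob C" by (rule Dom_Ob)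
lemma Cod_Ob' [simp]: "f \<in> Ar C \<Longrightarrow> Cod C f \<in> Ob C" by (rule Cod_Ob)

lemma Id_Ar [simp]: "a \<in> Ob C \<Longrightarrow> Id C a \<in> Ar C"
  and Dom_Id [simp]: "a \<in> Ob C \<Longrightarrow> Dom C (Id C a) = a"
  and Cod_Id [simp]: "a \<in> Ob C \<Longrightarrow> Cod C (Id C a) = a"
  using Id_hom by (auto simp: in_hom_set)

lemma Cmp_Ar [simp]: "f \<in> Ar C \<Longrightarrow> g \<in> Ar C \<Longrightarrow> Cod C f = Dom C g \<Longrightarrow> g \<cdot> f \<in> Ar C"
  and Dom_Cmp [simp]: "f \<in> Ar C \<Longrightarrow> g \<in> Ar C \<Longrightarrow> Cod C f = Dom C g \<Longrightarrow> Dom C (g \<cdot> f) = Dom C f"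
  and Cod_Cmp [simp]: "f \<in> Ar C \<Longrightarrow> g \<in> Ar C \<Longrightarrow> Cod C f = Dom C g \<Longrightarrow> Cod C (g \<cdot> f) = Cod C g"
  using Cmp_hom[of f "Dom C f" "Cod C f" g "Cod C g"] by (auto simp: in_hom_set)

lemma Cmp_Id_right [simp]: "f \<in> Ar C \<Longrightarrow> Dom C f = a \<Longrightarrow> f \<cdot> Id C a = f"
  by (rule Cmp_Id) (auto simp: in_hom_set)

lemma Cmp_Id_left [simp]: "f \<in> Ar C \<Longrightarrow> Cod C f = a \<Longrightarrow> Id C a \<cdot> f = f"
  by (rule Id_Cmp) (auto simp: in_hom_set)

lemma cassoc: "f \<in> Ar C \<Longrightarrow> g \<in> Ar C \<Longrightarrow> h \<in> Ar C \<Longrightarrow> Cod C f = Dom C g \<Longrightarrow> Cod C g = Dom C h \<Longrightarrow>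
    (h \<cdot> g) \<cdot> f = h \<cdot> (g \<cdot> f)"
  by (rule Cmp_assoc[symmetric]) (auto simp: in_hom_set)

text \<open>Turns an equation between composites into a rewrite rule for right-nested composites.\<close>

lemma extend_right: "g \<cdot> f = h \<Longrightarrow> f \<in> Ar C \<Longrightarrow> g \<in> Ar C \<Longrightarrow> Cod C f = Dom C g \<Longrightarrow>
    z \<in> Ar C \<Longrightarrow> Cod C z = Dom C f \<Longrightarrow> g \<cdot> (f \<cdot> z) = h \<cdot> z"
  using cassoc[of z f g] by simp

lemma inverse_arrows_unique:
  assumes "inverse_arrows C f g" "inverse_arrows C f h" shows "g = h"
proof -
  have "g = g \<cdot> (f \<cdot> h)" using assms by (simp add: inverse_arrows_def in_hom_set)
  also have "\<dots> = (g \<cdot> f) \<cdot> h"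
    using assms by (intro cassoc[symmetric]) (auto simp: inverse_arrows_def in_hom_set)
  also have "\<dots> = h" using assms by (simp add: inverse_arrows_def in_hom_set)
  finally show ?thesis .
qed

lemma inv_ar_eq: "inverse_arrows C f g \<Longrightarrow> inv_ar C f = g"
  unfolding inv_ar_def using inverse_arrows_unique by blast

lemma inverse_arrows_inv: "isom C f \<Longrightarrow> inverse_arrows C f (inv_ar C f)"
  using inv_ar_eq by (auto simp: isom_def)

lemma inv_Ar [simp]: "isom C f \<Longrightarrow> inv_ar C f \<in> Ar C"
  and Dom_inv [simp]: "isom C f \<Longrightarrow> Dom C (inv_ar C f) = Cod C f"
  and Cod_inv [simp]: "isom C f \<Longrightarrow> Cod C (inv_ar C f) = Dom C f"
  and inv_Cmp [simp]: "isom C f \<Longrightarrow> inv_ar C f \<cdot> f = Id C (Dom C f)"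
  and Cmp_inv [simp]: "isom C f \<Longrightarrow> f \<cdot> inv_ar C f = Id C (Cod C f)"
  using inverse_arrows_inv by (auto simp: inverse_arrows_def in_hom_set)

lemma inv_Cmp_right [simp]:
  "isom C f \<Longrightarrow> z \<in> Ar C \<Longrightarrow> Cod C z = Dom C f \<Longrightarrow> inv_ar C f \<cdot> (f \<cdot> z) = z"
  using extend_right[OF inv_Cmp] by simp

lemma Cmp_inv_right [simp]:
  "isom C f \<Longrightarrow> z \<in> Ar C \<Longrightarrow> Cod C z = Cod C f \<Longrightarrow> f \<cdot> (inv_ar C f \<cdot> z) = z"
  using extend_right[OF Cmp_inv] by simp

lemma inverse_arrowsI:
  assumes "f \<in> Ar C" "g \<in> Ar C" "Dom C g = Cod C f" "Cod C g = Dom C f"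
    "g \<cdot> f = Id C (Dom C f)" "f \<cdot> g = Id C (Cod C f)"
  shows "inverse_arrows C f g"
  using assms by (auto simp: inverse_arrows_def in_hom_set)

lemma inverse_arrows_sym: "inverse_arrows C f g \<Longrightarrow> inverse_arrows C g f"
  by (auto simp: inverse_arrows_def in_hom_set)

lemma isomI: "inverse_arrows C f g \<Longrightarrow> isom C f"
  by (auto simp: isom_def)

lemma inverse_arrows_Id: "a \<in> Ob C \<Longrightarrow> inverse_arrows C (Id C a) (Id C a)"
  by (rule inverse_arrowsI) auto

lemma isom_Id [simp]: "a \<in> Ob C \<Longrightarrow> isom C (Id C a)"
  and inv_Id [simp]: "a \<in> Ob C \<Longrightarrow> inv_ar C (Id C a) = Id C a"
  using inverse_arrows_Id isomI inv_ar_eq by auto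

lemma isom_inv [simp]: "isom C f \<Longrightarrow> isom C (inv_ar C f)"
  and inv_inv [simp]: "isom C f \<Longrightarrow> inv_ar C (inv_ar C f) = f"
  using inverse_arrows_inv inverse_arrows_sym isomI inv_ar_eq by blast+

lemma inverse_arrows_Cmp:
  assumes "isom C f" "isom C g" "Cod C f = Dom C g"
  shows "inverse_arrows C (g \<cdot> f) (inv_ar C f \<cdot> inv_ar C g)"
  using assms by (intro inverse_arrowsI) (simp_all add: cassoc)

lemma isom_Cmp [simp]: "isom C f \<Longrightarrow> isom C g \<Longrightarrow> Cod C f = Dom C g \<Longrightarrow> isom C (g \<cdot> f)"
  and inv_of_Cmp: "isom C f \<Longrightarrow> isom C g \<Longrightarrow> Cod C f = Dom C g \<Longrightarrow>
    inv_ar C (g \<cdot> f) = inv_ar C f \<cdot> inv_ar C g"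
  using inverse_arrows_Cmp isomI inv_ar_eq by blast+

lemma iso_cancel_left:
  assumes "isom C f" "g \<in> Ar C" "h \<in> Ar C" "Cod C g = Dom C f" "Cod C h = Dom C f" "f \<cdot> g = f \<cdot> h"
  shows "g = h"
  using assms inv_Cmp_right by metis

lemma iso_cancel_right:
  assumes "isom C f" "g \<in> Ar C" "h \<in> Ar C" "Dom C g = Cod C f" "Dom C h = Cod C f" "g \<cdot> f = h \<cdot> f"
  shows "g = h"
proof -
  have "g = (g \<cdot> f) \<cdot> inv_ar C f" using assms(1-5) by (simp add: cassoc)
  also have "\<dots> = h" unfolding assms(6) using assms(1-5) by (simp add: cassoc)
  finally show ?thesis .
qed

text \<open>Supplies naturality for inverse structure arrows: in the opposite category, for negative
  crossings and for the inverted multiplication of an algebra.\<close>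

lemma inv_conjugate:
  assumes "isom C f" "isom C g" "a \<in> Ar C" "b \<in> Ar C"
    "Dom C a = Dom C f" "Cod C a = Dom C g" "Dom C b = Cod C f" "Cod C b = Cod C g"
    "g \<cdot> a = b \<cdot> f"
  shows "a \<cdot> inv_ar C f = inv_ar C g \<cdot> b"
proof (rule iso_cancel_left[of g])
  show "g \<cdot> (a \<cdot> inv_ar C f) = g \<cdot> (inv_ar C g \<cdot> b)"
    using assms(1-8) extend_right[OF assms(9)] by (simp add: cassoc)
qed (use assms in auto)

end

section \<open>Functors and a recognition criterion for equivalences\<close>

lemma functor_Ob: "is_functor A B F \<Longrightarrow> a \<in> Ob A \<Longrightarrow> omap F a \<in> Ob B"
  and functor_hom: "is_functor A B F \<Longrightarrow> f \<in> hom_set A a b \<Longrightarrow> amap F f \<in> hom_set B (omap F a) (omap F b)"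
  and functor_Id: "is_functor A B F \<Longrightarrow> a \<in> Ob A \<Longrightarrow> amap F (Id A a) = Id B (omap F a)"
  and functor_Cmp: "is_functor A B F \<Longrightarrow> f \<in> Ar A \<Longrightarrow> g \<in> Ar A \<Longrightarrow> Cod A f = Dom A g \<Longrightarrow>
    amap F (g \<cdot>\<^bsub>A\<^esub> f) = amap F g \<cdot>\<^bsub>B\<^esub> amap F f"
  by (auto simp: is_functor_def in_hom_set)

lemma functor_Ar: "is_functor A B F \<Longrightarrow> f \<in> Ar A \<Longrightarrow> amap F f \<in> Ar B"
  and functor_Dom: "is_functor A B F \<Longrightarrow> f \<in> Ar A \<Longrightarrow> Dom B (amap F f) = omap F (Dom A f)"
  and functor_Cod: "is_functor A B F \<Longrightarrow> f \<in> Ar A \<Longrightarrow> Cod B (amap F f) = omap F (Cod A f)"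
  by (auto simp: is_functor_def in_hom_set)

lemma functor_inverse_arrows:
  assumes "is_functor A B F" "inverse_arrows A f g" "category A" "category B"
  shows "inverse_arrows B (amap F f) (amap F g)"
proof -
  have *: "f \<in> Ar A" "g \<in> Ar A" "Dom A g = Cod A f" "Cod A g = Dom A f"
    "g \<cdot>\<^bsub>A\<^esub> f = Id A (Dom A f)" "f \<cdot>\<^bsub>A\<^esub> g = Id A (Cod A f)"
    using assms(2) by (auto simp: inverse_arrows_def in_hom_set)
  have "amap F g \<cdot>\<^bsub>B\<^esub> amap F f = Id B (omap F (Dom A f))"
    using * assms(1) functor_Cmp[OF assms(1), of f g]
      functor_Id[OF assms(1), of "Dom A f"] category.Dom_Ob[OF assms(3)] by simp
  moreover have "amap F f \<cdot>\<^bsub>B\<^esub> amap F g = Id B (omap F (Cod A f))"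
    using * assms(1) functor_Cmp[OF assms(1), of g f]
      functor_Id[OF assms(1), of "Cod A f"] category.Cod_Ob[OF assms(3)] by simp
  ultimately show ?thesis
    using * functor_Ar[OF assms(1)] functor_Dom[OF assms(1)] functor_Cod[OF assms(1)]
    by (intro category.inverse_arrowsI[OF assms(4)]) simp_all
qed

text \<open>Full faithfulness together with essential surjectivity. In this form equivalences can be
  composed and dualised without carrying quasi-inverses along.\<close>

definition weak_equivalence ::
  "('o, 'm, 'x) cat_scheme \<Rightarrow> ('p, 'n, 'y) cat_scheme \<Rightarrow> ('o, 'm, 'p, 'n) cfunctor \<Rightarrow> bool" where
  "weak_equivalence A B F \<longleftrightarrow> category A \<and> category B \<and> is_functor A B F \<and>
     (\<forall>a\<in>Ob A. \<forall>a'\<in>Ob A. bij_betw (amap F) (hom_set A a a') (hom_set B (omap F a) (omap F a'))) \<and>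
     (\<forall>b\<in>Ob B. \<exists>a\<in>Ob A. \<exists>f. f \<in> iso_set B (omap F a) b)"

text \<open>Choice provides for each \<open>b\<close> a preimage up to isomorphism; arrows are
  conjugated by the chosen isomorphisms and lifted through \<open>F\<close>. Every equation in
  \<open>A\<close> is verified after applying the faithful \<open>F\<close>.\<close>

lemma weak_equivalence_imp_equivalent:
  fixes F :: "('o, 'm, 'p, 'n) cfunctor"
  assumes "weak_equivalence A B F"
  shows "equivalent_categories A B"
proof -
  have "category A" and "category B" and F: "is_functor A B F"
    and bij: "\<And>a a'. a \<in> Ob A \<Longrightarrow> a' \<in> Ob A \<Longrightarrow>
      bij_betw (amap F) (hom_set A a a') (hom_set B (omap F a) (omap F a'))"
    and es: "\<And>b. b \<in> Ob B \<Longrightarrow> \<exists>a\<in>Ob A. \<exists>f. f \<in> iso_set B (omap F a) b"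
    using assms by (auto simp: weak_equivalence_def)
  interpret A: category A by fact
  interpret B: category B by fact
  note F_simps [simp] = functor_Ob[OF F] functor_Ar[OF F] functor_Dom[OF F] functor_Cod[OF F]
  obtain k where k: "\<And>b. b \<in> Ob B \<Longrightarrow> k b \<in> Ob A \<and> (\<exists>f. f \<in> iso_set B (omap F (k b)) b)"
    using es by metis
  then obtain e where e: "\<And>b. b \<in> Ob B \<Longrightarrow> e b \<in> iso_set B (omap F (k b)) b" by metis
  have k' [simp]: "\<And>b. b \<in> Ob B \<Longrightarrow> k b \<in> Ob A" using k by blast
  have e' [simp]: "\<And>b. b \<in> Ob B \<Longrightarrow> isom B (e b)" "\<And>b. b \<in> Ob B \<Longrightarrow> Dom B (e b) = omap F (k b)"
    "\<And>b. b \<in> Ob B \<Longrightarrow> Cod B (e b) = b"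
    using e by (auto simp: in_iso_set)
  define lift where "lift a a' = inv_into (hom_set A a a') (amap F)" for a a'
  have lift_hom: "lift a a' g \<in> hom_set A a a'" and F_lift: "amap F (lift a a' g) = g"
    if "a \<in> Ob A" "a' \<in> Ob A" "g \<in> Ar B" "Dom B g = omap F a" "Cod B g = omap F a'" for a a' g
  proof -
    have "g \<in> amap F ` hom_set A a a'"
      using bij[OF that(1,2)] that(3-5) by (simp add: bij_betw_def in_hom_set)
    then show "lift a a' g \<in> hom_set A a a'" "amap F (lift a a' g) = g"
      unfolding lift_def by (rule inv_into_into, rule f_inv_into_f)
  qed
  have lift_Ar [simp]: "lift a a' g \<in> Ar A" "Dom A (lift a a' g) = a" "Cod A (lift a a' g) = a'"
    if "a \<in> Ob A" "a' \<in> Ob A" "g \<in> Ar B" "Dom B g = omap F a" "Cod B g = omap F a'" for a a' g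
    using lift_hom[OF that] by (auto simp: in_hom_set)
  have faithful: "f = g" if "f \<in> Ar A" "g \<in> Ar A" "Dom A f = Dom A g" "Cod A f = Cod A g"
    "amap F f = amap F g" for f g
    using bij[of "Dom A g" "Cod A g"] that by (auto simp: bij_betw_def in_hom_set inj_on_def)
  define K where "K = \<lparr>omap = k,
    amap = \<lambda>g. lift (k (Dom B g)) (k (Cod B g)) (inv_ar B (e (Cod B g)) \<cdot>\<^bsub>B\<^esub> (g \<cdot>\<^bsub>B\<^esub> e (Dom B g)))\<rparr>"
  \<comment> \<open>The unit is forced by a triangle identity: its image under \<open>F\<close> must
    be inverse to the counit \<open>e\<close> at \<open>F a\<close>.\<close>
  define \<eta> where "\<eta> a = lift a (k (omap F a)) (inv_ar B (e (omap F a)))" for a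
  have K_Ar [simp]: "amap K g \<in> Ar A" "Dom A (amap K g) = k (Dom B g)" "Cod A (amap K g) = k (Cod B g)"
    if "g \<in> Ar B" for g
    using that by (simp_all add: K_def)
  have FK: "amap F (amap K g) = inv_ar B (e (Cod B g)) \<cdot>\<^bsub>B\<^esub> (g \<cdot>\<^bsub>B\<^esub> e (Dom B g))" if "g \<in> Ar B" for g
    using that by (simp add: K_def F_lift)
  have K: "is_functor B A K"
    unfolding is_functor_def
  proof (intro conjI ballI impI)
    fix b assume b: "b \<in> Ob B"
    show "omap K b \<in> Ob A" using b by (simp add: K_def)
    show "amap K (Id B b) = Id A (omap K b)"
      by (rule faithful) (use b in \<open>simp_all add: FK functor_Id[OF F] K_def[THEN arg_cong[where f = omap]]\<close>)
  next
    fix g assume g: "g \<in> Ar B"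
    show "amap K g \<in> hom_set A (omap K (Dom B g)) (omap K (Cod B g))"
      using g by (auto simp: in_hom_set K_def[THEN arg_cong[where f = omap]])
    fix h assume h: "h \<in> Ar B" "Cod B g = Dom B h"
    show "amap K (h \<cdot>\<^bsub>B\<^esub> g) = amap K h \<cdot>\<^bsub>A\<^esub> amap K g"
      by (rule faithful) (use g h in \<open>simp_all add: FK functor_Cmp[OF F] B.cassoc flip: h(2)\<close>)
  qed
  have \<eta>_Ar [simp]: "\<eta> a \<in> Ar A" "Dom A (\<eta> a) = a" "Cod A (\<eta> a) = k (omap F a)" if "a \<in> Ob A" for a
    using that by (simp_all add: \<eta>_def)
  have F\<eta>: "amap F (\<eta> a) = inv_ar B (e (omap F a))" if "a \<in> Ob A" for a
    using that by (simp add: \<eta>_def F_lift)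
  have \<eta>_iso: "isom A (\<eta> a)" if a: "a \<in> Ob A" for a
  proof -
    \<comment> \<open>Lifting the counit itself gives an inverse of the unit, again by
      faithfulness.\<close>
    define \<theta> where "\<theta> = lift (k (omap F a)) a (e (omap F a))"
    have \<theta>: "\<theta> \<in> Ar A" "Dom A \<theta> = k (omap F a)" "Cod A \<theta> = a" "amap F \<theta> = e (omap F a)"
      using a by (simp_all add: \<theta>_def F_lift)
    have "\<theta> \<cdot>\<^bsub>A\<^esub> \<eta> a = Id A a"
      by (rule faithful) (use a \<theta> in \<open>simp_all add: functor_Cmp[OF F] functor_Id[OF F] F\<eta>\<close>)
    moreover have "\<eta> a \<cdot>\<^bsub>A\<^esub> \<theta> = Id A (k (omap F a))"
      by (rule faithful) (use a \<theta> in \<open>simp_all add: functor_Cmp[OF F] functor_Id[OF F] F\<eta>\<close>)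
    ultimately show ?thesis
      using a \<theta> by (intro A.isomI[of _ \<theta>] A.inverse_arrowsI) simp_all
  qed
  have "natural_isomorphism A A id_functor (comp_functor K F) \<eta>"
    unfolding natural_isomorphism_def natural_transformation_def
  proof (intro conjI ballI)
    fix a assume a: "a \<in> Ob A"
    show "\<eta> a \<in> hom_set A (omap id_functor a) (omap (comp_functor K F) a)"
      using a by (simp add: in_hom_set id_functor_def comp_functor_def K_def)
    show "\<eta> a \<in> iso_set A (omap id_functor a) (omap (comp_functor K F) a)"
      using a \<eta>_iso by (simp add: in_iso_set id_functor_def comp_functor_def K_def)
  next
    fix f assume f: "f \<in> Ar A"
    have "\<eta> (Cod A f) \<cdot>\<^bsub>A\<^esub> f = amap K (amap F f) \<cdot>\<^bsub>A\<^esub> \<eta> (Dom A f)"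
      by (rule faithful) (use f in \<open>simp_all add: functor_Cmp[OF F] F\<eta> FK B.cassoc\<close>)
    then show "\<eta> (Cod A f) \<cdot>\<^bsub>A\<^esub> amap id_functor f = amap (comp_functor K F) f \<cdot>\<^bsub>A\<^esub> \<eta> (Dom A f)"
      by (simp add: id_functor_def comp_functor_def)
  qed
  moreover have "natural_isomorphism B B (comp_functor F K) id_functor e"
    unfolding natural_isomorphism_def natural_transformation_def
    by (auto simp: in_hom_set in_iso_set id_functor_def comp_functor_def FK
      K_def[THEN arg_cong[where f = omap]])
  ultimately show ?thesis
    unfolding equivalent_categories_def
    using F K \<open>category A\<close> \<open>category B\<close> by blast
qed

lemma weak_equivalence_comp:
  assumes F: "weak_equivalence A B F" and K: "weak_equivalence B C K"
  shows "weak_equivalence A C (comp_functor K F)"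
proof -
  have "category A" "category B" "category C" and fF: "is_functor A B F" and fK: "is_functor B C K"
    using F K by (auto simp: weak_equivalence_def)
  interpret A: category A by fact
  interpret B: category B by fact
  interpret C: category C by fact
  note [simp] = functor_Ob[OF fF] functor_Ar[OF fF] functor_Dom[OF fF] functor_Cod[OF fF]
    functor_Ob[OF fK] functor_Ar[OF fK] functor_Dom[OF fK] functor_Cod[OF fK]
  have "is_functor A C (comp_functor K F)"
    by (auto simp: is_functor_def comp_functor_def in_hom_set
      functor_Id[OF fF] functor_Id[OF fK] functor_Cmp[OF fF] functor_Cmp[OF fK])
  moreover have "bij_betw (amap (comp_functor K F)) (hom_set A a a')
      (hom_set C (omap (comp_functor K F) a) (omap (comp_functor K F) a'))"
    if "a \<in> Ob A" "a' \<in> Ob A" for a a'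
    unfolding comp_functor_def cfunctor.simps comp_def
    by (rule bij_betw_trans[of "amap F" _ "hom_set B (omap F a) (omap F a')" "amap K", unfolded comp_def])
      (use F K that in \<open>auto simp: weak_equivalence_def\<close>)
  moreover have "\<exists>a\<in>Ob A. \<exists>f. f \<in> iso_set C (omap (comp_functor K F) a) c" if c: "c \<in> Ob C" for c
  proof -
    obtain b f where b: "b \<in> Ob B" "f \<in> iso_set C (omap K b) c"
      using K c unfolding weak_equivalence_def by blast
    obtain a g where a: "a \<in> Ob A" "g \<in> iso_set B (omap F a) b"
      using F b unfolding weak_equivalence_def by blast
    have "isom C (amap K g)"
      using functor_inverse_arrows[OF fK] B.inverse_arrows_inv[of g] a \<open>category B\<close> \<open>category C\<close>
      by (auto simp: in_iso_set isom_def)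
    then have "f \<cdot>\<^bsub>C\<^esub> amap K g \<in> iso_set C (omap K (omap F a)) c"
      using a b by (auto simp: in_iso_set)
    then show ?thesis using a by (auto simp: comp_functor_def)
  qed
  ultimately show ?thesis
    unfolding weak_equivalence_def using \<open>category A\<close> \<open>category C\<close> by blast
qed

text \<open>The plain opposite, for categories of algebras and of monoids, which carry no tensor
  product here; \<open>op_cat\<close> is its monoidal counterpart.\<close>

definition cat_op :: "('o, 'm, 'z) cat_scheme \<Rightarrow> ('o, 'm) cat" where
  "cat_op C = \<lparr>Ob = Ob C, Ar = Ar C, Dom = Cod C, Cod = Dom C, Id = Id C, Cmp = (\<lambda>g f. f \<cdot>\<^bsub>C\<^esub> g)\<rparr>"

lemma cat_op_simps [simp]:
  "Ob (cat_op C) = Ob C" "Ar (cat_op C) = Ar C" "Dom (cat_op C) = Cod C" "Cod (cat_op C) = Dom C"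
  "Id (cat_op C) = Id C" "g \<cdot>\<^bsub>cat_op C\<^esub> f = f \<cdot>\<^bsub>C\<^esub> g" "hom_set (cat_op C) a b = hom_set C b a"
  by (auto simp: cat_op_def hom_set_def)

lemma inverse_arrows_cat_op: "inverse_arrows (cat_op C) f g \<longleftrightarrow> inverse_arrows C f g"
  by (auto simp: inverse_arrows_def)

lemma isom_cat_op [simp]: "isom (cat_op C) f \<longleftrightarrow> isom C f"
  by (simp add: isom_def inverse_arrows_cat_op)

lemma (in category) category_cat_op: "category (cat_op C)"
  by unfold_locales (auto simp: in_hom_set cassoc)

lemma weak_equivalence_op:
  assumes "weak_equivalence A B F"
  shows "weak_equivalence (cat_op A) (cat_op B) F"
proof -
  have "category A" "category B" and fF: "is_functor A B F"
    using assms by (auto simp: weak_equivalence_def)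
  interpret A: category A by fact
  interpret B: category B by fact
  have "is_functor (cat_op A) (cat_op B) F"
    using fF by (auto simp: is_functor_def in_hom_set)
  moreover have "\<exists>a\<in>Ob A. \<exists>f. f \<in> iso_set (cat_op B) (omap F a) b" if b: "b \<in> Ob B" for b
  proof -
    obtain a f where "a \<in> Ob A" "f \<in> iso_set B (omap F a) b"
      using assms b unfolding weak_equivalence_def by blast
    then have "inv_ar B f \<in> iso_set (cat_op B) (omap F a) b" by (auto simp: in_iso_set)
    then show ?thesis using \<open>a \<in> Ob A\<close> by blast
  qed
  ultimately show ?thesis
    using assms A.category_cat_op B.category_cat_op by (simp add: weak_equivalence_def)
qed

lemma weak_equivalenceI:
  assumes "category A" "category B" "is_functor A B F"
    and inj: "\<And>f g. f \<in> Ar A \<Longrightarrow> g \<in> Ar A \<Longrightarrow> Dom A f = Dom A g \<Longrightarrow> Cod A f = Cod A g \<Longrightarrow>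
      amap F f = amap F g \<Longrightarrow> f = g"
    and surj: "\<And>a a' g. a \<in> Ob A \<Longrightarrow> a' \<in> Ob A \<Longrightarrow> g \<in> hom_set B (omap F a) (omap F a') \<Longrightarrow>
      \<exists>f\<in>hom_set A a a'. amap F f = g"
    and es: "\<And>b. b \<in> Ob B \<Longrightarrow> \<exists>a\<in>Ob A. \<exists>f. f \<in> iso_set B (omap F a) b"
  shows "weak_equivalence A B F"
  unfolding weak_equivalence_def
proof (intro conjI ballI assms(1-3) es)
  fix a assume a: "a \<in> Ob A"
  fix a' assume a': "a' \<in> Ob A"
  show "bij_betw (amap F) (hom_set A a a') (hom_set B (omap F a) (omap F a'))"
    unfolding bij_betw_def
  proof
    show "inj_on (amap F) (hom_set A a a')" by (intro inj_onI inj) (auto simp: in_hom_set)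
    show "amap F ` hom_set A a a' = hom_set B (omap F a) (omap F a')"
      using functor_hom[OF assms(3)] surj[OF a a'] by blast
  qed
qed

text \<open>When every object is hit exactly, identities serve as the isomorphisms. Both reversals
  of direction on the way to comonoids are of this kind.\<close>

lemma weak_equivalence_isoI:
  assumes "category A" "category B" "is_functor A B F"
    and inj: "\<And>f g. f \<in> Ar A \<Longrightarrow> g \<in> Ar A \<Longrightarrow> Dom A f = Dom A g \<Longrightarrow> Cod A f = Cod A g \<Longrightarrow>
      amap F f = amap F g \<Longrightarrow> f = g"
    and surj: "\<And>a a' g. a \<in> Ob A \<Longrightarrow> a' \<in> Ob A \<Longrightarrow> g \<in> hom_set B (omap F a) (omap F a') \<Longrightarrow>
      \<exists>f\<in>hom_set A a a'. amap F f = g"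
    and onto: "\<And>b. b \<in> Ob B \<Longrightarrow> \<exists>a\<in>Ob A. omap F a = b"
  shows "weak_equivalence A B F"
proof (rule weak_equivalenceI[OF assms(1-3) inj surj])
  interpret B: category B by fact
  fix b assume b: "b \<in> Ob B"
  then have "Id B b \<in> iso_set B b b" by (simp add: in_iso_set)
  then show "\<exists>a\<in>Ob A. \<exists>f. f \<in> iso_set B (omap F a) b"
    using onto[OF b] by metis
qed


section \<open>The categories of functors, of monoids and of algebras\<close>

text \<open>The source enters only through \<open>Dom\<close> and \<open>Cod\<close> landing in
  \<open>Ob\<close>, so that the lemma serves functor categories and categories of algebras
  alike.\<close>

lemma natural_transformation_comp:
  assumes A: "\<And>f. f \<in> Ar A \<Longrightarrow> Dom A f \<in> Ob A" "\<And>f. f \<in> Ar A \<Longrightarrow> Cod A f \<in> Ob A"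
    and "category B" and F: "is_functor A B F" "is_functor A B F'" "is_functor A B F''"
    and \<alpha>: "natural_transformation A B F F' \<alpha>" and \<beta>: "natural_transformation A B F' F'' \<beta>"
  shows "natural_transformation A B F F'' (\<lambda>a\<in>Ob A. \<beta> a \<cdot>\<^bsub>B\<^esub> \<alpha> a)"
proof -
  interpret B: category B by fact
  note [simp] = A functor_Ar[OF F(1)] functor_Dom[OF F(1)] functor_Cod[OF F(1)]
    functor_Ar[OF F(2)] functor_Dom[OF F(2)] functor_Cod[OF F(2)]
    functor_Ar[OF F(3)] functor_Dom[OF F(3)] functor_Cod[OF F(3)]
  have \<alpha>' [simp]: "\<alpha> a \<in> Ar B" "Dom B (\<alpha> a) = omap F a" "Cod B (\<alpha> a) = omap F' a" if "a \<in> Ob A" for a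
    using \<alpha> that by (auto simp: natural_transformation_def in_hom_set)
  have \<beta>' [simp]: "\<beta> a \<in> Ar B" "Dom B (\<beta> a) = omap F' a" "Cod B (\<beta> a) = omap F'' a" if "a \<in> Ob A" for a
    using \<beta> that by (auto simp: natural_transformation_def in_hom_set)
  have "(\<beta> (Cod A f) \<cdot>\<^bsub>B\<^esub> \<alpha> (Cod A f)) \<cdot>\<^bsub>B\<^esub> amap F f = amap F'' f \<cdot>\<^bsub>B\<^esub> (\<beta> (Dom A f) \<cdot>\<^bsub>B\<^esub> \<alpha> (Dom A f))"
    if f: "f \<in> Ar A" for f
  proof -
    have "\<alpha> (Cod A f) \<cdot>\<^bsub>B\<^esub> amap F f = amap F' f \<cdot>\<^bsub>B\<^esub> \<alpha> (Dom A f)"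
      and \<beta>f: "\<beta> (Cod A f) \<cdot>\<^bsub>B\<^esub> amap F' f = amap F'' f \<cdot>\<^bsub>B\<^esub> \<beta> (Dom A f)"
      using \<alpha> \<beta> f by (auto simp: natural_transformation_def)
    then show ?thesis using f B.extend_right[OF \<beta>f] by (simp add: B.cassoc)
  qed
  then show ?thesis
    by (auto simp: natural_transformation_def in_hom_set)
qed

lemma category_functor_category:
  assumes "category A" "category B"
  shows "category (functor_category A B)"
proof -
  interpret A: category A by fact
  interpret B: category B by fact
  show ?thesis
  proof (unfold_locales, goal_cases)
    case (1 f) then show ?case by (auto simp: functor_category_def Let_def)
  next
    case (2 f) then show ?case by (auto simp: functor_category_def Let_def)
  next
    case (3 a) then show ?case
      by (auto simp: functor_category_def Let_def in_hom_set natural_transformation_def is_functor_def)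
  next
    case (4 f a b g c) then show ?case
      using natural_transformation_comp[OF A.Dom_Ob A.Cod_Ob assms(2)]
      by (fastforce simp: functor_category_def Let_def in_hom_set)
  next
    case (5 f a b) then show ?case
      by (auto simp: functor_category_def Let_def in_hom_set natural_transformation_def is_functor_def
        intro!: extensionalityI[where A = "Ob A"])
  next
    case (6 f a b) then show ?case
      by (auto simp: functor_category_def Let_def in_hom_set natural_transformation_def is_functor_def
        intro!: extensionalityI[where A = "Ob A"])
  next
    case (7 f a b g c h d) then show ?case
      by (auto simp: functor_category_def Let_def in_hom_set natural_transformation_def is_functor_def
        B.cassoc intro!: extensionalityI[where A = "Ob A"])
  qed
qed


section \<open>Typing rules for tensor products; the categories of monoids and of algebras\<close>

lemma (in monoidal_category) Unit_Ob' [simp]: "Unit C \<in> Ob C"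
  and Tob_Ob' [simp]: "a \<in> Ob C \<Longrightarrow> b \<in> Ob C \<Longrightarrow> a \<odot> b \<in> Ob C"
  by (rule Unit_Ob) (rule Tob_Ob)

lemma (in monoidal_category) Tar_Ar [simp]: "f \<in> Ar C \<Longrightarrow> g \<in> Ar C \<Longrightarrow> f \<star> g \<in> Ar C"
  and Dom_Tar [simp]: "f \<in> Ar C \<Longrightarrow> g \<in> Ar C \<Longrightarrow> Dom C (f \<star> g) = Dom C f \<odot> Dom C g"
  and Cod_Tar [simp]: "f \<in> Ar C \<Longrightarrow> g \<in> Ar C \<Longrightarrow> Cod C (f \<star> g) = Cod C f \<odot> Cod C g"
  using Tar_hom[of f "Dom C f" "Cod C f" g "Dom C g" "Cod C g"] by (auto simp: in_hom_set)

lemma (in monoidal_category) Tar_Id' [simp]: "a \<in> Ob C \<Longrightarrow> b \<in> Ob C \<Longrightarrow> Id C a \<star> Id C b = Id C (a \<odot> b)"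
  by (rule Tar_Id)

lemma (in monoidal_category) Tar_Cmp: "f \<in> Ar C \<Longrightarrow> g \<in> Ar C \<Longrightarrow> f' \<in> Ar C \<Longrightarrow> g' \<in> Ar C \<Longrightarrow>
    Cod C f = Dom C g \<Longrightarrow> Cod C f' = Dom C g' \<Longrightarrow>
    (g \<star> g') \<cdot> (f \<star> f') = (g \<cdot> f) \<star> (g' \<cdot> f')"
  by (rule interchange[symmetric]) (auto simp: in_hom_set)

lemma (in monoidal_category) Tar_Cmp_right: "f \<in> Ar C \<Longrightarrow> g \<in> Ar C \<Longrightarrow> f' \<in> Ar C \<Longrightarrow> g' \<in> Ar C \<Longrightarrow>
    Cod C f = Dom C g \<Longrightarrow> Cod C f' = Dom C g' \<Longrightarrow> z \<in> Ar C \<Longrightarrow> Cod C z = Dom C f \<odot> Dom C f' \<Longrightarrow>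
    (g \<star> g') \<cdot> ((f \<star> f') \<cdot> z) = ((g \<cdot> f) \<star> (g' \<cdot> f')) \<cdot> z"
  using extend_right[OF Tar_Cmp] by simp

lemma category_Mon:
  fixes C :: "('o, 'm) bmoncat" (structure)
  assumes "monoidal_category C"
  shows "category (Mon C)"
proof -
  interpret monoidal_category C by fact
  show ?thesis
  proof (unfold_locales, goal_cases)
    case (4 f a b g c)
    then obtain x \<mu> \<eta> x' \<mu>' \<eta>' x'' \<mu>'' \<eta>'' h k where *: "f = ((x, \<mu>, \<eta>), (x', \<mu>', \<eta>'), h)"
      "g = ((x', \<mu>', \<eta>'), (x'', \<mu>'', \<eta>''), k)" "a = (x, \<mu>, \<eta>)" "b = (x', \<mu>', \<eta>')" "c = (x'', \<mu>'', \<eta>'')"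
      "is_monoid C a" "is_monoid C b" "is_monoid C c" "h \<in> hom_set C x x'" "k \<in> hom_set C x' x''"
      and h: "h \<cdot> \<mu> = \<mu>' \<cdot> (h \<star> h)" "h \<cdot> \<eta> = \<eta>'"
      and k: "k \<cdot> \<mu>' = \<mu>'' \<cdot> (k \<star> k)" "k \<cdot> \<eta>' = \<eta>''"
      by (auto simp: Mon_def in_hom_set)
    have "(k \<cdot> h) \<cdot> \<mu> = \<mu>'' \<cdot> ((k \<cdot> h) \<star> (k \<cdot> h))" "(k \<cdot> h) \<cdot> \<eta> = \<eta>''"
      using * extend_right[OF k(1)] h k(2) by (auto simp: in_hom_set cassoc is_monoid_def Tar_Cmp)
    then show ?case
      using * by (auto simp: Mon_def in_hom_set)
  qed (auto simp: Mon_def in_hom_set cassoc, auto simp: is_monoid_def in_hom_set)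
qed

lemma monoidal_transformation_comp:
  fixes C :: "('p, 'n) bmoncat" (structure)
  assumes "monoidal_category C" "Ob T = UNIV"
    and F: "braided_monoidal_functor T C F" and F': "braided_monoidal_functor T C F'"
    and F'': "braided_monoidal_functor T C F''"
    and \<alpha>: "monoidal_transformation T C F F' \<alpha>" and \<beta>: "monoidal_transformation T C F' F'' \<beta>"
  shows "monoidal_transformation T C F F'' (\<lambda>a\<in>Ob T. \<beta> a \<cdot> \<alpha> a)"
proof -
  interpret monoidal_category C by fact
  have nat: "natural_transformation T C F F' \<alpha>" "natural_transformation T C F' F'' \<beta>"
    using \<alpha> \<beta> by (auto simp: monoidal_transformation_def)
  have [simp]: "\<alpha> a \<in> Ar C" "Dom C (\<alpha> a) = omap F a" "Cod C (\<alpha> a) = omap F' a"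
    "\<beta> a \<in> Ar C" "Dom C (\<beta> a) = omap F' a" "Cod C (\<beta> a) = omap F'' a" for a
    using nat \<open>Ob T = UNIV\<close> by (auto simp: natural_transformation_def in_hom_set)
  have [simp]: "fmult F (a, b) \<in> Ar C" "Dom C (fmult F (a, b)) = omap F a \<odot> omap F b"
    "Cod C (fmult F (a, b)) = omap F (a \<odot>\<^bsub>T\<^esub> b)"
    "fmult F' (a, b) \<in> Ar C" "Dom C (fmult F' (a, b)) = omap F' a \<odot> omap F' b"
    "Cod C (fmult F' (a, b)) = omap F' (a \<odot>\<^bsub>T\<^esub> b)"
    "fmult F'' (a, b) \<in> Ar C" "Dom C (fmult F'' (a, b)) = omap F'' a \<odot> omap F'' b"
    "Cod C (fmult F'' (a, b)) = omap F'' (a \<odot>\<^bsub>T\<^esub> b)"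
    "funit F \<in> Ar C" "Dom C (funit F) = Unit C" "Cod C (funit F) = omap F (Unit T)" for a b
    using F F' F'' \<open>Ob T = UNIV\<close> by (auto simp: braided_monoidal_functor_def in_iso_set)
  have "\<beta> (Unit T) \<cdot> \<alpha> (Unit T) \<cdot> funit F = funit F''"
    using \<alpha> \<beta> \<open>Ob T = UNIV\<close> by (simp add: monoidal_transformation_def cassoc)
  moreover have "\<beta> (a \<odot>\<^bsub>T\<^esub> b) \<cdot> \<alpha> (a \<odot>\<^bsub>T\<^esub> b) \<cdot> fmult F (a, b) =
      fmult F'' (a, b) \<cdot> ((\<beta> a \<cdot> \<alpha> a) \<star> (\<beta> b \<cdot> \<alpha> b))" for a b
  proof -
    have "\<alpha> (a \<odot>\<^bsub>T\<^esub> b) \<cdot> fmult F (a, b) = fmult F' (a, b) \<cdot> (\<alpha> a \<star> \<alpha> b)"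
      and \<beta>m: "\<beta> (a \<odot>\<^bsub>T\<^esub> b) \<cdot> fmult F' (a, b) = fmult F'' (a, b) \<cdot> (\<beta> a \<star> \<beta> b)"
      using \<alpha> \<beta> \<open>Ob T = UNIV\<close> by (auto simp: monoidal_transformation_def)
    then show ?thesis using extend_right[OF \<beta>m] by (simp add: cassoc Tar_Cmp)
  qed
  moreover have "natural_transformation T C F F'' (\<lambda>a\<in>Ob T. \<beta> a \<cdot> \<alpha> a)"
    by (rule natural_transformation_comp[OF _ _ category_axioms _ _ _ nat])
      (use \<open>Ob T = UNIV\<close> F F' F'' in \<open>auto simp: braided_monoidal_functor_def\<close>)
  ultimately show ?thesis
    by (simp add: monoidal_transformation_def \<open>Ob T = UNIV\<close>)
qed

lemma category_Alg_on:
  fixes C :: "('p, 'n) bmoncat" (structure)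
  assumes "monoidal_category C" "Ob T = UNIV"
  shows "category (Alg_on P T C)"
proof -
  interpret monoidal_category C by fact
  have typing [simp]: "omap F a \<in> Ob C" "fmult F (a, b) \<in> Ar C" "Dom C (fmult F (a, b)) = omap F a \<odot> omap F b"
    "Cod C (fmult F (a, b)) = omap F (a \<odot>\<^bsub>T\<^esub> b)"
    "funit F \<in> Ar C" "Dom C (funit F) = Unit C" "Cod C (funit F) = omap F (Unit T)"
    if "braided_monoidal_functor T C F" for F a b
    using that \<open>Ob T = UNIV\<close> by (auto simp: braided_monoidal_functor_def in_iso_set is_functor_def)
  have nat: "\<forall>a. \<alpha> a \<in> Ar C \<and> Dom C (\<alpha> a) = omap F a \<and> Cod C (\<alpha> a) = omap F' a"
    if "monoidal_transformation T C F F' \<alpha>" for \<alpha> F F'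
    using that \<open>Ob T = UNIV\<close>
    by (auto simp: monoidal_transformation_def natural_transformation_def in_hom_set)
  have id: "monoidal_transformation T C F F (\<lambda>a\<in>Ob T. Id C (omap F a))" if F: "braided_monoidal_functor T C F" for F
  proof -
    have "is_functor T C F" using F by (simp add: braided_monoidal_functor_def)
    then show ?thesis
      using F \<open>Ob T = UNIV\<close> functor_Ar[of T C F] functor_Dom[of T C F] functor_Cod[of T C F]
      by (simp add: monoidal_transformation_def natural_transformation_def in_hom_set)
  qed
  show ?thesis
  proof (unfold_locales, goal_cases)
    case (1 f) then show ?case by (auto simp: Alg_on_def Let_def)
  next
    case (2 f) then show ?case by (auto simp: Alg_on_def Let_def)
  next
    case (3 F) then show ?case using id[of F] by (simp add: Alg_on_def Let_def in_hom_set)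
  next
    case (4 f a b g c) then show ?case
      using monoidal_transformation_comp[OF assms]
      by (fastforce simp: Alg_on_def Let_def in_hom_set)
  next
    case (5 f a b) then show ?case
      by (auto simp: Alg_on_def Let_def in_hom_set \<open>Ob T = UNIV\<close> restrict_UNIV fun_eq_iff dest!: nat)
  next
    case (6 f a b) then show ?case
      by (auto simp: Alg_on_def Let_def in_hom_set \<open>Ob T = UNIV\<close> restrict_UNIV fun_eq_iff dest!: nat)
  next
    case (7 f a b g c h d) then show ?case
      by (auto simp: Alg_on_def Let_def in_hom_set \<open>Ob T = UNIV\<close> restrict_UNIV fun_eq_iff dest!: nat
        intro!: cassoc[symmetric])
  qed
qed

section \<open>Coherence in monoidal categories\<close>

context monoidal_category
begin

lemma Assoc_isom [simp]: "a \<in> Ob C \<Longrightarrow> b \<in> Ob C \<Longrightarrow> c \<in> Ob C \<Longrightarrow> isom C (Assoc C a b c)"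
  and Dom_Assoc [simp]: "a \<in> Ob C \<Longrightarrow> b \<in> Ob C \<Longrightarrow> c \<in> Ob C \<Longrightarrow> Dom C (Assoc C a b c) = (a \<odot> b) \<odot> c"
  and Cod_Assoc [simp]: "a \<in> Ob C \<Longrightarrow> b \<in> Ob C \<Longrightarrow> c \<in> Ob C \<Longrightarrow> Cod C (Assoc C a b c) = a \<odot> (b \<odot> c)"
  using Assoc_iso by (auto simp: in_iso_set)

lemma LUnit_isom [simp]: "a \<in> Ob C \<Longrightarrow> isom C (LUnit C a)"
  and Dom_LUnit [simp]: "a \<in> Ob C \<Longrightarrow> Dom C (LUnit C a) = Unit C \<odot> a"
  and Cod_LUnit [simp]: "a \<in> Ob C \<Longrightarrow> Cod C (LUnit C a) = a"
  using LUnit_iso by (auto simp: in_iso_set)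

lemma RUnit_isom [simp]: "a \<in> Ob C \<Longrightarrow> isom C (RUnit C a)"
  and Dom_RUnit [simp]: "a \<in> Ob C \<Longrightarrow> Dom C (RUnit C a) = a \<odot> Unit C"
  and Cod_RUnit [simp]: "a \<in> Ob C \<Longrightarrow> Cod C (RUnit C a) = a"
  using RUnit_iso by (auto simp: in_iso_set)

lemma inverse_arrows_Tar:
  "isom C f \<Longrightarrow> isom C g \<Longrightarrow> inverse_arrows C (f \<star> g) (inv_ar C f \<star> inv_ar C g)"
  by (intro inverse_arrowsI) (simp_all add: Tar_Cmp)

lemma isom_Tar [simp]: "isom C f \<Longrightarrow> isom C g \<Longrightarrow> isom C (f \<star> g)"
  and inv_Tar: "isom C f \<Longrightarrow> isom C g \<Longrightarrow> inv_ar C (f \<star> g) = inv_ar C f \<star> inv_ar C g"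
  using inverse_arrows_Tar isomI inv_ar_eq by blast+

lemma Assoc_nat: "f \<in> Ar C \<Longrightarrow> g \<in> Ar C \<Longrightarrow> h \<in> Ar C \<Longrightarrow>
    Assoc C (Cod C f) (Cod C g) (Cod C h) \<cdot> ((f \<star> g) \<star> h) =
    (f \<star> (g \<star> h)) \<cdot> Assoc C (Dom C f) (Dom C g) (Dom C h)"
  by (rule Assoc_natural) (auto simp: in_hom_set)

lemma LUnit_nat: "f \<in> Ar C \<Longrightarrow> LUnit C (Cod C f) \<cdot> (Id C (Unit C) \<star> f) = f \<cdot> LUnit C (Dom C f)"
  by (rule LUnit_natural) (auto simp: in_hom_set)

lemma RUnit_nat: "f \<in> Ar C \<Longrightarrow> RUnit C (Cod C f) \<cdot> (f \<star> Id C (Unit C)) = f \<cdot> RUnit C (Dom C f)"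
  by (rule RUnit_natural) (auto simp: in_hom_set)

text \<open>Naturality of the left unitor makes \<open>f\<close> a conjugate of
  \<open>Id C (Unit C) \<star> f\<close>, so tensoring with the unit is faithful.\<close>

lemma Id_Unit_Tar_cancel:
  assumes "f \<in> Ar C" "g \<in> Ar C" "Dom C f = Dom C g" "Cod C f = Cod C g"
    "Id C (Unit C) \<star> f = Id C (Unit C) \<star> g"
  shows "f = g"
proof (rule iso_cancel_right[of "LUnit C (Dom C f)"])
  show "f \<cdot> LUnit C (Dom C f) = g \<cdot> LUnit C (Dom C f)"
    using LUnit_nat[OF assms(1)] LUnit_nat[OF assms(2)] assms(3-5) by metis
qed (use assms in auto)

lemma Tar_Id_Unit_cancel:
  assumes "f \<in> Ar C" "g \<in> Ar C" "Dom C f = Dom C g" "Cod C f = Cod C g"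
    "f \<star> Id C (Unit C) = g \<star> Id C (Unit C)"
  shows "f = g"
proof (rule iso_cancel_right[of "RUnit C (Dom C f)"])
  show "f \<cdot> RUnit C (Dom C f) = g \<cdot> RUnit C (Dom C f)"
    using RUnit_nat[OF assms(1)] RUnit_nat[OF assms(2)] assms(3-5) by metis
qed (use assms in auto)

text \<open>Kelly's consequences of the pentagon and triangle axioms.\<close>

lemma LUnit_Tob:
  assumes a: "a \<in> Ob C" and b: "b \<in> Ob C"
  shows "LUnit C (a \<odot> b) \<cdot> Assoc C (Unit C) a b = LUnit C a \<star> Id C b"
proof (rule Id_Unit_Tar_cancel)
  let ?I = "Unit C"
  \<comment> \<open>The first two arrows of the three-arrow leg of the pentagon for the unit twice,
    \<open>a\<close> and \<open>b\<close>. Being invertible, \<open>?P\<close> may be cancelled at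
    the end.\<close>
  let ?P = "Assoc C ?I (?I \<odot> a) b \<cdot> (Assoc C ?I ?I a \<star> Id C b)"
  have "(Id C ?I \<star> (LUnit C (a \<odot> b) \<cdot> Assoc C ?I a b)) \<cdot> ?P =
      (Id C ?I \<star> LUnit C (a \<odot> b)) \<cdot> ((Id C ?I \<star> Assoc C ?I a b) \<cdot> ?P)"
    using a b by (simp add: Tar_Cmp Tar_Cmp_right)
  also have "(Id C ?I \<star> Assoc C ?I a b) \<cdot> ?P = Assoc C ?I ?I (a \<odot> b) \<cdot> Assoc C (?I \<odot> ?I) a b"
    using pentagon[of ?I ?I a b] a b by (simp add: cassoc)
  also have "(Id C ?I \<star> LUnit C (a \<odot> b)) \<cdot> \<dots> = (RUnit C ?I \<star> (Id C a \<star> Id C b)) \<cdot> Assoc C (?I \<odot> ?I) a b"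
    using extend_right[OF triangle[of ?I "a \<odot> b"]] a b by simp
  also have "\<dots> = Assoc C ?I a b \<cdot> ((RUnit C ?I \<star> Id C a) \<star> Id C b)"
    using Assoc_nat[of "RUnit C ?I" "Id C a" "Id C b"] a b by simp
  also have "(RUnit C ?I \<star> Id C a) \<star> Id C b = ((Id C ?I \<star> LUnit C a) \<star> Id C b) \<cdot> (Assoc C ?I ?I a \<star> Id C b)"
    using triangle[of ?I a] a b by (simp add: Tar_Cmp)
  also have "Assoc C ?I a b \<cdot> \<dots> = (Id C ?I \<star> (LUnit C a \<star> Id C b)) \<cdot> ?P"
    using extend_right[OF Assoc_nat[of "Id C ?I" "LUnit C a" "Id C b"]] a b by (simp add: cassoc)
  finally have "(Id C ?I \<star> (LUnit C (a \<odot> b) \<cdot> Assoc C ?I a b)) \<cdot> ?P =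
      (Id C ?I \<star> (LUnit C a \<star> Id C b)) \<cdot> ?P" .
  then show "Id C ?I \<star> (LUnit C (a \<odot> b) \<cdot> Assoc C ?I a b) = Id C ?I \<star> (LUnit C a \<star> Id C b)"
    by (rule iso_cancel_right[of ?P, rotated 5]) (use a b in auto)
qed (use a b in auto)

lemma RUnit_Tob:
  assumes a: "a \<in> Ob C" and b: "b \<in> Ob C"
  shows "(Id C a \<star> RUnit C b) \<cdot> Assoc C a b (Unit C) = RUnit C (a \<odot> b)"
proof (rule Tar_Id_Unit_cancel)
  let ?I = "Unit C"
  have "Assoc C a b ?I \<cdot> (((Id C a \<star> RUnit C b) \<cdot> Assoc C a b ?I) \<star> Id C ?I) =
      (Assoc C a b ?I \<cdot> ((Id C a \<star> RUnit C b) \<star> Id C ?I)) \<cdot> (Assoc C a b ?I \<star> Id C ?I)"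
    using a b by (simp add: Tar_Cmp cassoc)
  also have "Assoc C a b ?I \<cdot> ((Id C a \<star> RUnit C b) \<star> Id C ?I) =
      (Id C a \<star> (RUnit C b \<star> Id C ?I)) \<cdot> Assoc C a (b \<odot> ?I) ?I"
    using Assoc_nat[of "Id C a" "RUnit C b" "Id C ?I"] a b by simp
  also have "Id C a \<star> (RUnit C b \<star> Id C ?I) = (Id C a \<star> (Id C b \<star> LUnit C ?I)) \<cdot> (Id C a \<star> Assoc C b ?I ?I)"
    using triangle[of b ?I] a b by (simp add: Tar_Cmp)
  also have "(\<dots> \<cdot> Assoc C a (b \<odot> ?I) ?I) \<cdot> (Assoc C a b ?I \<star> Id C ?I) =
      (Id C a \<star> (Id C b \<star> LUnit C ?I)) \<cdot> (Assoc C a b (?I \<odot> ?I) \<cdot> Assoc C (a \<odot> b) ?I ?I)"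
    using pentagon[of a b ?I ?I] a b by (simp add: cassoc)
  also have "\<dots> = Assoc C a b ?I \<cdot> (((Id C a \<star> Id C b) \<star> LUnit C ?I) \<cdot> Assoc C (a \<odot> b) ?I ?I)"
    using extend_right[OF Assoc_nat[of "Id C a" "Id C b" "LUnit C ?I", symmetric]] a b by (simp add: cassoc)
  also have "((Id C a \<star> Id C b) \<star> LUnit C ?I) \<cdot> Assoc C (a \<odot> b) ?I ?I = RUnit C (a \<odot> b) \<star> Id C ?I"
    using triangle[of "a \<odot> b" ?I] a b by simp
  finally have "Assoc C a b ?I \<cdot> (((Id C a \<star> RUnit C b) \<cdot> Assoc C a b ?I) \<star> Id C ?I) =
      Assoc C a b ?I \<cdot> (RUnit C (a \<odot> b) \<star> Id C ?I)" .
  then show "((Id C a \<star> RUnit C b) \<cdot> Assoc C a b ?I) \<star> Id C ?I = RUnit C (a \<odot> b) \<star> Id C ?I"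
    by (rule iso_cancel_left[of "Assoc C a b ?I", rotated 5]) (use a b in auto)
qed (use a b in auto)

text \<open>Naturality of the left unitor at itself identifies
  \<open>Id C (Unit C) \<star> LUnit C (Unit C)\<close> with the unitor at
  \<open>Unit C \<odot> Unit C\<close>; \<open>LUnit_Tob\<close> and the triangle then equate both
  unitors after tensoring with the unit.\<close>

lemma LUnit_Unit: "LUnit C (Unit C) = RUnit C (Unit C)"
proof (rule Tar_Id_Unit_cancel)
  let ?I = "Unit C"
  have "LUnit C ?I \<cdot> (Id C ?I \<star> LUnit C ?I) = LUnit C ?I \<cdot> LUnit C (?I \<odot> ?I)"
    using LUnit_nat[of "LUnit C ?I"] by simp
  then have "Id C ?I \<star> LUnit C ?I = LUnit C (?I \<odot> ?I)"
    by (rule iso_cancel_left[of "LUnit C ?I", rotated 5]) auto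
  then show "LUnit C ?I \<star> Id C ?I = RUnit C ?I \<star> Id C ?I"
    using LUnit_Tob[of ?I ?I] triangle[of ?I ?I] by simp
qed auto

end

context braided_monoidal_category
begin

lemma Braid_isom [simp]: "a \<in> Ob C \<Longrightarrow> b \<in> Ob C \<Longrightarrow> isom C (Braid C a b)"
  and Dom_Braid [simp]: "a \<in> Ob C \<Longrightarrow> b \<in> Ob C \<Longrightarrow> Dom C (Braid C a b) = a \<odot> b"
  and Cod_Braid [simp]: "a \<in> Ob C \<Longrightarrow> b \<in> Ob C \<Longrightarrow> Cod C (Braid C a b) = b \<odot> a"
  using Braid_iso by (auto simp: in_iso_set)

lemma Braid_nat: "f \<in> Ar C \<Longrightarrow> g \<in> Ar C \<Longrightarrow>
    Braid C (Cod C f) (Cod C g) \<cdot> (f \<star> g) = (g \<star> f) \<cdot> Braid C (Dom C f) (Dom C g)"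
  by (rule Braid_natural) (auto simp: in_hom_set)

end


section \<open>The opposite of a braided monoidal category\<close>

lemma op_cat_simps [simp]:
  "Ob (op_cat C) = Ob C" "Ar (op_cat C) = Ar C" "Dom (op_cat C) = Cod C" "Cod (op_cat C) = Dom C"
  "Id (op_cat C) = Id C" "g \<cdot>\<^bsub>op_cat C\<^esub> f = f \<cdot>\<^bsub>C\<^esub> g" "hom_set (op_cat C) a b = hom_set C b a"
  "Tob (op_cat C) = Tob C" "Tar (op_cat C) = Tar C" "Unit (op_cat C) = Unit C"
  "Assoc (op_cat C) a b c = inv_ar C (Assoc C a b c)"
  "LUnit (op_cat C) a = inv_ar C (LUnit C a)" "RUnit (op_cat C) a = inv_ar C (RUnit C a)"
  "Braid (op_cat C) a b = inv_ar C (Braid C a b)"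
  by (auto simp: op_cat_def hom_set_def)

lemma inverse_arrows_op_cat [simp]: "inverse_arrows (op_cat C) f g \<longleftrightarrow> inverse_arrows C f g"
  by (auto simp: inverse_arrows_def)

lemma isom_op_cat [simp]: "isom (op_cat C) f \<longleftrightarrow> isom C f"
  by (simp add: isom_def)

lemma inv_ar_op_cat [simp]: "inv_ar (op_cat C) f = inv_ar C f"
  by (simp add: inv_ar_def)

text \<open>Inverting both sides of a coherence equation reverses the order of composition, as the
  opposite does; so the pentagon and the triangle pass to themselves, and naturality squares to
  those of the inverses.\<close>

lemma monoidal_category_op_cat:
  fixes C :: "('o, 'm) bmoncat" (structure)
  assumes "monoidal_category C"
  shows "monoidal_category (op_cat C)"
proof -
  interpret monoidal_category C by fact
  show ?thesis
  proof (unfold_locales, goal_cases)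
    case (14 f a a' g b b' h c c')
    then show ?case
      using inv_conjugate[OF _ _ _ _ _ _ _ _ Assoc_nat[of f g h]] by (auto simp: in_hom_set)
  next
    case (16 f a b)
    then show ?case
      using inv_conjugate[OF _ _ _ _ _ _ _ _ LUnit_nat[of f]] by (auto simp: in_hom_set)
  next
    case (18 f a b)
    then show ?case
      using inv_conjugate[OF _ _ _ _ _ _ _ _ RUnit_nat[of f]] by (auto simp: in_hom_set)
  next
    case (19 a b c d)
    then show ?case
      using arg_cong[OF pentagon[of a b c d], of "inv_ar C"] by (simp add: inv_of_Cmp inv_Tar cassoc)
  next
    case (20 a b)
    then show ?case
      using arg_cong[OF triangle[of a b], of "inv_ar C"] by (simp add: inv_of_Cmp inv_Tar cassoc)
  qed (auto simp: in_hom_set in_iso_set cassoc Tar_Cmp)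
qed

text \<open>Each hexagon also passes to itself under inversion: since the braiding is inverted as
  well, the two hexagons are not exchanged.\<close>

lemma braided_monoidal_category_op_cat:
  fixes C :: "('o, 'm) bmoncat" (structure)
  assumes "braided_monoidal_category C"
  shows "braided_monoidal_category (op_cat C)"
proof -
  interpret braided_monoidal_category C by fact
  interpret op: monoidal_category "op_cat C"
    using monoidal_category_op_cat monoidal_category_axioms by blast
  show ?thesis
  proof (unfold_locales, goal_cases)
    case (1 a b)
    then show ?case by (auto simp: in_iso_set)
  next
    case (2 f a a' g b b')
    then show ?case
      using inv_conjugate[OF _ _ _ _ _ _ _ _ Braid_nat[of f g]] by (auto simp: in_hom_set)
  next
    case (3 a b c)
    then show ?case
      using arg_cong[OF hexagon1[of a b c], of "inv_ar C"] by (simp add: inv_of_Cmp inv_Tar cassoc)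
  next
    case (4 a b c)
    then show ?case
      using arg_cong[OF hexagon2[of a b c], of "inv_ar C"] by (simp add: inv_of_Cmp inv_Tar cassoc)
  qed
qed

lemma symmetric_monoidal_category_op_cat:
  fixes C :: "('o, 'm) bmoncat" (structure)
  assumes "symmetric_monoidal_category C"
  shows "symmetric_monoidal_category (op_cat C)"
proof -
  interpret symmetric_monoidal_category C by fact
  interpret op: braided_monoidal_category "op_cat C"
    using braided_monoidal_category_op_cat braided_monoidal_category_axioms by blast
  show ?thesis
  proof (unfold_locales, goal_cases)
    case (1 a b)
    then show ?case
      using arg_cong[OF symmetry[of a b], of "inv_ar C"] by (simp add: inv_of_Cmp)
  qed
qed

lemma strict_monoidal_op_cat:
  fixes C :: "('o, 'm) bmoncat" (structure)
  assumes "monoidal_category C" "strict_monoidal C"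
  shows "strict_monoidal (op_cat C)"
proof -
  interpret monoidal_category C by fact
  show ?thesis using assms(2) by (simp add: strict_monoidal_def)
qed

section \<open>Braid words\<close>

declare One_nat_def [simp del]

lemma bwords_Nil [simp]: "[] \<in> bwords n"
  and bwords_Cons [simp]: "(i, e) # w \<in> bwords n \<longleftrightarrow> 1 \<le> i \<and> i < n \<and> w \<in> bwords n"
  and bwords_append [simp]: "v @ w \<in> bwords n \<longleftrightarrow> v \<in> bwords n \<and> w \<in> bwords n"
  by (auto simp: bwords_def)

lemma bwords_mono: "w \<in> bwords n \<Longrightarrow> n \<le> m \<Longrightarrow> w \<in> bwords m"
  by (auto simp: bwords_def)

lemma word_shift_simps [simp]:
  "word_shift d [] = []" "word_shift d ((i, e) # w) = (d + i, e) # word_shift d w"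
  "word_shift d (v @ w) = word_shift d v @ word_shift d w"
  "word_shift 0 w = w" "word_shift a (word_shift b w) = word_shift (a + b) w"
  by (auto simp: word_shift_def)

lemma word_inv_simps [simp]:
  "word_inv [] = []" "word_inv ((i, e) # w) = word_inv w @ [(i, \<not> e)]"
  "word_inv (v @ w) = word_inv w @ word_inv v"
  by (auto simp: word_inv_def)

lemma word_inv_word_inv [simp]: "word_inv (word_inv w) = w"
  by (induction w) auto

lemma word_inv_shift: "word_inv (word_shift d w) = word_shift d (word_inv w)"
  by (induction w) auto

lemma bwords_shift: "w \<in> bwords n \<Longrightarrow> d + n \<le> m \<Longrightarrow> word_shift d w \<in> bwords m"
  by (induction w) auto

lemma bwords_inv [simp]: "word_inv w \<in> bwords n \<longleftrightarrow> w \<in> bwords n"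
  by (induction w) auto

lemma block_word_0 [simp]: "block_word 0 b = []"
  by (simp add: block_word_def)

text \<open>The product of the generators with indices \<open>b\<close>, ..., \<open>1\<close>:
  strand \<open>1\<close> crosses over the next \<open>b\<close> strands. Block braids are composed
  of such passages, one strand at a time.\<close>

definition pass_word :: "nat \<Rightarrow> bword" where
  "pass_word b = map (\<lambda>k. (k, True)) (rev [1..<Suc b])"

text \<open>The rightmost factor acts first, so strand \<open>Suc a\<close>, which is next to the
  second block, crosses before the other \<open>a\<close> strands.\<close>

lemma block_word_Suc: "block_word (Suc a) b = block_word a b @ word_shift a (pass_word b)"
proof -
  have "rev [Suc a..<Suc a + b] = map ((+) a) (rev [1..<Suc b])"
    by (induction b) auto
  then show ?thesis by (simp add: block_word_def pass_word_def word_shift_def comp_def del: upt_Suc) (simp add: block_word_def)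
qed

lemma block_word_1_1 [simp]: "block_word 1 1 = [(1, True)]"
  by (simp add: block_word_def One_nat_def)

lemma pass_word_Suc: "pass_word (Suc b) = (Suc b, True) # pass_word b"
  by (simp add: pass_word_def)

lemma pass_word_0 [simp]: "pass_word 0 = []"
  by (simp add: pass_word_def)

lemma block_word_0_right [simp]: "block_word a 0 = []"
  by (induction a) (auto simp: block_word_Suc)

text \<open>An equality of words and not only of braids, because block words are built strand by
  strand in the first block. It is the left hexagon in combinatorial form.\<close>

lemma block_word_add: "block_word (a + b) c = block_word a c @ word_shift a (block_word b c)"
  by (induction b) (auto simp: block_word_Suc)

lemma pass_word_bwords: "pass_word b \<in> bwords (Suc b)"
  by (induction b) (auto simp: pass_word_Suc elim: bwords_mono)

lemma block_word_bwords: "block_word a b \<in> bwords (a + b)"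
proof (induction a)
  case (Suc a)
  then show ?case
    using bwords_shift[OF pass_word_bwords[of b], of a "Suc a + b"]
    by (auto simp: block_word_Suc elim: bwords_mono)
qed auto

section \<open>The permutation underlying a word\<close>

lemma word_perm_append [simp]: "word_perm (v @ w) = word_perm v \<circ> word_perm w"
  by (induction v rule: word_perm.induct) auto

lemma word_perm_permutes: "w \<in> bwords n \<Longrightarrow> word_perm w permutes {1..n}"
proof (induction w rule: word_perm.induct)
  case (2 i e w)
  then have "transpose i (Suc i) permutes {1..n}" by (intro permutes_swap_id) auto
  moreover have "word_perm w permutes {1..n}" using 2 by simp
  ultimately show ?case by (simp only: word_perm.simps permutes_compose)
qed (simp add: permutes_id del: id_apply)

lemma bij_word_perm: "bij (word_perm w)"
  by (induction w rule: word_perm.induct) (simp_all only: word_perm.simps bij_id bij_comp bij_transpose)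

abbreviation word_perm_inv :: "bword \<Rightarrow> nat \<Rightarrow> nat" where
  "word_perm_inv w \<equiv> inv_into UNIV (word_perm w)"

lemma inv_word_perm_Cons: "word_perm_inv ((i, e) # w) = word_perm_inv w \<circ> transpose i (Suc i)"
  by (simp add: o_inv_distrib bij_word_perm)

text \<open>The word into which \<^const>\<open>cable_word\<close> turns the letter \<open>(i, e)\<close> acting on bundles of
  widths \<open>d\<close>.\<close>

definition cable_letter :: "(nat \<Rightarrow> nat) \<Rightarrow> nat \<Rightarrow> bool \<Rightarrow> bword" where
  "cable_letter d i e = word_shift (\<Sum>p = 1..<i. d p)
     (if e then block_word (d i) (d (Suc i)) else word_inv (block_word (d (Suc i)) (d i)))"

lemma cable_word_Cons:
  "cable_word c ((i, e) # w) = cable_letter (c \<circ> word_perm_inv w) i e @ cable_word c w"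
  by (simp add: cable_letter_def Let_def)

declare cable_word.simps(2) [simp del]
declare cable_word_Cons [simp]

lemma sum_add: "(\<Sum>p = 1..n + k. d p) = (\<Sum>p = 1..n. d p) + (\<Sum>p = 1..k. d (n + p))"
  for d :: "nat \<Rightarrow> nat"
  by (induction k) auto

lemma sum_permutes: "\<sigma> permutes {1..n} \<Longrightarrow> (\<Sum>p = 1..n. d (\<sigma> p)) = (\<Sum>p = 1..n. d p)"
  for d :: "nat \<Rightarrow> nat"
  using sum.permute[of \<sigma> "{1..n}" d] by (simp add: comp_def)

lemma sum_inv_word_perm:
  "w \<in> bwords n \<Longrightarrow> (\<Sum>p = 1..n. d (word_perm_inv w p)) = (\<Sum>p = 1..n. d p)" for d :: "nat \<Rightarrow> nat"
  by (intro sum_permutes permutes_inv word_perm_permutes)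

lemma sum_1_lessThan: "(\<Sum>p = 1..<Suc j. d p) = (\<Sum>p = 1..j. d p)" for d :: "nat \<Rightarrow> nat"
  by (simp add: atLeastLessThanSuc_atLeastAtMost)

text \<open>The \<open>j\<close> strands before the crossing, the two that cross and the
  \<open>r\<close> after it: the shape in which sums and iterated tensor products are split.\<close>

lemma split_letter: "1 \<le> i \<Longrightarrow> i < m \<Longrightarrow> \<exists>j r. i = Suc j \<and> m = j + (2 + r)"
  by (rule exI[of _ "i - 1"], rule exI[of _ "m - i - 1"]) auto

lemma cable_letter_bwords:
  assumes "1 \<le> i" "i < m"
  shows "cable_letter d i e \<in> bwords (\<Sum>p = 1..m. d p)"
proof -
  obtain j r where j: "i = Suc j" "m = j + (2 + r)"
    using split_letter[OF assms] by blast
  have "(\<Sum>p = 1..<i. d p) + (d i + d (Suc i)) \<le> (\<Sum>p = 1..m. d p)"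
    unfolding j sum_1_lessThan sum_add by (simp add: numeral_2_eq_2)
  then show ?thesis
    using block_word_bwords[of "d i" "d (Suc i)"] block_word_bwords[of "d (Suc i)" "d i"]
    by (auto simp: cable_letter_def add.commute intro!: bwords_shift)
qed

lemma cable_word_bwords: "w \<in> bwords m \<Longrightarrow> cable_word c w \<in> bwords (\<Sum>p = 1..m. c p)"
proof (induction w rule: word_perm.induct)
  case (2 i e w)
  then have "cable_letter (c \<circ> word_perm_inv w) i e \<in> bwords (\<Sum>p = 1..m. (c \<circ> word_perm_inv w) p)"
    by (intro cable_letter_bwords) auto
  then show ?case using 2 by (simp add: sum_inv_word_perm)
qed auto

lemma cable_word_one:
  assumes "\<And>p. p \<in> {1..m} \<Longrightarrow> c p = 1"
  shows "w \<in> bwords m \<Longrightarrow> cable_word c w = w"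
proof (induction w rule: word_perm.induct)
  case (2 i e w)
  have perm: "word_perm_inv w permutes {1..m}"
    using 2 by (intro permutes_inv word_perm_permutes) simp
  have c: "c (word_perm_inv w p) = 1" if "p \<in> {1..m}" for p
    using assms[of "word_perm_inv w p"] permutes_in_image[OF perm, of p] that by auto
  have "(\<Sum>p = 1..<i. c (word_perm_inv w p)) = (\<Sum>p = 1..<i. 1)"
    using 2 by (intro sum.cong refl c) auto
  then have "cable_letter (c \<circ> word_perm_inv w) i e = [(i, e)]"
    using 2 c[of i] c[of "Suc i"] by (simp add: cable_letter_def)
  then show ?case using 2 by simp
qed simp


section \<open>Strict braided monoidal categories on the natural numbers\<close>

text \<open>A strict braided monoidal category whose objects are the natural numbers under addition,
  with associators and unitors suppressed; \<open>Braid_add_right\<close> and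
  \<open>Braid_add_left\<close> are the two hexagons.\<close>

locale prob = category P for P :: "(nat, 'm) bmoncat" (structure) +
  assumes Ob_P [simp]: "Ob P = UNIV"
    and Ten_Ar [simp]: "f \<in> Ar P \<Longrightarrow> g \<in> Ar P \<Longrightarrow> f \<star> g \<in> Ar P"
    and Dom_Ten [simp]: "f \<in> Ar P \<Longrightarrow> g \<in> Ar P \<Longrightarrow> Dom P (f \<star> g) = Dom P f + Dom P g"
    and Cod_Ten [simp]: "f \<in> Ar P \<Longrightarrow> g \<in> Ar P \<Longrightarrow> Cod P (f \<star> g) = Cod P f + Cod P g"
    and Ten_Id [simp]: "Id P a \<star> Id P b = Id P (a + b)"
    and Ten_Cmp: "f \<in> Ar P \<Longrightarrow> g \<in> Ar P \<Longrightarrow> f' \<in> Ar P \<Longrightarrow> g' \<in> Ar P \<Longrightarrow>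
      Cod P f = Dom P g \<Longrightarrow> Cod P f' = Dom P g' \<Longrightarrow> (g \<star> g') \<cdot> (f \<star> f') = (g \<cdot> f) \<star> (g' \<cdot> f')"
    and Ten_assoc: "f \<in> Ar P \<Longrightarrow> g \<in> Ar P \<Longrightarrow> h \<in> Ar P \<Longrightarrow> (f \<star> g) \<star> h = f \<star> (g \<star> h)"
    and Ten_unit_left [simp]: "f \<in> Ar P \<Longrightarrow> Id P 0 \<star> f = f"
    and Ten_unit_right [simp]: "f \<in> Ar P \<Longrightarrow> f \<star> Id P 0 = f"
    and Braid_isom [simp]: "isom P (Braid P a b)"
    and Dom_Braid [simp]: "Dom P (Braid P a b) = a + b"
    and Cod_Braid [simp]: "Cod P (Braid P a b) = b + a"
    and Braid_nat: "f \<in> Ar P \<Longrightarrow> g \<in> Ar P \<Longrightarrow>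
      Braid P (Cod P f) (Cod P g) \<cdot> (f \<star> g) = (g \<star> f) \<cdot> Braid P (Dom P f) (Dom P g)"
    and Braid_add_right: "Braid P a (b + c) = (Id P b \<star> Braid P a c) \<cdot> (Braid P a b \<star> Id P c)"
    and Braid_add_left: "Braid P (a + b) c = (Braid P a c \<star> Id P b) \<cdot> (Id P a \<star> Braid P b c)"
begin

text \<open>The hexagon with two unit factors makes this isomorphism idempotent.\<close>

lemma Braid_0_right: "Braid P a 0 = Id P a"
proof (rule iso_cancel_right[of "Braid P a 0"])
  show "Braid P a 0 \<cdot> Braid P a 0 = Id P a \<cdot> Braid P a 0"
    using Braid_add_right[of a 0 0] by simp
qed auto

lemma Braid_0_left: "Braid P 0 a = Id P a"
proof (rule iso_cancel_right[of "Braid P 0 a"])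
  show "Braid P 0 a \<cdot> Braid P 0 a = Id P a \<cdot> Braid P 0 a"
    using Braid_add_left[of 0 0 a] by simp
qed auto

lemma Ten_inverse_arrows:
  "isom P f \<Longrightarrow> isom P g \<Longrightarrow> inverse_arrows P (f \<star> g) (inv_ar P f \<star> inv_ar P g)"
  by (intro inverse_arrowsI) (simp_all add: Ten_Cmp)

lemma isom_Ten [simp]: "isom P f \<Longrightarrow> isom P g \<Longrightarrow> isom P (f \<star> g)"
  and inv_Ten: "isom P f \<Longrightarrow> isom P g \<Longrightarrow> inv_ar P (f \<star> g) = inv_ar P f \<star> inv_ar P g"
  using Ten_inverse_arrows isomI inv_ar_eq by blast+

text \<open>The arguments are exchanged in the negative case so that both signs run from
  \<open>a + b\<close> to \<open>b + a\<close>, and their naturality has a common statement.\<close>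

definition crossing :: "bool \<Rightarrow> nat \<Rightarrow> nat \<Rightarrow> 'm" where
  "crossing e a b = (if e then Braid P a b else inv_ar P (Braid P b a))"

lemma crossing_isom [simp]: "isom P (crossing e a b)"
  and Dom_crossing [simp]: "Dom P (crossing e a b) = a + b"
  and Cod_crossing [simp]: "Cod P (crossing e a b) = b + a"
  by (auto simp: crossing_def)

lemma crossing_Ar [simp]: "crossing e a b \<in> Ar P"
  by (rule isom_Ar[OF crossing_isom])

lemma crossing_nat:
  assumes "f \<in> Ar P" "g \<in> Ar P"
  shows "crossing e (Cod P f) (Cod P g) \<cdot> (f \<star> g) = (g \<star> f) \<cdot> crossing e (Dom P f) (Dom P g)"
proof (cases e)
  case True
  then show ?thesis using Braid_nat[OF assms] by (simp add: crossing_def)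
next
  case False
  have "(f \<star> g) \<cdot> Braid P (Dom P g) (Dom P f) = Braid P (Cod P g) (Cod P f) \<cdot> (g \<star> f)"
    using Braid_nat[OF assms(2,1)] by simp
  then show ?thesis
    using False assms inv_conjugate[of "Braid P (Dom P g) (Dom P f)" "Braid P (Cod P g) (Cod P f)" "g \<star> f" "f \<star> g"]
    by (simp add: crossing_def)
qed

lemma inv_crossing: "inv_ar P (crossing e a b) = crossing (\<not> e) b a"
  by (simp add: crossing_def)

subsection \<open>Iterated tensor products\<close>

primrec big :: "nat \<Rightarrow> (nat \<Rightarrow> 'm) \<Rightarrow> 'm" where
  "big 0 f = Id P 0"
| "big (Suc n) f = big n f \<star> f (Suc n)"

lemma big_Ar [simp]: "(\<And>i. f i \<in> Ar P) \<Longrightarrow> big n f \<in> Ar P"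
  by (induction n) auto

lemma Dom_big [simp]: "(\<And>i. f i \<in> Ar P) \<Longrightarrow> Dom P (big n f) = (\<Sum>i = 1..n. Dom P (f i))"
  and Cod_big [simp]: "(\<And>i. f i \<in> Ar P) \<Longrightarrow> Cod P (big n f) = (\<Sum>i = 1..n. Cod P (f i))"
  by (induction n) auto

lemma big_cong: "(\<And>i. i \<in> {1..n} \<Longrightarrow> f i = g i) \<Longrightarrow> big n f = big n g"
  by (induction n) auto

lemma big_add: "(\<And>i. f i \<in> Ar P) \<Longrightarrow> big (n + k) f = big n f \<star> big k (\<lambda>i. f (n + i))"
  by (induction k) (simp_all add: Ten_assoc)

lemma big_Cmp:
  assumes "\<And>i. f i \<in> Ar P" "\<And>i. g i \<in> Ar P" "\<And>i. i \<in> {1..n} \<Longrightarrow> Cod P (g i) = Dom P (f i)"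
  shows "big n f \<cdot> big n g = big n (\<lambda>i. f i \<cdot> g i)"
  using assms(3)
proof (induction n)
  case (Suc n)
  have "(\<Sum>i = 1..n. Cod P (g i)) = (\<Sum>i = 1..n. Dom P (f i))"
    using Suc.prems by (intro sum.cong) auto
  then show ?case using Suc assms(1,2) by (simp add: Ten_Cmp)
qed simp

lemma big_Id: "big n (\<lambda>i. Id P (a i)) = Id P (\<Sum>i = 1..n. a i)"
  by (induction n) auto

text \<open>By strict associativity a flat product over all strands can be read bundle by bundle;
  strand \<open>k\<close> of bundle \<open>i\<close> stands behind all strands of the earlier
  bundles.\<close>

lemma big_sum:
  assumes "\<And>i. f i \<in> Ar P"
  shows "big (\<Sum>p = 1..m. c p) f = big m (\<lambda>i. big (c i) (\<lambda>k. f ((\<Sum>p = 1..<i. c p) + k)))"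
proof (induction m)
  case (Suc m)
  have "(\<Sum>p = 1..Suc m. c p) = (\<Sum>p = 1..m. c p) + c (Suc m)" by simp
  then show ?case
    using Suc big_add[of f "\<Sum>p = 1..m. c p" "c (Suc m)", OF assms]
    by (simp add: sum_1_lessThan del: sum.op_ivl_Suc)
qed auto

lemma big_split_two:
  assumes "\<And>i. f i \<in> Ar P"
  shows "big (j + (2 + r)) f = big j f \<star> ((f (Suc j) \<star> f (Suc (Suc j))) \<star> big r (\<lambda>p. f (j + (2 + p))))"
proof -
  have "big (j + (2 + r)) f = big j f \<star> (big 2 (\<lambda>i. f (j + i)) \<star> big r (\<lambda>p. f (j + (2 + p))))"
    using assms by (simp only: big_add add.assoc)
  then show ?thesis using assms by (simp add: numeral_2_eq_2)
qed

subsection \<open>The action of braid words\<close>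

definition gen :: "nat \<Rightarrow> nat \<Rightarrow> bool \<Rightarrow> 'm" where
  "gen n i e = Id P (i - 1) \<star> (crossing e 1 1 \<star> Id P (n - Suc i))"

lemma gen_isom [simp]: "isom P (gen n i e)"
  and gen_Ar [simp]: "gen n i e \<in> Ar P"
  and Dom_gen [simp]: "1 \<le> i \<Longrightarrow> i < n \<Longrightarrow> Dom P (gen n i e) = n"
  and Cod_gen [simp]: "1 \<le> i \<Longrightarrow> i < n \<Longrightarrow> Cod P (gen n i e) = n"
  by (simp_all add: gen_def)

lemma inv_gen: "inv_ar P (gen n i e) = gen n i (\<not> e)"
  by (simp add: gen_def inv_Ten inv_crossing)

fun act :: "nat \<Rightarrow> bword \<Rightarrow> 'm" where
  "act n [] = Id P n"
| "act n ((i, e) # w) = gen n i e \<cdot> act n w"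

lemma act_typing: "w \<in> bwords n \<Longrightarrow> isom P (act n w) \<and> Dom P (act n w) = n \<and> Cod P (act n w) = n"
  by (induction w rule: word_perm.induct) auto

lemma isom_act [simp]: "w \<in> bwords n \<Longrightarrow> isom P (act n w)"
  and Dom_act [simp]: "w \<in> bwords n \<Longrightarrow> Dom P (act n w) = n"
  and Cod_act [simp]: "w \<in> bwords n \<Longrightarrow> Cod P (act n w) = n"
  using act_typing by auto

lemma act_append: "v \<in> bwords n \<Longrightarrow> w \<in> bwords n \<Longrightarrow> act n (v @ w) = act n v \<cdot> act n w"
  by (induction v rule: word_perm.induct) (auto simp: cassoc)

lemma act_shift:
  assumes "w \<in> bwords n"
  shows "act (a + (n + b)) (word_shift a w) = Id P a \<star> (act n w \<star> Id P b)"
  using assms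
proof (induction w rule: word_perm.induct)
  case (2 i e w)
  have "gen (a + (n + b)) (a + i) e = Id P a \<star> (gen n i e \<star> Id P b)"
  proof -
    have *: "a + i - 1 = a + (i - 1)" "a + (n + b) - Suc (a + i) = (n - Suc i) + b" using 2 by auto
    show ?thesis unfolding gen_def * by (simp add: Ten_assoc flip: Ten_Id)
  qed
  then show ?case using 2 by (simp add: Ten_Cmp)
qed simp

lemma act_extend: "w \<in> bwords n \<Longrightarrow> act (n + b) w = act n w \<star> Id P b"
  using act_shift[of w n 0 b] by simp

lemma act_shift': "w \<in> bwords n \<Longrightarrow> act (a + n) (word_shift a w) = Id P a \<star> act n w"
  using act_shift[of w n a 0] by simp

lemma act_inv: "w \<in> bwords n \<Longrightarrow> act n (word_inv w) = inv_ar P (act n w)"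
proof (induction w rule: word_perm.induct)
  case (2 i e w)
  then show ?case by (simp add: act_append inv_of_Cmp inv_gen)
qed simp

text \<open>The recursion of \<open>pass_word\<close> is the right hexagon with second argument
  \<open>b + 1\<close>. The left hexagon then plays the same part for
  \<open>act_block\<close>.\<close>

lemma act_pass: "act (Suc b) (pass_word b) = Braid P 1 b"
proof (induction b)
  case 0
  show ?case using Braid_0_right[of 1] by (simp add: One_nat_def)
next
  case (Suc b)
  have "act (Suc (Suc b)) (pass_word b) = Braid P 1 b \<star> Id P 1"
    using pass_word_bwords[of b] Suc act_extend[of "pass_word b" "Suc b" 1] by (simp flip: Suc_eq_plus1)
  then have "act (Suc (Suc b)) (pass_word (Suc b)) = (Id P b \<star> Braid P 1 1) \<cdot> (Braid P 1 b \<star> Id P 1)"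
    by (simp add: pass_word_Suc gen_def crossing_def)
  then show ?case using Braid_add_right[of 1 b 1] by (simp flip: Suc_eq_plus1)
qed

lemma act_block: "act (a + b) (block_word a b) = Braid P a b"
proof (induction a)
  case 0
  show ?case using Braid_0_left by simp
next
  case (Suc a)
  have "block_word a b \<in> bwords (a + b + 1)"
    using block_word_bwords[of a b] by (rule bwords_mono) simp
  moreover have "word_shift a (pass_word b) \<in> bwords (a + b + 1)"
    using pass_word_bwords[of b] by (rule bwords_shift) simp
  ultimately have "act (a + b + 1) (block_word (Suc a) b) =
      act (a + b + 1) (block_word a b) \<cdot> act (a + b + 1) (word_shift a (pass_word b))"
    by (simp only: block_word_Suc act_append)
  also have "act (a + b + 1) (block_word a b) = Braid P a b \<star> Id P 1"
    using block_word_bwords[of a b] act_extend Suc by simp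
  also have "act (a + b + 1) (word_shift a (pass_word b)) = Id P a \<star> Braid P 1 b"
    using act_shift'[of "pass_word b" "Suc b" a] pass_word_bwords[of b] act_pass[of b]
    by (simp flip: Suc_eq_plus1)
  finally show ?case using Braid_add_left[of a 1 b] by (simp flip: Suc_eq_plus1)
qed

text \<open>Cancellation is invertibility of the crossing, far commutation is the interchange law,
  and the braid relation is the Yang-Baxter equation, which follows from naturality of the braiding
  with respect to itself.\<close>

lemma act_artin:
  assumes "artin r s" "r \<in> bwords n" "s \<in> bwords n"
  shows "act n r = act n s"
  using assms
proof (cases rule: artin.cases)
  case (cancel i e)
  have "act n [(i, e), (i, \<not> e)] = act n [(i, e)] \<cdot> act n (word_inv [(i, e)])"
    using assms cancel by (simp add: cassoc)
  also have "\<dots> = Id P n"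
    using assms cancel by (subst act_inv) auto
  finally show ?thesis using cancel by simp
next
  case (far i k)
  \<comment> \<open>\<open>X\<close> occupies the strands \<open>1\<close> to \<open>i + 1\<close>
    and \<open>Y\<close> the remaining ones, so the two letters act on different tensor
    factors.\<close>
  define X where "X = Id P (i - 1) \<star> Braid P 1 1"
  define Y where "Y = Id P (k - i - 2) \<star> (Braid P 1 1 \<star> Id P (n - Suc k))"
  have ik: "1 \<le> i" "i + 2 \<le> k" "k < n" using assms far by auto
  have X: "X \<in> Ar P" "Dom P X = i + 1" "Cod P X = i + 1" using ik by (auto simp: X_def)
  have Y: "Y \<in> Ar P" "Dom P Y = n - Suc i" "Cod P Y = n - Suc i" using ik by (auto simp: Y_def)
  have "act n [(i, True)] = X \<star> Id P (n - Suc i)"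
    using ik by (simp add: gen_def crossing_def X_def Ten_assoc)
  moreover have "act n [(k, True)] = Id P (i + 1) \<star> Y"
  proof -
    have "k - 1 = i + 1 + (k - i - 2)" using ik by simp
    then have "Id P (k - 1) = Id P (i + 1) \<star> Id P (k - i - 2)" by simp
    then show ?thesis using ik by (simp add: gen_def crossing_def Y_def Ten_assoc del: Ten_Id)
  qed
  moreover have "act n [(i, True), (k, True)] = act n [(i, True)] \<cdot> act n [(k, True)]"
    "act n [(k, True), (i, True)] = act n [(k, True)] \<cdot> act n [(i, True)]"
    using ik by (simp_all add: cassoc)
  ultimately show ?thesis using far ik X Y by (simp add: Ten_Cmp del: act.simps)
next
  case (braid i)
  let ?c = "Braid P 1 1"
  define j r where "j = i - 1" and "r = n - i - 2"
  have n: "i = j + 1" "n = j + (3 + r)" using assms braid by (auto simp: j_def r_def)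
  have word: "act n (word_shift j w) = Id P j \<star> (act 3 w \<star> Id P r)" if "w \<in> bwords 3" for w
    unfolding n by (rule act_shift[OF that])
  have B12: "Braid P 1 2 = (Id P 1 \<star> ?c) \<cdot> (?c \<star> Id P 1)"
    using Braid_add_right[of 1 1 1] by (simp add: numeral_2_eq_2)
  \<comment> \<open>A strand passing over two others may do so before or after these cross:
    naturality of \<open>Braid P 1 2\<close>, with the hexagon expanding it into elementary
    crossings.\<close>
  have nat: "Braid P 1 2 \<cdot> (Id P 1 \<star> ?c) = (?c \<star> Id P 1) \<cdot> Braid P 1 2"
    using Braid_nat[of "Id P 1" ?c] by (simp add: numeral_2_eq_2)
  have "act 3 [(1, True), (2, True), (1, True)] = (?c \<star> Id P 1) \<cdot> Braid P 1 2"
    by (simp add: gen_def crossing_def B12[unfolded One_nat_def] One_nat_def)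
  also have "\<dots> = (Id P 1 \<star> ?c) \<cdot> ((?c \<star> Id P 1) \<cdot> (Id P 1 \<star> ?c))"
    unfolding nat[symmetric] by (simp add: B12 cassoc)
  also have "\<dots> = act 3 [(2, True), (1, True), (2, True)]"
    by (simp add: gen_def crossing_def One_nat_def)
  finally show ?thesis
    using braid word[of "[(1, True), (2, True), (1, True)]"] word[of "[(2, True), (1, True), (2, True)]"] n
    by (simp add: One_nat_def)
qed

lemma act_braid_eq:
  assumes "braid_eq n v w"
  shows "v \<in> bwords n \<and> w \<in> bwords n \<and> act n v = act n w"
  using assms
proof induction
  case (step r s u v)
  then show ?case using act_artin[of r s n] by (simp add: act_append)
qed auto

lemma act_cable_letter:
  assumes "1 \<le> i" "i < m"
  shows "act (\<Sum>p = 1..m. d p) (cable_letter d i e) =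
    Id P (\<Sum>p = 1..<i. d p) \<star> (crossing e (d i) (d (Suc i)) \<star> Id P (\<Sum>p = 1..m - Suc i. d (Suc i + p)))"
proof -
  obtain j r where j: "i = Suc j" "m = j + (2 + r)"
    using split_letter[OF assms] by blast
  let ?w = "if e then block_word (d i) (d (Suc i)) else word_inv (block_word (d (Suc i)) (d i))"
  have w: "?w \<in> bwords (d i + d (Suc i))"
    using block_word_bwords[of "d i" "d (Suc i)"] block_word_bwords[of "d (Suc i)" "d i"]
    by (auto simp: add.commute)
  have "act (d i + d (Suc i)) ?w = crossing e (d i) (d (Suc i))"
    using act_block[of "d i" "d (Suc i)"] act_block[of "d (Suc i)" "d i"]
      act_inv[OF block_word_bwords[of "d (Suc i)" "d i"]]
    by (simp add: crossing_def add.commute)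
  moreover have "(\<Sum>p = 1..m. d p) =
      (\<Sum>p = 1..<i. d p) + ((d i + d (Suc i)) + (\<Sum>p = 1..m - Suc i. d (Suc i + p)))"
    unfolding j sum_1_lessThan sum_add by (simp add: numeral_2_eq_2)
  ultimately show ?thesis
    using act_shift[OF w, of "\<Sum>p = 1..<i. d p" "\<Sum>p = 1..m - Suc i. d (Suc i + p)"]
    by (simp add: cable_letter_def)
qed

text \<open>Only the two factors that cross change places, and for them the claim is naturality of
  the crossing; the outer factors meet identities.\<close>

lemma cable_letter_nat:
  assumes i: "1 \<le> i" "i < m" and f [simp]: "\<And>p. f p \<in> Ar P"
  shows "act (\<Sum>p = 1..m. Cod P (f p)) (cable_letter (Cod P \<circ> f) i e) \<cdot> big m f =
    big m (f \<circ> transpose i (Suc i)) \<cdot> act (\<Sum>p = 1..m. Dom P (f p)) (cable_letter (Dom P \<circ> f) i e)"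
proof -
  obtain j r where j: "i = Suc j" "m = j + (2 + r)"
    using split_letter[OF i] by blast
  let ?f = "f \<circ> transpose i (Suc i)"
  have big_f: "big m f = big j f \<star> ((f i \<star> f (Suc i)) \<star> big r (\<lambda>p. f (Suc i + p)))"
    unfolding j by (subst big_split_two) auto
  have "big m ?f = big j ?f \<star> ((f (Suc i) \<star> f i) \<star> big r (\<lambda>p. ?f (Suc i + p)))"
    unfolding j by (subst big_split_two) auto
  also have "big j ?f = big j f" by (rule big_cong) (auto simp: j transpose_def)
  also have "big r (\<lambda>p. ?f (Suc i + p)) = big r (\<lambda>p. f (Suc i + p))"
    by (rule big_cong) (auto simp: j transpose_def)
  finally have big_f': "big m ?f = big j f \<star> ((f (Suc i) \<star> f i) \<star> big r (\<lambda>p. f (Suc i + p)))" .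
  have cod: "act (\<Sum>p = 1..m. Cod P (f p)) (cable_letter (Cod P \<circ> f) i e) =
      Id P (\<Sum>p = 1..j. Cod P (f p)) \<star> (crossing e (Cod P (f i)) (Cod P (f (Suc i))) \<star>
        Id P (\<Sum>p = 1..r. Cod P (f (Suc i + p))))"
    using act_cable_letter[OF i, of "Cod P \<circ> f" e] j by (simp add: sum_1_lessThan del: sum.op_ivl_Suc)
  have dom: "act (\<Sum>p = 1..m. Dom P (f p)) (cable_letter (Dom P \<circ> f) i e) =
      Id P (\<Sum>p = 1..j. Dom P (f p)) \<star> (crossing e (Dom P (f i)) (Dom P (f (Suc i))) \<star>
        Id P (\<Sum>p = 1..r. Dom P (f (Suc i + p))))"
    using act_cable_letter[OF i, of "Dom P \<circ> f" e] j by (simp add: sum_1_lessThan del: sum.op_ivl_Suc)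
  show ?thesis
    unfolding cod dom big_f big_f'
    by (simp add: Ten_Cmp crossing_nat j)
qed

text \<open>Naturality of the braiding, for bundles: a family of arrows slides along the strands of a
  braid word whose strands are cabled according to the targets, respectively the sources.\<close>

lemma cable_nat:
  assumes [simp]: "\<And>p. f p \<in> Ar P" and "w \<in> bwords m"
  shows "act (\<Sum>p = 1..m. Cod P (f p)) (cable_word (Cod P \<circ> f) w) \<cdot> big m f =
    big m (f \<circ> word_perm_inv w) \<cdot> act (\<Sum>p = 1..m. Dom P (f p)) (cable_word (Dom P \<circ> f) w)"
  using assms(2)
proof (induction w rule: word_perm.induct)
  case 1
  show ?case by simp
next
  case (2 i e w)
  let ?\<sigma> = "word_perm_inv w"
  have i: "1 \<le> i" "i < m" and w: "w \<in> bwords m" using 2 by auto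
  have sums: "(\<Sum>p = 1..m. Cod P (f (?\<sigma> p))) = (\<Sum>p = 1..m. Cod P (f p))"
    "(\<Sum>p = 1..m. Dom P (f (?\<sigma> p))) = (\<Sum>p = 1..m. Dom P (f p))"
    "(\<Sum>p = 1..m. Dom P (f (?\<sigma> (transpose i (Suc i) p)))) = (\<Sum>p = 1..m. Dom P (f p))"
    using sum_inv_word_perm[OF w, of "\<lambda>p. Cod P (f p)"] sum_inv_word_perm[OF w, of "\<lambda>p. Dom P (f p)"]
      sum_permutes[OF permutes_swap_id[of i "{1..m}" "Suc i"], of "\<lambda>p. Dom P (f (?\<sigma> p))"] i by auto
  have words: "cable_letter (Cod P \<circ> f \<circ> ?\<sigma>) i e \<in> bwords (\<Sum>p = 1..m. Cod P (f p))"
    "cable_letter (Dom P \<circ> f \<circ> ?\<sigma>) i e \<in> bwords (\<Sum>p = 1..m. Dom P (f p))"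
    "cable_word (Cod P \<circ> f) w \<in> bwords (\<Sum>p = 1..m. Cod P (f p))"
    "cable_word (Dom P \<circ> f) w \<in> bwords (\<Sum>p = 1..m. Dom P (f p))"
    using cable_letter_bwords[OF i, of "Cod P \<circ> f \<circ> ?\<sigma>" e] cable_letter_bwords[OF i, of "Dom P \<circ> f \<circ> ?\<sigma>" e]
      cable_word_bwords[OF w, of "Cod P \<circ> f"] cable_word_bwords[OF w, of "Dom P \<circ> f"] sums by simp_all
  have letter: "act (\<Sum>p = 1..m. Cod P (f p)) (cable_letter (Cod P \<circ> f \<circ> ?\<sigma>) i e) \<cdot> big m (f \<circ> ?\<sigma>) =
      big m (f \<circ> ?\<sigma> \<circ> transpose i (Suc i)) \<cdot> act (\<Sum>p = 1..m. Dom P (f p)) (cable_letter (Dom P \<circ> f \<circ> ?\<sigma>) i e)"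
    using cable_letter_nat[OF i, of "f \<circ> ?\<sigma>" e] sums by (simp add: comp_assoc)
  have "act (\<Sum>p = 1..m. Cod P (f p)) (cable_word (Cod P \<circ> f) ((i, e) # w)) \<cdot> big m f =
      act (\<Sum>p = 1..m. Cod P (f p)) (cable_letter (Cod P \<circ> f \<circ> ?\<sigma>) i e) \<cdot>
        (act (\<Sum>p = 1..m. Cod P (f p)) (cable_word (Cod P \<circ> f) w) \<cdot> big m f)"
    using words by (simp add: act_append cassoc)
  also have "\<dots> = act (\<Sum>p = 1..m. Cod P (f p)) (cable_letter (Cod P \<circ> f \<circ> ?\<sigma>) i e) \<cdot>
      (big m (f \<circ> ?\<sigma>) \<cdot> act (\<Sum>p = 1..m. Dom P (f p)) (cable_word (Dom P \<circ> f) w))"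
    by (simp only: 2(1)[OF w])
  also have "\<dots> = big m (f \<circ> ?\<sigma> \<circ> transpose i (Suc i)) \<cdot>
      (act (\<Sum>p = 1..m. Dom P (f p)) (cable_letter (Dom P \<circ> f \<circ> ?\<sigma>) i e) \<cdot>
       act (\<Sum>p = 1..m. Dom P (f p)) (cable_word (Dom P \<circ> f) w))"
    using extend_right[OF letter] words sums by (simp add: cassoc)
  also have "\<dots> = big m (f \<circ> word_perm_inv ((i, e) # w)) \<cdot>
      act (\<Sum>p = 1..m. Dom P (f p)) (cable_word (Dom P \<circ> f) ((i, e) # w))"
    using words by (simp add: act_append inv_word_perm_Cons comp_assoc del: word_perm.simps)
  finally show ?case .
qed

end

section \<open>Monoids with a group action in a strict braided category\<close>

text \<open>For fibre cardinalities \<open>c\<close>, the position \<open>k\<close> lies in the fibre over \<open>blk c k\<close>.\<close>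

definition blk :: "(nat \<Rightarrow> nat) \<Rightarrow> nat \<Rightarrow> nat" where
  "blk c k = (LEAST i. k \<le> (\<Sum>p = 1..i. c p))"

lemma sum_prefix_mono: "i \<le> j \<Longrightarrow> (\<Sum>p = 1..i. c p) \<le> (\<Sum>p = 1..j. c p)" for c :: "nat \<Rightarrow> nat"
  by (intro sum_mono2) auto

lemma sum_prefix_Suc: "1 \<le> i \<Longrightarrow> (\<Sum>p = 1..i. c p) = (\<Sum>p = 1..<i. c p) + c i" for c :: "nat \<Rightarrow> nat"
  by (cases i) (auto simp: atLeastLessThanSuc_atLeastAtMost)

lemma blk_eqI:
  assumes "1 \<le> i" "(\<Sum>p = 1..<i. c p) < k" "k \<le> (\<Sum>p = 1..i. c p)"
  shows "blk c k = i"
  unfolding blk_def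
proof (rule Least_equality)
  fix j assume j: "k \<le> (\<Sum>p = 1..j. c p)"
  show "i \<le> j"
  proof (rule ccontr)
    assume "\<not> i \<le> j"
    then have "(\<Sum>p = 1..j. c p) \<le> (\<Sum>p = 1..<i. c p)" by (intro sum_mono2) auto
    then show False using j assms by simp
  qed
qed (use assms in simp)

lemma blk_add: "1 \<le> i \<Longrightarrow> 1 \<le> k \<Longrightarrow> k \<le> c i \<Longrightarrow> blk c ((\<Sum>p = 1..<i. c p) + k) = i"
  by (intro blk_eqI) (auto simp: sum_prefix_Suc)

text \<open>\<open>r g\<close> is an endomorphism also for \<open>g\<close> outside the carrier, so
  that iterated products over arbitrary labels are arrows without side conditions.\<close>

locale strict_gmonoid = prob P for P :: "(nat, 'm) bmoncat" (structure) +
  fixes G :: "'g monoid" and m e :: 'm and r :: "'g \<Rightarrow> 'm"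
  assumes m_Ar [simp]: "m \<in> Ar P" and Dom_m [simp]: "Dom P m = 2" and Cod_m [simp]: "Cod P m = 1"
    and e_Ar [simp]: "e \<in> Ar P" and Dom_e [simp]: "Dom P e = 0" and Cod_e [simp]: "Cod P e = 1"
    and r_Ar [simp]: "r g \<in> Ar P" and Dom_r [simp]: "Dom P (r g) = 1" and Cod_r [simp]: "Cod P (r g) = 1"
    and m_assoc: "m \<cdot> (m \<star> Id P 1) = m \<cdot> (Id P 1 \<star> m)"
    and m_unit_left: "m \<cdot> (e \<star> Id P 1) = Id P 1"
    and m_unit_right: "m \<cdot> (Id P 1 \<star> e) = Id P 1"
    and r_m: "r g \<cdot> m = m \<cdot> (r g \<star> r g)"
    and r_e: "r g \<cdot> e = e"
    and r_one: "r \<one>\<^bsub>G\<^esub> = Id P 1"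
    and r_mult: "g \<in> carrier G \<Longrightarrow> h \<in> carrier G \<Longrightarrow> r (g \<otimes>\<^bsub>G\<^esub> h) = r g \<cdot> r h"
begin

section \<open>Iterated multiplication and its compatibility with braids and labels\<close>

primrec mu :: "nat \<Rightarrow> 'm" where
  "mu 0 = e"
| "mu (Suc k) = m \<cdot> (mu k \<star> Id P 1)"

lemma mu_typing: "mu k \<in> Ar P \<and> Dom P (mu k) = k \<and> Cod P (mu k) = 1"
  by (induction k) auto

lemma mu_Ar [simp]: "mu k \<in> Ar P"
  and Dom_mu [simp]: "Dom P (mu k) = k"
  and Cod_mu [simp]: "Cod P (mu k) = 1"
  using mu_typing by auto

lemma mu_1: "mu 1 = Id P 1"
  by (simp add: One_nat_def m_unit_left[unfolded One_nat_def])

lemma mu_2: "mu 2 = m"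
  using mu_1 by (simp add: numeral_2_eq_2 One_nat_def)

text \<open>Generalised associativity by induction on the second factor: \<open>m_unit_right\<close>
  starts it and one use of \<open>m_assoc\<close> carries it on.\<close>

lemma mu_add: "m \<cdot> (mu a \<star> mu b) = mu (a + b)"
proof (induction b)
  case 0
  have "mu a \<star> e = (Id P 1 \<star> e) \<cdot> mu a"
    using Ten_Cmp[of "mu a" "Id P 1" "Id P 0" e] by simp
  then show ?case using extend_right[OF m_unit_right, of "mu a"] by simp
next
  case (Suc b)
  have "mu a \<star> mu (Suc b) = (Id P 1 \<star> m) \<cdot> ((mu a \<star> mu b) \<star> Id P 1)"
    by (simp add: Ten_Cmp Ten_assoc)
  then have "m \<cdot> (mu a \<star> mu (Suc b)) = m \<cdot> ((m \<star> Id P 1) \<cdot> ((mu a \<star> mu b) \<star> Id P 1))"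
    using extend_right[OF m_assoc, of "(mu a \<star> mu b) \<star> Id P 1"] by (simp add: cassoc)
  also have "\<dots> = mu (a + Suc b)" using Suc by (simp add: Ten_Cmp)
  finally show ?case .
qed

lemma mu_big: "mu k \<cdot> big k (\<lambda>j. mu (d j)) = mu (\<Sum>j = 1..k. d j)"
proof (induction k)
  case (Suc k)
  have "mu (Suc k) \<cdot> big (Suc k) (\<lambda>j. mu (d j)) = m \<cdot> ((mu k \<cdot> big k (\<lambda>j. mu (d j))) \<star> mu (d (Suc k)))"
    by (simp add: cassoc Ten_Cmp)
  then show ?case using Suc mu_add by simp
qed simp

lemma r_mu: "r g \<cdot> mu k = mu k \<cdot> big k (\<lambda>_. r g)"
proof (induction k)
  case (Suc k)
  have "r g \<cdot> mu (Suc k) = m \<cdot> ((r g \<cdot> mu k) \<star> r g)"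
    using extend_right[OF r_m[of g], of "mu k \<star> Id P 1"] by (simp add: cassoc Ten_Cmp)
  then show ?case using Suc by (simp add: cassoc Ten_Cmp)
qed (simp add: r_e)

lemma big_mu_mu:
  "big l (\<lambda>i. mu (c i)) \<cdot> big (\<Sum>p = 1..l. c p) (\<lambda>k. mu (d k)) =
    big l (\<lambda>i. mu (\<Sum>k = 1..c i. d ((\<Sum>p = 1..<i. c p) + k)))"
  by (subst big_sum) (simp_all add: big_Cmp mu_big)

text \<open>Equivariance of the multiplication copies the label of a fibre to each strand in it,
  which is how \<open>lab_pull\<close> treats labels.\<close>

lemma big_r_mu:
  "big l (\<lambda>i. r (x i)) \<cdot> big l (\<lambda>i. mu (c i)) =
    big l (\<lambda>i. mu (c i)) \<cdot> big (\<Sum>p = 1..l. c p) (\<lambda>k. r (x (blk c k)))"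
proof -
  have "big (\<Sum>p = 1..l. c p) (\<lambda>k. r (x (blk c k))) =
      big l (\<lambda>i. big (c i) (\<lambda>k. r (x (blk c ((\<Sum>p = 1..<i. c p) + k)))))"
    by (subst big_sum) simp_all
  also have "\<dots> = big l (\<lambda>i. big (c i) (\<lambda>k. r (x i)))"
    by (intro big_cong) (simp add: blk_add)
  finally show ?thesis by (simp add: big_Cmp r_mu)
qed

text \<open>The instance of \<open>cable_nat\<close> for multiplications: all targets are single
  strands, so the word is changed on the source side only.\<close>

lemma act_mu:
  assumes "w \<in> bwords l"
  shows "act l w \<cdot> big l (\<lambda>i. mu (c i)) =
    big l (\<lambda>i. mu (c (word_perm_inv w i))) \<cdot> act (\<Sum>p = 1..l. c p) (cable_word c w)"
  using cable_nat[of "\<lambda>i. mu (c i)" w l] assms cable_word_one[of l "\<lambda>p. 1" w]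
  by (simp add: comp_def)

text \<open>Here all bundles have width one at both ends, and \<open>cable_nat\<close> merely
  carries the labels along the strands.\<close>

lemma r_act:
  assumes "w \<in> bwords n"
  shows "big n (\<lambda>i. r (x i)) \<cdot> act n w = act n w \<cdot> big n (\<lambda>i. r (x (word_perm w i)))"
  using cable_nat[of "\<lambda>i. r (x (word_perm w i))" w n] assms cable_word_one[of n "\<lambda>p. 1" w]
  by (simp add: comp_def surj_f_inv_f bij_is_surj bij_word_perm)

section \<open>Interpretation of arrows in normal form\<close>

definition interp :: "nat \<Rightarrow> nat \<Rightarrow> (nat \<Rightarrow> nat) \<Rightarrow> bword \<Rightarrow> (nat \<Rightarrow> 'g) \<Rightarrow> 'm" where
  "interp n l c w x = big l (\<lambda>i. mu (c i)) \<cdot> (act n w \<cdot> big n (\<lambda>i. r (x i)))"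

lemma interp_Ar [simp]: "w \<in> bwords n \<Longrightarrow> (\<Sum>p = 1..l. c p) = n \<Longrightarrow> interp n l c w x \<in> Ar P"
  and Dom_interp [simp]: "w \<in> bwords n \<Longrightarrow> (\<Sum>p = 1..l. c p) = n \<Longrightarrow> Dom P (interp n l c w x) = n"
  and Cod_interp [simp]: "w \<in> bwords n \<Longrightarrow> (\<Sum>p = 1..l. c p) = n \<Longrightarrow> Cod P (interp n l c w x) = l"
  by (simp_all add: interp_def)

lemma interp_cong:
  assumes "\<And>i. i \<in> {1..l} \<Longrightarrow> c i = c' i" "\<And>i. i \<in> {1..n} \<Longrightarrow> x i = x' i" "act n w = act n w'"
  shows "interp n l c w x = interp n l c' w' x'"
  unfolding interp_def using assms
  by (intro arg_cong2[of _ _ _ _ "(\<cdot>)"] big_cong) auto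

text \<open>The second labels slide through the first multiplications, where they are copied along
  fibres, and then through the first braid. The second braid slides through the first
  multiplications and is cabled there. What remains are two layers of multiplications, which
  merge.\<close>

lemma interp_Cmp:
  assumes w1: "w1 \<in> bwords n" and w2: "w2 \<in> bwords l"
    and c1: "(\<Sum>p = 1..l. c1 p) = n" and c2: "(\<Sum>p = 1..q. c2 p) = l"
    and x1: "\<And>i. i \<in> {1..n} \<Longrightarrow> x1 i \<in> carrier G"
    and x2: "\<And>i. i \<in> {1..n} \<Longrightarrow> x2 (blk c1 (word_perm w1 i)) \<in> carrier G"
  shows "interp l q c2 w2 x2 \<cdot> interp n l c1 w1 x1 =
    interp n q (\<lambda>i. \<Sum>k = 1..c2 i. c1 (word_perm_inv w2 ((\<Sum>p = 1..<i. c2 p) + k)))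
      (cable_word c1 w2 @ w1) (\<lambda>i. x2 (blk c1 (word_perm w1 i)) \<otimes>\<^bsub>G\<^esub> x1 i)"
proof -
  let ?M1 = "big l (\<lambda>i. mu (c1 i))" and ?M2 = "big q (\<lambda>i. mu (c2 i))"
  let ?M1' = "big l (\<lambda>i. mu (c1 (word_perm_inv w2 i)))"
  let ?L1 = "big n (\<lambda>i. r (x1 i))" and ?L2 = "big l (\<lambda>i. r (x2 i))"
  let ?L2' = "big n (\<lambda>i. r (x2 (blk c1 i)))" and ?L2'' = "big n (\<lambda>i. r (x2 (blk c1 (word_perm w1 i))))"
  have cw: "cable_word c1 w2 \<in> bwords n" using cable_word_bwords[OF w2, of c1] c1 by simp
  have c1': "(\<Sum>p = 1..l. c1 (word_perm_inv w2 p)) = n" using sum_inv_word_perm[OF w2, of c1] c1 by simp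
  note typing = w1 w2 c1 c2 cw c1'
  have 1: "?L2 \<cdot> ?M1 = ?M1 \<cdot> ?L2'" using big_r_mu[of l x2 c1] c1 by simp
  have 2: "act l w2 \<cdot> ?M1 = ?M1' \<cdot> act n (cable_word c1 w2)" using act_mu[OF w2, of c1] c1 by simp
  have 3: "?L2' \<cdot> act n w1 = act n w1 \<cdot> ?L2''" using r_act[OF w1, of "\<lambda>i. x2 (blk c1 i)"] by simp
  have 4: "?L2'' \<cdot> ?L1 = big n (\<lambda>i. r (x2 (blk c1 (word_perm w1 i)) \<otimes>\<^bsub>G\<^esub> x1 i))"
    using x1 x2 r_mult by (simp add: big_Cmp) (intro big_cong, simp)
  have 5: "?M2 \<cdot> ?M1' = big q (\<lambda>i. mu (\<Sum>k = 1..c2 i. c1 (word_perm_inv w2 ((\<Sum>p = 1..<i. c2 p) + k))))"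
    using big_mu_mu[of q c2 "\<lambda>i. c1 (word_perm_inv w2 i)"] c2 by simp
  have "interp l q c2 w2 x2 \<cdot> interp n l c1 w1 x1 = ?M2 \<cdot> (act l w2 \<cdot> (?L2 \<cdot> (?M1 \<cdot> (act n w1 \<cdot> ?L1))))"
    using typing by (simp add: interp_def cassoc)
  also have "\<dots> = ?M2 \<cdot> (act l w2 \<cdot> (?M1 \<cdot> (?L2' \<cdot> (act n w1 \<cdot> ?L1))))"
    using typing by (simp add: extend_right[OF 1] cassoc)
  also have "\<dots> = ?M2 \<cdot> (act l w2 \<cdot> (?M1 \<cdot> (act n w1 \<cdot> (?L2'' \<cdot> ?L1))))"
    using typing by (simp add: extend_right[OF 3] cassoc)
  also have "\<dots> = ?M2 \<cdot> (?M1' \<cdot> (act n (cable_word c1 w2) \<cdot> (act n w1 \<cdot> (?L2'' \<cdot> ?L1))))"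
    using typing by (simp add: extend_right[OF 2] cassoc)
  also have "\<dots> = (?M2 \<cdot> ?M1') \<cdot> (act n (cable_word c1 w2 @ w1) \<cdot> (?L2'' \<cdot> ?L1))"
    using typing by (simp add: act_append cassoc)
  finally show ?thesis unfolding interp_def 4 5 .
qed

lemma interp_Ten:
  assumes w: "w \<in> bwords n" "w' \<in> bwords n'"
    and c: "(\<Sum>p = 1..l. c p) = n" "(\<Sum>p = 1..l'. c' p) = n'"
  shows "interp (n + n') (l + l') (\<lambda>i. if i \<le> l then c i else c' (i - l)) (w @ word_shift n w')
      (\<lambda>i. if i \<le> n then x i else x' (i - n)) = interp n l c w x \<star> interp n' l' c' w' x'"
proof -
  have *: "big (a + b) (\<lambda>i. f (if i \<le> a then g i else h (i - a))) = big a (\<lambda>i. f (g i)) \<star> big b (\<lambda>i. f (h i))"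
    if "\<And>y. f y \<in> Ar P" for a b and f :: "'z \<Rightarrow> 'm" and g h
  proof -
    have "big a (\<lambda>i. f (if i \<le> a then g i else h (i - a))) = big a (\<lambda>i. f (g i))"
      "big b (\<lambda>i. f (if a + i \<le> a then g (a + i) else h (a + i - a))) = big b (\<lambda>i. f (h i))"
      by (intro big_cong; simp)+
    then show ?thesis using that by (subst big_add) simp_all
  qed
  have "word_shift n w' \<in> bwords (n + n')" "w \<in> bwords (n + n')"
    using w by (auto intro: bwords_shift bwords_mono)
  then have "act (n + n') (w @ word_shift n w') = act n w \<star> act n' w'"
    using w by (simp add: act_append act_extend act_shift' Ten_Cmp)
  then show ?thesis using w c by (simp add: interp_def * Ten_Cmp)
qed

lemma interp_word:
  assumes "w \<in> bwords n" "\<And>i. i \<in> {1..n} \<Longrightarrow> c i = 1" "\<And>i. i \<in> {1..n} \<Longrightarrow> x i = \<one>\<^bsub>G\<^esub>"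
  shows "interp n n c w x = act n w"
proof -
  have "interp n n c w x = interp n n (\<lambda>_. 1) w (\<lambda>_. \<one>\<^bsub>G\<^esub>)"
    using assms by (intro interp_cong) auto
  also have "\<dots> = act n w" using assms(1) by (simp add: interp_def mu_1 r_one big_Id)
  finally show ?thesis .
qed

lemma interp_2: "interp 2 1 (\<lambda>_. 2) [] (\<lambda>_. \<one>\<^bsub>G\<^esub>) = m"
  by (simp add: interp_def r_one big_Id mu_2) (simp add: One_nat_def mu_2)

lemma interp_0: "interp 0 1 (\<lambda>_. 0) [] x = e"
  by (simp add: interp_def) (simp add: One_nat_def)

lemma interp_1: "interp 1 1 (\<lambda>_. 1) [] (\<lambda>_. g) = r g"
proof -
  have "big 1 f = f 1" if "f 1 \<in> Ar P" for f using that by (simp add: One_nat_def)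
  then show ?thesis by (simp add: interp_def mu_1)
qed

end

section \<open>Cabling respects the braid relations\<close>

lemma braid_eq_bwords: "braid_eq n v w \<Longrightarrow> v \<in> bwords n \<and> w \<in> bwords n"
  by (induction rule: braid_eq.induct) auto

lemma braid_eq_context:
  assumes "braid_eq n v w" "u \<in> bwords n" "u' \<in> bwords n"
  shows "braid_eq n (u @ v @ u') (u @ w @ u')"
  using assms
proof induction
  case (step r s x y)
  then show ?case using braid_eq.step[of r s "u @ x" "y @ u'" n] by simp
next
  case (trans a b c)
  then show ?case using braid_eq.trans by blast
qed (auto intro: braid_eq.refl braid_eq.sym)

lemma braid_eq_append:
  assumes "braid_eq n v v'" "braid_eq n w w'"
  shows "braid_eq n (v @ w) (v' @ w')"
  using braid_eq_context[OF assms(1), of "[]" w] braid_eq_context[OF assms(2), of v' "[]"]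
    braid_eq_bwords[OF assms(1)] braid_eq_bwords[OF assms(2)] by (auto intro: braid_eq.trans)

lemma artin_imp_braid_eq: "artin r s \<Longrightarrow> r \<in> bwords n \<Longrightarrow> s \<in> bwords n \<Longrightarrow> braid_eq n r s"
  using braid_eq.step[of r s "[]" "[]" n] by simp

lemma artin_shift: "artin r s \<Longrightarrow> artin (word_shift d r) (word_shift d s)"
  by (induction rule: artin.induct)
    (auto simp: intro!: artin.cancel artin.far artin.braid[of "d + _", simplified])

lemma braid_eq_shift:
  assumes "braid_eq n v w" "d + n \<le> m"
  shows "braid_eq m (word_shift d v) (word_shift d w)"
  using assms
proof induction
  case (step r s x y)
  then have "word_shift d (x @ r @ y) \<in> bwords m" "word_shift d (x @ s @ y) \<in> bwords m"
    using bwords_shift by blast+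
  then show ?case
    using braid_eq.step[of "word_shift d r" "word_shift d s" "word_shift d x" "word_shift d y" m]
      artin_shift[OF step(1)] by simp
next
  case (trans a b c)
  then show ?case using braid_eq.trans by blast
qed (auto intro: braid_eq.refl braid_eq.sym bwords_shift)

lemma braid_eq_mono: "braid_eq n v w \<Longrightarrow> n \<le> m \<Longrightarrow> braid_eq m v w"
  using braid_eq_shift[of n v w 0 m] by simp

lemma braid_eq_inv_right: "w \<in> bwords n \<Longrightarrow> braid_eq n (w @ word_inv w) []"
proof (induction w rule: word_perm.induct)
  case (2 i e w)
  then have "braid_eq n ([(i, e)] @ (w @ word_inv w) @ [(i, \<not> e)]) ([(i, e)] @ [] @ [(i, \<not> e)])"
    by (intro braid_eq_context) auto
  moreover have "braid_eq n [(i, e), (i, \<not> e)] []"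
    using 2 by (intro artin_imp_braid_eq artin.cancel) auto
  ultimately show ?case by (auto intro: braid_eq.trans)
qed (auto intro: braid_eq.refl)

lemma braid_eq_inv_left: "w \<in> bwords n \<Longrightarrow> braid_eq n (word_inv w @ w) []"
  using braid_eq_inv_right[of "word_inv w" n] by simp

text \<open>The far and braid relations are given for positive letters. Block words are positive, so
  the sliding arguments can stay within positive words.\<close>

definition positive :: "bword \<Rightarrow> bool" where
  "positive w \<longleftrightarrow> (\<forall>(i, e) \<in> set w. e)"

lemma positive_simps [simp]:
  "positive []" "positive ((i, e) # w) \<longleftrightarrow> e \<and> positive w"
  "positive (v @ w) \<longleftrightarrow> positive v \<and> positive w" "positive (word_shift d w) \<longleftrightarrow> positive w"
  by (auto simp: positive_def word_shift_def)

lemma positive_pass [simp]: "positive (pass_word b)"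
  by (auto simp: positive_def pass_word_def)

lemma positive_block [simp]: "positive (block_word a b)"
  by (auto simp: positive_def block_word_def)

lemma far_letter_commute:
  assumes "positive w" "w \<in> bwords n" "1 \<le> i" "i < n" "\<And>k. k \<in> fst ` set w \<Longrightarrow> i + 2 \<le> k"
  shows "braid_eq n ((i, True) # w) (w @ [(i, True)])"
  using assms
proof (induction w rule: word_perm.induct)
  case (2 k e w)
  have "braid_eq n [(i, True), (k, True)] [(k, True), (i, True)]"
    using 2 by (intro artin_imp_braid_eq artin.far) auto
  then have "braid_eq n ([(i, True), (k, True)] @ w) ([(k, True), (i, True)] @ w)"
    using 2 by (intro braid_eq_append braid_eq.refl) auto
  moreover have "braid_eq n ([(k, True)] @ ((i, True) # w)) ([(k, True)] @ (w @ [(i, True)]))"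
    using 2 by (intro braid_eq_append braid_eq.refl) auto
  ultimately show ?case using 2 by (auto intro: braid_eq.trans)
qed (auto intro: braid_eq.refl)

lemma far_commute:
  assumes "positive v" "positive w" "v \<in> bwords n" "w \<in> bwords n"
    "\<And>i k. i \<in> fst ` set v \<Longrightarrow> k \<in> fst ` set w \<Longrightarrow> i + 2 \<le> k"
  shows "braid_eq n (v @ w) (w @ v)"
  using assms
proof (induction v rule: word_perm.induct)
  case (2 i e v)
  have IH: "braid_eq n (v @ w) (w @ v)" using 2 by auto
  have "braid_eq n ([(i, True)] @ (v @ w)) ([(i, True)] @ (w @ v))"
    using 2 by (intro braid_eq_append[OF braid_eq.refl IH]) auto
  moreover have "braid_eq n (((i, True) # w) @ v) ((w @ [(i, True)]) @ v)"
    using 2 by (intro braid_eq_append far_letter_commute braid_eq.refl) auto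
  ultimately show ?case using 2 by (auto intro: braid_eq.trans)
qed (auto intro: braid_eq.refl)

lemma bwords_letters: "w \<in> bwords n \<Longrightarrow> k \<in> fst ` set w \<Longrightarrow> 1 \<le> k \<and> k < n"
  by (auto simp: bwords_def)

lemma fst_set_word_shift: "fst ` set (word_shift d w) = (+) d ` fst ` set w"
  by (force simp: word_shift_def)

lemma block_word_2: "block_word 2 c = pass_word c @ word_shift 1 (pass_word c)"
  using block_word_Suc[of 1 c] block_word_Suc[of 0 c] by (simp add: numeral_2_eq_2 One_nat_def)

text \<open>One more strand in the second block: the letter \<open>Suc (Suc c)\<close> of the second
  passage moves to the front past \<open>pass_word c\<close>, whose letters are at most
  \<open>c\<close>.\<close>

lemma block_word_2_Suc:
  "braid_eq (Suc (Suc (Suc c))) (block_word 2 (Suc c)) ([(Suc c, True), (Suc (Suc c), True)] @ block_word 2 c)"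
proof -
  let ?n = "Suc (Suc (Suc c))"
  have p: "pass_word c \<in> bwords ?n" "word_shift 1 (pass_word c) \<in> bwords ?n"
    using pass_word_bwords[of c] by (auto intro: bwords_mono bwords_shift)
  have "braid_eq ?n (pass_word c @ [(Suc (Suc c), True)]) ([(Suc (Suc c), True)] @ pass_word c)"
    using p bwords_letters[OF pass_word_bwords[of c]] by (intro far_commute) force+
  then have "braid_eq ?n ([(Suc c, True)] @ (pass_word c @ [(Suc (Suc c), True)]) @ word_shift 1 (pass_word c))
      ([(Suc c, True)] @ ([(Suc (Suc c), True)] @ pass_word c) @ word_shift 1 (pass_word c))"
    using p by (intro braid_eq_context) auto
  then show ?thesis by (simp add: block_word_2 pass_word_Suc flip: Suc_eq_plus1_left)
qed

text \<open>Two strands may cross each other before or after passing over \<open>c\<close> others.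
  Each of the \<open>c\<close> strands costs one braid relation.\<close>

lemma block_word_2_nat:
  "braid_eq (Suc (Suc c)) ((Suc c, True) # block_word 2 c) (block_word 2 c @ [(1, True)])"
proof (induction c)
  case 0
  show ?case by (simp add: One_nat_def braid_eq.refl)
next
  case (Suc c)
  let ?n = "Suc (Suc (Suc c))"
  let ?x = "(Suc c, True)" and ?y = "(Suc (Suc c), True)"
  have b: "block_word 2 c \<in> bwords ?n" using block_word_bwords[of 2 c] by (rule bwords_mono) simp
  have b': "block_word 2 (Suc c) \<in> bwords ?n" using block_word_bwords[of 2 "Suc c"] by (rule bwords_mono) simp
  have 1: "braid_eq ?n ([?y] @ block_word 2 (Suc c)) ([?y] @ [?x, ?y] @ block_word 2 c)"
    by (intro braid_eq_append block_word_2_Suc braid_eq.refl) auto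
  have "braid_eq ?n [?y, ?x, ?y] [?x, ?y, ?x]"
    by (intro braid_eq.sym[OF artin_imp_braid_eq] artin.braid) auto
  then have 2: "braid_eq ?n ([?y, ?x, ?y] @ block_word 2 c) ([?x, ?y, ?x] @ block_word 2 c)"
    using b by (intro braid_eq_append braid_eq.refl) auto
  have 3: "braid_eq ?n ([?x, ?y] @ (?x # block_word 2 c)) ([?x, ?y] @ (block_word 2 c @ [(1, True)]))"
    by (intro braid_eq_append braid_eq.refl braid_eq_mono[OF Suc]) auto
  have 4: "braid_eq ?n (([?x, ?y] @ block_word 2 c) @ [(1, True)]) (block_word 2 (Suc c) @ [(1, True)])"
    by (intro braid_eq_append braid_eq.sym[OF block_word_2_Suc] braid_eq.refl) auto
  show ?case
    using braid_eq.trans[OF 1[unfolded append_Cons append_Nil] braid_eq.trans[OF 2[unfolded append_Cons append_Nil]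
      braid_eq.trans[OF 3[unfolded append_Cons append_Nil] 4[unfolded append_assoc append_Cons append_Nil]]]] .
qed

text \<open>Only the passage of the two crossing strands changes the letter; the passages of the
  \<open>j\<close> strands before and the \<open>r\<close> strands after them commute with it, one
  on each side of the change of index.\<close>

lemma block_word_letter_nat:
  assumes "1 \<le> i" "i < a"
  shows "braid_eq (a + c) ((c + i, True) # block_word a c) (block_word a c @ [(i, True)])"
proof -
  obtain j r where j: "i = Suc j" "a = j + (2 + r)" using split_letter[OF assms] by blast
  let ?n = "a + c" and ?A = "block_word j c" and ?B = "word_shift j (block_word 2 c)"
    and ?D = "word_shift (j + 2) (block_word r c)"
  have block: "block_word a c = ?A @ ?B @ ?D"
    unfolding j block_word_add by simp
  have ABD: "?A \<in> bwords ?n" "?B \<in> bwords ?n" "?D \<in> bwords ?n"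
    using block_word_bwords[of a c] unfolding block by auto
  have 1: "braid_eq ?n (([(c + i, True)] @ ?A) @ ?B @ ?D) ((?A @ [(c + i, True)]) @ ?B @ ?D)"
    using ABD j bwords_letters[OF block_word_bwords[of j c]]
    by (intro braid_eq_append braid_eq.sym[OF far_commute] braid_eq.refl) force+
  have "braid_eq ?n (word_shift j ((Suc c, True) # block_word 2 c)) (word_shift j (block_word 2 c @ [(1, True)]))"
    using j by (intro braid_eq_shift[OF block_word_2_nat]) auto
  then have "braid_eq ?n ([(c + i, True)] @ ?B) (?B @ [(i, True)])" using j by (simp add: ac_simps flip: Suc_eq_plus1_left)
  then have 2: "braid_eq ?n (?A @ ([(c + i, True)] @ ?B) @ ?D) (?A @ (?B @ [(i, True)]) @ ?D)"
    using ABD by (intro braid_eq_context) auto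
  have "i + 2 \<le> k" if k: "k \<in> fst ` set ?D" for k
  proof -
    obtain k' where "k = (j + 2) + k'" "k' \<in> fst ` set (block_word r c)"
      using k unfolding fst_set_word_shift by blast
    then show ?thesis using bwords_letters[OF block_word_bwords] j by fastforce
  qed
  then have D: "braid_eq ?n ([(i, True)] @ ?D) (?D @ [(i, True)])"
    using ABD j by (intro far_commute) auto
  then have 3: "braid_eq ?n ((?A @ ?B) @ ([(i, True)] @ ?D)) ((?A @ ?B) @ (?D @ [(i, True)]))"
    using ABD by (intro braid_eq_append[OF braid_eq.refl D]) auto
  show ?thesis
    unfolding block using 1 2 3 by (auto intro: braid_eq.trans)
qed

text \<open>Naturality of the block braid in its first argument, at the level of words. With a block
  word for \<open>u\<close> it becomes the cabled braid relation.\<close>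

lemma block_word_nat:
  assumes "positive u" "u \<in> bwords a"
  shows "braid_eq (a + c) (word_shift c u @ block_word a c) (block_word a c @ u)"
  using assms
proof (induction u rule: word_perm.induct)
  case 1
  then show ?case using block_word_bwords by (simp add: braid_eq.refl)
next
  case (2 i e u)
  have IH: "braid_eq (a + c) (word_shift c u @ block_word a c) (block_word a c @ u)" using 2 by auto
  have "braid_eq (a + c) ([(c + i, True)] @ (word_shift c u @ block_word a c)) ([(c + i, True)] @ (block_word a c @ u))"
    using 2 by (intro braid_eq_append[OF braid_eq.refl IH]) auto
  moreover have "braid_eq (a + c) (((c + i, True) # block_word a c) @ u) ((block_word a c @ [(i, True)]) @ u)"
    using 2 by (intro braid_eq_append braid_eq.refl block_word_letter_nat) (auto intro: bwords_mono)
  ultimately show ?case using 2 by (auto intro: braid_eq.trans)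
qed

section \<open>Cabling of composites and of Artin's relations\<close>

lemma cable_word_append:
  "cable_word c (u @ v) = cable_word (c \<circ> word_perm_inv v) u @ cable_word c v"
proof (induction u rule: word_perm.induct)
  case (2 i e u)
  have "word_perm_inv (u @ v) = word_perm_inv v \<circ> word_perm_inv u"
    by (simp add: o_inv_distrib bij_word_perm)
  then have "c \<circ> word_perm_inv (u @ v) = (c \<circ> word_perm_inv v) \<circ> word_perm_inv u"
    by (simp only: comp_assoc)
  then show ?case
    using 2 by (simp only: append_Cons cable_word_Cons append_assoc)
qed simp

lemma word_perm_artin: "artin r s \<Longrightarrow> word_perm r = word_perm s"
proof (induction rule: artin.induct)
  case (cancel i e)
  show ?case by (simp add: fun_eq_iff)
next
  case (far i k)
  then show ?case by (auto simp: fun_eq_iff transpose_def)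
next
  case (braid i)
  show ?case by (auto simp: fun_eq_iff transpose_def)
qed

lemma word_perm_braid_eq: "braid_eq n v w \<Longrightarrow> word_perm v = word_perm w"
  by (induction rule: braid_eq.induct) (auto simp: word_perm_artin)

lemma sum_prefix_cong: "(\<And>p. p < i \<Longrightarrow> d p = d' p) \<Longrightarrow> (\<Sum>p = 1..<i. d p) = (\<Sum>p = 1..<i. d' p)"
  for d :: "nat \<Rightarrow> nat"
  by (intro sum.cong) auto

lemma word_perm_inv_0: "word_perm_inv [] = id"
  and word_perm_inv_1: "word_perm_inv [(i, e)] = transpose i (Suc i)"
  and word_perm_inv_2: "word_perm_inv [(i, e), (k, e')] = transpose k (Suc k) \<circ> transpose i (Suc i)"
  by (simp_all only: inv_word_perm_Cons word_perm.simps(1) inv_id id_comp)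

text \<open>A cancelling pair becomes a word followed by its inverse, far letters become words on
  separate strands, and the braid relation becomes naturality of a block braid.\<close>

lemma cable_word_artin:
  assumes "artin r s" "r \<in> bwords m" "s \<in> bwords m"
  shows "braid_eq (\<Sum>p = 1..m. c p) (cable_word c r) (cable_word c s)"
  using assms
proof (cases rule: artin.cases)
  case (cancel i e)
  let ?X = "cable_letter (c \<circ> transpose i (Suc i)) i e"
  have "(\<Sum>p = 1..<i. c (transpose i (Suc i) p)) = (\<Sum>p = 1..<i. c p)"
    by (intro sum_prefix_cong) (simp add: transpose_def)
  \<comment> \<open>The right letter acts first, on the original widths; the left one acts after the
    crossing, on exchanged widths. Hence the two cabled letters are inverse words.\<close>
  then have X: "cable_letter c i (\<not> e) = word_inv ?X"
    by (simp add: cable_letter_def word_inv_shift)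
  have "cable_word c r = ?X @ word_inv ?X"
    using cancel X by (simp add: inv_word_perm_Cons comp_def)
  moreover have "?X \<in> bwords (\<Sum>p = 1..m. c p)"
    using cable_letter_bwords[of i m "c \<circ> transpose i (Suc i)" e] assms cancel
      sum_permutes[OF permutes_swap_id[of i "{1..m}" "Suc i"], of c] by simp
  ultimately show ?thesis using cancel braid_eq_inv_right by simp
next
  case (far i k)
  let ?X = "cable_letter c i True" and ?Y = "cable_letter c k True"
  have ik: "1 \<le> i" "i + 2 \<le> k" "k < m" using assms far by auto
  have X: "cable_letter (c \<circ> transpose k (Suc k)) i True = ?X"
  proof -
    have "(\<Sum>p = 1..<i. c (transpose k (Suc k) p)) = (\<Sum>p = 1..<i. c p)"
      using ik by (intro sum_prefix_cong) (simp add: transpose_def)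
    then show ?thesis using ik by (simp add: cable_letter_def transpose_def)
  qed
  have Y: "cable_letter (c \<circ> transpose i (Suc i)) k True = ?Y"
  proof -
    have "{1..<k} = {1..k - 1}" using ik by auto
    then have "(\<Sum>p = 1..<k. c (transpose i (Suc i) p)) = (\<Sum>p = 1..<k. c p)"
      using ik sum_permutes[OF permutes_swap_id[of i "{1..k - 1}" "Suc i"], of c] by simp
    then show ?thesis using ik by (simp add: cable_letter_def transpose_def)
  qed
  have XY: "?X \<in> bwords (\<Sum>p = 1..m. c p)" "?Y \<in> bwords (\<Sum>p = 1..m. c p)"
    using ik by (auto intro!: cable_letter_bwords)
  have "braid_eq (\<Sum>p = 1..m. c p) (?X @ ?Y) (?Y @ ?X)"
  proof (rule far_commute[OF _ _ XY])
    fix x y assume "x \<in> fst ` set ?X" "y \<in> fst ` set ?Y"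
    then obtain x' y' where x': "x = (\<Sum>p = 1..<i. c p) + x'" "x' \<in> fst ` set (block_word (c i) (c (Suc i)))"
      and y': "y = (\<Sum>p = 1..<k. c p) + y'" "y' \<in> fst ` set (block_word (c k) (c (Suc k)))"
      unfolding cable_letter_def fst_set_word_shift if_True by blast
    have "x' < c i + c (Suc i)" "1 \<le> y'"
      using bwords_letters[OF block_word_bwords] x' y' by blast+
    \<comment> \<open>The bundles at \<open>i\<close> and \<open>i + 1\<close> end before the bundle
      at \<open>k\<close> begins, so letters of the two cabled words are at least two apart.\<close>
    moreover have "(\<Sum>p = 1..<i. c p) + c i + c (Suc i) \<le> (\<Sum>p = 1..<k. c p)"
    proof -
      have "(\<Sum>p = 1..<i. c p) + c i + c (Suc i) = (\<Sum>p = 1..<i + 2. c p)"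
        using ik by (simp add: numeral_2_eq_2)
      also have "\<dots> \<le> (\<Sum>p = 1..<k. c p)" using ik by (intro sum_mono2) auto
      finally show ?thesis .
    qed
    ultimately show "x + 2 \<le> y" using x' y' by linarith
  qed (simp_all add: cable_letter_def)
  then show ?thesis using far X Y by (simp add: inv_word_perm_Cons comp_def)
next
  case (braid i)
  let ?N = "\<Sum>p = 1..m. c p" and ?o = "\<Sum>p = 1..<i. c p"
    and ?a = "c i" and ?b = "c (Suc i)" and ?d = "c (Suc (Suc i))"
  have i: "1 \<le> i" "Suc i < m" using assms braid by auto
  have sum_i: "(\<Sum>p = 1..<Suc i. f p) = (\<Sum>p = 1..<i. f p) + f i" for f :: "nat \<Rightarrow> nat"
    using i by simp
  have [simp]: "(\<Sum>p = 1..<i. c (transpose i (Suc i) p)) = ?o"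
    "(\<Sum>p = 1..<i. c (transpose (Suc i) (Suc (Suc i)) p)) = ?o"
    "(\<Sum>p = 1..<i. c (transpose i (Suc i) (transpose (Suc i) (Suc (Suc i)) p))) = ?o"
    "(\<Sum>p = 1..<i. c (transpose (Suc i) (Suc (Suc i)) (transpose i (Suc i) p))) = ?o"
    by (intro sum_prefix_cong; simp add: transpose_def)+
  have tr [simp]: "transpose (Suc i) (Suc (Suc i)) i = i"
    "transpose i (Suc i) (Suc (Suc i)) = Suc (Suc i)" by (auto simp: transpose_def)
  have bound: "?o + (?a + ?b + ?d) \<le> ?N"
  proof -
    have "?o + (?a + ?b + ?d) = (\<Sum>p = 1..<Suc (Suc (Suc i)). c p)" using i by simp
    also have "\<dots> \<le> ?N" using i by (intro sum_mono2) auto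
    finally show ?thesis .
  qed
  have r: "cable_word c r = word_shift ?o
      (block_word ?b ?d @ word_shift ?b (block_word ?a ?d) @ block_word ?a ?b)"
    using braid by (simp only: cable_word_Cons cable_word.simps(1) word_perm_inv_0 word_perm_inv_1
      word_perm_inv_2 append_Nil2) (use i in \<open>simp add: cable_letter_def sum_i\<close>)
  have s: "cable_word c s = word_shift ?o
      (word_shift ?d (block_word ?a ?b) @ block_word ?a ?d @ word_shift ?a (block_word ?b ?d))"
    using braid by (simp only: cable_word_Cons cable_word.simps(1) word_perm_inv_0 word_perm_inv_1
      word_perm_inv_2 append_Nil2) (use i in \<open>simp add: cable_letter_def sum_i\<close>)
  \<comment> \<open>The cabled braid relation: the crossing of the first two bundles slides through
    their joint passage over the third.\<close>
  have nat: "braid_eq (?a + ?b + ?d) (word_shift ?d (block_word ?a ?b) @ block_word (?a + ?b) ?d)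
      (block_word (?a + ?b) ?d @ block_word ?a ?b)"
    by (intro block_word_nat block_word_bwords positive_block)
  have ba: "block_word (?a + ?b) ?d = block_word ?b ?d @ word_shift ?b (block_word ?a ?d)"
    using block_word_add[of ?b ?a ?d] by (simp add: add.commute)
  have "braid_eq (?a + ?b + ?d)
      (word_shift ?d (block_word ?a ?b) @ (block_word ?a ?d @ word_shift ?a (block_word ?b ?d)))
      ((block_word ?b ?d @ word_shift ?b (block_word ?a ?d)) @ block_word ?a ?b)"
    unfolding block_word_add[of ?a ?b ?d, symmetric] ba[symmetric] by (rule nat)
  from braid_eq.sym[OF braid_eq_shift[OF this[unfolded append_assoc] bound]]
  show ?thesis unfolding r s .
qed

text \<open>Letters to the left of a rewritten factor see the bundle widths as permuted by that
  factor. Both sides of a relation have the same permutation, so the cabling of the left part is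
  unaffected.\<close>

lemma cable_word_braid_eq:
  assumes "braid_eq m v w"
  shows "braid_eq (\<Sum>p = 1..m. c p) (cable_word c v) (cable_word c w)"
  using assms
proof induction
  case (step r s x y)
  let ?d = "c \<circ> word_perm_inv y"
  have xy: "x \<in> bwords m" "y \<in> bwords m" "r \<in> bwords m" "s \<in> bwords m" using step by auto
  have rs: "word_perm r = word_perm s" using step by (intro word_perm_artin)
  have d: "(\<Sum>p = 1..m. ?d p) = (\<Sum>p = 1..m. c p)" using sum_inv_word_perm[OF xy(2), of c] by simp
  have d': "(\<Sum>p = 1..m. (?d \<circ> word_perm_inv s) p) = (\<Sum>p = 1..m. c p)"
    using sum_inv_word_perm[OF xy(4), of ?d] d by simp
  have "braid_eq (\<Sum>p = 1..m. c p) (cable_word ?d r) (cable_word ?d s)"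
    using cable_word_artin[OF step(1) xy(3,4), of ?d] d by simp
  moreover have "cable_word (?d \<circ> word_perm_inv s) x \<in> bwords (\<Sum>p = 1..m. c p)"
    using cable_word_bwords[OF xy(1), of "?d \<circ> word_perm_inv s"] d' by simp
  moreover have "cable_word c y \<in> bwords (\<Sum>p = 1..m. c p)"
    using cable_word_bwords[OF xy(2), of c] .
  ultimately have "braid_eq (\<Sum>p = 1..m. c p)
      (cable_word (?d \<circ> word_perm_inv s) x @ cable_word ?d r @ cable_word c y)
      (cable_word (?d \<circ> word_perm_inv s) x @ cable_word ?d s @ cable_word c y)"
    by (intro braid_eq_context)
  moreover have "cable_word c (x @ z @ y) = cable_word (?d \<circ> word_perm_inv z) x @ cable_word ?d z @ cable_word c y" for z
    using cable_word_append[of c "x @ z" y] cable_word_append[of ?d x z] by simp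
  ultimately show ?case using rs by simp
next
  case (trans a b c)
  then show ?case using braid_eq.trans by blast
qed (auto intro: braid_eq.refl braid_eq.sym cable_word_bwords)


section \<open>Coxeter's presentation of the symmetric groups\<close>

text \<open>Adjoins to the braid relations the change of sign of a letter, which expresses that each
  generator is its own inverse.\<close>

inductive sym_eq :: "nat \<Rightarrow> bword \<Rightarrow> bword \<Rightarrow> bool" for n where
  braid: "braid_eq n v w \<Longrightarrow> sym_eq n v w"
| flip: "u @ [(i, e)] @ v \<in> bwords n \<Longrightarrow> sym_eq n (u @ [(i, e)] @ v) (u @ [(i, \<not> e)] @ v)"
| trans: "sym_eq n u v \<Longrightarrow> sym_eq n v w \<Longrightarrow> sym_eq n u w"

lemma sym_eq_bwords: "sym_eq n v w \<Longrightarrow> v \<in> bwords n \<and> w \<in> bwords n"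
  by (induction rule: sym_eq.induct) (auto dest: braid_eq_bwords)

lemma sym_eq_refl: "w \<in> bwords n \<Longrightarrow> sym_eq n w w"
  by (intro sym_eq.braid braid_eq.refl)

lemma sym_eq_sym: "sym_eq n v w \<Longrightarrow> sym_eq n w v"
proof (induction rule: sym_eq.induct)
  case (flip u i e v)
  then show ?case using sym_eq.flip[of u i "\<not> e" v n] by simp
qed (auto intro: sym_eq.braid braid_eq.sym sym_eq.trans)

lemma sym_eq_context:
  assumes "sym_eq n v w" "u \<in> bwords n" "u' \<in> bwords n"
  shows "sym_eq n (u @ v @ u') (u @ w @ u')"
  using assms
proof induction
  case (braid v w)
  then show ?case by (intro sym_eq.braid braid_eq_context)
next
  case (flip x i e y)
  then show ?case using sym_eq.flip[of "u @ x" i e "y @ u'" n] by simp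
next
  case (trans a b c)
  then show ?case using sym_eq.trans by blast
qed

lemma sym_eq_append:
  assumes "sym_eq n v v'" "sym_eq n w w'"
  shows "sym_eq n (v @ w) (v' @ w')"
  using sym_eq_context[OF assms(1), of "[]" w] sym_eq_context[OF assms(2), of v' "[]"]
    sym_eq_bwords[OF assms(1)] sym_eq_bwords[OF assms(2)] by (auto intro: sym_eq.trans)

lemma sym_eq_mono: "sym_eq n v w \<Longrightarrow> n \<le> m \<Longrightarrow> sym_eq m v w"
proof (induction rule: sym_eq.induct)
  case (braid v w)
  then show ?case using sym_eq.braid[OF braid_eq_mono] by simp
next
  case (flip u i e v)
  then have "u @ [(i, e)] @ v \<in> bwords m" using bwords_mono by blast
  then show ?case by (rule sym_eq.flip)
next
  case (trans u v w)
  show ?case by (rule sym_eq.trans[OF trans.IH(1)[OF trans.prems] trans.IH(2)[OF trans.prems]])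
qed

lemma word_perm_sym_eq: "sym_eq n v w \<Longrightarrow> word_perm v = word_perm w"
  by (induction rule: sym_eq.induct) (auto simp: word_perm_braid_eq)

text \<open>The coset representatives of \<open>\<Sigma>\<^sub>n\<close> in the symmetric group on one more letter.\<close>

definition coset_word :: "nat \<Rightarrow> nat \<Rightarrow> bword" where
  "coset_word k n = map (\<lambda>i. (i, True)) [k..<Suc n]"

lemma coset_word_Cons: "k \<le> n \<Longrightarrow> coset_word k n = (k, True) # coset_word (Suc k) n"
  by (simp add: coset_word_def upt_conv_Cons del: upt_Suc)

lemma coset_word_Nil [simp]: "coset_word (Suc n) n = []"
  by (simp add: coset_word_def)

lemma coset_word_bwords: "1 \<le> k \<Longrightarrow> coset_word k n \<in> bwords (Suc n)"
  by (auto simp: coset_word_def bwords_def)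

lemma positive_coset_word [simp]: "positive (coset_word k n)"
  by (auto simp: coset_word_def positive_def)

lemma fst_set_coset_word: "fst ` set (coset_word k n) = {k..n}"
  by (auto simp: coset_word_def image_def)

lemma coset_word_split:
  assumes "k < i" "i \<le> n"
  shows "\<exists>u. coset_word k n = u @ [(i - 1, True), (i, True)] @ coset_word (Suc i) n \<and>
    positive u \<and> fst ` set u = {k..<i - 1}"
proof (intro exI conjI)
  let ?u = "map (\<lambda>i. (i, True)) [k..<i - 1]"
  have "[k..<Suc n] = [k..<i - 1] @ [i - 1..<Suc n]"
    using assms upt_add_eq_append[of k "i - 1" "Suc n - (i - 1)"] by (simp del: upt_Suc)
  also have "[i - 1..<Suc n] = [i - 1, i] @ [Suc i..<Suc n]"
    using assms by (simp add: upt_conv_Cons del: upt_Suc)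
  finally show "coset_word k n = ?u @ [(i - 1, True), (i, True)] @ coset_word (Suc i) n"
    by (simp add: coset_word_def del: upt_Suc)
qed (auto simp: positive_def image_def)

text \<open>Generators permute the cosets. Depending on the position of \<open>i\<close> the letter
  commutes through the representative, lengthens it, shortens it, or passes through it with its
  index lowered by a braid relation.\<close>

lemma sym_eq_coset_letter:
  assumes "1 \<le> k" "k \<le> Suc n" "1 \<le> i" "i \<le> n"
  shows "\<exists>l v. 1 \<le> l \<and> l \<le> Suc n \<and> v \<in> bwords n \<and>
    sym_eq (Suc n) ((i, True) # coset_word k n) (coset_word l n @ v)"
proof -
  let ?x = "(i, True)"
  have k: "coset_word k n \<in> bwords (Suc n)" using assms by (intro coset_word_bwords)
  consider "i + 2 \<le> k" | "k = Suc i" | "k = i" | "k < i" by linarith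
  then show ?thesis
  proof cases
    case 1
    then have "braid_eq (Suc n) ([?x] @ coset_word k n) (coset_word k n @ [?x])"
      using assms k by (intro far_commute) (auto simp: fst_set_coset_word)
    then have "sym_eq (Suc n) (?x # coset_word k n) (coset_word k n @ [?x])" by (simp add: sym_eq.braid)
    moreover have "[?x] \<in> bwords n" using 1 assms by simp
    ultimately show ?thesis using assms by blast
  next
    case 2
    then have "?x # coset_word k n = coset_word i n @ []" using assms coset_word_Cons[of i n] by simp
    then show ?thesis
      using assms coset_word_bwords[of i n] sym_eq_refl[of "?x # coset_word k n" "Suc n"]
      by (intro exI[of _ i] exI[of _ "[]"]) auto
  next
    case 3
    have l: "coset_word (Suc k) n \<in> bwords (Suc n)" by (intro coset_word_bwords) simp
    have "sym_eq (Suc n) ([(i, True)] @ [(i, True)] @ coset_word (Suc k) n) ([(i, True)] @ [(i, \<not> True)] @ coset_word (Suc k) n)"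
      using assms l 3 by (intro sym_eq.flip) auto
    moreover have "braid_eq (Suc n) ([(i, True), (i, \<not> True)] @ coset_word (Suc k) n) ([] @ coset_word (Suc k) n)"
      using assms l 3 by (intro braid_eq_append braid_eq.refl artin_imp_braid_eq artin.cancel) auto
    ultimately have "sym_eq (Suc n) (?x # coset_word k n) (coset_word (Suc k) n @ [])"
      using 3 assms coset_word_Cons[of k n] by (auto intro: sym_eq.trans sym_eq.braid)
    then show ?thesis using 3 assms by (intro exI[of _ "Suc k"] exI[of _ "[]"]) auto
  next
    case 4
    \<comment> \<open>With \<open>x\<close> for the letter and \<open>y\<close> for its predecessor,
      \<open>x u y x t\<close> becomes \<open>u x y x t\<close>, then \<open>u y x y t\<close>, then
      \<open>u y x t y\<close>: the representative is restored and \<open>y\<close> comes out on the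
      right.\<close>
    let ?y = "(i - 1, True)" and ?t = "coset_word (Suc i) n"
    obtain u where u: "coset_word k n = u @ [?y, ?x] @ ?t" "positive u" "fst ` set u = {k..<i - 1}"
      using coset_word_split[of k i n] 4 assms by blast
    have ut: "u \<in> bwords (Suc n)" "?t \<in> bwords (Suc n)" "1 < i" using k u(1) 4 assms by auto
    have ux: "braid_eq (Suc n) (u @ [?x]) ([?x] @ u)"
      using assms ut u by (intro far_commute) auto
    have 1: "braid_eq (Suc n) (([?x] @ u) @ ([?y, ?x] @ ?t)) ((u @ [?x]) @ ([?y, ?x] @ ?t))"
      using assms ut by (intro braid_eq_append[OF braid_eq.sym[OF ux]] braid_eq.refl) auto
    have xy: "braid_eq (Suc n) [?y, ?x, ?y] [?x, ?y, ?x]"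
      using ut assms artin.braid[of "i - 1"] by (intro artin_imp_braid_eq) auto
    have 2: "braid_eq (Suc n) (u @ [?x, ?y, ?x] @ ?t) (u @ [?y, ?x, ?y] @ ?t)"
      using ut by (intro braid_eq_context[OF braid_eq.sym[OF xy]]) auto
    have yt: "braid_eq (Suc n) ([?y] @ ?t) (?t @ [?y])"
      using ut assms by (intro far_commute) (auto simp: fst_set_coset_word)
    have 3: "braid_eq (Suc n) ((u @ [?y, ?x]) @ ([?y] @ ?t)) ((u @ [?y, ?x]) @ (?t @ [?y]))"
      using ut assms by (intro braid_eq_append[OF braid_eq.refl yt]) auto
    have "braid_eq (Suc n) (?x # coset_word k n) (coset_word k n @ [?y])"
      unfolding u(1) using 1 2 3 by (auto intro: braid_eq.trans)
    moreover have "[?y] \<in> bwords n" using ut assms by auto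
    ultimately show ?thesis using assms by (blast intro: sym_eq.braid)
  qed
qed

text \<open>Starting from the right end of the word, each letter is made positive and absorbed into
  the representative, which emits a word of the smaller group on its right.\<close>

lemma sym_eq_normal_form:
  "w \<in> bwords (Suc n) \<Longrightarrow> \<exists>k v. 1 \<le> k \<and> k \<le> Suc n \<and> v \<in> bwords n \<and> sym_eq (Suc n) w (coset_word k n @ v)"
proof (induction w rule: word_perm.induct)
  case 1
  show ?case using sym_eq_refl[of "[]"] by (intro exI[of _ "Suc n"] exI[of _ "[]"]) auto
next
  case (2 i e w)
  then obtain k v where k: "1 \<le> k" "k \<le> Suc n" "v \<in> bwords n" "sym_eq (Suc n) w (coset_word k n @ v)"
    by auto
  have i: "1 \<le> i" "i \<le> n" using 2 by auto
  obtain l v' where l: "1 \<le> l" "l \<le> Suc n" "v' \<in> bwords n"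
    "sym_eq (Suc n) ((i, True) # coset_word k n) (coset_word l n @ v')"
    using sym_eq_coset_letter[OF k(1,2) i] by blast
  have "sym_eq (Suc n) ([] @ [(i, e)] @ w) ([] @ [(i, \<not> e)] @ w)"
    using 2 by (intro sym_eq.flip) simp
  then have "sym_eq (Suc n) ((i, e) # w) ((i, True) # w)"
    using sym_eq_refl[OF 2(2)] by (cases e) auto
  moreover have "sym_eq (Suc n) ([(i, True)] @ w) ([(i, True)] @ (coset_word k n @ v))"
    using i by (intro sym_eq_append[OF sym_eq_refl k(4)]) auto
  moreover have "sym_eq (Suc n) (((i, True) # coset_word k n) @ v) ((coset_word l n @ v') @ v)"
    using k(3) by (intro sym_eq_append[OF l(4) sym_eq_refl]) (auto intro: bwords_mono)
  ultimately have "sym_eq (Suc n) ((i, e) # w) (coset_word l n @ (v' @ v))"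
    by (auto intro: sym_eq.trans)
  then show ?case using l k(3) by (intro exI[of _ l] exI[of _ "v' @ v"]) auto
qed

lemma word_perm_coset_word: "k \<le> Suc n \<Longrightarrow> word_perm (coset_word k n) (Suc n) = k"
proof (induction "Suc n - k" arbitrary: k)
  case (Suc d)
  then have "word_perm (coset_word (Suc k) n) (Suc n) = Suc k" by simp
  then show ?case using Suc coset_word_Cons[of k n] by simp
qed simp

text \<open>In normal form the image of \<open>Suc n\<close> determines the coset word, because the
  remaining word fixes \<open>Suc n\<close>. Cancelling the coset word leaves equal permutations of
  \<open>n\<close> letters.\<close>

theorem word_perm_eq_imp_sym_eq:
  "v \<in> bwords n \<Longrightarrow> w \<in> bwords n \<Longrightarrow> word_perm v = word_perm w \<Longrightarrow> sym_eq n v w"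
proof (induction n arbitrary: v w)
  case 0
  then have "v = []" "w = []" by (auto simp: bwords_def)
  then show ?case by (simp add: sym_eq_refl)
next
  case (Suc n)
  obtain k v' where k: "1 \<le> k" "k \<le> Suc n" "v' \<in> bwords n" "sym_eq (Suc n) v (coset_word k n @ v')"
    using sym_eq_normal_form[OF Suc.prems(1)] by blast
  obtain l w' where l: "1 \<le> l" "l \<le> Suc n" "w' \<in> bwords n" "sym_eq (Suc n) w (coset_word l n @ w')"
    using sym_eq_normal_form[OF Suc.prems(2)] by blast
  have fix_n: "word_perm u (Suc n) = Suc n" if "u \<in> bwords n" for u
    using permutes_not_in[OF word_perm_permutes[OF that]] by simp
  have perm: "word_perm (coset_word k n) \<circ> word_perm v' = word_perm (coset_word l n) \<circ> word_perm w'"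
    using word_perm_sym_eq[OF k(4)] word_perm_sym_eq[OF l(4)] Suc.prems(3) by (simp only: word_perm_append)
  then have "k = l"
    using fix_n[OF k(3)] fix_n[OF l(3)] word_perm_coset_word[OF k(2)] word_perm_coset_word[OF l(2)]
    by (metis comp_apply)
  then have "word_perm v' = word_perm w'"
    using perm bij_is_inj[OF bij_word_perm[of "coset_word l n"]] by (simp add: fun.inj_map_strong inj_def fun_eq_iff)
  then have "sym_eq n v' w'" using Suc.IH k(3) l(3) by blast
  then have "sym_eq (Suc n) v' w'" by (rule sym_eq_mono) simp
  then have "sym_eq (Suc n) (coset_word k n @ v') (coset_word l n @ w')"
    unfolding \<open>k = l\<close> using l(1) by (intro sym_eq_append sym_eq_refl coset_word_bwords)
  then show ?case using k(4) l(4) by (blast intro: sym_eq.trans sym_eq_sym)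
qed

lemma permutes_imp_word_perm: "\<sigma> permutes {1..n} \<Longrightarrow> \<exists>w\<in>bwords n. word_perm w = \<sigma>"
proof (induction n arbitrary: \<sigma>)
  case 0
  then have "\<sigma> = id" by simp
  then show ?case by (intro bexI[of _ "[]"]) auto
next
  case (Suc n)
  define k where "k = \<sigma> (Suc n)"
  have k: "1 \<le> k" "k \<le> Suc n" using permutes_in_image[OF Suc.prems, of "Suc n"] by (auto simp: k_def)
  \<comment> \<open>This representative carries \<open>Suc n\<close> to the same place as
    \<open>\<sigma>\<close>, so after its removal \<open>Suc n\<close> is fixed and the induction
    hypothesis applies.\<close>
  let ?c = "coset_word k n"
  have c: "?c \<in> bwords (Suc n)" using k by (intro coset_word_bwords)
  have c_perm: "word_perm_inv ?c \<circ> \<sigma> permutes {1..Suc n}"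
    using c by (intro permutes_compose Suc.prems permutes_inv word_perm_permutes)
  have c_k: "word_perm_inv ?c k = Suc n"
    using word_perm_coset_word[OF k(2)] by (intro inv_f_eq bij_is_inj bij_word_perm)
  have "word_perm_inv ?c \<circ> \<sigma> permutes {1..n}"
    by (rule permutes_superset[OF c_perm]) (use c_k in \<open>auto simp: k_def le_Suc_eq\<close>)
  then obtain w where w: "w \<in> bwords n" "word_perm w = word_perm_inv ?c \<circ> \<sigma>" using Suc.IH by blast
  then have "word_perm (?c @ w) = \<sigma>"
    by (simp add: fun_eq_iff surj_f_inv_f bij_is_surj bij_word_perm)
  moreover have "?c @ w \<in> bwords (Suc n)" using c bwords_mono[OF w(1), of "Suc n"] by simp
  ultimately show ?case by blast
qed

text \<open>All letters act through crossings of single strands, so it is enough that the braiding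
  of \<open>1\<close> with itself is an involution.\<close>

lemma (in prob) act_sym_eq:
  assumes sym: "Braid P 1 1 \<cdot> Braid P 1 1 = Id P 2" and "sym_eq n v w"
  shows "act n v = act n w"
proof -
  have "inverse_arrows P (Braid P 1 1) (Braid P 1 1)"
    by (intro inverse_arrowsI) (simp_all add: sym isom_Ar[OF Braid_isom])
  then have "inv_ar P (Braid P 1 1) = Braid P 1 1" by (rule inv_ar_eq)
  then have crossing: "crossing e 1 1 = Braid P 1 1" for e by (simp add: crossing_def)
  show ?thesis
    using assms(2)
  proof induction
    case (braid v w)
    from act_braid_eq[OF this] show ?case by simp
  next
    case (flip u i e v)
    then show ?case by (simp add: act_append gen_def crossing)
  next
    case (trans u v w)
    show ?case by (rule HOL.trans[OF trans.IH])
  qed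
qed

section \<open>Order-preserving maps and cabled permutations\<close>

lemma sum_fibre_card:
  assumes "finite A"
  shows "(\<Sum>p\<in>A. fibre_card n \<phi> p) = card {k \<in> {1..n}. \<phi> k \<in> A}"
proof -
  have "card (\<Union>p\<in>A. {k \<in> {1..n}. \<phi> k = p}) = (\<Sum>p\<in>A. card {k \<in> {1..n}. \<phi> k = p})"
    by (intro card_UN_disjoint assms) auto
  moreover have "(\<Union>p\<in>A. {k \<in> {1..n}. \<phi> k = p}) = {k \<in> {1..n}. \<phi> k \<in> A}" by auto
  ultimately show ?thesis by (simp add: fibre_card_def)
qed

lemma D_hom_range: "\<phi> \<in> D_hom n m \<Longrightarrow> k \<in> {1..n} \<Longrightarrow> \<phi> k \<in> {1..m}"
  by (auto simp: D_hom_def)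

lemma D_hom_mono: "\<phi> \<in> D_hom n m \<Longrightarrow> 1 \<le> j \<Longrightarrow> j \<le> k \<Longrightarrow> k \<le> n \<Longrightarrow> \<phi> j \<le> \<phi> k"
  by (rule mono_onD[of "{1..n}"]) (auto simp: D_hom_def)

lemma D_hom_sum: "\<phi> \<in> D_hom n m \<Longrightarrow> (\<Sum>p = 1..m. fibre_card n \<phi> p) = n"
proof -
  assume \<phi>: "\<phi> \<in> D_hom n m"
  have "{k \<in> {1..n}. \<phi> k \<in> {1..m}} = {1..n}" using D_hom_range[OF \<phi>] by auto
  then show ?thesis using sum_fibre_card[of "{1..m}" n \<phi>] by simp
qed

text \<open>Monotonicity places all points of smaller value before \<open>k\<close>, and all points
  up to \<open>k\<close> in the fibres up to \<open>\<phi> k\<close>; this pins \<open>k\<close>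
  between two prefix sums.\<close>

lemma D_hom_blk:
  assumes \<phi>: "\<phi> \<in> D_hom n m" and k: "k \<in> {1..n}"
  shows "blk (fibre_card n \<phi>) k = \<phi> k"
proof (rule blk_eqI)
  show "1 \<le> \<phi> k" using D_hom_range[OF \<phi> k] by simp
  have "{j \<in> {1..n}. \<phi> j \<in> {1..<\<phi> k}} \<subseteq> {1..<k}"
  proof
    fix j assume j: "j \<in> {j \<in> {1..n}. \<phi> j \<in> {1..<\<phi> k}}"
    then have "\<not> k \<le> j" using D_hom_mono[OF \<phi>, of k j] k by auto
    then show "j \<in> {1..<k}" using j by auto
  qed
  then have "card {j \<in> {1..n}. \<phi> j \<in> {1..<\<phi> k}} \<le> card {1..<k}" by (intro card_mono) auto
  then have "(\<Sum>p = 1..<\<phi> k. fibre_card n \<phi> p) \<le> k - 1" by (simp add: sum_fibre_card)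
  then show "(\<Sum>p = 1..<\<phi> k. fibre_card n \<phi> p) < k" using k by auto
  have "{1..k} \<subseteq> {j \<in> {1..n}. \<phi> j \<in> {1..\<phi> k}}"
    using k D_hom_range[OF \<phi>] D_hom_mono[OF \<phi>, of _ k] by auto
  then have "card {1..k} \<le> card {j \<in> {1..n}. \<phi> j \<in> {1..\<phi> k}}" by (intro card_mono) auto
  then show "k \<le> (\<Sum>p = 1..\<phi> k. fibre_card n \<phi> p)" by (simp add: sum_fibre_card)
qed

lemma blk_bounds:
  assumes "1 \<le> k" "k \<le> (\<Sum>p = 1..m. c p)"
  shows "1 \<le> blk c k" "blk c k \<le> m" "(\<Sum>p = 1..<blk c k. c p) < k" "k \<le> (\<Sum>p = 1..blk c k. c p)"
proof -
  let ?Q = "\<lambda>i. k \<le> (\<Sum>p = 1..i. c p)"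
  show Q: "?Q (blk c k)" unfolding blk_def using assms(2) by (rule LeastI)
  show "blk c k \<le> m" unfolding blk_def using assms(2) by (rule Least_le)
  show pos: "1 \<le> blk c k"
  proof (rule ccontr)
    assume "\<not> 1 \<le> blk c k"
    then have "blk c k = 0" by simp
    then show False using Q assms(1) by simp
  qed
  have "\<not> ?Q (blk c k - 1)" using pos not_less_Least[of "blk c k - 1" ?Q] by (simp add: blk_def)
  moreover have "{1..<blk c k} = {1..blk c k - 1}" using pos by auto
  ultimately show "(\<Sum>p = 1..<blk c k. c p) < k" by simp
qed

lemma blk_iff:
  assumes "1 \<le> k" "k \<le> (\<Sum>p = 1..m. c p)" "1 \<le> i"
  shows "blk c k = i \<longleftrightarrow> (\<Sum>p = 1..<i. c p) < k \<and> k \<le> (\<Sum>p = 1..<i. c p) + c i"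
  using blk_eqI[OF assms(3), of c k] blk_bounds[OF assms(1,2)] sum_prefix_Suc[OF assms(3), of c] by auto

lemma blk_D_hom:
  assumes "(\<Sum>p = 1..m. c p) = n"
  shows "(\<lambda>k\<in>{1..n}. blk c k) \<in> D_hom n m"
  unfolding D_hom_def
proof (intro CollectI conjI)
  show "(\<lambda>k\<in>{1..n}. blk c k) \<in> {1..n} \<rightarrow>\<^sub>E {1..m}"
    using blk_bounds(1,2)[of _ c m] assms by auto
  show "mono_on {1..n} (\<lambda>k\<in>{1..n}. blk c k)"
  proof (rule mono_onI)
    fix j k assume jk: "j \<in> {1..n}" "k \<in> {1..n}" "j \<le> k"
    have "blk c j \<le> blk c k"
      unfolding blk_def[of c j]
      using jk blk_bounds(4)[of k c m] assms by (intro Least_le) auto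
    then show "(\<lambda>k\<in>{1..n}. blk c k) j \<le> (\<lambda>k\<in>{1..n}. blk c k) k" using jk by simp
  qed
qed

lemma sum_prefix_le: "i \<in> {1..m} \<Longrightarrow> (\<Sum>p = 1..<i. c p) + c i \<le> (\<Sum>p = 1..m. c p)" for c :: "nat \<Rightarrow> nat"
  using sum_prefix_Suc[of i c] sum_prefix_mono[of i m c] by simp

lemma blk_fibre:
  assumes "(\<Sum>p = 1..m. c p) = n" "i \<in> {1..m}"
  shows "{k \<in> {1..n}. blk c k = i} = {Suc (\<Sum>p = 1..<i. c p)..(\<Sum>p = 1..<i. c p) + c i}"
proof (rule Set.set_eqI)
  fix k
  show "k \<in> {k \<in> {1..n}. blk c k = i} \<longleftrightarrow> k \<in> {Suc (\<Sum>p = 1..<i. c p)..(\<Sum>p = 1..<i. c p) + c i}"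
    using blk_iff[of k c m i] assms sum_prefix_le[OF assms(2), of c]
    unfolding mem_Collect_eq atLeastAtMost_iff Suc_le_eq by linarith
qed

lemma fibre_card_blk:
  assumes "(\<Sum>p = 1..m. c p) = n" "i \<in> {1..m}"
  shows "fibre_card n (\<lambda>k\<in>{1..n}. blk c k) i = c i"
proof -
  have "{k \<in> {1..n}. (\<lambda>k\<in>{1..n}. blk c k) k = i} = {k \<in> {1..n}. blk c k = i}" by auto
  then show ?thesis using blk_fibre[OF assms] by (simp add: fibre_card_def)
qed

lemma blk_cong:
  assumes "\<And>p. p \<in> {1..m} \<Longrightarrow> c p = d p" "1 \<le> k" "k \<le> (\<Sum>p = 1..m. c p)"
  shows "blk c k = blk d k"
proof (rule blk_eqI[symmetric])
  note b = blk_bounds[OF assms(2,3)]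
  show "1 \<le> blk c k" by (rule b)
  have "(\<Sum>p = 1..<blk c k. d p) = (\<Sum>p = 1..<blk c k. c p)"
    "(\<Sum>p = 1..blk c k. d p) = (\<Sum>p = 1..blk c k. c p)"
    using assms(1) b(2) by (intro sum.cong; simp)+
  then show "(\<Sum>p = 1..<blk c k. d p) < k" "k \<le> (\<Sum>p = 1..blk c k. d p)" using b by simp_all
qed

lemma D_hom_eq_blk: "\<phi> \<in> D_hom n m \<Longrightarrow> \<phi> = (\<lambda>k\<in>{1..n}. blk (fibre_card n \<phi>) k)"
  by (rule extensionalityI[of _ "{1..n}"]) (auto simp: D_hom_blk, auto simp: D_hom_def PiE_def)

text \<open>A monotone map is determined by its fibre cardinalities, so the description in
  \<open>push\<close> has exactly one solution: the map whose cardinalities are those of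
  \<open>\<phi>\<close> moved along \<open>\<sigma>\<close>.\<close>

lemma push_eq:
  assumes \<phi>: "\<phi> \<in> D_hom n m" and \<sigma>: "\<sigma> permutes {1..m}"
  shows "push n m \<sigma> \<phi> = (\<lambda>k\<in>{1..n}. blk (\<lambda>p. fibre_card n \<phi> (inv_into UNIV \<sigma> p)) k)"
  unfolding push_def
proof (rule the_equality)
  let ?d = "\<lambda>p. fibre_card n \<phi> (inv_into UNIV \<sigma> p)"
  have d: "(\<Sum>p = 1..m. ?d p) = n"
    using sum_permutes[OF permutes_inv[OF \<sigma>], of "fibre_card n \<phi>"] D_hom_sum[OF \<phi>] by simp
  have inv: "inv_into UNIV \<sigma> (\<sigma> i) = i" for i using permutes_inverses[OF \<sigma>] by simp
  have mem: "\<sigma> i \<in> {1..m}" if "i \<in> {1..m}" for i using permutes_in_image[OF \<sigma>, of i] that by simp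
  show "(\<lambda>k\<in>{1..n}. blk ?d k) \<in> D_hom n m \<and>
      (\<forall>i\<in>{1..m}. fibre_card n (\<lambda>k\<in>{1..n}. blk ?d k) (\<sigma> i) = fibre_card n \<phi> i)"
    using blk_D_hom[OF d] fibre_card_blk[OF d mem] inv by simp
  fix \<psi> assume \<psi>: "\<psi> \<in> D_hom n m \<and> (\<forall>i\<in>{1..m}. fibre_card n \<psi> (\<sigma> i) = fibre_card n \<phi> i)"
  have "fibre_card n \<psi> p = ?d p" if "p \<in> {1..m}" for p
  proof -
    have "inv_into UNIV \<sigma> p \<in> {1..m}" using permutes_in_image[OF permutes_inv[OF \<sigma>], of p] that by simp
    then show ?thesis using \<psi> permutes_inverses(1)[OF \<sigma>, of p] by force
  qed
  then have "blk (fibre_card n \<psi>) k = blk ?d k" if "k \<in> {1..n}" for k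
    using that D_hom_sum[of \<psi> n m] \<psi> by (intro blk_cong[of m]) auto
  then show "\<psi> = (\<lambda>k\<in>{1..n}. blk ?d k)"
    using D_hom_eq_blk[of \<psi> n m] \<psi> by (metis (no_types, lifting) restrict_ext)
qed

section \<open>Permutations of block words and of cabled words\<close>

lemma word_perm_shift: "word_perm (word_shift d w) x = (if x < d then x else d + word_perm w (x - d))"
proof (induction w rule: word_perm.induct)
  case (2 i e w)
  then show ?case by (auto simp: transpose_def)
qed simp

lemma word_perm_0: "w \<in> bwords n \<Longrightarrow> word_perm w 0 = 0"
  using permutes_not_in[OF word_perm_permutes, of w n 0] by simp

lemma word_perm_above: "w \<in> bwords n \<Longrightarrow> n < x \<Longrightarrow> word_perm w x = x"
  using permutes_not_in[OF word_perm_permutes, of w n x] by simp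

lemma word_perm_pass:
  "word_perm (pass_word b) x = (if x = 1 then Suc b else if 1 < x \<and> x \<le> Suc b then x - 1 else x)"
proof (induction b)
  case 0
  show ?case by simp
next
  case (Suc b)
  then show ?case by (auto simp: pass_word_Suc transpose_def)
qed

lemma word_perm_block:
  "word_perm (block_word a b) x =
    (if 1 \<le> x \<and> x \<le> a then b + x else if a < x \<and> x \<le> a + b then x - a else x)"
proof (induction a arbitrary: x)
  case 0
  show ?case by simp
next
  case (Suc a)
  consider "x = 0" | "1 \<le> x" "x \<le> a" | "x = Suc a" | "Suc a < x" "x \<le> Suc a + b" | "Suc a + b < x"
    by linarith
  then show ?case
  proof cases
    case 4
    then obtain y where "x = a + Suc y" "1 \<le> y" "y \<le> b" by (intro that[of "x - Suc a"]) auto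
    then show ?thesis by (simp add: block_word_Suc Suc word_perm_shift word_perm_pass)
  next
    case 5
    then obtain y where "x = a + Suc (b + y)" "1 \<le> y" by (intro that[of "x - (Suc a + b)"]) auto
    then show ?thesis by (simp add: block_word_Suc Suc word_perm_shift word_perm_pass)
  qed (simp_all add: block_word_Suc Suc word_perm_shift word_perm_pass)
qed

lemma word_perm_inv_word: "word_perm (word_inv w) = word_perm_inv w"
proof (induction w rule: word_perm.induct)
  case (2 i e w)
  have "word_perm [(i, \<not> e)] = transpose i (Suc i)" by (simp only: word_perm.simps comp_id)
  then show ?case
    using 2 by (simp only: inv_word_perm_Cons word_inv_simps word_perm_append)
qed (simp only: word_inv_simps word_perm.simps inv_id)

lemma word_perm_inv_block: "word_perm (word_inv (block_word b a)) x = word_perm (block_word a b) x"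
  unfolding word_perm_inv_word
  by (intro inv_f_eq bij_is_inj bij_word_perm) (auto simp: word_perm_block)

text \<open>Bundles move rigidly: strand \<open>t\<close> of a bundle stays its strand
  \<open>t\<close>, and only the total width in front of the bundle changes.\<close>

lemma word_perm_cable_letter:
  assumes i: "1 \<le> i" and p: "1 \<le> p" and t: "1 \<le> t" "t \<le> d p"
  shows "word_perm (cable_letter d i e) ((\<Sum>q = 1..<p. d q) + t) =
    (\<Sum>q = 1..<transpose i (Suc i) p. d (transpose i (Suc i) q)) + t"
proof -
  let ?o = "\<Sum>q = 1..<i. d q" and ?s = "transpose i (Suc i)"
  have letter: "word_perm (cable_letter d i e) x =
      (if x < ?o then x else ?o + word_perm (block_word (d i) (d (Suc i))) (x - ?o))" for x
    by (simp add: cable_letter_def word_perm_shift word_perm_inv_block)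
  have o: "(\<Sum>q = 1..<i. d (?s q)) = ?o" by (intro sum_prefix_cong) (simp add: transpose_def)
  consider "p < i" | "p = i" | "p = Suc i" | "Suc i < p" by linarith
  then show ?thesis
  proof cases
    case 1
    have "(\<Sum>q = 1..<p. d q) + d p \<le> ?o"
    proof -
      have "(\<Sum>q = 1..<p. d q) + d p = (\<Sum>q = 1..<Suc p. d q)" using p by simp
      also have "\<dots> \<le> ?o" using 1 by (intro sum_mono2) auto
      finally show ?thesis .
    qed
    moreover have "(\<Sum>q = 1..<p. d (?s q)) = (\<Sum>q = 1..<p. d q)"
      using 1 by (intro sum_prefix_cong) (simp add: transpose_def)
    ultimately show ?thesis using 1 t by (auto simp: letter word_perm_block)
  next
    case 2
    have "(\<Sum>q = 1..<Suc i. d (?s q)) = ?o + d (Suc i)" using i o by simp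
    then show ?thesis using 2 t by (simp add: letter word_perm_block)
  next
    case 3
    have "(\<Sum>q = 1..<Suc i. d q) = ?o + d i" using i by simp
    then show ?thesis using 3 t o by (simp add: letter word_perm_block)
  next
    case 4
    have "(\<Sum>q = 1..<Suc (Suc i). d q) \<le> (\<Sum>q = 1..<p. d q)" using 4 by (intro sum_mono2) auto
    then have "?o + d i + d (Suc i) \<le> (\<Sum>q = 1..<p. d q)" using i by simp
    moreover have "(\<Sum>q = 1..<p. d (?s q)) = (\<Sum>q = 1..<p. d q)"
    proof -
      have "{1..<p} = {1..p - 1}" using p by auto
      then show ?thesis using 4 i sum_permutes[OF permutes_swap_id[of i "{1..p - 1}" "Suc i"], of d] by simp
    qed
    ultimately show ?thesis using 4 t by (auto simp: letter word_perm_block transpose_def)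
  qed
qed

lemma word_perm_cable_word:
  assumes "w \<in> bwords m" "p \<in> {1..m}" "1 \<le> t" "t \<le> c p"
  shows "word_perm (cable_word c w) ((\<Sum>q = 1..<p. c q) + t) =
    (\<Sum>q = 1..<word_perm w p. c (word_perm_inv w q)) + t"
  using assms(1)
proof (induction w rule: word_perm.induct)
  case 1
  show ?case by (simp add: word_perm_inv_0)
next
  case (2 i e w)
  let ?d = "c \<circ> word_perm_inv w" and ?p = "word_perm w p"
  have w: "w \<in> bwords m" and i: "1 \<le> i" using 2 by auto
  have "?p \<in> {1..m}" using permutes_in_image[OF word_perm_permutes[OF w], of p] assms(2) by simp
  then have p: "1 \<le> ?p" by simp
  have "?d ?p = c p" by (simp add: bij_is_inj bij_word_perm)
  then have t: "t \<le> ?d ?p" using assms by simp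
  have "word_perm (cable_letter ?d i e) ((\<Sum>q = 1..<?p. ?d q) + t) =
      (\<Sum>q = 1..<transpose i (Suc i) ?p. ?d (transpose i (Suc i) q)) + t"
    by (rule word_perm_cable_letter[OF i p assms(3), of ?d, OF t])
  then show ?case
    using 2(1)[OF w] unfolding inv_word_perm_Cons cable_word_Cons
    by (simp only: word_perm_append word_perm.simps comp_apply)
qed

text \<open>Both functions enumerate the same finite set in increasing order.\<close>

lemma strict_mono_image_unique:
  fixes f g :: "nat \<Rightarrow> nat"
  assumes "finite A" "f ` A = g ` A"
    and f: "\<And>x y. x \<in> A \<Longrightarrow> y \<in> A \<Longrightarrow> x < y \<Longrightarrow> f x < f y"
    and g: "\<And>x y. x \<in> A \<Longrightarrow> y \<in> A \<Longrightarrow> x < y \<Longrightarrow> g x < g y"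
    and "x \<in> A"
  shows "f x = g x"
proof -
  let ?xs = "sorted_list_of_set A"
  have *: "sorted_wrt (<) (map h ?xs)" if "\<And>x y. x \<in> A \<Longrightarrow> y \<in> A \<Longrightarrow> x < y \<Longrightarrow> h x < h y" for h :: "nat \<Rightarrow> nat"
    unfolding sorted_wrt_map
    by (rule sorted_wrt_mono_rel[OF _ strict_sorted_list_of_set]) (use that \<open>finite A\<close> in auto)
  have "map f ?xs = map g ?xs"
    using *[OF f] *[OF g] assms(1,2)
    by (intro strict_sorted_equal) auto
  then show ?thesis using assms(1,5) by simp
qed

text \<open>The cabled word keeps the order within each bundle and carries fibres of
  \<open>\<phi>\<close> to fibres of the pushed map, which is what the description in
  \<open>perm_cable\<close> asks for.\<close>

lemma perm_cable_eq:
  assumes \<phi>: "\<phi> \<in> D_hom n m" and w: "w \<in> bwords m"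
  shows "perm_cable n m \<phi> (word_perm w) = word_perm (cable_word (fibre_card n \<phi>) w)"
  unfolding perm_cable_def
proof (rule the_equality)
  let ?c = "fibre_card n \<phi>" and ?\<sigma> = "word_perm w"
  let ?\<tau> = "word_perm (cable_word ?c w)" and ?d = "\<lambda>q. ?c (word_perm_inv w q)"
  have \<sigma>: "?\<sigma> permutes {1..m}" by (rule word_perm_permutes[OF w])
  have n: "(\<Sum>p = 1..m. ?c p) = n" by (rule D_hom_sum[OF \<phi>])
  have d: "(\<Sum>p = 1..m. ?d p) = n" using sum_inv_word_perm[OF w, of ?c] n by simp
  have push: "push n m ?\<sigma> \<phi> = (\<lambda>k\<in>{1..n}. blk ?d k)" by (rule push_eq[OF \<phi> \<sigma>])
  have \<tau>: "?\<tau> permutes {1..n}" using word_perm_permutes[OF cable_word_bwords[OF w, of ?c]] n by simp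
  have \<sigma>_mem: "?\<sigma> i \<in> {1..m}" if "i \<in> {1..m}" for i using permutes_in_image[OF \<sigma>, of i] that by simp
  have pos: "\<exists>t. 1 \<le> t \<and> t \<le> ?c (\<phi> k) \<and> k = (\<Sum>q = 1..<\<phi> k. ?c q) + t \<and>
      ?\<tau> k = (\<Sum>q = 1..<?\<sigma> (\<phi> k). ?d q) + t" if k: "k \<in> {1..n}" for k
  proof -
    have \<phi>k: "\<phi> k \<in> {1..m}" by (rule D_hom_range[OF \<phi> k])
    define t where "t = k - (\<Sum>q = 1..<\<phi> k. ?c q)"
    have "(\<Sum>q = 1..<\<phi> k. ?c q) < k \<and> k \<le> (\<Sum>q = 1..<\<phi> k. ?c q) + ?c (\<phi> k)"
      using blk_iff[of k ?c m "\<phi> k"] D_hom_blk[OF \<phi> k] k n \<phi>k by simp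
    then have t: "1 \<le> t" "t \<le> ?c (\<phi> k)" "k = (\<Sum>q = 1..<\<phi> k. ?c q) + t" by (auto simp: t_def)
    then show ?thesis using word_perm_cable_word[OF w \<phi>k, of t ?c] t by (intro exI[of _ t]) simp
  qed
  have mono: "?\<tau> i < ?\<tau> k" if "i \<in> {1..n}" "k \<in> {1..n}" "\<phi> i = \<phi> k" "i < k" for i k
    using pos[OF that(1)] pos[OF that(2)] that(3,4) by auto
  have fib: "?\<sigma> (\<phi> i) = push n m ?\<sigma> \<phi> (?\<tau> i)" if i: "i \<in> {1..n}" for i
  proof -
    obtain t where t: "1 \<le> t" "t \<le> ?c (\<phi> i)" "?\<tau> i = (\<Sum>q = 1..<?\<sigma> (\<phi> i). ?d q) + t"
      using pos[OF i] by blast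
    have "?d (?\<sigma> (\<phi> i)) = ?c (\<phi> i)" by (simp add: bij_is_inj bij_word_perm)
    then have "blk ?d (?\<tau> i) = ?\<sigma> (\<phi> i)"
      unfolding t(3) using t \<sigma>_mem[OF D_hom_range[OF \<phi> i]] by (intro blk_add) auto
    then show ?thesis using push permutes_in_image[OF \<tau>, of i] i by simp
  qed
  show "?\<tau> permutes {1..n} \<and>
      (\<forall>i\<in>{1..n}. \<forall>k\<in>{1..n}. \<phi> i = \<phi> k \<and> i < k \<longrightarrow> ?\<tau> i < ?\<tau> k) \<and>
      (\<forall>i\<in>{1..n}. ?\<sigma> (\<phi> i) = push n m ?\<sigma> \<phi> (?\<tau> i))"
    using \<tau> mono fib by blast
  fix \<tau>' assume \<tau>': "\<tau>' permutes {1..n} \<and>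
      (\<forall>i\<in>{1..n}. \<forall>k\<in>{1..n}. \<phi> i = \<phi> k \<and> i < k \<longrightarrow> \<tau>' i < \<tau>' k) \<and>
      (\<forall>i\<in>{1..n}. ?\<sigma> (\<phi> i) = push n m ?\<sigma> \<phi> (\<tau>' i))"
  let ?F = "\<lambda>i. {k \<in> {1..n}. \<phi> k = i}" and ?H = "\<lambda>i. {k \<in> {1..n}. push n m ?\<sigma> \<phi> k = i}"
  have image: "\<rho> ` ?F i = ?H (?\<sigma> i)" if "\<rho> permutes {1..n}" "\<forall>k\<in>{1..n}. ?\<sigma> (\<phi> k) = push n m ?\<sigma> \<phi> (\<rho> k)"
    "i \<in> {1..m}" for \<rho> i
  proof (rule card_subset_eq)
    show "\<rho> ` ?F i \<subseteq> ?H (?\<sigma> i)" using that permutes_in_image[OF that(1)] by auto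
    have "card (\<rho> ` ?F i) = fibre_card n \<phi> i"
      using permutes_inj_on[OF that(1)] by (simp add: card_image fibre_card_def)
    also have "\<dots> = ?d (?\<sigma> i)" by (simp add: bij_is_inj bij_word_perm)
    also have "\<dots> = card (?H (?\<sigma> i))"
      using fibre_card_blk[OF d \<sigma>_mem[OF that(3)]] push by (simp add: fibre_card_def)
    finally show "card (\<rho> ` ?F i) = card (?H (?\<sigma> i))" .
  qed simp
  \<comment> \<open>On each fibre both permutations are increasing with the same image, namely a
    fibre of the pushed map, and only one such map exists.\<close>
  show "\<tau>' = ?\<tau>"
  proof
    fix k show "\<tau>' k = ?\<tau> k"
    proof (cases "k \<in> {1..n}")
      case True
      have i: "\<phi> k \<in> {1..m}" by (rule D_hom_range[OF \<phi> True])
      show ?thesis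
      proof (rule strict_mono_image_unique[of "?F (\<phi> k)" \<tau>' ?\<tau>])
        show "\<tau>' ` ?F (\<phi> k) = ?\<tau> ` ?F (\<phi> k)"
          using image[of \<tau>' "\<phi> k"] image[of ?\<tau> "\<phi> k"] \<tau>' \<tau> fib i by simp
      qed (use \<tau>' mono True in auto)
    next
      case False
      then show ?thesis using \<tau>' \<tau> by (metis permutes_not_in)
    qed
  qed
qed


section \<open>The two families of strand groups\<close>

text \<open>\<open>cls n\<close> sends a word to its permutation or to its braid class. The
  assumptions say that every operation can be computed on arbitrary representing words.\<close>

locale strand_family =
  fixes J :: "'j strands" and cls :: "nat \<Rightarrow> bword \<Rightarrow> 'j"
  assumes elts: "elts J n = cls n ` bwords n"
    and jone: "jone J n = cls n []"
    and jmul: "v \<in> bwords n \<Longrightarrow> w \<in> bwords n \<Longrightarrow> jmul J n (cls n v) (cls n w) = cls n (v @ w)"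
    and jperm: "w \<in> bwords n \<Longrightarrow> jperm J (cls n w) = word_perm w"
    and cable: "w \<in> bwords m \<Longrightarrow> \<phi> \<in> D_hom n m \<Longrightarrow>
      cable J n m \<phi> (cls m w) = cls n (cable_word (fibre_card n \<phi>) w)"
    and juxt: "v \<in> bwords n \<Longrightarrow> w \<in> bwords m \<Longrightarrow>
      juxt J n m (cls n v) (cls m w) = cls (n + m) (v @ word_shift n w)"
    and block: "block J n m = cls (n + m) (block_word n m)"
    and cls_braid_eq: "braid_eq n v w \<Longrightarrow> cls n v = cls n w"

interpretation perm: strand_family perm_strands "\<lambda>n. word_perm"
proof
  fix n m :: nat and v w :: bword and \<phi>
  show "elts perm_strands n = word_perm ` bwords n"
    using permutes_imp_word_perm word_perm_permutes by (auto simp: perm_strands_def)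
  show "jone perm_strands n = word_perm []" by (simp only: perm_strands_def strands.simps word_perm.simps)
  show "jmul perm_strands n (word_perm v) (word_perm w) = word_perm (v @ w)"
    by (simp only: perm_strands_def strands.simps word_perm_append)
  show "jperm perm_strands (word_perm w) = word_perm w" by (simp add: perm_strands_def)
  show "cable perm_strands n m \<phi> (word_perm w) = word_perm (cable_word (fibre_card n \<phi>) w)"
    if "w \<in> bwords m" "\<phi> \<in> D_hom n m"
    using perm_cable_eq[OF that(2,1)] by (simp add: perm_strands_def)
  show "juxt perm_strands n m (word_perm v) (word_perm w) = word_perm (v @ word_shift n w)"
    if v: "v \<in> bwords n" and w: "w \<in> bwords m"
  proof
    fix i
    consider "i < n" | "i = n" | "n < i" by linarith
    then show "juxt perm_strands n m (word_perm v) (word_perm w) i = word_perm (v @ word_shift n w) i"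
    proof cases
      \<comment> \<open>Position \<open>n\<close> belongs to the first factor in \<open>juxt\<close>
        but to the shifted range in \<open>word_perm_shift\<close>; the two agree because
        \<open>word_perm w\<close> fixes \<open>0\<close>.\<close>
      case 2
      then show ?thesis using word_perm_0[OF w] by (simp add: perm_strands_def word_perm_shift)
    next
      case 3
      have "word_perm w (i - n) \<noteq> word_perm w 0"
        using 3 by (simp add: inj_eq[OF bij_is_inj[OF bij_word_perm]])
      then have "n < n + word_perm w (i - n)" using word_perm_0[OF w] by simp
      then show ?thesis using 3 word_perm_above[OF v] by (simp add: perm_strands_def word_perm_shift)
    qed (simp add: perm_strands_def word_perm_shift)
  qed
  show "block perm_strands n m = word_perm (block_word n m)"
    by (auto simp: perm_strands_def word_perm_block fun_eq_iff)
  show "word_perm v = word_perm w" if "braid_eq n v w"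
    using that by (rule word_perm_braid_eq)
qed

section \<open>Braid classes as a family of strand groups\<close>

lemma bclass_eq: "braid_eq n v w \<Longrightarrow> bclass n v = bclass n w"
  unfolding bclass_def by (blast intro: braid_eq.sym braid_eq.trans)

lemma bclass_eqD:
  assumes "w \<in> bwords n" "bclass n v = bclass n w" shows "braid_eq n v w"
proof -
  have "w \<in> bclass n w" using braid_eq.refl[OF assms(1)] by (simp add: bclass_def)
  then have "w \<in> bclass n v" by (simp only: assms(2))
  then show ?thesis by (simp add: bclass_def)
qed

lemma brep_bclass: "w \<in> bwords n \<Longrightarrow> braid_eq n w (brep (bclass n w))"
  unfolding brep_def using someI[of "\<lambda>v. v \<in> bclass n w" w] by (simp add: bclass_def braid_eq.refl)

interpretation braid: strand_family braid_strands bclass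
proof
  fix n m :: nat and v w :: bword and \<phi>
  show "elts braid_strands n = bclass n ` bwords n" by (simp add: braid_strands_def)
  show "jone braid_strands n = bclass n []" by (simp add: braid_strands_def)
  show "jmul braid_strands n (bclass n v) (bclass n w) = bclass n (v @ w)" if "v \<in> bwords n" "w \<in> bwords n"
    using bclass_eq[OF braid_eq_append[OF brep_bclass[OF that(1)] brep_bclass[OF that(2)]]]
    by (simp add: braid_strands_def)
  show "jperm braid_strands (bclass n w) = word_perm w" if "w \<in> bwords n"
    using word_perm_braid_eq[OF brep_bclass[OF that]] by (simp add: braid_strands_def)
  show "cable braid_strands n m \<phi> (bclass m w) = bclass n (cable_word (fibre_card n \<phi>) w)"
    if "w \<in> bwords m" "\<phi> \<in> D_hom n m"
    using bclass_eq[OF cable_word_braid_eq[OF brep_bclass[OF that(1)], of "fibre_card n \<phi>"]] D_hom_sum[OF that(2)]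
    by (simp add: braid_strands_def)
  show "juxt braid_strands n m (bclass n v) (bclass m w) = bclass (n + m) (v @ word_shift n w)"
    if "v \<in> bwords n" "w \<in> bwords m"
  proof -
    have "braid_eq (n + m) (v @ word_shift n w) (brep (bclass n v) @ word_shift n (brep (bclass m w)))"
      using braid_eq_mono[OF brep_bclass[OF that(1)], of "n + m"] braid_eq_shift[OF brep_bclass[OF that(2)], of n "n + m"]
      by (intro braid_eq_append) simp_all
    then show ?thesis using bclass_eq by (simp add: braid_strands_def)
  qed
  show "block braid_strands n m = bclass (n + m) (block_word n m)" by (simp add: braid_strands_def)
  show "bclass n v = bclass n w" if "braid_eq n v w" using that by (rule bclass_eq)
qed

section \<open>The category of labelled strands and order-preserving maps\<close>

lemma blk_one: "1 \<le> k \<Longrightarrow> blk (\<lambda>_. 1) k = k"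
  by (rule blk_eqI) auto

lemma sum_nested:
  "(\<Sum>p = 1..i. \<Sum>k = 1..c p. d ((\<Sum>q = 1..<p. c q) + k)) = (\<Sum>t = 1..\<Sum>p = 1..i. c p. d t)"
  for c d :: "nat \<Rightarrow> nat"
proof (induction i)
  case (Suc i)
  have "{1..<Suc i} = {1..i}" by auto
  then show ?case using Suc sum_add[of d "\<Sum>p = 1..i. c p" "c (Suc i)"] by simp
qed simp

text \<open>Composition of monotone maps in terms of cardinalities: a fibre of the composite is a
  run of consecutive fibres of the inner map, whence the nested sum.\<close>

lemma blk_comp:
  assumes l: "(\<Sum>p = 1..q. c p) = l" and k: "1 \<le> k" "k \<le> (\<Sum>p = 1..l. d p)"
  shows "blk c (blk d k) = blk (\<lambda>i. \<Sum>k = 1..c i. d ((\<Sum>p = 1..<i. c p) + k)) k"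
proof (rule blk_eqI[symmetric])
  let ?a = "blk d k"
  let ?i = "blk c ?a"
  note a = blk_bounds[OF k]
  have i: "1 \<le> ?i" "(\<Sum>p = 1..<?i. c p) < ?a" "?a \<le> (\<Sum>p = 1..?i. c p)"
    using blk_bounds[of ?a c q] a l by auto
  show "1 \<le> ?i" by (rule i)
  have "{1..<?i} = {1..?i - 1}" using i(1) by auto
  then have "(\<Sum>p = 1..<?i. \<Sum>k = 1..c p. d ((\<Sum>q = 1..<p. c q) + k)) = (\<Sum>t = 1..\<Sum>p = 1..<?i. c p. d t)"
    using sum_nested[of d c "?i - 1"] by simp
  also have "\<dots> \<le> (\<Sum>t = 1..<?a. d t)" using i(2) by (intro sum_mono2) auto
  also have "\<dots> < k" by (rule a)
  finally show "(\<Sum>p = 1..<?i. \<Sum>k = 1..c p. d ((\<Sum>q = 1..<p. c q) + k)) < k" .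
  have "k \<le> (\<Sum>t = 1..?a. d t)" by (rule a)
  also have "\<dots> \<le> (\<Sum>t = 1..\<Sum>p = 1..?i. c p. d t)" using i(3) by (rule sum_prefix_mono)
  finally show "k \<le> (\<Sum>p = 1..?i. \<Sum>k = 1..c p. d ((\<Sum>q = 1..<p. c q) + k))" by (simp only: sum_nested)
qed

lemma sum_append:
  "(\<Sum>p = 1..l + j. if p \<le> l then c p else c' (p - l)) = (\<Sum>p = 1..l. c p) + (\<Sum>p = 1..j. c' p)"
  for c c' :: "nat \<Rightarrow> nat"
  using sum_add[of "\<lambda>p. if p \<le> l then c p else c' (p - l)" l j] by (simp cong: sum.cong_simp)

lemma blk_append:
  assumes n: "(\<Sum>p = 1..l. c p) = n" and n': "(\<Sum>p = 1..l'. c' p) = n'" and k: "1 \<le> k" "k \<le> n + n'"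
  shows "blk (\<lambda>i. if i \<le> l then c i else c' (i - l)) k = (if k \<le> n then blk c k else l + blk c' (k - n))"
proof (cases "k \<le> n")
  case True
  have "blk (\<lambda>i. if i \<le> l then c i else c' (i - l)) k = blk c k"
    using True n k by (intro blk_cong[of l c, symmetric]) auto
  then show ?thesis using True by simp
next
  case False
  let ?d = "\<lambda>i. if i \<le> l then c i else c' (i - l)" and ?b = "blk c' (k - n)"
  have "1 \<le> k - n" "k - n \<le> (\<Sum>p = 1..l'. c' p)" using False k n' by auto
  note b = blk_bounds[OF this]
  have "blk ?d k = l + ?b"
  proof (rule blk_eqI)
    show "1 \<le> l + ?b" using b by simp
    have "{1..<l + ?b} = {1..l + (?b - 1)}" "{1..<?b} = {1..?b - 1}" using b(1) by auto
    then show "(\<Sum>p = 1..<l + ?b. ?d p) < k"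
      using sum_append[of l c c' "?b - 1"] b(3) n False by simp
    show "k \<le> (\<Sum>p = 1..l + ?b. ?d p)"
      using sum_append[of l c c' ?b] b(4) n False by simp
  qed
  then show ?thesis using False by simp
qed

lemma cable_letter_cong:
  assumes "1 \<le> i" "i < m" "\<And>p. p \<in> {1..m} \<Longrightarrow> d p = d' p"
  shows "cable_letter d i e = cable_letter d' i e"
proof -
  have "(\<Sum>p = 1..<i. d p) = (\<Sum>p = 1..<i. d' p)" using assms by (intro sum.cong) auto
  then show ?thesis using assms by (simp add: cable_letter_def)
qed

lemma cable_word_cong:
  assumes "\<And>p. p \<in> {1..m} \<Longrightarrow> c p = c' p"
  shows "w \<in> bwords m \<Longrightarrow> cable_word c w = cable_word c' w"
proof (induction w rule: word_perm.induct)
  case (2 i e w)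
  have perm: "word_perm_inv w permutes {1..m}"
    using 2 by (intro permutes_inv word_perm_permutes) simp
  have "cable_letter (c \<circ> word_perm_inv w) i e = cable_letter (c' \<circ> word_perm_inv w) i e"
    using 2 assms permutes_in_image[OF perm] by (intro cable_letter_cong[of i m]) auto
  then show ?case using 2 by simp
qed simp

section \<open>Composition and tensor product in coordinates\<close>

lemma DJG_simps [simp]:
  "Ob (DJG J G) = UNIV" "Dom (DJG J G) (n, t) = n" "Cod (DJG J G) (n, m, u) = m"
  "Tob (DJG J G) a b = a + b" "Unit (DJG J G) = 0"
  "Assoc (DJG J G) a b c = Id (DJG J G) (a + b + c)"
  "LUnit (DJG J G) a = Id (DJG J G) a" "RUnit (DJG J G) a = Id (DJG J G) a"
  by (simp_all add: DJG_def Let_def)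

lemma DJG_Cmp:
  "(m, l, \<phi>\<^sub>2, x\<^sub>2, j\<^sub>2) \<cdot>\<^bsub>DJG J G\<^esub> (n, m', \<phi>\<^sub>1, x\<^sub>1, j\<^sub>1) =
    (n, l, \<lambda>i\<in>{1..n}. \<phi>\<^sub>2 (push n m (jperm J j\<^sub>2) \<phi>\<^sub>1 i),
     \<lambda>i\<in>{1..n}. (\<lambda>i\<in>{1..n}. x\<^sub>2 (\<phi>\<^sub>1 i)) (jperm J j\<^sub>1 i) \<otimes>\<^bsub>G\<^esub> x\<^sub>1 i,
     jmul J n (cable J n m \<phi>\<^sub>1 j\<^sub>2) j\<^sub>1)"
  by (simp only: DJG_def Let_def lab_push_def lab_pull_def lab_mul_def bmoncat.simps cat.simps prod.case)

locale strand_group = strand_family J cls + G: group G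
  for J :: "'j strands" and cls :: "nat \<Rightarrow> bword \<Rightarrow> 'j" and G :: "'g monoid"
begin

abbreviation T :: "(nat, nat \<times> nat \<times> (nat \<Rightarrow> nat) \<times> (nat \<Rightarrow> 'g) \<times> 'j) bmoncat" where
  "T \<equiv> DJG J G"

text \<open>Arrows of \<^term>\<open>T\<close> in coordinates: fibre cardinalities, a braid word and labels.\<close>

definition tarr :: "nat \<Rightarrow> nat \<Rightarrow> (nat \<Rightarrow> nat) \<Rightarrow> bword \<Rightarrow> (nat \<Rightarrow> 'g) \<Rightarrow>
    nat \<times> nat \<times> (nat \<Rightarrow> nat) \<times> (nat \<Rightarrow> 'g) \<times> 'j" where
  "tarr n m c w x = (n, m, (\<lambda>k\<in>{1..n}. blk c k), (\<lambda>i\<in>{1..n}. x i), cls n w)"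

definition tdata :: "nat \<Rightarrow> nat \<Rightarrow> (nat \<Rightarrow> nat) \<Rightarrow> bword \<Rightarrow> (nat \<Rightarrow> 'g) \<Rightarrow> bool" where
  "tdata n m c w x \<longleftrightarrow> (\<Sum>p = 1..m. c p) = n \<and> w \<in> bwords n \<and> (\<forall>i\<in>{1..n}. x i \<in> carrier G)"

lemma tarr_typing [simp]:
  "Dom T (tarr n m c w x) = n" "Cod T (tarr n m c w x) = m"
  by (simp_all add: tarr_def)

lemma tarr_Ar [simp]: "tdata n m c w x \<Longrightarrow> tarr n m c w x \<in> Ar T"
  using blk_D_hom[of c m n] by (auto simp: tdata_def tarr_def DJG_def Let_def lab_elts_def elts)

lemma tarr_cong:
  assumes "(\<Sum>p = 1..m. c p) = n" "\<And>i. i \<in> {1..m} \<Longrightarrow> c i = c' i" "\<And>i. i \<in> {1..n} \<Longrightarrow> x i = x' i"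
    "cls n w = cls n w'"
  shows "tarr n m c w x = tarr n m c' w' x'"
proof -
  have "(\<lambda>k\<in>{1..n}. blk c k) = (\<lambda>k\<in>{1..n}. blk c' k)"
    using assms(1,2) by (intro restrict_ext blk_cong[of m]) auto
  moreover have "(\<lambda>i\<in>{1..n}. x i) = (\<lambda>i\<in>{1..n}. x' i)"
    using assms(3) by (intro restrict_ext)
  ultimately show ?thesis using assms(4) by (simp add: tarr_def)
qed

lemma Ar_T_cases:
  assumes "t \<in> Ar T"
  obtains n m c w x where "t = tarr n m c w x" "tdata n m c w x"
proof -
  obtain n m \<phi> x j where t: "t = (n, m, \<phi>, x, j)" by (metis prod_cases5)
  then have \<phi>: "\<phi> \<in> D_hom n m" and x: "x \<in> {1..n} \<rightarrow>\<^sub>E carrier G" and j: "j \<in> elts J n"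
    using assms by (auto simp: DJG_def Let_def lab_elts_def)
  obtain w where w: "w \<in> bwords n" "j = cls n w" using j by (auto simp: elts)
  have "(\<lambda>i\<in>{1..n}. x i) = x" using x by (simp add: PiE_def extensional_restrict)
  then have "t = tarr n m (fibre_card n \<phi>) w x"
    using D_hom_eq_blk[OF \<phi>] w by (simp add: t tarr_def)
  moreover have "tdata n m (fibre_card n \<phi>) w x"
    using D_hom_sum[OF \<phi>] w x by (auto simp: tdata_def)
  ultimately show ?thesis by (rule that)
qed

text \<open>The coordinates of the composite are those of \<open>interp_Cmp\<close>, so that
  functoriality of the interpretation amounts to comparing the two lemmas.\<close>

lemma tarr_Cmp:
  assumes t1: "tdata n l c1 w1 x1" and t2: "tdata l q c2 w2 x2"
  shows "tarr l q c2 w2 x2 \<cdot>\<^bsub>T\<^esub> tarr n l c1 w1 x1 =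
    tarr n q (\<lambda>i. \<Sum>k = 1..c2 i. c1 (word_perm_inv w2 ((\<Sum>p = 1..<i. c2 p) + k)))
      (cable_word c1 w2 @ w1) (\<lambda>i. x2 (blk c1 (word_perm w1 i)) \<otimes>\<^bsub>G\<^esub> x1 i)"
proof -
  have n: "(\<Sum>p = 1..l. c1 p) = n" and l: "(\<Sum>p = 1..q. c2 p) = l"
    and w: "w1 \<in> bwords n" "w2 \<in> bwords l" using t1 t2 by (auto simp: tdata_def)
  let ?\<phi>1 = "\<lambda>k\<in>{1..n}. blk c1 k" and ?d = "\<lambda>p. c1 (word_perm_inv w2 p)"
  have \<phi>1: "?\<phi>1 \<in> D_hom n l" by (rule blk_D_hom[OF n])
  have d: "(\<Sum>p = 1..l. ?d p) = n" using sum_inv_word_perm[OF w(2), of c1] n by simp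
  have inv_mem: "word_perm_inv w2 p \<in> {1..l}" if "p \<in> {1..l}" for p
    using permutes_in_image[OF permutes_inv[OF word_perm_permutes[OF w(2)]], of p] that by simp
  have push: "push n l (word_perm w2) ?\<phi>1 = (\<lambda>k\<in>{1..n}. blk ?d k)"
    unfolding push_eq[OF \<phi>1 word_perm_permutes[OF w(2)]]
  proof (rule restrict_ext)
    fix k assume "k \<in> {1..n}"
    then show "blk (\<lambda>p. fibre_card n ?\<phi>1 (word_perm_inv w2 p)) k = blk ?d k"
      using d by (intro blk_cong[of l ?d, symmetric]) (simp_all add: fibre_card_blk[OF n inv_mem])
  qed
  have order: "(\<lambda>i\<in>{1..n}. (\<lambda>k\<in>{1..l}. blk c2 k) (push n l (word_perm w2) ?\<phi>1 i)) =
      (\<lambda>k\<in>{1..n}. blk (\<lambda>i. \<Sum>k = 1..c2 i. ?d ((\<Sum>p = 1..<i. c2 p) + k)) k)"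
  proof (rule restrict_ext)
    fix k assume k: "k \<in> {1..n}"
    then have "blk ?d k \<in> {1..l}" using blk_bounds[of k ?d l] d by auto
    then show "(\<lambda>k\<in>{1..l}. blk c2 k) (push n l (word_perm w2) ?\<phi>1 k) =
        blk (\<lambda>i. \<Sum>k = 1..c2 i. ?d ((\<Sum>p = 1..<i. c2 p) + k)) k"
      using k d blk_comp[OF l, of k ?d] by (simp add: push)
  qed
  have "cable_word (fibre_card n ?\<phi>1) w2 = cable_word c1 w2"
    by (intro cable_word_cong[OF _ w(2)] fibre_card_blk[OF n])
  then have cab: "cable J n l ?\<phi>1 (cls l w2) = cls n (cable_word c1 w2)"
    using cable[OF w(2) \<phi>1] by simp
  have cw: "cable_word c1 w2 \<in> bwords n" using cable_word_bwords[OF w(2), of c1] n by simp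
  have lab: "(\<lambda>i\<in>{1..n}. (\<lambda>i\<in>{1..n}. (\<lambda>i\<in>{1..l}. x2 i) (?\<phi>1 i)) (word_perm w1 i) \<otimes>\<^bsub>G\<^esub> (\<lambda>i\<in>{1..n}. x1 i) i) =
      (\<lambda>i\<in>{1..n}. x2 (blk c1 (word_perm w1 i)) \<otimes>\<^bsub>G\<^esub> x1 i)"
  proof (rule restrict_ext)
    fix i assume i: "i \<in> {1..n}"
    then have "word_perm w1 i \<in> {1..n}" using permutes_in_image[OF word_perm_permutes[OF w(1)]] by blast
    moreover from this have "blk c1 (word_perm w1 i) \<in> {1..l}" using blk_bounds[of _ c1 l] n by auto
    ultimately show "(\<lambda>i\<in>{1..n}. (\<lambda>i\<in>{1..l}. x2 i) (?\<phi>1 i)) (word_perm w1 i) \<otimes>\<^bsub>G\<^esub> (\<lambda>i\<in>{1..n}. x1 i) i =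
        x2 (blk c1 (word_perm w1 i)) \<otimes>\<^bsub>G\<^esub> x1 i"
      using i by simp
  qed
  show ?thesis
    unfolding tarr_def DJG_Cmp jperm[OF w(1)] jperm[OF w(2)] cab jmul[OF cw w(1)] order lab ..
qed

lemma tdata_Cmp:
  assumes t1: "tdata n l c1 w1 x1" and t2: "tdata l q c2 w2 x2"
  shows "tdata n q (\<lambda>i. \<Sum>k = 1..c2 i. c1 (word_perm_inv w2 ((\<Sum>p = 1..<i. c2 p) + k)))
      (cable_word c1 w2 @ w1) (\<lambda>i. x2 (blk c1 (word_perm w1 i)) \<otimes>\<^bsub>G\<^esub> x1 i)"
proof -
  have n: "(\<Sum>p = 1..l. c1 p) = n" and l: "(\<Sum>p = 1..q. c2 p) = l"
    and w: "w1 \<in> bwords n" "w2 \<in> bwords l" using t1 t2 by (auto simp: tdata_def)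
  have "(\<Sum>p = 1..q. \<Sum>k = 1..c2 p. c1 (word_perm_inv w2 ((\<Sum>q = 1..<p. c2 q) + k))) = n"
    using sum_nested[of "\<lambda>p. c1 (word_perm_inv w2 p)" c2 q] l n sum_inv_word_perm[OF w(2), of c1] by simp
  moreover have "cable_word c1 w2 \<in> bwords n" using cable_word_bwords[OF w(2), of c1] n by simp
  moreover have "x2 (blk c1 (word_perm w1 i)) \<otimes>\<^bsub>G\<^esub> x1 i \<in> carrier G" if i: "i \<in> {1..n}" for i
  proof -
    have "word_perm w1 i \<in> {1..n}" using i permutes_in_image[OF word_perm_permutes[OF w(1)]] by blast
    then have "blk c1 (word_perm w1 i) \<in> {1..l}" using blk_bounds[of _ c1 l] n by auto
    then show ?thesis using t1 t2 i by (simp add: tdata_def)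
  qed
  ultimately show ?thesis using w by (simp add: tdata_def)
qed

lemma tarr_Tar:
  assumes t: "tdata n l c w x" and t': "tdata n' l' c' w' x'"
  shows "tarr n l c w x \<star>\<^bsub>T\<^esub> tarr n' l' c' w' x' =
    tarr (n + n') (l + l') (\<lambda>i. if i \<le> l then c i else c' (i - l)) (w @ word_shift n w')
      (\<lambda>i. if i \<le> n then x i else x' (i - n))"
proof -
  have n: "(\<Sum>p = 1..l. c p) = n" "(\<Sum>p = 1..l'. c' p) = n'"
    and w: "w \<in> bwords n" "w' \<in> bwords n'" using t t' by (auto simp: tdata_def)
  have order: "(\<lambda>i\<in>{1..n + n'}. if i \<le> n then (\<lambda>k\<in>{1..n}. blk c k) i else l + (\<lambda>k\<in>{1..n'}. blk c' k) (i - n)) =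
      (\<lambda>k\<in>{1..n + n'}. blk (\<lambda>i. if i \<le> l then c i else c' (i - l)) k)"
  proof (rule restrict_ext)
    fix k assume "k \<in> {1..n + n'}"
    then show "(if k \<le> n then (\<lambda>k\<in>{1..n}. blk c k) k else l + (\<lambda>k\<in>{1..n'}. blk c' k) (k - n)) =
        blk (\<lambda>i. if i \<le> l then c i else c' (i - l)) k"
      using blk_append[OF n, of k] by auto
  qed
  have lab: "(\<lambda>i\<in>{1..n + n'}. if i \<le> n then (\<lambda>i\<in>{1..n}. x i) i else (\<lambda>i\<in>{1..n'}. x' i) (i - n)) =
      (\<lambda>i\<in>{1..n + n'}. if i \<le> n then x i else x' (i - n))"
    by (rule restrict_ext) auto
  show ?thesis
    unfolding tarr_def by (simp add: DJG_def Let_def juxt[OF w] order lab)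
qed

lemma tdata_Tar:
  assumes "tdata n l c w x" "tdata n' l' c' w' x'"
  shows "tdata (n + n') (l + l') (\<lambda>i. if i \<le> l then c i else c' (i - l)) (w @ word_shift n w')
      (\<lambda>i. if i \<le> n then x i else x' (i - n))"
proof -
  have lab: "(if i \<le> n then x i else x' (i - n)) \<in> carrier G" if i: "i \<in> {1..n + n'}" for i
  proof (cases "i \<le> n")
    case False
    then have "i - n \<in> {1..n'}" using i by auto
    then show ?thesis using assms(2) False by (simp add: tdata_def)
  qed (use assms(1) i in \<open>simp add: tdata_def\<close>)
  have "w \<in> bwords n" "w' \<in> bwords n'" using assms by (simp_all add: tdata_def)
  then have "w @ word_shift n w' \<in> bwords (n + n')"
    using bwords_mono[of w n "n + n'"] bwords_shift[of w' n' n "n + n'"] by simp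
  moreover have "(\<Sum>p = 1..l + l'. if p \<le> l then c p else c' (p - l)) = n + n'"
    using assms sum_append[of l c c' l'] by (simp add: tdata_def)
  ultimately show ?thesis unfolding tdata_def using lab by blast
qed

lemma Id_T: "Id T n = tarr n n (\<lambda>_. 1) [] (\<lambda>_. \<one>\<^bsub>G\<^esub>)"
proof -
  have "(\<lambda>k\<in>{1..n}. blk (\<lambda>_. 1) k) = (\<lambda>k\<in>{1..n}. k)" by (rule restrict_ext) (simp add: blk_one)
  then show ?thesis by (simp add: tarr_def DJG_def Let_def lab_one_def jone)
qed

lemma Braid_T: "Braid T a b = tarr (a + b) (b + a) (\<lambda>_. 1) (block_word a b) (\<lambda>_. \<one>\<^bsub>G\<^esub>)"
proof -
  have "(\<lambda>k\<in>{1..a + b}. blk (\<lambda>_. 1) k) = (\<lambda>k\<in>{1..a + b}. k)" by (rule restrict_ext) (simp add: blk_one)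
  then show ?thesis by (simp add: tarr_def DJG_def Let_def block)
qed

lemma tdata_word: "w \<in> bwords n \<Longrightarrow> tdata n n (\<lambda>_. 1) w (\<lambda>_. \<one>\<^bsub>G\<^esub>)"
  by (simp add: tdata_def)

lemma tdata_Braid: "tdata (a + b) (b + a) (\<lambda>_. 1) (block_word a b) (\<lambda>_. \<one>\<^bsub>G\<^esub>)"
  using block_word_bwords[of a b] by (simp add: tdata_def)

lemma T_closed:
  assumes "s \<in> Ar T" "t \<in> Ar T"
  shows "s \<star>\<^bsub>T\<^esub> t \<in> Ar T" "Dom T (s \<star>\<^bsub>T\<^esub> t) = Dom T s + Dom T t" "Cod T (s \<star>\<^bsub>T\<^esub> t) = Cod T s + Cod T t"
proof -
  obtain n m c w x where s: "s = tarr n m c w x" "tdata n m c w x" using assms(1) by (rule Ar_T_cases)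
  obtain n' m' c' w' x' where t: "t = tarr n' m' c' w' x'" "tdata n' m' c' w' x'"
    using assms(2) by (rule Ar_T_cases)
  show "s \<star>\<^bsub>T\<^esub> t \<in> Ar T" "Dom T (s \<star>\<^bsub>T\<^esub> t) = Dom T s + Dom T t" "Cod T (s \<star>\<^bsub>T\<^esub> t) = Cod T s + Cod T t"
    unfolding s(1) t(1) tarr_Tar[OF s(2) t(2)] using tdata_Tar[OF s(2) t(2)] by simp_all
qed

lemma T_Cmp_closed:
  assumes "s \<in> Ar T" "t \<in> Ar T" "Cod T s = Dom T t"
  shows "t \<cdot>\<^bsub>T\<^esub> s \<in> Ar T" "Dom T (t \<cdot>\<^bsub>T\<^esub> s) = Dom T s" "Cod T (t \<cdot>\<^bsub>T\<^esub> s) = Cod T t"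
proof -
  obtain n m c w x where s: "s = tarr n m c w x" "tdata n m c w x" using assms(1) by (rule Ar_T_cases)
  obtain m' l c' w' x' where t': "t = tarr m' l c' w' x'" "tdata m' l c' w' x'"
    using assms(2) by (rule Ar_T_cases)
  then have t: "t = tarr m l c' w' x'" "tdata m l c' w' x'" using assms(3) s by auto
  show "t \<cdot>\<^bsub>T\<^esub> s \<in> Ar T" "Dom T (t \<cdot>\<^bsub>T\<^esub> s) = Dom T s" "Cod T (t \<cdot>\<^bsub>T\<^esub> s) = Cod T t"
    unfolding s(1) t(1) tarr_Cmp[OF s(2) t(2)] using tdata_Cmp[OF s(2) t(2)] by simp_all
qed

subsection \<open>Generators and relations\<close>

definition mult_ar where "mult_ar = tarr 2 1 (\<lambda>_. 2) [] (\<lambda>_. \<one>\<^bsub>G\<^esub>)"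
definition unit_ar where "unit_ar = tarr 0 1 (\<lambda>_. 0) [] (\<lambda>_. \<one>\<^bsub>G\<^esub>)"
definition group_ar where "group_ar g = tarr 1 1 (\<lambda>_. 1) [] (\<lambda>_. g)"
definition cross_ar where "cross_ar e = tarr 2 2 (\<lambda>_. 1) [(1, e)] (\<lambda>_. \<one>\<^bsub>G\<^esub>)"

lemma sum_1_2: "(\<Sum>p = 1..2. c p) = c 1 + c 2" for c :: "nat \<Rightarrow> nat"
  by (simp add: One_nat_def numeral_2_eq_2)

lemma tdata_gens:
  "tdata 2 1 (\<lambda>_. 2) [] (\<lambda>_. \<one>\<^bsub>G\<^esub>)" "tdata 0 1 (\<lambda>_. 0) [] (\<lambda>_. \<one>\<^bsub>G\<^esub>)"
  "g \<in> carrier G \<Longrightarrow> tdata 1 1 (\<lambda>_. 1) [] (\<lambda>_. g)" "tdata 2 2 (\<lambda>_. 1) [(1, e)] (\<lambda>_. \<one>\<^bsub>G\<^esub>)"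
  by (simp_all add: tdata_def)

lemma gens_Ar [simp]:
  "mult_ar \<in> Ar T" "unit_ar \<in> Ar T" "g \<in> carrier G \<Longrightarrow> group_ar g \<in> Ar T" "cross_ar e \<in> Ar T"
  by (simp_all add: mult_ar_def unit_ar_def group_ar_def cross_ar_def tdata_gens)

lemma gens_typing [simp]:
  "Dom T mult_ar = 2" "Cod T mult_ar = 1" "Dom T unit_ar = 0" "Cod T unit_ar = 1"
  "Dom T (group_ar g) = 1" "Cod T (group_ar g) = 1" "Dom T (cross_ar e) = 2" "Cod T (cross_ar e) = 2"
  by (simp_all add: mult_ar_def unit_ar_def group_ar_def cross_ar_def)

lemma Id_Ar_T [simp]: "Id T n \<in> Ar T" "Dom T (Id T n) = n" "Cod T (Id T n) = n"
  by (simp_all add: Id_T tdata_word)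

lemma Braid_1_1_T: "Braid T 1 1 = cross_ar True"
  by (simp add: Braid_T cross_ar_def)

lemma word_ar_Cmp:
  assumes "v \<in> bwords n" "w \<in> bwords n"
  shows "tarr n n (\<lambda>_. 1) v (\<lambda>_. \<one>\<^bsub>G\<^esub>) \<cdot>\<^bsub>T\<^esub> tarr n n (\<lambda>_. 1) w (\<lambda>_. \<one>\<^bsub>G\<^esub>) =
    tarr n n (\<lambda>_. 1) (v @ w) (\<lambda>_. \<one>\<^bsub>G\<^esub>)"
  unfolding tarr_Cmp[OF tdata_word[OF assms(2)] tdata_word[OF assms(1)]]
  using assms by (intro tarr_cong) (simp_all add: cable_word_one[of n])

lemma cross_ar_inverse:
  "cross_ar e \<cdot>\<^bsub>T\<^esub> cross_ar (\<not> e) = Id T 2"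
proof -
  have "cross_ar e \<cdot>\<^bsub>T\<^esub> cross_ar (\<not> e) = tarr 2 2 (\<lambda>_. 1) ([(1, e)] @ [(1, \<not> e)]) (\<lambda>_. \<one>\<^bsub>G\<^esub>)"
    unfolding cross_ar_def by (rule word_ar_Cmp) simp_all
  also have "\<dots> = Id T 2"
    unfolding Id_T by (intro tarr_cong cls_braid_eq artin_imp_braid_eq)
      (simp_all add: artin.cancel)
  finally show ?thesis .
qed

lemma mult_assoc_T: "mult_ar \<cdot>\<^bsub>T\<^esub> (mult_ar \<star>\<^bsub>T\<^esub> Id T 1) = mult_ar \<cdot>\<^bsub>T\<^esub> (Id T 1 \<star>\<^bsub>T\<^esub> mult_ar)"
proof -
  have t: "mult_ar \<star>\<^bsub>T\<^esub> Id T 1 = tarr (2 + 1) 2 (\<lambda>i. if i \<le> 1 then 2 else 1) [] (\<lambda>_. \<one>\<^bsub>G\<^esub>)"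
    "Id T 1 \<star>\<^bsub>T\<^esub> mult_ar = tarr (1 + 2) 2 (\<lambda>i. if i \<le> 1 then 1 else 2) [] (\<lambda>_. \<one>\<^bsub>G\<^esub>)"
    unfolding mult_ar_def Id_T
    using tarr_Tar[OF tdata_gens(1) tdata_word[of "[]" 1, OF bwords_Nil]]
      tarr_Tar[OF tdata_word[of "[]" 1, OF bwords_Nil] tdata_gens(1)] by simp_all
  have "mult_ar \<cdot>\<^bsub>T\<^esub> (mult_ar \<star>\<^bsub>T\<^esub> Id T 1) = tarr 3 1 (\<lambda>_. 3) [] (\<lambda>_. \<one>\<^bsub>G\<^esub>)"
    unfolding t unfolding mult_ar_def
    by (subst tarr_Cmp) (auto simp: tdata_def sum_1_2 intro!: tarr_cong)
  moreover have "mult_ar \<cdot>\<^bsub>T\<^esub> (Id T 1 \<star>\<^bsub>T\<^esub> mult_ar) = tarr 3 1 (\<lambda>_. 3) [] (\<lambda>_. \<one>\<^bsub>G\<^esub>)"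
    unfolding t unfolding mult_ar_def
    by (subst tarr_Cmp) (auto simp: tdata_def sum_1_2 intro!: tarr_cong)
  ultimately show ?thesis by simp
qed

lemma mult_unit_T:
  "mult_ar \<cdot>\<^bsub>T\<^esub> (unit_ar \<star>\<^bsub>T\<^esub> Id T 1) = Id T 1" "mult_ar \<cdot>\<^bsub>T\<^esub> (Id T 1 \<star>\<^bsub>T\<^esub> unit_ar) = Id T 1"
proof -
  have t: "unit_ar \<star>\<^bsub>T\<^esub> Id T 1 = tarr 1 2 (\<lambda>i. if i \<le> 1 then 0 else 1) [] (\<lambda>_. \<one>\<^bsub>G\<^esub>)"
    "Id T 1 \<star>\<^bsub>T\<^esub> unit_ar = tarr 1 2 (\<lambda>i. if i \<le> 1 then 1 else 0) [] (\<lambda>_. \<one>\<^bsub>G\<^esub>)"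
    unfolding unit_ar_def Id_T
    using tarr_Tar[OF tdata_gens(2) tdata_word[of "[]" 1, OF bwords_Nil]]
      tarr_Tar[OF tdata_word[of "[]" 1, OF bwords_Nil] tdata_gens(2)] by simp_all
  show "mult_ar \<cdot>\<^bsub>T\<^esub> (unit_ar \<star>\<^bsub>T\<^esub> Id T 1) = Id T 1" "mult_ar \<cdot>\<^bsub>T\<^esub> (Id T 1 \<star>\<^bsub>T\<^esub> unit_ar) = Id T 1"
    unfolding t unfolding mult_ar_def Id_T
    by (subst tarr_Cmp; auto simp: tdata_def sum_1_2 intro!: tarr_cong)+
qed

lemma group_mult_T:
  assumes "g \<in> carrier G"
  shows "group_ar g \<cdot>\<^bsub>T\<^esub> mult_ar = mult_ar \<cdot>\<^bsub>T\<^esub> (group_ar g \<star>\<^bsub>T\<^esub> group_ar g)"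
proof -
  have t: "group_ar g \<star>\<^bsub>T\<^esub> group_ar g = tarr 2 2 (\<lambda>_. 1) [] (\<lambda>_. g)"
    unfolding group_ar_def using tarr_Tar[OF tdata_gens(3)[OF assms] tdata_gens(3)[OF assms]] by simp
  show ?thesis
    unfolding t unfolding mult_ar_def group_ar_def
    using assms by (subst (1 2) tarr_Cmp) (auto simp: tdata_def sum_1_2 intro!: tarr_cong)
qed

lemma group_unit_T:
  assumes "g \<in> carrier G"
  shows "group_ar g \<cdot>\<^bsub>T\<^esub> unit_ar = unit_ar"
  unfolding unit_ar_def group_ar_def
  using assms by (subst tarr_Cmp) (auto simp: tdata_def intro!: tarr_cong)

lemma group_one_T: "group_ar \<one>\<^bsub>G\<^esub> = Id T 1"
  by (simp add: group_ar_def Id_T)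

lemma group_Cmp_T:
  assumes "g \<in> carrier G" "h \<in> carrier G"
  shows "group_ar g \<cdot>\<^bsub>T\<^esub> group_ar h = group_ar (g \<otimes>\<^bsub>G\<^esub> h)"
  unfolding group_ar_def
  using assms by (subst tarr_Cmp) (auto simp: tdata_def intro!: tarr_cong)


section \<open>Generation by multiplication, unit, group elements and crossings\<close>

lemma tarr_decompose:
  assumes "tdata n m c w x"
  shows "tarr n m c w x = tarr n m c [] (\<lambda>_. \<one>\<^bsub>G\<^esub>) \<cdot>\<^bsub>T\<^esub> (tarr n n (\<lambda>_. 1) w (\<lambda>_. \<one>\<^bsub>G\<^esub>) \<cdot>\<^bsub>T\<^esub> tarr n n (\<lambda>_. 1) [] x)"
proof -
  have w: "w \<in> bwords n" and c: "(\<Sum>p = 1..m. c p) = n" and x: "\<And>i. i \<in> {1..n} \<Longrightarrow> x i \<in> carrier G"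
    using assms by (auto simp: tdata_def)
  have d: "tdata n n (\<lambda>_. 1) [] x" "tdata n n (\<lambda>_. 1) w x" "tdata n m c [] (\<lambda>_. \<one>\<^bsub>G\<^esub>)"
    using w c x by (auto simp: tdata_def)
  have "tarr n n (\<lambda>_. 1) w (\<lambda>_. \<one>\<^bsub>G\<^esub>) \<cdot>\<^bsub>T\<^esub> tarr n n (\<lambda>_. 1) [] x = tarr n n (\<lambda>_. 1) w x"
    unfolding tarr_Cmp[OF d(1) tdata_word[OF w]]
    using w x by (intro tarr_cong) (auto simp: cable_word_one[of n])
  moreover have "tarr n m c [] (\<lambda>_. \<one>\<^bsub>G\<^esub>) \<cdot>\<^bsub>T\<^esub> tarr n n (\<lambda>_. 1) w x = tarr n m c w x"
    unfolding tarr_Cmp[OF d(2,3)]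
    using w c x by (intro tarr_cong) auto
  ultimately show ?thesis by simp
qed

lemma tarr_letter:
  assumes "1 \<le> i" "i < n"
  shows "tarr n n (\<lambda>_. 1) [(i, e)] (\<lambda>_. \<one>\<^bsub>G\<^esub>) = Id T (i - 1) \<star>\<^bsub>T\<^esub> (cross_ar e \<star>\<^bsub>T\<^esub> Id T (n - Suc i))"
proof -
  obtain j r where j: "i = Suc j" "n = j + (2 + r)" using split_letter[OF assms] by blast
  have "cross_ar e \<star>\<^bsub>T\<^esub> Id T r = tarr (2 + r) (2 + r) (\<lambda>_. 1) [(1, e)] (\<lambda>_. \<one>\<^bsub>G\<^esub>)"
    unfolding cross_ar_def Id_T using tarr_Tar[OF tdata_gens(4)[of e] tdata_word[of "[]" r, OF bwords_Nil]] by simp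
  moreover have "Id T j \<star>\<^bsub>T\<^esub> tarr (2 + r) (2 + r) (\<lambda>_. 1) [(1, e)] (\<lambda>_. \<one>\<^bsub>G\<^esub>) =
      tarr (j + (2 + r)) (j + (2 + r)) (\<lambda>_. 1) [(j + 1, e)] (\<lambda>_. \<one>\<^bsub>G\<^esub>)"
    unfolding Id_T
    using tarr_Tar[OF tdata_word[of "[]" j, OF bwords_Nil] tdata_word[of "[(1, e)]" "2 + r"]] by simp
  moreover have "i - 1 = j" "n - Suc i = r" "[(i, e)] = [(j + 1, e)]" using j by auto
  ultimately show ?thesis unfolding j(2)[symmetric] by (simp only:)
qed

text \<open>Labels are tensor products of group elements, words are composites of elementary
  crossings, and monotone maps are tensor products of iterated multiplications. Used to extend
  naturality from the generators to all arrows.\<close>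

lemma T_induct:
  assumes t: "t \<in> Ar T"
    and Cmp: "\<And>s t. s \<in> Ar T \<Longrightarrow> t \<in> Ar T \<Longrightarrow> Cod T s = Dom T t \<Longrightarrow> X s \<Longrightarrow> X t \<Longrightarrow> X (t \<cdot>\<^bsub>T\<^esub> s)"
    and Tar: "\<And>s t. s \<in> Ar T \<Longrightarrow> t \<in> Ar T \<Longrightarrow> X s \<Longrightarrow> X t \<Longrightarrow> X (s \<star>\<^bsub>T\<^esub> t)"
    and Id: "\<And>n. X (Id T n)" and mult: "X mult_ar" and unit: "X unit_ar"
    and grp: "\<And>g. g \<in> carrier G \<Longrightarrow> X (group_ar g)" and cross: "\<And>e. X (cross_ar e)"
  shows "X t"
proof -
  have labels: "X (tarr n n (\<lambda>_. 1) [] x)" if "\<And>i. i \<in> {1..n} \<Longrightarrow> x i \<in> carrier G" for n x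
    using that
  proof (induction n)
    case 0
    have "tarr 0 0 (\<lambda>_. 1) [] x = Id T 0" unfolding Id_T by (intro tarr_cong) auto
    then show ?case using Id by simp
  next
    case (Suc n)
    have d: "tdata n n (\<lambda>_. 1) [] x" "x (Suc n) \<in> carrier G" using Suc.prems by (auto simp: tdata_def)
    have "tarr n n (\<lambda>_. 1) [] x \<star>\<^bsub>T\<^esub> group_ar (x (Suc n)) =
        tarr (n + 1) (n + 1) (\<lambda>i. if i \<le> n then 1 else 1) [] (\<lambda>i. if i \<le> n then x i else x (Suc n))"
      unfolding group_ar_def using tarr_Tar[OF d(1) tdata_gens(3)[OF d(2)]] by simp
    also have "\<dots> = tarr (Suc n) (Suc n) (\<lambda>_. 1) [] x"
      unfolding Suc_eq_plus1[symmetric] by (intro tarr_cong) (auto simp: le_Suc_eq)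
    finally show ?case
      using Tar[OF tarr_Ar[OF d(1)] gens_Ar(3)[OF d(2)] Suc.IH grp[OF d(2)]] Suc.prems by auto
  qed
  have words: "X (tarr n n (\<lambda>_. 1) w (\<lambda>_. \<one>\<^bsub>G\<^esub>))" if "w \<in> bwords n" for n w
    using that
  proof (induction w rule: word_perm.induct)
    case 1
    then show ?case using Id by (simp add: Id_T)
  next
    case (2 i e w)
    then have i: "1 \<le> i" "i < n" and w: "w \<in> bwords n" "[(i, e)] \<in> bwords n" by auto
    have "X (tarr n n (\<lambda>_. 1) [(i, e)] (\<lambda>_. \<one>\<^bsub>G\<^esub>))"
      unfolding tarr_letter[OF i] by (intro Tar Id cross T_closed gens_Ar Id_Ar_T)
    then show ?case
      using Cmp[OF tarr_Ar[OF tdata_word[OF w(1)]] tarr_Ar[OF tdata_word[OF w(2)]]] 2(1)[OF w(1)]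
        word_ar_Cmp[OF w(2,1)] by simp
  qed
  have mults: "X (tarr k 1 (\<lambda>_. k) [] (\<lambda>_. \<one>\<^bsub>G\<^esub>))" for k
  proof (induction k)
    case 0
    show ?case using unit by (simp add: unit_ar_def)
  next
    case (Suc k)
    have d: "tdata k 1 (\<lambda>_. k) [] (\<lambda>_. \<one>\<^bsub>G\<^esub>)" by (simp add: tdata_def)
    let ?s = "tarr k 1 (\<lambda>_. k) [] (\<lambda>_. \<one>\<^bsub>G\<^esub>) \<star>\<^bsub>T\<^esub> Id T 1"
    have "?s = tarr (k + 1) (1 + 1) (\<lambda>i. if i \<le> 1 then k else 1) [] (\<lambda>_. \<one>\<^bsub>G\<^esub>)"
      unfolding Id_T using tarr_Tar[OF d tdata_word[of "[]" 1, OF bwords_Nil]] by simp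
    then have s: "?s = tarr (Suc k) 2 (\<lambda>i. if i \<le> 1 then k else 1) [] (\<lambda>_. \<one>\<^bsub>G\<^esub>)"
      by (simp only: Suc_eq_plus1 one_add_one)
    have "mult_ar \<cdot>\<^bsub>T\<^esub> ?s = tarr (Suc k) 1 (\<lambda>_. Suc k) [] (\<lambda>_. \<one>\<^bsub>G\<^esub>)"
      unfolding s unfolding mult_ar_def
      by (subst tarr_Cmp) (auto simp: tdata_def sum_1_2 intro!: tarr_cong)
    moreover have "X (mult_ar \<cdot>\<^bsub>T\<^esub> ?s)"
      using tarr_Ar[OF d] Suc by (intro Cmp Tar Id mult) (simp_all add: T_closed)
    ultimately show ?case by simp
  qed
  have orders: "X (tarr (\<Sum>p = 1..m. c p) m c [] (\<lambda>_. \<one>\<^bsub>G\<^esub>))" for m c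
  proof (induction m)
    case 0
    have "tarr 0 0 c [] (\<lambda>_. \<one>\<^bsub>G\<^esub>) = Id T 0" unfolding Id_T by (intro tarr_cong) auto
    then show ?case using Id by simp
  next
    case (Suc m)
    let ?n = "\<Sum>p = 1..m. c p" and ?k = "c (Suc m)"
    have d: "tdata ?n m c [] (\<lambda>_. \<one>\<^bsub>G\<^esub>)" "tdata ?k 1 (\<lambda>_. ?k) [] (\<lambda>_. \<one>\<^bsub>G\<^esub>)" by (simp_all add: tdata_def)
    have "tarr ?n m c [] (\<lambda>_. \<one>\<^bsub>G\<^esub>) \<star>\<^bsub>T\<^esub> tarr ?k 1 (\<lambda>_. ?k) [] (\<lambda>_. \<one>\<^bsub>G\<^esub>) =
        tarr (?n + ?k) (m + 1) (\<lambda>i. if i \<le> m then c i else ?k) [] (\<lambda>_. \<one>\<^bsub>G\<^esub>)"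
      using tarr_Tar[OF d] by simp
    also have "\<dots> = tarr (\<Sum>p = 1..Suc m. c p) (Suc m) c [] (\<lambda>_. \<one>\<^bsub>G\<^esub>)"
      unfolding Suc_eq_plus1[symmetric] sum.cl_ivl_Suc
      using sum_append[of m c "\<lambda>_. ?k" 1] by (simp, intro tarr_cong) (auto simp: le_Suc_eq)
    finally show ?case using Tar[OF tarr_Ar[OF d(1)] tarr_Ar[OF d(2)] Suc mults] by simp
  qed
  obtain n m c w x where t: "t = tarr n m c w x" "tdata n m c w x" using t by (rule Ar_T_cases)
  have w: "w \<in> bwords n" and c: "(\<Sum>p = 1..m. c p) = n" and x: "\<And>i. i \<in> {1..n} \<Longrightarrow> x i \<in> carrier G"
    using t(2) by (auto simp: tdata_def)
  have d: "tdata n n (\<lambda>_. 1) [] x" "tdata n m c [] (\<lambda>_. \<one>\<^bsub>G\<^esub>)"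
    using w c x by (auto simp: tdata_def)
  show ?thesis
    unfolding t(1) tarr_decompose[OF t(2)]
    using orders[of c m] c tarr_Ar[OF d(1)] tarr_Ar[OF d(2)] tarr_Ar[OF tdata_word[OF w]]
    by (intro Cmp labels words w x) (simp_all add: T_Cmp_closed)
qed

text \<open>The braiding of the opposite category involves \<open>inv_ar\<close>, a definite
  description; uniqueness of the inverse is therefore read off from coordinates.\<close>

lemma inverse_arrows_word:
  assumes v: "v \<in> bwords n"
  shows "inverse_arrows T (tarr n n (\<lambda>_. 1) v (\<lambda>_. \<one>\<^bsub>G\<^esub>)) t \<longleftrightarrow>
    t = tarr n n (\<lambda>_. 1) (word_inv v) (\<lambda>_. \<one>\<^bsub>G\<^esub>)"
proof
  let ?b = "tarr n n (\<lambda>_. 1) v (\<lambda>_. \<one>\<^bsub>G\<^esub>)" and ?b' = "tarr n n (\<lambda>_. 1) (word_inv v) (\<lambda>_. \<one>\<^bsub>G\<^esub>)"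
  have v': "word_inv v \<in> bwords n" using v by simp
  show "inverse_arrows T ?b t" if "t = ?b'"
  proof -
    have "?b' \<cdot>\<^bsub>T\<^esub> ?b = Id T n" "?b \<cdot>\<^bsub>T\<^esub> ?b' = Id T n"
      unfolding word_ar_Cmp[OF v v'] word_ar_Cmp[OF v' v] Id_T
      using cls_braid_eq[OF braid_eq_inv_left[OF v]] cls_braid_eq[OF braid_eq_inv_right[OF v]]
      by (auto intro!: tarr_cong)
    then show ?thesis
      using that tarr_Ar[OF tdata_word[OF v]] tarr_Ar[OF tdata_word[OF v']]
      by (simp add: inverse_arrows_def in_hom_set)
  qed
  assume inv: "inverse_arrows T ?b t"
  then have "t \<in> Ar T" by (simp add: inverse_arrows_def in_hom_set)
  then obtain n' m' c w x where t': "t = tarr n' m' c w x" "tdata n' m' c w x" by (rule Ar_T_cases)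
  then have t: "t = tarr n n c w x" "tdata n n c w x" using inv by (auto simp: inverse_arrows_def in_hom_set)
  have w: "w \<in> bwords n" and c: "(\<Sum>p = 1..n. c p) = n" and x: "\<And>i. i \<in> {1..n} \<Longrightarrow> x i \<in> carrier G"
    using t(2) by (auto simp: tdata_def)
  have fc: "fibre_card n (\<lambda>k\<in>{1..n}. blk d k) i = d i" if "i \<in> {1..n}" "(\<Sum>p = 1..n. d p) = n" for d i
    using fibre_card_blk[OF that(2,1)] .
  have "t \<cdot>\<^bsub>T\<^esub> ?b = Id T n" using inv by (simp add: inverse_arrows_def)
  \<comment> \<open>The monotone part of the left inverse law already forces every fibre of
    \<open>t\<close> to be a singleton.\<close>
  then have "(\<lambda>k\<in>{1..n}. blk (\<lambda>i. \<Sum>k = 1..c i. 1) k) = (\<lambda>k\<in>{1..n}. blk (\<lambda>_. 1) k)"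
    unfolding t(1) tarr_Cmp[OF tdata_word[OF v] t(2)] Id_T by (simp only: tarr_def prod.inject)
  then have c1: "c i = 1" if "i \<in> {1..n}" for i
    using fc[OF that, of c] fc[OF that, of "\<lambda>_. 1"] c by simp
  have cab: "cable_word c v = v" using c1 by (intro cable_word_one[OF _ v])
  have "?b \<cdot>\<^bsub>T\<^esub> t = Id T n" using inv by (simp add: inverse_arrows_def)
  then have lab: "(\<lambda>i\<in>{1..n}. \<one>\<^bsub>G\<^esub> \<otimes>\<^bsub>G\<^esub> x i) = (\<lambda>i\<in>{1..n}. \<one>\<^bsub>G\<^esub>)" and cl: "cls n (v @ w) = cls n []"
    unfolding t(1) tarr_Cmp[OF t(2) tdata_word[OF v]] Id_T cab by (simp_all only: tarr_def prod.inject)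
  have x1: "x i = \<one>\<^bsub>G\<^esub>" if "i \<in> {1..n}" for i
    using fun_cong[OF lab, of i] that x[OF that] by simp
  \<comment> \<open>Cancellation among strands: the class of \<open>v @ w\<close> is trivial, and
    multiplying by the inverse of \<open>v\<close> on the left isolates that of
    \<open>w\<close>.\<close>
  have "braid_eq n ((word_inv v @ v) @ w) ([] @ w)"
    using w by (intro braid_eq_append braid_eq_inv_left[OF v] braid_eq.refl)
  then have "cls n w = cls n (word_inv v @ (v @ w))" using cls_braid_eq by simp
  also have "\<dots> = cls n (word_inv v @ [])"
    using jmul[OF v', of "v @ w"] jmul[OF v', of "[]"] v w cl by simp
  finally have "cls n w = cls n (word_inv v)" by simp
  then show "t = ?b'" unfolding t(1) using c c1 x1 by (intro tarr_cong) auto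
qed

lemma inv_ar_word:
  assumes "v \<in> bwords n"
  shows "inv_ar T (tarr n n (\<lambda>_. 1) v (\<lambda>_. \<one>\<^bsub>G\<^esub>)) = tarr n n (\<lambda>_. 1) (word_inv v) (\<lambda>_. \<one>\<^bsub>G\<^esub>)"
  unfolding inv_ar_def inverse_arrows_word[OF assms] by simp

lemma inv_Id_T: "inv_ar T (Id T n) = Id T n"
  unfolding Id_T by (simp add: inv_ar_word)

lemma inverse_arrows_Braid_T: "inverse_arrows T (Braid T a b) (inv_ar T (Braid T a b))"
proof -
  have "Braid T a b = tarr (a + b) (a + b) (\<lambda>_. 1) (block_word a b) (\<lambda>_. \<one>\<^bsub>G\<^esub>)"
    by (simp add: Braid_T add.commute)
  then show ?thesis
    using inverse_arrows_word[OF block_word_bwords[of a b]] inv_ar_word[OF block_word_bwords[of a b]] by simp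
qed

end


section \<open>The functor classified by a strict monoid with group action\<close>

text \<open>\<open>act_cls\<close> is the point where the two families differ: Artin's relations
  provide it for braids, symmetry and Coxeter's presentation for permutations.\<close>

locale classified_functor = strand_group J cls G + strict_gmonoid P G m e r
  for J :: "'j strands" and cls and G :: "'g monoid" and P :: "(nat, 'm) bmoncat" and m e :: 'm and r +
  assumes act_cls: "v \<in> bwords n \<Longrightarrow> w \<in> bwords n \<Longrightarrow> cls n v = cls n w \<Longrightarrow> act n v = act n w"
begin

definition F_ar :: "nat \<times> nat \<times> (nat \<Rightarrow> nat) \<times> (nat \<Rightarrow> 'g) \<times> 'j \<Rightarrow> 'm" where
  "F_ar = (\<lambda>(n, m, \<phi>, x, j). interp n m (fibre_card n \<phi>) (SOME w. w \<in> bwords n \<and> cls n w = j) x)"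

text \<open>The word picked in \<open>F_ar\<close> represents the same element as \<open>w\<close>,
  hence acts in the same way by \<open>act_cls\<close>; so the choice does not matter.\<close>

lemma F_tarr:
  assumes "tdata n l c w x"
  shows "F_ar (tarr n l c w x) = interp n l c w x"
proof -
  have w: "w \<in> bwords n" and c: "(\<Sum>p = 1..l. c p) = n" using assms by (auto simp: tdata_def)
  let ?w = "SOME w'. w' \<in> bwords n \<and> cls n w' = cls n w"
  have "?w \<in> bwords n \<and> cls n ?w = cls n w"
    using w by (intro someI[of "\<lambda>w'. w' \<in> bwords n \<and> cls n w' = cls n w" w]) simp
  then have "act n ?w = act n w" using act_cls w by blast
  then have "interp n l (fibre_card n (\<lambda>k\<in>{1..n}. blk c k)) ?w (\<lambda>i\<in>{1..n}. x i) = interp n l c w x"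
    by (intro interp_cong fibre_card_blk[OF c]) auto
  then show ?thesis by (simp only: F_ar_def tarr_def prod.case)
qed

lemma F_typing:
  assumes "t \<in> Ar T"
  shows "F_ar t \<in> Ar P" "Dom P (F_ar t) = Dom T t" "Cod P (F_ar t) = Cod T t"
proof -
  obtain n l c w x where t: "t = tarr n l c w x" "tdata n l c w x" using assms by (rule Ar_T_cases)
  then show "F_ar t \<in> Ar P" "Dom P (F_ar t) = Dom T t" "Cod P (F_ar t) = Cod T t"
    by (simp_all add: F_tarr) (simp_all add: tdata_def)
qed

lemma F_Cmp:
  assumes "s \<in> Ar T" "t \<in> Ar T" "Cod T s = Dom T t"
  shows "F_ar (t \<cdot>\<^bsub>T\<^esub> s) = F_ar t \<cdot>\<^bsub>P\<^esub> F_ar s"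
proof -
  obtain n l c w x where s: "s = tarr n l c w x" "tdata n l c w x" using assms(1) by (rule Ar_T_cases)
  obtain l' q c' w' x' where t': "t = tarr l' q c' w' x'" "tdata l' q c' w' x'"
    using assms(2) by (rule Ar_T_cases)
  then have t: "t = tarr l q c' w' x'" "tdata l q c' w' x'" using assms(3) s by auto
  have n: "(\<Sum>p = 1..l. c p) = n" and w: "w \<in> bwords n" using s(2) by (auto simp: tdata_def)
  have lab: "x' (blk c (word_perm w i)) \<in> carrier G" if i: "i \<in> {1..n}" for i
  proof -
    have "word_perm w i \<in> {1..n}" using i permutes_in_image[OF word_perm_permutes[OF w]] by blast
    then have "blk c (word_perm w i) \<in> {1..l}" using blk_bounds[of _ c l] n by auto
    then show ?thesis using t(2) by (simp add: tdata_def)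
  qed
  show ?thesis
    unfolding s(1) t(1) tarr_Cmp[OF s(2) t(2)] F_tarr[OF tdata_Cmp[OF s(2) t(2)]] F_tarr[OF s(2)] F_tarr[OF t(2)]
    using s(2) t(2) lab by (intro interp_Cmp[symmetric]) (auto simp: tdata_def)
qed

lemma F_Tar:
  assumes "s \<in> Ar T" "t \<in> Ar T"
  shows "F_ar (s \<star>\<^bsub>T\<^esub> t) = F_ar s \<star>\<^bsub>P\<^esub> F_ar t"
proof -
  obtain n l c w x where s: "s = tarr n l c w x" "tdata n l c w x" using assms(1) by (rule Ar_T_cases)
  obtain n' l' c' w' x' where t: "t = tarr n' l' c' w' x'" "tdata n' l' c' w' x'"
    using assms(2) by (rule Ar_T_cases)
  show ?thesis
    unfolding s(1) t(1) tarr_Tar[OF s(2) t(2)] F_tarr[OF tdata_Tar[OF s(2) t(2)]] F_tarr[OF s(2)] F_tarr[OF t(2)]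
    using s(2) t(2) by (intro interp_Ten) (auto simp: tdata_def)
qed

lemma F_word: "w \<in> bwords n \<Longrightarrow> F_ar (tarr n n (\<lambda>_. 1) w (\<lambda>_. \<one>\<^bsub>G\<^esub>)) = act n w"
  by (simp add: F_tarr tdata_word interp_word)

lemma F_Id: "F_ar (Id T n) = Id P n"
  by (simp add: Id_T F_word)

lemma F_Braid: "F_ar (Braid T a b) = Braid P a b"
proof -
  have "Braid T a b = tarr (a + b) (a + b) (\<lambda>_. 1) (block_word a b) (\<lambda>_. \<one>\<^bsub>G\<^esub>)"
    by (simp add: Braid_T add.commute)
  then show ?thesis using F_word[OF block_word_bwords[of a b]] act_block[of a b] by simp
qed

lemma F_gens: "F_ar mult_ar = m" "F_ar unit_ar = e" "g \<in> carrier G \<Longrightarrow> F_ar (group_ar g) = r g"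
  unfolding mult_ar_def unit_ar_def group_ar_def
  by (simp_all only: F_tarr tdata_gens interp_2 interp_0 interp_1)

end

section \<open>Coherent families of objects\<close>

text \<open>A coherent family is a strong monoidal functor from the discrete monoidal category of natural
  numbers.  The full subcategory on its members becomes a strict braided monoidal category
  \<open>fam_cat\<close> with objects the natural numbers.\<close>

locale coherent_family = braided_monoidal_category C for C :: "('o, 'm) bmoncat" (structure) +
  fixes p :: "nat \<Rightarrow> 'o" and can :: "nat \<Rightarrow> nat \<Rightarrow> 'm" and u :: 'm
  assumes p_Ob [simp]: "p n \<in> Ob C"
    and can_isom [simp]: "isom C (can a b)"
    and Dom_can [simp]: "Dom C (can a b) = p a \<odot> p b"
    and Cod_can [simp]: "Cod C (can a b) = p (a + b)"
    and u_isom [simp]: "isom C u" and Dom_u [simp]: "Dom C u = Unit C" and Cod_u [simp]: "Cod C u = p 0"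
    and can_assoc: "can a (b + c) \<cdot> ((Id C (p a) \<star> can b c) \<cdot> Assoc C (p a) (p b) (p c)) =
      can (a + b) c \<cdot> (can a b \<star> Id C (p c))"
    and can_unit_left: "can 0 a \<cdot> (u \<star> Id C (p a)) = LUnit C (p a)"
    and can_unit_right: "can a 0 \<cdot> (Id C (p a) \<star> u) = RUnit C (p a)"
begin

lemma can_Ar [simp]: "can a b \<in> Ar C" by (rule isom_Ar[OF can_isom])
lemma u_Ar [simp]: "u \<in> Ar C" by (rule isom_Ar[OF u_isom])

text \<open>The indices of sources and targets are arguments because \<open>p\<close> need not be
  injective: an arrow of \<open>C\<close> does not determine them.\<close>

definition ten :: "nat \<Rightarrow> nat \<Rightarrow> nat \<Rightarrow> nat \<Rightarrow> 'm \<Rightarrow> 'm \<Rightarrow> 'm" where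
  "ten a b a' b' f g = can b b' \<cdot> ((f \<star> g) \<cdot> inv_ar C (can a a'))"

definition br :: "nat \<Rightarrow> nat \<Rightarrow> 'm" where
  "br a b = can b a \<cdot> (Braid C (p a) (p b) \<cdot> inv_ar C (can a b))"

lemma ten_typing [simp]:
  assumes "f \<in> Ar C" "Dom C f = p a" "Cod C f = p b" "g \<in> Ar C" "Dom C g = p a'" "Cod C g = p b'"
  shows "ten a b a' b' f g \<in> Ar C" "Dom C (ten a b a' b' f g) = p (a + a')" "Cod C (ten a b a' b' f g) = p (b + b')"
  using assms by (simp_all add: ten_def)

lemma ten_can:
  assumes "f \<in> Ar C" "Dom C f = p a" "Cod C f = p b" "g \<in> Ar C" "Dom C g = p a'" "Cod C g = p b'"
  shows "ten a b a' b' f g \<cdot> can a a' = can b b' \<cdot> (f \<star> g)"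
  using assms by (simp add: ten_def cassoc)

lemma ten_Id: "ten a a b b (Id C (p a)) (Id C (p b)) = Id C (p (a + b))"
  by (simp add: ten_def)

lemma ten_Cmp:
  assumes "f \<in> Ar C" "Dom C f = p a" "Cod C f = p b" "g \<in> Ar C" "Dom C g = p b" "Cod C g = p c"
    "f' \<in> Ar C" "Dom C f' = p a'" "Cod C f' = p b'" "g' \<in> Ar C" "Dom C g' = p b'" "Cod C g' = p c'"
  shows "ten b c b' c' g g' \<cdot> ten a b a' b' f f' = ten a c a' c' (g \<cdot> f) (g' \<cdot> f')"
  using assms by (simp add: ten_def cassoc Tar_Cmp_right)

lemma br_typing [simp]: "isom C (br a b)" "Dom C (br a b) = p (a + b)" "Cod C (br a b) = p (b + a)"
  by (simp_all add: br_def)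

lemma br_Ar [simp]: "br a b \<in> Ar C" by (rule isom_Ar[OF br_typing(1)])

lemma br_can: "br a b \<cdot> can a b = can b a \<cdot> Braid C (p a) (p b)"
  by (simp add: br_def cassoc)

lemma ten_cancel:
  assumes "f \<in> Ar C" "g \<in> Ar C" "Dom C f = p (a + b)" "Dom C g = p (a + b)" "f \<cdot> can a b = g \<cdot> can a b"
  shows "f = g"
  using assms(5) by (rule iso_cancel_right[of "can a b", rotated 5]) (use assms in auto)

text \<open>Both sides are compared after the isomorphism out of the left-bracketed product, where
  \<open>can_assoc\<close> trades one bracketing for the other around the naturality of the
  associator.\<close>

lemma ten_assoc:
  assumes f: "f \<in> Ar C" "Dom C f = p a" "Cod C f = p b" and g: "g \<in> Ar C" "Dom C g = p a'" "Cod C g = p b'"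
    and h: "h \<in> Ar C" "Dom C h = p a''" "Cod C h = p b''"
  shows "ten (a + a') (b + b') a'' b'' (ten a b a' b' f g) h = ten a b (a' + a'') (b' + b'') f (ten a' b' a'' b'' g h)"
proof (rule iso_cancel_right[of "can (a + a') a'' \<cdot> (can a a' \<star> Id C (p a''))"])
  let ?I = "Id C" and ?\<alpha> = "Assoc C (p a) (p a') (p a'')"
  note [simp] = f g h
  have "ten (a + a') (b + b') a'' b'' (ten a b a' b' f g) h \<cdot> (can (a + a') a'' \<cdot> (can a a' \<star> ?I (p a''))) =
      can (b + b') b'' \<cdot> ((ten a b a' b' f g \<star> h) \<cdot> (can a a' \<star> ?I (p a'')))"
    using extend_right[OF ten_can[of "ten a b a' b' f g" "a + a'" "b + b'" h a'' b'']] by (simp add: cassoc)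
  also have "\<dots> = can (b + b') b'' \<cdot> ((can b b' \<star> ?I (p b'')) \<cdot> ((f \<star> g) \<star> h))"
    by (simp add: Tar_Cmp ten_can)
  also have "\<dots> = can b (b' + b'') \<cdot> ((?I (p b) \<star> can b' b'') \<cdot> (Assoc C (p b) (p b') (p b'') \<cdot> ((f \<star> g) \<star> h)))"
    using extend_right[OF can_assoc[of b b' b'', symmetric]] by (simp add: cassoc add.assoc)
  also have "\<dots> = can b (b' + b'') \<cdot> ((?I (p b) \<star> can b' b'') \<cdot> ((f \<star> (g \<star> h)) \<cdot> ?\<alpha>))"
    using Assoc_nat[of f g h] by simp
  also have "\<dots> = can b (b' + b'') \<cdot> ((f \<star> (ten a' b' a'' b'' g h \<cdot> can a' a'')) \<cdot> ?\<alpha>)"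
    by (simp add: Tar_Cmp_right ten_can)
  also have "\<dots> = can b (b' + b'') \<cdot> ((f \<star> ten a' b' a'' b'' g h) \<cdot> ((?I (p a) \<star> can a' a'') \<cdot> ?\<alpha>))"
    by (simp add: Tar_Cmp_right)
  also have "\<dots> = ten a b (a' + a'') (b' + b'') f (ten a' b' a'' b'' g h) \<cdot>
      (can a (a' + a'') \<cdot> ((?I (p a) \<star> can a' a'') \<cdot> ?\<alpha>))"
    using extend_right[OF ten_can[of f a b "ten a' b' a'' b'' g h" "a' + a''" "b' + b''"]] by (simp add: cassoc add.assoc)
  also have "can a (a' + a'') \<cdot> ((?I (p a) \<star> can a' a'') \<cdot> ?\<alpha>) = can (a + a') a'' \<cdot> (can a a' \<star> ?I (p a''))"
    by (rule can_assoc)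
  finally show "ten (a + a') (b + b') a'' b'' (ten a b a' b' f g) h \<cdot> (can (a + a') a'' \<cdot> (can a a' \<star> ?I (p a''))) =
      ten a b (a' + a'') (b' + b'') f (ten a' b' a'' b'' g h) \<cdot> (can (a + a') a'' \<cdot> (can a a' \<star> ?I (p a'')))" .
qed (use f g h in \<open>simp_all add: add.assoc\<close>)

lemma ten_unit_left:
  assumes f [simp]: "f \<in> Ar C" "Dom C f = p a" "Cod C f = p b"
  shows "ten 0 0 a b (Id C (p 0)) f = f"
proof (rule iso_cancel_right[of "can 0 a \<cdot> (u \<star> Id C (p a))"])
  have "ten 0 0 a b (Id C (p 0)) f \<cdot> (can 0 a \<cdot> (u \<star> Id C (p a))) = can 0 b \<cdot> ((Id C (p 0) \<star> f) \<cdot> (u \<star> Id C (p a)))"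
    using extend_right[OF ten_can[of "Id C (p 0)" 0 0 f a b]] by (simp add: cassoc)
  also have "\<dots> = can 0 b \<cdot> ((u \<star> Id C (p b)) \<cdot> (Id C (Unit C) \<star> f))" by (simp add: Tar_Cmp)
  also have "\<dots> = LUnit C (p b) \<cdot> (Id C (Unit C) \<star> f)"
    using extend_right[OF can_unit_left[of b]] by simp
  also have "\<dots> = f \<cdot> (can 0 a \<cdot> (u \<star> Id C (p a)))" using LUnit_nat[of f] can_unit_left by simp
  finally show "ten 0 0 a b (Id C (p 0)) f \<cdot> (can 0 a \<cdot> (u \<star> Id C (p a))) = f \<cdot> (can 0 a \<cdot> (u \<star> Id C (p a)))" .
qed simp_all

lemma ten_unit_right:
  assumes f [simp]: "f \<in> Ar C" "Dom C f = p a" "Cod C f = p b"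
  shows "ten a b 0 0 f (Id C (p 0)) = f"
proof (rule iso_cancel_right[of "can a 0 \<cdot> (Id C (p a) \<star> u)"])
  have "ten a b 0 0 f (Id C (p 0)) \<cdot> (can a 0 \<cdot> (Id C (p a) \<star> u)) = can b 0 \<cdot> ((f \<star> Id C (p 0)) \<cdot> (Id C (p a) \<star> u))"
    using extend_right[OF ten_can[of f a b "Id C (p 0)" 0 0]] by (simp add: cassoc)
  also have "\<dots> = can b 0 \<cdot> ((Id C (p b) \<star> u) \<cdot> (f \<star> Id C (Unit C)))" by (simp add: Tar_Cmp)
  also have "\<dots> = RUnit C (p b) \<cdot> (f \<star> Id C (Unit C))"
    using extend_right[OF can_unit_right[of b]] by simp
  also have "\<dots> = f \<cdot> (can a 0 \<cdot> (Id C (p a) \<star> u))" using RUnit_nat[of f] can_unit_right by simp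
  finally show "ten a b 0 0 f (Id C (p 0)) \<cdot> (can a 0 \<cdot> (Id C (p a) \<star> u)) = f \<cdot> (can a 0 \<cdot> (Id C (p a) \<star> u))" .
qed simp_all

lemma br_nat:
  assumes f [simp]: "f \<in> Ar C" "Dom C f = p a" "Cod C f = p b" and g [simp]: "g \<in> Ar C" "Dom C g = p a'" "Cod C g = p b'"
  shows "br b b' \<cdot> ten a b a' b' f g = ten a' b' a b g f \<cdot> br a a'"
proof (rule ten_cancel[of _ _ a a'])
  have "(br b b' \<cdot> ten a b a' b' f g) \<cdot> can a a' = br b b' \<cdot> (can b b' \<cdot> (f \<star> g))"
    by (simp add: cassoc ten_can)
  also have "\<dots> = can b' b \<cdot> (Braid C (p b) (p b') \<cdot> (f \<star> g))"
    using extend_right[OF br_can[of b b']] by (simp add: cassoc)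
  also have "Braid C (p b) (p b') \<cdot> (f \<star> g) = (g \<star> f) \<cdot> Braid C (p a) (p a')"
    using Braid_nat[of f g] by simp
  also have "can b' b \<cdot> \<dots> = ten a' b' a b g f \<cdot> (can a' a \<cdot> Braid C (p a) (p a'))"
    using extend_right[OF ten_can[of g a' b' f a b]] by (simp add: cassoc)
  also have "\<dots> = (ten a' b' a b g f \<cdot> br a a') \<cdot> can a a'" by (simp add: cassoc br_can)
  finally show "(br b b' \<cdot> ten a b a' b' f g) \<cdot> can a a' = (ten a' b' a b g f \<cdot> br a a') \<cdot> can a a'" .
qed simp_all

text \<open>The first hexagon conjugated by the coherence isomorphisms, compared on the bracketing
  \<open>(p a \<odot> p b) \<odot> p c\<close>.\<close>

lemma br_add_right:
  "br a (b + c) = ten b b (a + c) (c + a) (Id C (p b)) (br a c) \<cdot> ten (a + b) (b + a) c c (br a b) (Id C (p c))"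
proof (rule iso_cancel_right[of "can (a + b) c \<cdot> (can a b \<star> Id C (p c))"])
  let ?I = "Id C" and ?B = "\<lambda>a b. Braid C (p a) (p b)" and ?\<alpha> = "\<lambda>a b c. Assoc C (p a) (p b) (p c)"
  let ?t1 = "ten b b (a + c) (c + a) (?I (p b)) (br a c)" and ?t2 = "ten (a + b) (b + a) c c (br a b) (?I (p c))"
  have "(?t1 \<cdot> ?t2) \<cdot> (can (a + b) c \<cdot> (can a b \<star> ?I (p c))) =
      ?t1 \<cdot> (can (b + a) c \<cdot> ((br a b \<star> ?I (p c)) \<cdot> (can a b \<star> ?I (p c))))"
    using extend_right[OF ten_can[of "br a b" "a + b" "b + a" "?I (p c)" c c]] by (simp add: cassoc add.assoc)
  also have "\<dots> = ?t1 \<cdot> ((can (b + a) c \<cdot> (can b a \<star> ?I (p c))) \<cdot> (?B a b \<star> ?I (p c)))"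
    by (simp add: Tar_Cmp br_can cassoc)
  also have "\<dots> = ?t1 \<cdot> (can b (a + c) \<cdot> ((?I (p b) \<star> can a c) \<cdot> (?\<alpha> b a c \<cdot> (?B a b \<star> ?I (p c)))))"
    unfolding can_assoc[symmetric] by (simp add: cassoc)
  also have "\<dots> = can b (c + a) \<cdot> ((?I (p b) \<star> br a c) \<cdot> ((?I (p b) \<star> can a c) \<cdot> (?\<alpha> b a c \<cdot> (?B a b \<star> ?I (p c)))))"
    using extend_right[OF ten_can[of "?I (p b)" b b "br a c" "a + c" "c + a"]] by (simp add: cassoc)
  also have "\<dots> = can b (c + a) \<cdot> ((?I (p b) \<star> can c a) \<cdot> ((?I (p b) \<star> ?B a c) \<cdot> (?\<alpha> b a c \<cdot> (?B a b \<star> ?I (p c)))))"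
    by (simp add: Tar_Cmp_right br_can)
  also have "(?I (p b) \<star> ?B a c) \<cdot> (?\<alpha> b a c \<cdot> (?B a b \<star> ?I (p c))) =
      ?\<alpha> b c a \<cdot> (Braid C (p a) (p b \<odot> p c) \<cdot> ?\<alpha> a b c)"
    using hexagon1[of "p a" "p b" "p c"] by (simp add: cassoc)
  also have "can b (c + a) \<cdot> ((?I (p b) \<star> can c a) \<cdot> (?\<alpha> b c a \<cdot> (Braid C (p a) (p b \<odot> p c) \<cdot> ?\<alpha> a b c))) =
      (can b (c + a) \<cdot> ((?I (p b) \<star> can c a) \<cdot> ?\<alpha> b c a)) \<cdot> (Braid C (p a) (p b \<odot> p c) \<cdot> ?\<alpha> a b c)"
    by (simp add: cassoc)
  also have "\<dots> = can (b + c) a \<cdot> (((can b c \<star> ?I (p a)) \<cdot> Braid C (p a) (p b \<odot> p c)) \<cdot> ?\<alpha> a b c)"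
    unfolding can_assoc by (simp add: cassoc)
  also have "(can b c \<star> ?I (p a)) \<cdot> Braid C (p a) (p b \<odot> p c) = ?B a (b + c) \<cdot> (?I (p a) \<star> can b c)"
    using Braid_nat[of "?I (p a)" "can b c"] by simp
  also have "can (b + c) a \<cdot> ((?B a (b + c) \<cdot> (?I (p a) \<star> can b c)) \<cdot> ?\<alpha> a b c) =
      br a (b + c) \<cdot> (can a (b + c) \<cdot> ((?I (p a) \<star> can b c) \<cdot> ?\<alpha> a b c))"
    using extend_right[OF br_can[of a "b + c"]] by (simp add: cassoc)
  also have "\<dots> = br a (b + c) \<cdot> (can (a + b) c \<cdot> (can a b \<star> ?I (p c)))"
    unfolding can_assoc ..
  finally show "br a (b + c) \<cdot> (can (a + b) c \<cdot> (can a b \<star> ?I (p c))) =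
      (?t1 \<cdot> ?t2) \<cdot> (can (a + b) c \<cdot> (can a b \<star> ?I (p c)))" by (rule HOL.sym)
qed (simp_all add: ac_simps)

text \<open>The second hexagon in the same manner, now on the bracketing
  \<open>p a \<odot> (p b \<odot> p c)\<close>, because it is stated with inverse
  associators.\<close>

lemma br_add_left:
  "br (a + b) c = ten (a + c) (c + a) b b (br a c) (Id C (p b)) \<cdot> ten a a (b + c) (c + b) (Id C (p a)) (br b c)"
proof (rule iso_cancel_right[of "can a (b + c) \<cdot> (Id C (p a) \<star> can b c)"])
  let ?I = "Id C" and ?B = "\<lambda>a b. Braid C (p a) (p b)" and ?\<alpha> = "\<lambda>a b c. Assoc C (p a) (p b) (p c)"
  let ?t1 = "ten (a + c) (c + a) b b (br a c) (?I (p b))" and ?t2 = "ten a a (b + c) (c + b) (?I (p a)) (br b c)"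
  have swap: "can a (b + c) \<cdot> (?I (p a) \<star> can b c) =
      (can (a + b) c \<cdot> (can a b \<star> ?I (p c))) \<cdot> inv_ar C (?\<alpha> a b c)" for a b c
    unfolding can_assoc[symmetric] by (simp add: cassoc)
  have "(?t1 \<cdot> ?t2) \<cdot> (can a (b + c) \<cdot> (?I (p a) \<star> can b c)) =
      ?t1 \<cdot> (can a (c + b) \<cdot> ((?I (p a) \<star> br b c) \<cdot> (?I (p a) \<star> can b c)))"
    using extend_right[OF ten_can[of "?I (p a)" a a "br b c" "b + c" "c + b"]] by (simp add: cassoc add.assoc)
  also have "\<dots> = ?t1 \<cdot> ((can a (c + b) \<cdot> (?I (p a) \<star> can c b)) \<cdot> (?I (p a) \<star> ?B b c))"
    by (simp add: Tar_Cmp br_can cassoc)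
  also have "\<dots> = ?t1 \<cdot> (can (a + c) b \<cdot> ((can a c \<star> ?I (p b)) \<cdot> (inv_ar C (?\<alpha> a c b) \<cdot> (?I (p a) \<star> ?B b c))))"
    unfolding swap by (simp add: cassoc add.assoc)
  also have "\<dots> = can (c + a) b \<cdot> ((br a c \<star> ?I (p b)) \<cdot> ((can a c \<star> ?I (p b)) \<cdot> (inv_ar C (?\<alpha> a c b) \<cdot> (?I (p a) \<star> ?B b c))))"
    using extend_right[OF ten_can[of "br a c" "a + c" "c + a" "?I (p b)" b b]] by (simp add: cassoc)
  also have "\<dots> = can (c + a) b \<cdot> ((can c a \<star> ?I (p b)) \<cdot> ((?B a c \<star> ?I (p b)) \<cdot> (inv_ar C (?\<alpha> a c b) \<cdot> (?I (p a) \<star> ?B b c))))"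
    by (simp add: Tar_Cmp_right br_can)
  also have "(?B a c \<star> ?I (p b)) \<cdot> (inv_ar C (?\<alpha> a c b) \<cdot> (?I (p a) \<star> ?B b c)) =
      inv_ar C (?\<alpha> c a b) \<cdot> (Braid C (p a \<odot> p b) (p c) \<cdot> inv_ar C (?\<alpha> a b c))"
    using hexagon2[of "p a" "p b" "p c"] by (simp add: cassoc)
  also have "can (c + a) b \<cdot> ((can c a \<star> ?I (p b)) \<cdot> (inv_ar C (?\<alpha> c a b) \<cdot> (Braid C (p a \<odot> p b) (p c) \<cdot> inv_ar C (?\<alpha> a b c)))) =
      ((can (c + a) b \<cdot> (can c a \<star> ?I (p b))) \<cdot> inv_ar C (?\<alpha> c a b)) \<cdot> (Braid C (p a \<odot> p b) (p c) \<cdot> inv_ar C (?\<alpha> a b c))"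
    by (simp add: cassoc)
  also have "\<dots> = can c (a + b) \<cdot> (((?I (p c) \<star> can a b) \<cdot> Braid C (p a \<odot> p b) (p c)) \<cdot> inv_ar C (?\<alpha> a b c))"
    unfolding swap[symmetric] by (simp add: cassoc)
  also have "(?I (p c) \<star> can a b) \<cdot> Braid C (p a \<odot> p b) (p c) = ?B (a + b) c \<cdot> (can a b \<star> ?I (p c))"
    using Braid_nat[of "can a b" "?I (p c)"] by simp
  also have "can c (a + b) \<cdot> ((?B (a + b) c \<cdot> (can a b \<star> ?I (p c))) \<cdot> inv_ar C (?\<alpha> a b c)) =
      br (a + b) c \<cdot> ((can (a + b) c \<cdot> (can a b \<star> ?I (p c))) \<cdot> inv_ar C (?\<alpha> a b c))"
    using extend_right[OF br_can[of "a + b" c]] by (simp add: cassoc)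
  also have "\<dots> = br (a + b) c \<cdot> (can a (b + c) \<cdot> (?I (p a) \<star> can b c))"
    unfolding swap ..
  finally show "br (a + b) c \<cdot> (can a (b + c) \<cdot> (?I (p a) \<star> can b c)) =
      (?t1 \<cdot> ?t2) \<cdot> (can a (b + c) \<cdot> (?I (p a) \<star> can b c))" by (rule HOL.sym)
qed (simp_all add: ac_simps)

text \<open>Arrows are tagged with their indices, again because \<open>p\<close> need not be
  injective. Associators and unitors are identities here: \<open>ten\<close> and \<open>br\<close>
  have absorbed the bracketings.\<close>

definition fam_cat :: "(nat, nat \<times> nat \<times> 'm) bmoncat" where
  "fam_cat = \<lparr>Ob = UNIV, Ar = {(n, m, f). f \<in> hom_set C (p n) (p m)},
     Dom = (\<lambda>(n, m, f). n), Cod = (\<lambda>(n, m, f). m), Id = (\<lambda>n. (n, n, Id C (p n))),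
     Cmp = (\<lambda>(m, l, g) (n, _, f). (n, l, g \<cdot> f)),
     Tob = (+), Tar = (\<lambda>(n, m, f) (n', m', f'). (n + n', m + m', ten n m n' m' f f')), Unit = 0,
     Assoc = (\<lambda>a b c. (a + b + c, a + b + c, Id C (p (a + b + c)))),
     LUnit = (\<lambda>n. (n, n, Id C (p n))), RUnit = (\<lambda>n. (n, n, Id C (p n))),
     Braid = (\<lambda>a b. (a + b, b + a, br a b))\<rparr>"

lemma fam_cat_simps [simp]:
  "Ob fam_cat = UNIV" "(n, m, f) \<in> Ar fam_cat \<longleftrightarrow> f \<in> Ar C \<and> Dom C f = p n \<and> Cod C f = p m"
  "Dom fam_cat (n, m, f) = n" "Cod fam_cat (n, m, f) = m" "Id fam_cat n = (n, n, Id C (p n))"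
  "(m', l, g) \<cdot>\<^bsub>fam_cat\<^esub> (n, m, f) = (n, l, g \<cdot> f)"
  "(n, m, f) \<star>\<^bsub>fam_cat\<^esub> (n', m', f') = (n + n', m + m', ten n m n' m' f f')"
  "Braid fam_cat a b = (a + b, b + a, br a b)"
  by (auto simp: fam_cat_def in_hom_set)

lemma fam_cat_ArE:
  assumes "t \<in> Ar fam_cat"
  obtains n m f where "t = (n, m, f)" "f \<in> Ar C" "Dom C f = p n" "Cod C f = p m"
  using assms by (cases t) auto

lemma prob_fam_cat: "prob fam_cat"
proof -
  interpret F: category fam_cat
    by unfold_locales (auto simp: in_hom_set cassoc elim!: fam_cat_ArE)
  show ?thesis
  proof (unfold_locales, goal_cases)
    case (10 a b)
    have "inverse_arrows fam_cat (a + b, b + a, br a b) (b + a, a + b, inv_ar C (br a b))"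
      by (intro F.inverse_arrowsI) simp_all
    then show ?case by (auto intro: F.isomI)
  next
    case (13 f g) then show ?case by (auto elim!: fam_cat_ArE simp: br_nat)
  next
    case (14 a b c) show ?case using br_add_right[of a b c] by (simp add: add.assoc)
  next
    case (15 a b c) show ?case using br_add_left[of a b c] by (simp add: add.assoc)
  next
    case (7 f g h) then show ?case by (auto elim!: fam_cat_ArE simp: ten_assoc add.assoc)
  qed (auto elim!: fam_cat_ArE simp: ten_Id ten_Cmp ten_unit_left ten_unit_right)
qed

text \<open>A strict monoid on the object \<open>1\<close> has its multiplication on
  \<open>p 2\<close>, a monoid in \<open>C\<close> on \<open>p 1 \<odot> p 1\<close>. The
  isomorphism \<open>can 1 1\<close> mediates between the two, and \<open>u\<close> does so for the
  units in the lemmas that follow.\<close>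

lemma monoid_assoc_iff:
  assumes m [simp]: "m \<in> Ar C" "Dom C m = p 2" "Cod C m = p 1"
  defines "\<mu> \<equiv> m \<cdot> can 1 1"
  shows "\<mu> \<cdot> (\<mu> \<star> Id C (p 1)) = \<mu> \<cdot> ((Id C (p 1) \<star> \<mu>) \<cdot> Assoc C (p 1) (p 1) (p 1)) \<longleftrightarrow>
    m \<cdot> ten 2 1 1 1 m (Id C (p 1)) = m \<cdot> ten 1 1 2 1 (Id C (p 1)) m"
proof -
  let ?I = "Id C (p 1)" and ?K = "can 2 1 \<cdot> (can 1 1 \<star> Id C (p 1))"
  have c [simp]: "Cod C (can 1 1) = p 2" using Cod_can[of 1 1] by simp
  have c3 [simp]: "Cod C (can 2 1) = p 3" "Cod C (can 1 2) = p 3" using Cod_can[of 2 1] Cod_can[of 1 2] by simp_all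
  have t [simp]: "ten 2 1 1 1 m ?I \<in> Ar C" "Dom C (ten 2 1 1 1 m ?I) = p 3" "Cod C (ten 2 1 1 1 m ?I) = p 2"
      "ten 1 1 2 1 ?I m \<in> Ar C" "Dom C (ten 1 1 2 1 ?I m) = p 3" "Cod C (ten 1 1 2 1 ?I m) = p 2"
    using ten_typing[of m 2 1 ?I 1 1] ten_typing[of ?I 1 1 m 2 1] by simp_all
  have K: "can 1 2 \<cdot> ((?I \<star> can 1 1) \<cdot> Assoc C (p 1) (p 1) (p 1)) = ?K"
    using can_assoc[of 1 1 1] by simp
  have "\<mu> \<cdot> (\<mu> \<star> ?I) = m \<cdot> (can 1 1 \<cdot> ((m \<star> ?I) \<cdot> (can 1 1 \<star> ?I)))"
    by (simp add: \<mu>_def cassoc Tar_Cmp)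
  also have "\<dots> = (m \<cdot> ten 2 1 1 1 m ?I) \<cdot> ?K"
    using extend_right[OF ten_can[of m 2 1 ?I 1 1, symmetric]] by (simp add: cassoc)
  finally have L: "\<mu> \<cdot> (\<mu> \<star> ?I) = (m \<cdot> ten 2 1 1 1 m ?I) \<cdot> ?K" .
  have "\<mu> \<cdot> ((?I \<star> \<mu>) \<cdot> Assoc C (p 1) (p 1) (p 1)) = m \<cdot> (can 1 1 \<cdot> ((?I \<star> m) \<cdot> ((?I \<star> can 1 1) \<cdot> Assoc C (p 1) (p 1) (p 1))))"
    by (simp add: \<mu>_def cassoc Tar_Cmp_right)
  also have "\<dots> = (m \<cdot> ten 1 1 2 1 ?I m) \<cdot> (can 1 2 \<cdot> ((?I \<star> can 1 1) \<cdot> Assoc C (p 1) (p 1) (p 1)))"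
    using extend_right[OF ten_can[of ?I 1 1 m 2 1, symmetric]] by (simp add: cassoc)
  finally have R: "\<mu> \<cdot> ((?I \<star> \<mu>) \<cdot> Assoc C (p 1) (p 1) (p 1)) = (m \<cdot> ten 1 1 2 1 ?I m) \<cdot> ?K" unfolding K .
  show ?thesis unfolding L R
    using iso_cancel_right[of ?K "m \<cdot> ten 2 1 1 1 m ?I" "m \<cdot> ten 1 1 2 1 ?I m"] by auto
qed

lemma monoid_unit_left_iff:
  assumes m [simp]: "m \<in> Ar C" "Dom C m = p 2" "Cod C m = p 1" and e [simp]: "e \<in> Ar C" "Dom C e = p 0" "Cod C e = p 1"
  shows "(m \<cdot> can 1 1) \<cdot> ((e \<cdot> u) \<star> Id C (p 1)) = LUnit C (p 1) \<longleftrightarrow> m \<cdot> ten 0 1 1 1 e (Id C (p 1)) = Id C (p 1)"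
proof -
  let ?I = "Id C (p 1)"
  have c [simp]: "Cod C (can 1 1) = p 2" "Cod C (can 0 1) = p 1" using Cod_can[of 1 1] Cod_can[of 0 1] by simp_all
  have t [simp]: "ten 0 1 1 1 e ?I \<in> Ar C" "Dom C (ten 0 1 1 1 e ?I) = p 1" "Cod C (ten 0 1 1 1 e ?I) = p 2"
    using ten_typing[of e 0 1 ?I 1 1] by simp_all
  have "(m \<cdot> can 1 1) \<cdot> ((e \<cdot> u) \<star> ?I) = m \<cdot> (can 1 1 \<cdot> ((e \<star> ?I) \<cdot> (u \<star> ?I)))"
    by (simp add: cassoc Tar_Cmp)
  also have "\<dots> = (m \<cdot> ten 0 1 1 1 e ?I) \<cdot> (can 0 1 \<cdot> (u \<star> ?I))"
    using extend_right[OF ten_can[of e 0 1 ?I 1 1, symmetric]] by (simp add: cassoc)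
  finally have "(m \<cdot> can 1 1) \<cdot> ((e \<cdot> u) \<star> ?I) = (m \<cdot> ten 0 1 1 1 e ?I) \<cdot> LUnit C (p 1)"
    unfolding can_unit_left .
  then show ?thesis
    using iso_cancel_right[of "LUnit C (p 1)" "m \<cdot> ten 0 1 1 1 e ?I" ?I] by auto
qed

lemma monoid_unit_right_iff:
  assumes m [simp]: "m \<in> Ar C" "Dom C m = p 2" "Cod C m = p 1" and e [simp]: "e \<in> Ar C" "Dom C e = p 0" "Cod C e = p 1"
  shows "(m \<cdot> can 1 1) \<cdot> (Id C (p 1) \<star> (e \<cdot> u)) = RUnit C (p 1) \<longleftrightarrow> m \<cdot> ten 1 1 0 1 (Id C (p 1)) e = Id C (p 1)"
proof -
  let ?I = "Id C (p 1)"
  have c [simp]: "Cod C (can 1 1) = p 2" "Cod C (can 1 0) = p 1" using Cod_can[of 1 1] Cod_can[of 1 0] by simp_all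
  have t [simp]: "ten 1 1 0 1 ?I e \<in> Ar C" "Dom C (ten 1 1 0 1 ?I e) = p 1" "Cod C (ten 1 1 0 1 ?I e) = p 2"
    using ten_typing[of ?I 1 1 e 0 1] by simp_all
  have "(m \<cdot> can 1 1) \<cdot> (?I \<star> (e \<cdot> u)) = m \<cdot> (can 1 1 \<cdot> ((?I \<star> e) \<cdot> (?I \<star> u)))"
    by (simp add: cassoc Tar_Cmp)
  also have "\<dots> = (m \<cdot> ten 1 1 0 1 ?I e) \<cdot> (can 1 0 \<cdot> (?I \<star> u))"
    using extend_right[OF ten_can[of ?I 1 1 e 0 1, symmetric]] by (simp add: cassoc)
  finally have "(m \<cdot> can 1 1) \<cdot> (?I \<star> (e \<cdot> u)) = (m \<cdot> ten 1 1 0 1 ?I e) \<cdot> RUnit C (p 1)"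
    unfolding can_unit_right .
  then show ?thesis
    using iso_cancel_right[of "RUnit C (p 1)" "m \<cdot> ten 1 1 0 1 ?I e" ?I] by auto
qed

lemma monoid_hom_iff:
  assumes m [simp]: "m \<in> Ar C" "Dom C m = p 2" "Cod C m = p 1" and r [simp]: "r \<in> Ar C" "Dom C r = p 1" "Cod C r = p 1"
  shows "r \<cdot> (m \<cdot> can 1 1) = (m \<cdot> can 1 1) \<cdot> (r \<star> r) \<longleftrightarrow> r \<cdot> m = m \<cdot> ten 1 1 1 1 r r"
proof -
  have c [simp]: "Cod C (can 1 1) = p 2" using Cod_can[of 1 1] by simp
  have t [simp]: "ten 1 1 1 1 r r \<in> Ar C" "Dom C (ten 1 1 1 1 r r) = p 2" "Cod C (ten 1 1 1 1 r r) = p 2"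
    using ten_typing[of r 1 1 r 1 1] by simp_all
  have "(m \<cdot> can 1 1) \<cdot> (r \<star> r) = (m \<cdot> ten 1 1 1 1 r r) \<cdot> can 1 1"
    using ten_can[of r 1 1 r 1 1] by (simp add: cassoc)
  moreover have "r \<cdot> (m \<cdot> can 1 1) = (r \<cdot> m) \<cdot> can 1 1" by (simp add: cassoc)
  ultimately show ?thesis
    using iso_cancel_right[of "can 1 1" "r \<cdot> m" "m \<cdot> ten 1 1 1 1 r r"] by auto
qed

lemma unit_hom_iff:
  assumes "e \<in> Ar C" "Dom C e = p 0" "Cod C e = p 1" "r \<in> Ar C" "Dom C r = p 1" "Cod C r = p 1"
  shows "r \<cdot> (e \<cdot> u) = e \<cdot> u \<longleftrightarrow> r \<cdot> e = e"
proof -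
  have "r \<cdot> (e \<cdot> u) = (r \<cdot> e) \<cdot> u" using assms by (simp add: cassoc)
  then show ?thesis using assms iso_cancel_right[of u "r \<cdot> e" e] by auto
qed

end

subsection \<open>Tensor powers\<close>

context monoidal_category
begin

text \<open>Starting from the unit makes \<open>pow_can\<close> definable from right unitors and
  associators, at the price that \<open>pow x 1\<close> is \<open>Unit C \<odot> x\<close> instead
  of \<open>x\<close>.\<close>

primrec pow :: "'o \<Rightarrow> nat \<Rightarrow> 'o" where
  "pow x 0 = Unit C"
| "pow x (Suc n) = pow x n \<odot> x"

primrec pow_can :: "'o \<Rightarrow> nat \<Rightarrow> nat \<Rightarrow> 'm" where
  "pow_can x a 0 = RUnit C (pow x a)"
| "pow_can x a (Suc b) = (pow_can x a b \<star> Id C x) \<cdot> inv_ar C (Assoc C (pow x a) (pow x b) x)"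

lemma pow_Ob [simp]: "x \<in> Ob C \<Longrightarrow> pow x n \<in> Ob C"
  by (induction n) auto

lemma pow_can_typing:
  "x \<in> Ob C \<Longrightarrow> isom C (pow_can x a b) \<and> Dom C (pow_can x a b) = pow x a \<odot> pow x b \<and>
    Cod C (pow_can x a b) = pow x (a + b)"
  by (induction b) auto

lemma pow_can_isom [simp]: "x \<in> Ob C \<Longrightarrow> isom C (pow_can x a b)"
  and Dom_pow_can [simp]: "x \<in> Ob C \<Longrightarrow> Dom C (pow_can x a b) = pow x a \<odot> pow x b"
  and Cod_pow_can [simp]: "x \<in> Ob C \<Longrightarrow> Cod C (pow_can x a b) = pow x (a + b)"
  using pow_can_typing by auto

text \<open>The pentagon rearranged for the inverse associators that occur in
  \<open>pow_can\<close>.\<close>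

lemma pentagon_inv:
  assumes [simp]: "a \<in> Ob C" "b \<in> Ob C" "c \<in> Ob C" "d \<in> Ob C"
  shows "inv_ar C (Assoc C a (b \<odot> c) d) \<cdot> ((Id C a \<star> inv_ar C (Assoc C b c d)) \<cdot> Assoc C a b (c \<odot> d)) =
    (Assoc C a b c \<star> Id C d) \<cdot> inv_ar C (Assoc C (a \<odot> b) c d)"
proof (rule iso_cancel_right[of "Assoc C (a \<odot> b) c d"])
  have "(inv_ar C (Assoc C a (b \<odot> c) d) \<cdot> ((Id C a \<star> inv_ar C (Assoc C b c d)) \<cdot> Assoc C a b (c \<odot> d))) \<cdot> Assoc C (a \<odot> b) c d =
      inv_ar C (Assoc C a (b \<odot> c) d) \<cdot> ((Id C a \<star> inv_ar C (Assoc C b c d)) \<cdot> (Assoc C a b (c \<odot> d) \<cdot> Assoc C (a \<odot> b) c d))"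
    by (simp add: cassoc)
  also have "Assoc C a b (c \<odot> d) \<cdot> Assoc C (a \<odot> b) c d =
      (Id C a \<star> Assoc C b c d) \<cdot> (Assoc C a (b \<odot> c) d \<cdot> (Assoc C a b c \<star> Id C d))"
    using pentagon[of a b c d] by (simp add: cassoc)
  also have "inv_ar C (Assoc C a (b \<odot> c) d) \<cdot> ((Id C a \<star> inv_ar C (Assoc C b c d)) \<cdot> \<dots>) = Assoc C a b c \<star> Id C d"
    by (simp add: Tar_Cmp_right)
  also have "\<dots> = ((Assoc C a b c \<star> Id C d) \<cdot> inv_ar C (Assoc C (a \<odot> b) c d)) \<cdot> Assoc C (a \<odot> b) c d"
    by (simp add: cassoc)
  finally show "(inv_ar C (Assoc C a (b \<odot> c) d) \<cdot> ((Id C a \<star> inv_ar C (Assoc C b c d)) \<cdot> Assoc C a b (c \<odot> d))) \<cdot> Assoc C (a \<odot> b) c d =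
    ((Assoc C a b c \<star> Id C d) \<cdot> inv_ar C (Assoc C (a \<odot> b) c d)) \<cdot> Assoc C (a \<odot> b) c d" .
qed simp_all

lemma Assoc_inv_nat:
  assumes "f \<in> Ar C" "g \<in> Ar C" "h \<in> Ar C"
  shows "inv_ar C (Assoc C (Cod C f) (Cod C g) (Cod C h)) \<cdot> (f \<star> (g \<star> h)) =
    ((f \<star> g) \<star> h) \<cdot> inv_ar C (Assoc C (Dom C f) (Dom C g) (Dom C h))"
  using inv_conjugate[OF _ _ _ _ _ _ _ _ Assoc_nat[OF assms]] assms by simp

text \<open>Induction on the last exponent: \<open>RUnit_Tob\<close> is the base, and each further
  factor \<open>x\<close> uses the pentagon once.\<close>

lemma pow_can_assoc:
  assumes x [simp]: "x \<in> Ob C"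
  shows "pow_can x a (b + c) \<cdot> ((Id C (pow x a) \<star> pow_can x b c) \<cdot> Assoc C (pow x a) (pow x b) (pow x c)) =
    pow_can x (a + b) c \<cdot> (pow_can x a b \<star> Id C (pow x c))"
proof (induction c)
  case 0
  show ?case using RUnit_Tob[of "pow x a" "pow x b"] RUnit_nat[of "pow_can x a b"] by simp
next
  case (Suc c)
  let ?p = "pow x" and ?k = "pow_can x"
  have "?k a (b + Suc c) \<cdot> ((Id C (?p a) \<star> ?k b (Suc c)) \<cdot> Assoc C (?p a) (?p b) (?p (Suc c))) =
      (?k a (b + c) \<star> Id C x) \<cdot> (inv_ar C (Assoc C (?p a) (?p (b + c)) x) \<cdot> ((Id C (?p a) \<star> (?k b c \<star> Id C x)) \<cdot>
        ((Id C (?p a) \<star> inv_ar C (Assoc C (?p b) (?p c) x)) \<cdot> Assoc C (?p a) (?p b) (?p c \<odot> x))))"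
    by (simp add: cassoc Tar_Cmp_right)
  also have "\<dots> = (?k a (b + c) \<star> Id C x) \<cdot> (((Id C (?p a) \<star> ?k b c) \<star> Id C x) \<cdot>
      (inv_ar C (Assoc C (?p a) (?p b \<odot> ?p c) x) \<cdot>
        ((Id C (?p a) \<star> inv_ar C (Assoc C (?p b) (?p c) x)) \<cdot> Assoc C (?p a) (?p b) (?p c \<odot> x))))"
    using extend_right[OF Assoc_inv_nat[of "Id C (?p a)" "?k b c" "Id C x"]] by (simp add: cassoc)
  also have "\<dots> = (?k a (b + c) \<star> Id C x) \<cdot> (((Id C (?p a) \<star> ?k b c) \<star> Id C x) \<cdot>
      ((Assoc C (?p a) (?p b) (?p c) \<star> Id C x) \<cdot> inv_ar C (Assoc C (?p a \<odot> ?p b) (?p c) x)))"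
    by (simp only: pentagon_inv[OF pow_Ob[OF x] pow_Ob[OF x] pow_Ob[OF x] x])
  also have "\<dots> = ((?k a (b + c) \<cdot> ((Id C (?p a) \<star> ?k b c) \<cdot> Assoc C (?p a) (?p b) (?p c))) \<star> Id C x) \<cdot>
      inv_ar C (Assoc C (?p a \<odot> ?p b) (?p c) x)"
    by (simp add: Tar_Cmp_right cassoc)
  also have "\<dots> = ((?k (a + b) c \<cdot> (?k a b \<star> Id C (?p c))) \<star> Id C x) \<cdot> inv_ar C (Assoc C (?p a \<odot> ?p b) (?p c) x)"
    by (simp only: Suc)
  also have "\<dots> = (?k (a + b) c \<star> Id C x) \<cdot> (((?k a b \<star> Id C (?p c)) \<star> Id C x) \<cdot> inv_ar C (Assoc C (?p a \<odot> ?p b) (?p c) x))"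
    by (simp add: Tar_Cmp_right)
  also have "((?k a b \<star> Id C (?p c)) \<star> Id C x) \<cdot> inv_ar C (Assoc C (?p a \<odot> ?p b) (?p c) x) =
      inv_ar C (Assoc C (?p (a + b)) (?p c) x) \<cdot> (?k a b \<star> (Id C (?p c) \<star> Id C x))"
    using Assoc_inv_nat[of "?k a b" "Id C (?p c)" "Id C x"] by simp
  finally show ?case by (simp add: cassoc)
qed

text \<open>The definition of \<open>pow_can\<close> mentions right unitors only;
  \<open>LUnit_Unit\<close> starts the comparison with the left ones and \<open>LUnit_Tob\<close>
  continues it.\<close>

lemma pow_can_unit_left: "x \<in> Ob C \<Longrightarrow> pow_can x 0 a = LUnit C (pow x a)"
proof (induction a)
  case 0
  show ?case using LUnit_Unit by simp
next
  case (Suc a)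
  have "LUnit C (pow x a) \<star> Id C x = LUnit C (pow x a \<odot> x) \<cdot> Assoc C (Unit C) (pow x a) x"
    using LUnit_Tob[of "pow x a" x] Suc by simp
  then show ?case using Suc by (simp add: cassoc)
qed

text \<open>In a strict category the coherence isomorphisms of tensor powers are identities, so the
  construction for arbitrary targets yields a strict functor.\<close>

lemma strict_pow:
  assumes "strict_monoidal C" "x \<in> Ob C"
  shows "pow x (a + b) = pow x a \<odot> pow x b \<and> pow_can x a b = Id C (pow x a \<odot> pow x b)"
proof (induction b)
  case 0
  show ?case using assms by (simp add: strict_monoidal_def)
next
  case (Suc b)
  have "(pow x a \<odot> pow x b) \<odot> x = pow x a \<odot> (pow x b \<odot> x)"
    "Assoc C (pow x a) (pow x b) x = Id C (pow x a \<odot> (pow x b \<odot> x))"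
    using assms pow_Ob[OF assms(2)] unfolding strict_monoidal_def by blast+
  then show ?case using Suc assms by simp
qed

end

lemma coherent_family_pow:
  fixes C :: "('o, 'm) bmoncat" (structure)
  assumes "braided_monoidal_category C" "x \<in> Ob C"
  shows "coherent_family C (monoidal_category.pow C x) (monoidal_category.pow_can C x) (Id C (Unit C))"
proof -
  interpret braided_monoidal_category C by fact
  show ?thesis
    using assms(2) by unfold_locales (simp_all add: pow_can_assoc pow_can_unit_left)
qed

subsection \<open>Transport of monoids\<close>

lemma is_monoid_transport:
  fixes C :: "('o, 'm) bmoncat" (structure)
  assumes "monoidal_category C" and M: "is_monoid C (x, \<mu>, \<eta>)"
    and l: "isom C l" "Dom C l = y" "Cod C l = x"
  shows "is_monoid C (y, inv_ar C l \<cdot> (\<mu> \<cdot> (l \<star> l)), inv_ar C l \<cdot> \<eta>)"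
proof -
  interpret monoidal_category C by fact
  have x [simp]: "x \<in> Ob C" and y [simp]: "y \<in> Ob C"
    and \<mu> [simp]: "\<mu> \<in> Ar C" "Dom C \<mu> = x \<odot> x" "Cod C \<mu> = x"
    and \<eta> [simp]: "\<eta> \<in> Ar C" "Dom C \<eta> = Unit C" "Cod C \<eta> = x"
    and assoc: "\<mu> \<cdot> (\<mu> \<star> Id C x) = \<mu> \<cdot> ((Id C x \<star> \<mu>) \<cdot> Assoc C x x x)"
    and unit: "\<mu> \<cdot> (\<eta> \<star> Id C x) = LUnit C x" "\<mu> \<cdot> (Id C x \<star> \<eta>) = RUnit C x"
    using M l Dom_Ob[of l] by (auto simp: is_monoid_def in_hom_set cassoc)
  note [simp] = l
  have l_Ar [simp]: "l \<in> Ar C" using l by simp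
  let ?l' = "inv_ar C l"
  let ?\<mu> = "?l' \<cdot> (\<mu> \<cdot> (l \<star> l))" and ?\<eta> = "?l' \<cdot> \<eta>"
  have "?\<mu> \<cdot> (?\<mu> \<star> Id C y) = ?l' \<cdot> (\<mu> \<cdot> ((\<mu> \<cdot> (l \<star> l)) \<star> l))"
    by (simp add: cassoc Tar_Cmp)
  also have "\<dots> = ?l' \<cdot> (\<mu> \<cdot> ((\<mu> \<star> Id C x) \<cdot> ((l \<star> l) \<star> l)))" by (simp add: Tar_Cmp)
  also have "\<dots> = ?l' \<cdot> (\<mu> \<cdot> ((Id C x \<star> \<mu>) \<cdot> (Assoc C x x x \<cdot> ((l \<star> l) \<star> l))))"
    using extend_right[OF assoc] by (simp add: cassoc)
  also have "Assoc C x x x \<cdot> ((l \<star> l) \<star> l) = (l \<star> (l \<star> l)) \<cdot> Assoc C y y y"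
    using Assoc_nat[of l l l] by simp
  also have "?l' \<cdot> (\<mu> \<cdot> ((Id C x \<star> \<mu>) \<cdot> ((l \<star> (l \<star> l)) \<cdot> Assoc C y y y))) = ?\<mu> \<cdot> ((Id C y \<star> ?\<mu>) \<cdot> Assoc C y y y)"
    by (simp add: cassoc Tar_Cmp_right)
  finally have 1: "?\<mu> \<cdot> (?\<mu> \<star> Id C y) = ?\<mu> \<cdot> ((Id C y \<star> ?\<mu>) \<cdot> Assoc C y y y)" .
  have "?\<mu> \<cdot> (?\<eta> \<star> Id C y) = ?l' \<cdot> (\<mu> \<cdot> ((\<eta> \<star> Id C x) \<cdot> (Id C (Unit C) \<star> l)))"
    by (simp add: cassoc Tar_Cmp)
  also have "\<dots> = LUnit C y" using extend_right[OF unit(1)] LUnit_nat[of l] by simp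
  finally have 2: "?\<mu> \<cdot> (?\<eta> \<star> Id C y) = LUnit C y" .
  have "?\<mu> \<cdot> (Id C y \<star> ?\<eta>) = ?l' \<cdot> (\<mu> \<cdot> ((Id C x \<star> \<eta>) \<cdot> (l \<star> Id C (Unit C))))"
    by (simp add: cassoc Tar_Cmp)
  also have "\<dots> = RUnit C y" using extend_right[OF unit(2)] RUnit_nat[of l] by simp
  finally have 3: "?\<mu> \<cdot> (Id C y \<star> ?\<eta>) = RUnit C y" .
  show ?thesis
    using 1 2 3 by (simp add: is_monoid_def in_hom_set cassoc)
qed

section \<open>Monoids with group action in coordinates\<close>

definition gmonoid_data :: "('g, 'z) monoid_scheme \<Rightarrow> ('o, 'm) bmoncat \<Rightarrow> 'o \<Rightarrow> 'm \<Rightarrow> 'm \<Rightarrow> ('g \<Rightarrow> 'm) \<Rightarrow> bool" where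
  "gmonoid_data G C x \<mu> \<eta> \<rho> \<longleftrightarrow> is_monoid C (x, \<mu>, \<eta>) \<and>
     (\<forall>g\<in>carrier G. \<rho> g \<in> hom_set C x x \<and> \<rho> g \<cdot>\<^bsub>C\<^esub> \<mu> = \<mu> \<cdot>\<^bsub>C\<^esub> (\<rho> g \<star>\<^bsub>C\<^esub> \<rho> g) \<and> \<rho> g \<cdot>\<^bsub>C\<^esub> \<eta> = \<eta>) \<and>
     \<rho> \<one>\<^bsub>G\<^esub> = Id C x \<and> (\<forall>g\<in>carrier G. \<forall>h\<in>carrier G. \<rho> (g \<otimes>\<^bsub>G\<^esub> h) = \<rho> g \<cdot>\<^bsub>C\<^esub> \<rho> h)"

definition gmonoid_ob :: "('g, 'z) monoid_scheme \<Rightarrow> 'o \<times> 'm \<times> 'm \<Rightarrow> ('g \<Rightarrow> 'm) \<Rightarrow>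
    (unit, 'g, 'o \<times> 'm \<times> 'm, ('o \<times> 'm \<times> 'm) \<times> ('o \<times> 'm \<times> 'm) \<times> 'm) cfunctor" where
  "gmonoid_ob G M \<rho> = \<lparr>omap = \<lambda>_. M, amap = \<lambda>g\<in>carrier G. (M, M, \<rho> g)\<rparr>"

definition gmonoid_hom :: "('g, 'z) monoid_scheme \<Rightarrow> ('o, 'm) bmoncat \<Rightarrow> 'o \<times> 'm \<times> 'm \<Rightarrow> ('g \<Rightarrow> 'm) \<Rightarrow>
    'o \<times> 'm \<times> 'm \<Rightarrow> ('g \<Rightarrow> 'm) \<Rightarrow> 'm \<Rightarrow> bool" where
  "gmonoid_hom G C = (\<lambda>(x, \<mu>, \<eta>) \<rho> (x', \<mu>', \<eta>') \<rho>' f. f \<in> hom_set C x x' \<and>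
     f \<cdot>\<^bsub>C\<^esub> \<mu> = \<mu>' \<cdot>\<^bsub>C\<^esub> (f \<star>\<^bsub>C\<^esub> f) \<and> f \<cdot>\<^bsub>C\<^esub> \<eta> = \<eta>' \<and>
     (\<forall>g\<in>carrier G. f \<cdot>\<^bsub>C\<^esub> \<rho> g = \<rho>' g \<cdot>\<^bsub>C\<^esub> f))"

lemma one_object_category_simps [simp]:
  "Ob (one_object_category G) = {()}" "Ar (one_object_category G) = carrier G"
  "Dom (one_object_category G) g = ()" "Cod (one_object_category G) g = ()"
  "Id (one_object_category G) a = \<one>\<^bsub>G\<^esub>" "g \<cdot>\<^bsub>one_object_category G\<^esub> h = g \<otimes>\<^bsub>G\<^esub> h"
  by (simp_all add: one_object_category_def)

lemma category_one_object: "group G \<Longrightarrow> category (one_object_category G)"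
proof -
  assume "group G"
  then interpret group G .
  show ?thesis by unfold_locales (auto simp: in_hom_set m_assoc)
qed

lemma extensional_unit [simp]: "f \<in> extensional {()}"
  by (auto simp: extensional_def)

lemma Mon_simps:
  "M \<in> Ob (Mon C) \<longleftrightarrow> is_monoid C M"
  "((x, \<mu>, \<eta>), (x', \<mu>', \<eta>'), f) \<in> Ar (Mon C) \<longleftrightarrow> is_monoid C (x, \<mu>, \<eta>) \<and> is_monoid C (x', \<mu>', \<eta>') \<and>
     f \<in> hom_set C x x' \<and> f \<cdot>\<^bsub>C\<^esub> \<mu> = \<mu>' \<cdot>\<^bsub>C\<^esub> (f \<star>\<^bsub>C\<^esub> f) \<and> f \<cdot>\<^bsub>C\<^esub> \<eta> = \<eta>'"
  "Dom (Mon C) (M, M', f) = M" "Cod (Mon C) (M, M', f) = M'" "Id (Mon C) M = (M, M, Id C (fst M))"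
  "(M', M'', g) \<cdot>\<^bsub>Mon C\<^esub> (M, N, f) = (M, M'', g \<cdot>\<^bsub>C\<^esub> f)"
  by (auto simp: Mon_def)

lemma functor_category_simps:
  "Ob (functor_category A B) = {F. is_functor A B F \<and> extensional_functor A F}"
  "(F, F', \<alpha>) \<in> Ar (functor_category A B) \<longleftrightarrow> F \<in> Ob (functor_category A B) \<and> F' \<in> Ob (functor_category A B) \<and>
     \<alpha> \<in> extensional (Ob A) \<and> natural_transformation A B F F' \<alpha>"
  "Dom (functor_category A B) (F, F', \<alpha>) = F" "Cod (functor_category A B) (F, F', \<alpha>) = F'"
  "Id (functor_category A B) F = (F, F, \<lambda>a\<in>Ob A. Id B (omap F a))"
  "(F', F'', \<beta>) \<cdot>\<^bsub>functor_category A B\<^esub> (F, K, \<alpha>) = (F, F'', \<lambda>a\<in>Ob A. \<beta> a \<cdot>\<^bsub>B\<^esub> \<alpha> a)"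
  by (simp_all add: functor_category_def Let_def)

lemma gmonoid_ob_in_GMon:
  assumes "group G"
  shows "gmonoid_ob G (x, \<mu>, \<eta>) \<rho> \<in> Ob (GMon G C) \<longleftrightarrow> gmonoid_data G C x \<mu> \<eta> \<rho>"
proof -
  interpret group G by fact
  show ?thesis
    by (auto simp: GMon_def functor_category_simps is_functor_def extensional_functor_def gmonoid_ob_def
      gmonoid_data_def in_hom_set Mon_simps)
qed

lemma GMon_ObE:
  assumes "H \<in> Ob (GMon G C)" "group G"
  obtains x \<mu> \<eta> \<rho> where "H = gmonoid_ob G (x, \<mu>, \<eta>) \<rho>" "gmonoid_data G C x \<mu> \<eta> \<rho>"
proof -
  have H: "is_functor (one_object_category G) (Mon C) H" "amap H \<in> extensional (carrier G)"
    using assms by (auto simp: GMon_def functor_category_simps extensional_functor_def)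
  obtain x \<mu> \<eta> where M: "omap H () = (x, \<mu>, \<eta>)" by (metis prod_cases3)
  define \<rho> where "\<rho> g = snd (snd (amap H g))" for g
  have "amap H g = ((x, \<mu>, \<eta>), (x, \<mu>, \<eta>), \<rho> g)" if "g \<in> carrier G" for g
  proof -
    have "amap H g \<in> hom_set (Mon C) (x, \<mu>, \<eta>) (x, \<mu>, \<eta>)" using H(1) that M by (auto simp: is_functor_def)
    then show ?thesis by (cases "amap H g") (auto simp: \<rho>_def in_hom_set Mon_simps)
  qed
  then have "amap H = (\<lambda>g\<in>carrier G. ((x, \<mu>, \<eta>), (x, \<mu>, \<eta>), \<rho> g))"
    using H(2) by (intro extensionalityI[OF H(2)]) auto
  moreover have "omap H = (\<lambda>_. (x, \<mu>, \<eta>))" using M by (auto simp: fun_eq_iff)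
  ultimately have "H = gmonoid_ob G (x, \<mu>, \<eta>) \<rho>" by (cases H) (simp add: gmonoid_ob_def)
  then show ?thesis
    using gmonoid_ob_in_GMon[OF assms(2), of x \<mu> \<eta> \<rho> C] assms(1) by (intro that) simp_all
qed

lemma gmonoid_hom_in_GMon:
  assumes "group G" and M: "M = (x, \<mu>, \<eta>)" and M': "M' = (x', \<mu>', \<eta>')"
    and "gmonoid_data G C x \<mu> \<eta> \<rho>" "gmonoid_data G C x' \<mu>' \<eta>' \<rho>'"
  shows "(gmonoid_ob G M \<rho>, gmonoid_ob G M' \<rho>', \<lambda>_. (M, M', f)) \<in> Ar (GMon G C) \<longleftrightarrow> gmonoid_hom G C M \<rho> M' \<rho>' f"
proof -
  have "gmonoid_ob G M \<rho> \<in> Ob (GMon G C)" "gmonoid_ob G M' \<rho>' \<in> Ob (GMon G C)"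
    unfolding M M' using assms(4,5) by (simp_all only: gmonoid_ob_in_GMon[OF assms(1)])
  then have "(gmonoid_ob G M \<rho>, gmonoid_ob G M' \<rho>', \<lambda>_. (M, M', f)) \<in> Ar (GMon G C) \<longleftrightarrow>
      natural_transformation (one_object_category G) (Mon C) (gmonoid_ob G M \<rho>) (gmonoid_ob G M' \<rho>') (\<lambda>_. (M, M', f))"
    by (simp add: GMon_def functor_category_simps(2))
  also have "\<dots> \<longleftrightarrow> gmonoid_hom G C M \<rho> M' \<rho>' f"
    using assms(4,5)
    by (auto simp: natural_transformation_def gmonoid_ob_def gmonoid_hom_def M M' in_hom_set Mon_simps gmonoid_data_def)
  finally show ?thesis .
qed

lemma GMon_ArE:
  assumes "(gmonoid_ob G M \<rho>, gmonoid_ob G M' \<rho>', \<alpha>) \<in> Ar (GMon G C)"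
  obtains f where "\<alpha> = (\<lambda>_. (M, M', f))"
proof -
  have "\<alpha> () \<in> hom_set (Mon C) M M'"
    using assms by (auto simp: GMon_def functor_category_simps natural_transformation_def gmonoid_ob_def)
  then obtain f where "\<alpha> () = (M, M', f)" by (cases "\<alpha> ()") (auto simp: in_hom_set Mon_def)
  then show ?thesis by (intro that[of f]) (auto simp: fun_eq_iff)
qed

lemma GMon_simps:
  "Dom (GMon G C) (H, H', \<alpha>) = H" "Cod (GMon G C) (H, H', \<alpha>) = H'"
  "Id (GMon G C) (gmonoid_ob G M \<rho>) = (gmonoid_ob G M \<rho>, gmonoid_ob G M \<rho>, \<lambda>_. (M, M, Id C (fst M)))"
  "(H', H'', \<lambda>_. (M', M'', g)) \<cdot>\<^bsub>GMon G C\<^esub> (H, K, \<lambda>_. (M, N, f)) = (H, H'', \<lambda>_. (M, M'', g \<cdot>\<^bsub>C\<^esub> f))"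
  by (auto simp: GMon_def functor_category_simps gmonoid_ob_def Mon_simps fun_eq_iff)

lemma category_GMon:
  assumes "group G" "monoidal_category C"
  shows "category (GMon G C)"
  unfolding GMon_def by (intro category_functor_category category_one_object category_Mon assms)

text \<open>Applied to the left unitor, it carries the structure from \<open>x\<close> to
  \<open>pow x 1\<close>, together with mutually inverse homomorphisms.\<close>

lemma gmonoid_data_transport:
  fixes C :: "('o, 'm) bmoncat" (structure)
  assumes "monoidal_category C" and M: "gmonoid_data G C x \<mu> \<eta> \<rho>"
    and l: "isom C l" "Dom C l = y" "Cod C l = x"
  defines "\<mu>' \<equiv> inv_ar C l \<cdot> (\<mu> \<cdot> (l \<star> l))" and "\<eta>' \<equiv> inv_ar C l \<cdot> \<eta>" and "\<rho>' \<equiv> \<lambda>g. inv_ar C l \<cdot> (\<rho> g \<cdot> l)"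
  shows "gmonoid_data G C y \<mu>' \<eta>' \<rho>'"
    and "gmonoid_hom G C (y, \<mu>', \<eta>') \<rho>' (x, \<mu>, \<eta>) \<rho> l"
    and "gmonoid_hom G C (x, \<mu>, \<eta>) \<rho> (y, \<mu>', \<eta>') \<rho>' (inv_ar C l)"
proof -
  interpret monoidal_category C by fact
  note [simp] = l
  have l_Ar [simp]: "l \<in> Ar C" using l by simp
  have x [simp]: "x \<in> Ob C" and \<mu> [simp]: "\<mu> \<in> Ar C" "Dom C \<mu> = x \<odot> x" "Cod C \<mu> = x"
    and \<eta> [simp]: "\<eta> \<in> Ar C" "Dom C \<eta> = Unit C" "Cod C \<eta> = x"
    using M by (auto simp: gmonoid_data_def is_monoid_def in_hom_set)
  have \<rho> [simp]: "\<rho> g \<in> Ar C" "Dom C (\<rho> g) = x" "Cod C (\<rho> g) = x"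
    and \<rho>\<mu>: "\<rho> g \<cdot> \<mu> = \<mu> \<cdot> (\<rho> g \<star> \<rho> g)" and \<rho>\<eta>: "\<rho> g \<cdot> \<eta> = \<eta>" if "g \<in> carrier G" for g
    using M that by (auto simp: gmonoid_data_def in_hom_set)
  have 1: "is_monoid C (y, \<mu>', \<eta>')"
    unfolding \<mu>'_def \<eta>'_def using M l by (intro is_monoid_transport[OF assms(1)]) (auto simp: gmonoid_data_def)
  have 2: "\<rho>' g \<in> hom_set C y y" "\<rho>' g \<cdot> \<mu>' = \<mu>' \<cdot> (\<rho>' g \<star> \<rho>' g)" "\<rho>' g \<cdot> \<eta>' = \<eta>'" if g: "g \<in> carrier G" for g
  proof -
    note [simp] = \<rho>[OF g]
    show "\<rho>' g \<in> hom_set C y y" by (simp add: \<rho>'_def in_hom_set)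
    show "\<rho>' g \<cdot> \<mu>' = \<mu>' \<cdot> (\<rho>' g \<star> \<rho>' g)"
      using extend_right[OF \<rho>\<mu>[OF g]] by (simp add: \<rho>'_def \<mu>'_def cassoc Tar_Cmp)
    show "\<rho>' g \<cdot> \<eta>' = \<eta>'" by (simp add: \<rho>'_def \<eta>'_def cassoc \<rho>\<eta>[OF g])
  qed
  have 3: "\<rho>' \<one>\<^bsub>G\<^esub> = Id C y" using M by (simp add: \<rho>'_def gmonoid_data_def)
  have 4: "\<rho>' (g \<otimes>\<^bsub>G\<^esub> h) = \<rho>' g \<cdot> \<rho>' h" if gh: "g \<in> carrier G" "h \<in> carrier G" for g h
    using M gh \<rho>[OF gh(1)] \<rho>[OF gh(2)] by (simp add: \<rho>'_def gmonoid_data_def cassoc)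
  show "gmonoid_data G C y \<mu>' \<eta>' \<rho>'" using 1 2 3 4 by (simp add: gmonoid_data_def)
  show "gmonoid_hom G C (y, \<mu>', \<eta>') \<rho>' (x, \<mu>, \<eta>) \<rho> l"
    by (simp add: gmonoid_hom_def in_hom_set \<mu>'_def \<eta>'_def \<rho>'_def)
  show "gmonoid_hom G C (x, \<mu>, \<eta>) \<rho> (y, \<mu>', \<eta>') \<rho>' (inv_ar C l)"
    by (simp add: gmonoid_hom_def in_hom_set \<mu>'_def \<eta>'_def \<rho>'_def cassoc Tar_Cmp)
qed


section \<open>Maps between coherent families\<close>

locale two_families = L: coherent_family C p can u + R: coherent_family C p' can' u'
  for C :: "('o, 'm) bmoncat" (structure) and p can u p' can' u'
begin

text \<open>A monoidal transformation between the two families, regarded as functors on the discrete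
  category of natural numbers.\<close>

definition family_map :: "(nat \<Rightarrow> 'm) \<Rightarrow> bool" where
  "family_map \<alpha> \<longleftrightarrow> (\<forall>n. \<alpha> n \<in> hom_set C (p n) (p' n)) \<and> \<alpha> 0 \<cdot> u = u' \<and>
     (\<forall>a b. \<alpha> (a + b) \<cdot> can a b = can' a b \<cdot> (\<alpha> a \<star> \<alpha> b))"

text \<open>Each member of the source family is built from the preceding one and \<open>p 1\<close>
  through the invertible \<open>u\<close> and \<open>can n 1\<close>.\<close>

lemma family_map_unique:
  assumes \<alpha>: "family_map \<alpha>" and \<beta>: "family_map \<beta>" and 1: "\<alpha> 1 = \<beta> 1"
  shows "\<alpha> n = \<beta> n"
proof (induction n)
  case 0
  show ?case
  proof (rule L.iso_cancel_right[of u])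
    show "\<alpha> 0 \<cdot> u = \<beta> 0 \<cdot> u" using \<alpha> \<beta> by (simp add: family_map_def)
  qed (use \<alpha> \<beta> in \<open>auto simp: family_map_def in_hom_set\<close>)
next
  case (Suc n)
  have "\<alpha> (n + 1) = \<beta> (n + 1)"
  proof (rule L.iso_cancel_right[of "can n 1"])
    show "\<alpha> (n + 1) \<cdot> can n 1 = \<beta> (n + 1) \<cdot> can n 1"
      using \<alpha> \<beta> Suc 1 by (simp add: family_map_def del: add_Suc_right)
  qed (use \<alpha> \<beta> in \<open>auto simp: family_map_def in_hom_set\<close>)
  then show ?case by (simp only: Suc_eq_plus1)
qed

text \<open>These values are forced on a family map whose value at \<open>1\<close> is
  \<open>f\<close>, by compatibility with \<open>u\<close> and with \<open>can n 1\<close>.\<close>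

primrec extend :: "'m \<Rightarrow> nat \<Rightarrow> 'm" where
  "extend f 0 = u' \<cdot> inv_ar C u"
| "extend f (Suc n) = can' n 1 \<cdot> ((extend f n \<star> f) \<cdot> inv_ar C (can n 1))"

context
  fixes f
  assumes f [simp]: "f \<in> Ar C" "Dom C f = p 1" "Cod C f = p' 1"
begin

lemma extend_plus1: "extend f (n + 1) = can' n 1 \<cdot> ((extend f n \<star> f) \<cdot> inv_ar C (can n 1))"
  by (simp only: extend.simps flip: Suc_eq_plus1)

lemma extend_typing: "extend f n \<in> Ar C \<and> Dom C (extend f n) = p n \<and> Cod C (extend f n) = p' n"
  by (induction n) (auto simp flip: Suc_eq_plus1)

lemma extend_Ar [simp]: "extend f n \<in> Ar C" "Dom C (extend f n) = p n" "Cod C (extend f n) = p' n"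
  using extend_typing by auto

text \<open>Degree one is reached as \<open>0 + 1\<close>, so the unit constraints of the two
  families have to cancel.\<close>

lemma extend_1: "extend f 1 = f"
proof (rule L.iso_cancel_right[of "can 0 1 \<cdot> (u \<star> Id C (p 1))"])
  have "extend f 1 \<cdot> (can 0 1 \<cdot> (u \<star> Id C (p 1))) = can' 0 1 \<cdot> ((u' \<star> Id C (p' 1)) \<cdot> (Id C (Unit C) \<star> f))"
    using extend.simps(2)[of f 0] by (simp add: L.cassoc L.Tar_Cmp flip: One_nat_def)
  also have "\<dots> = LUnit C (p' 1) \<cdot> (Id C (Unit C) \<star> f)"
    using L.extend_right[OF R.can_unit_left[of 1]] by simp
  also have "\<dots> = f \<cdot> (can 0 1 \<cdot> (u \<star> Id C (p 1)))"
    using L.LUnit_nat[of f] L.can_unit_left[of 1] by simp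
  finally show "extend f 1 \<cdot> (can 0 1 \<cdot> (u \<star> Id C (p 1))) = f \<cdot> (can 0 1 \<cdot> (u \<star> Id C (p 1)))" .
qed simp_all

lemma extend_Suc_can: "extend f (b + 1) \<cdot> can b 1 = can' b 1 \<cdot> (extend f b \<star> f)"
  by (simp add: L.cassoc extend_plus1)

text \<open>The definition gives the case \<open>b = 1\<close>; \<open>can_assoc\<close> in both
  families and naturality of the associator carry it to all \<open>b\<close>.\<close>

lemma extend_can: "extend f (a + b) \<cdot> can a b = can' a b \<cdot> (extend f a \<star> extend f b)"
proof (induction b)
  case 0
  have "extend f (a + 0) \<cdot> can a 0 = can' a 0 \<cdot> (extend f a \<star> extend f 0)"
  proof (rule L.iso_cancel_right[of "Id C (p a) \<star> u"])
    have "(extend f (a + 0) \<cdot> can a 0) \<cdot> (Id C (p a) \<star> u) = extend f a \<cdot> RUnit C (p a)"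
      using L.can_unit_right[of a] by (simp add: L.cassoc)
    also have "\<dots> = RUnit C (p' a) \<cdot> (extend f a \<star> Id C (Unit C))"
      using L.RUnit_nat[of "extend f a"] by simp
    also have "\<dots> = can' a 0 \<cdot> ((Id C (p' a) \<star> u') \<cdot> (extend f a \<star> Id C (Unit C)))"
      using L.extend_right[OF R.can_unit_right[of a]] by simp
    also have "\<dots> = (can' a 0 \<cdot> (extend f a \<star> extend f 0)) \<cdot> (Id C (p a) \<star> u)"
      by (simp add: L.cassoc L.Tar_Cmp)
    finally show "(extend f (a + 0) \<cdot> can a 0) \<cdot> (Id C (p a) \<star> u) =
        (can' a 0 \<cdot> (extend f a \<star> extend f 0)) \<cdot> (Id C (p a) \<star> u)" .
  qed simp_all
  then show ?case .
next
  case (Suc b)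
  let ?e = "extend f" and ?\<alpha> = "Assoc C (p a) (p b) (p 1)"
  have "?e (a + (b + 1)) \<cdot> can a (b + 1) = can' a (b + 1) \<cdot> (?e a \<star> ?e (b + 1))"
  proof (rule L.iso_cancel_right[of "(Id C (p a) \<star> can b 1) \<cdot> ?\<alpha>"])
    have "(?e (a + (b + 1)) \<cdot> can a (b + 1)) \<cdot> ((Id C (p a) \<star> can b 1) \<cdot> ?\<alpha>) =
        ?e ((a + b) + 1) \<cdot> (can (a + b) 1 \<cdot> (can a b \<star> Id C (p 1)))"
      using L.can_assoc[of a b 1] by (simp add: L.cassoc add.assoc del: extend.simps)
    also have "\<dots> = can' (a + b) 1 \<cdot> ((?e (a + b) \<star> f) \<cdot> (can a b \<star> Id C (p 1)))"
      using L.extend_right[OF extend_Suc_can[of "a + b"]] by (simp add: L.cassoc del: extend.simps)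
    also have "\<dots> = can' (a + b) 1 \<cdot> ((can' a b \<star> Id C (p' 1)) \<cdot> ((?e a \<star> ?e b) \<star> f))"
      by (simp add: L.Tar_Cmp Suc del: extend.simps)
    also have "\<dots> = (can' a (b + 1) \<cdot> ((Id C (p' a) \<star> can' b 1) \<cdot> Assoc C (p' a) (p' b) (p' 1))) \<cdot> ((?e a \<star> ?e b) \<star> f)"
      unfolding R.can_assoc by (simp add: L.cassoc del: extend.simps)
    also have "\<dots> = can' a (b + 1) \<cdot> ((Id C (p' a) \<star> can' b 1) \<cdot> ((?e a \<star> (?e b \<star> f)) \<cdot> ?\<alpha>))"
      using L.Assoc_nat[of "?e a" "?e b" f] by (simp add: L.cassoc del: extend.simps)
    also have "\<dots> = can' a (b + 1) \<cdot> ((?e a \<star> (?e (b + 1) \<cdot> can b 1)) \<cdot> ?\<alpha>)"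
      unfolding extend_Suc_can by (simp add: L.Tar_Cmp_right del: extend.simps)
    also have "\<dots> = (can' a (b + 1) \<cdot> (?e a \<star> ?e (b + 1))) \<cdot> ((Id C (p a) \<star> can b 1) \<cdot> ?\<alpha>)"
      by (simp add: L.cassoc L.Tar_Cmp_right del: extend.simps)
    finally show "(?e (a + (b + 1)) \<cdot> can a (b + 1)) \<cdot> ((Id C (p a) \<star> can b 1) \<cdot> ?\<alpha>) =
        (can' a (b + 1) \<cdot> (?e a \<star> ?e (b + 1))) \<cdot> ((Id C (p a) \<star> can b 1) \<cdot> ?\<alpha>)" .
  qed (simp_all del: extend.simps)
  then show ?case by (simp only: Suc_eq_plus1)
qed

lemma family_map_extend: "family_map (extend f)"
  by (simp add: family_map_def in_hom_set extend_can L.cassoc)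

end

end

lemma Alg_on_simps:
  "F \<in> Ob (Alg_on Q T C) \<longleftrightarrow> braided_monoidal_functor T C F \<and> Q F \<and> extensional_functor T F \<and>
     fmult F \<in> extensional (Ob T \<times> Ob T)"
  "(F, F', \<alpha>) \<in> Ar (Alg_on Q T C) \<longleftrightarrow> F \<in> Ob (Alg_on Q T C) \<and> F' \<in> Ob (Alg_on Q T C) \<and>
     \<alpha> \<in> extensional (Ob T) \<and> monoidal_transformation T C F F' \<alpha>"
  "Dom (Alg_on Q T C) (F, F', \<alpha>) = F" "Cod (Alg_on Q T C) (F, F', \<alpha>) = F'"
  "Id (Alg_on Q T C) F = (F, F, \<lambda>a\<in>Ob T. Id C (omap F a))"
  "(F', F'', \<beta>) \<cdot>\<^bsub>Alg_on Q T C\<^esub> (F, K, \<alpha>) = (F, F'', \<lambda>a\<in>Ob T. \<beta> a \<cdot>\<^bsub>C\<^esub> \<alpha> a)"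
  by (auto simp: Alg_on_def Let_def)


section \<open>From algebras to monoids with group action\<close>

locale algebra_setup = strand_group J cls G + C: braided_monoidal_category C
  for J :: "'j strands" and cls and G :: "'g monoid" and C :: "('o, 'm) bmoncat" (structure)
begin

definition mon_of where
  "mon_of F = (omap F 1, amap F mult_ar \<cdot> fmult F (1, 1), amap F unit_ar \<cdot> funit F)"

definition act_of where "act_of F g = amap F (group_ar g)"

definition gmon_of where "gmon_of F = gmonoid_ob G (mon_of F) (act_of F)"

definition Phi where
  "Phi = \<lparr>omap = gmon_of, amap = (\<lambda>(F, F', \<alpha>). (gmon_of F, gmon_of F', \<lambda>_. (mon_of F, mon_of F', \<alpha> 1)))\<rparr>"

end

locale algebra = algebra_setup J cls G C
  for J :: "'j strands" and cls and G :: "'g monoid" and C :: "('o, 'm) bmoncat" (structure) +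
  fixes F :: "(nat, nat \<times> nat \<times> (nat \<Rightarrow> nat) \<times> (nat \<Rightarrow> 'g) \<times> 'j, 'o, 'm) mfunctor"
  assumes F: "braided_monoidal_functor T C F"
begin

lemma is_functor_F: "is_functor T C F"
  using F by (simp add: braided_monoidal_functor_def)

lemma F_Ar [simp]: "t \<in> Ar T \<Longrightarrow> amap F t \<in> Ar C"
  and Dom_F [simp]: "t \<in> Ar T \<Longrightarrow> Dom C (amap F t) = omap F (Dom T t)"
  and Cod_F [simp]: "t \<in> Ar T \<Longrightarrow> Cod C (amap F t) = omap F (Cod T t)"
  using functor_Ar[OF is_functor_F] functor_Dom[OF is_functor_F] functor_Cod[OF is_functor_F] by auto

lemma F_Id: "amap F (Id T n) = Id C (omap F n)"
  using functor_Id[OF is_functor_F] by simp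

lemma F_Cmp: "s \<in> Ar T \<Longrightarrow> t \<in> Ar T \<Longrightarrow> Cod T s = Dom T t \<Longrightarrow> amap F (t \<cdot>\<^bsub>T\<^esub> s) = amap F t \<cdot> amap F s"
  using functor_Cmp[OF is_functor_F] by simp

lemma F_Tar_fmult: "s \<in> Ar T \<Longrightarrow> t \<in> Ar T \<Longrightarrow>
    amap F (s \<star>\<^bsub>T\<^esub> t) \<cdot> fmult F (Dom T s, Dom T t) = fmult F (Cod T s, Cod T t) \<cdot> (amap F s \<star> amap F t)"
  using F by (simp add: braided_monoidal_functor_def)

lemma F_Braid_fmult: "amap F (Braid T a b) \<cdot> fmult F (a, b) = fmult F (b, a) \<cdot> Braid C (omap F a) (omap F b)"
  using F by (simp add: braided_monoidal_functor_def)

end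

text \<open>The values of an algebra on objects form a coherent family under its own structure maps,
  so its values on tensor products are described by the strict tensor
  \<open>fam.ten\<close>.\<close>

sublocale algebra \<subseteq> fam: coherent_family C "omap F" "\<lambda>a b. fmult F (a, b)" "funit F"
proof -
  interpret C': braided_monoidal_category C by (rule C.braided_monoidal_category_axioms)
  have Ob: "omap F n \<in> Ob C" for n using functor_Ob[OF is_functor_F] by simp
  have mult: "isom C (fmult F (a, b))" "Dom C (fmult F (a, b)) = omap F a \<odot> omap F b"
    "Cod C (fmult F (a, b)) = omap F (a + b)" for a b
    using F by (auto simp: braided_monoidal_functor_def in_iso_set)
  have unit: "isom C (funit F)" "Dom C (funit F) = Unit C" "Cod C (funit F) = omap F 0"
    using F by (auto simp: braided_monoidal_functor_def in_iso_set)
  note [simp] = Ob mult unit isom_Ar[OF mult(1)] isom_Ar[OF unit(1)]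
  have assoc: "fmult F (a, b + c) \<cdot> (Id C (omap F a) \<star> fmult F (b, c)) \<cdot> Assoc C (omap F a) (omap F b) (omap F c) =
      Id C (omap F (a + b + c)) \<cdot> fmult F (a + b, c) \<cdot> (fmult F (a, b) \<star> Id C (omap F c))" for a b c
    using F by (simp add: braided_monoidal_functor_def F_Id)
  have lunit: "Id C (omap F a) \<cdot> fmult F (0, a) \<cdot> (funit F \<star> Id C (omap F a)) = LUnit C (omap F a)" for a
    using F by (simp add: braided_monoidal_functor_def F_Id)
  have runit: "Id C (omap F a) \<cdot> fmult F (a, 0) \<cdot> (Id C (omap F a) \<star> funit F) = RUnit C (omap F a)" for a
    using F by (simp add: braided_monoidal_functor_def F_Id)
  show "coherent_family C (omap F) (\<lambda>a b. fmult F (a, b)) (funit F)"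
  proof (unfold_locales, goal_cases)
    case (8 a b c)
    show ?case using assoc[of a b c] by (simp add: C.cassoc add.assoc)
  next
    case (9 a)
    show ?case using lunit[of a] by simp
  next
    case (10 a)
    show ?case using runit[of a] by simp
  qed simp_all
qed

context algebra
begin

lemma F_Tar: "s \<in> Ar T \<Longrightarrow> t \<in> Ar T \<Longrightarrow>
    amap F (s \<star>\<^bsub>T\<^esub> t) = fam.ten (Dom T s) (Cod T s) (Dom T t) (Cod T t) (amap F s) (amap F t)"
  using F_Tar_fmult[of s t]
    fam.ten_cancel[of "amap F (s \<star>\<^bsub>T\<^esub> t)" "fam.ten (Dom T s) (Cod T s) (Dom T t) (Cod T t) (amap F s) (amap F t)"]
  by (simp add: T_closed fam.ten_can)

text \<open>The relations between the generators of \<open>T\<close> are mapped by \<open>F\<close>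
  and translated back to \<open>C\<close> by the comparison lemmas for coherent families.\<close>

lemma gmonoid_data_of:
  "gmonoid_data G C (omap F 1) (amap F mult_ar \<cdot> fmult F (1, 1)) (amap F unit_ar \<cdot> funit F) (act_of F)"
proof -
  let ?m = "amap F mult_ar" and ?e = "amap F unit_ar" and ?I = "Id C (omap F 1)"
  have c [simp]: "Cod C (fmult F (1, 1)) = omap F 2" using fam.Cod_can[of 1 1] by simp
  have "?m \<cdot> fam.ten 2 1 1 1 ?m ?I = ?m \<cdot> fam.ten 1 1 2 1 ?I ?m"
    using arg_cong[OF mult_assoc_T, of "amap F"] by (simp add: F_Cmp T_closed F_Tar F_Id)
  then have 1: "(?m \<cdot> fmult F (1, 1)) \<cdot> ((?m \<cdot> fmult F (1, 1)) \<star> ?I) =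
      (?m \<cdot> fmult F (1, 1)) \<cdot> ((?I \<star> (?m \<cdot> fmult F (1, 1))) \<cdot> Assoc C (omap F 1) (omap F 1) (omap F 1))"
    using fam.monoid_assoc_iff[of ?m] by simp
  have "?m \<cdot> fam.ten 0 1 1 1 ?e ?I = ?I"
    using arg_cong[OF mult_unit_T(1), of "amap F"] by (simp add: F_Cmp T_closed F_Tar F_Id)
  then have 2: "(?m \<cdot> fmult F (1, 1)) \<cdot> ((?e \<cdot> funit F) \<star> ?I) = LUnit C (omap F 1)"
    using fam.monoid_unit_left_iff[of ?m ?e] by simp
  have "?m \<cdot> fam.ten 1 1 0 1 ?I ?e = ?I"
    using arg_cong[OF mult_unit_T(2), of "amap F"] by (simp add: F_Cmp T_closed F_Tar F_Id)
  then have 3: "(?m \<cdot> fmult F (1, 1)) \<cdot> (?I \<star> (?e \<cdot> funit F)) = RUnit C (omap F 1)"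
    using fam.monoid_unit_right_iff[of ?m ?e] by simp
  have 4: "act_of F g \<cdot> (?m \<cdot> fmult F (1, 1)) = (?m \<cdot> fmult F (1, 1)) \<cdot> (act_of F g \<star> act_of F g)"
    if "g \<in> carrier G" for g
  proof -
    have "act_of F g \<cdot> ?m = ?m \<cdot> fam.ten 1 1 1 1 (act_of F g) (act_of F g)"
      using arg_cong[OF group_mult_T[OF that], of "amap F"] that by (simp add: F_Cmp T_closed F_Tar act_of_def)
    then show ?thesis using fam.monoid_hom_iff[of ?m "act_of F g"] that by (simp add: act_of_def)
  qed
  have 5: "act_of F g \<cdot> (?e \<cdot> funit F) = ?e \<cdot> funit F" if "g \<in> carrier G" for g
  proof -
    have "act_of F g \<cdot> ?e = ?e"
      using arg_cong[OF group_unit_T[OF that], of "amap F"] that by (simp add: F_Cmp act_of_def)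
    then show ?thesis using fam.unit_hom_iff[of ?e "act_of F g"] that by (simp add: act_of_def)
  qed
  have 6: "act_of F (g \<otimes>\<^bsub>G\<^esub> h) = act_of F g \<cdot> act_of F h" if "g \<in> carrier G" "h \<in> carrier G" for g h
    using arg_cong[OF group_Cmp_T[OF that], of "amap F"] that by (simp add: F_Cmp act_of_def)
  have 7: "act_of F \<one>\<^bsub>G\<^esub> = ?I" by (simp add: act_of_def group_one_T F_Id)
  show ?thesis
    using 1 2 3 4 5 6 7
    by (simp add: gmonoid_data_def is_monoid_def in_hom_set C.cassoc) (simp add: act_of_def)
qed

lemma gmon_of_in_GMon: "gmon_of F \<in> Ob (GMon G C)"
  using gmonoid_data_of by (simp add: gmon_of_def mon_of_def gmonoid_ob_in_GMon[OF G.is_group])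

end

locale algebra_pair = A: algebra J cls G C F + B: algebra J cls G C F'
  for J :: "'j strands" and cls and G :: "'g monoid" and C :: "('o, 'm) bmoncat" (structure) and F F'

sublocale algebra_pair \<subseteq> two_families C "omap F" "\<lambda>a b. fmult F (a, b)" "funit F"
    "omap F'" "\<lambda>a b. fmult F' (a, b)" "funit F'"
  ..

context algebra_pair
begin

lemma family_map_of_transformation:
  assumes "monoidal_transformation A.T C F F' \<alpha>"
  shows "family_map \<alpha>"
  using assms by (simp add: family_map_def monoidal_transformation_def natural_transformation_def)

lemma gmonoid_hom_of_transformation:
  assumes \<alpha>: "monoidal_transformation A.T C F F' \<alpha>"
  shows "gmonoid_hom G C (A.mon_of F) (A.act_of F) (A.mon_of F') (A.act_of F') (\<alpha> 1)"
proof -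
  have nat: "\<alpha> (Cod A.T t) \<cdot> amap F t = amap F' t \<cdot> \<alpha> (Dom A.T t)" if "t \<in> Ar A.T" for t
    using \<alpha> that by (simp add: monoidal_transformation_def natural_transformation_def)
  have \<alpha>_Ar [simp]: "\<alpha> n \<in> Ar C" "Dom C (\<alpha> n) = omap F n" "Cod C (\<alpha> n) = omap F' n" for n
    using \<alpha> by (auto simp: monoidal_transformation_def natural_transformation_def in_hom_set)
  have c [simp]: "Cod C (fmult F (1, 1)) = omap F 2" "Cod C (fmult F' (1, 1)) = omap F' 2"
    using A.fam.Cod_can[of 1 1] B.fam.Cod_can[of 1 1] by simp_all
  have unit: "\<alpha> 0 \<cdot> funit F = funit F'" and mult: "\<alpha> 2 \<cdot> fmult F (1, 1) = fmult F' (1, 1) \<cdot> (\<alpha> 1 \<star> \<alpha> 1)"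
    using family_map_of_transformation[OF \<alpha>] one_add_one[where 'a = nat]
    unfolding family_map_def by (metis, metis)
  have m: "\<alpha> 1 \<cdot> amap F A.mult_ar = amap F' A.mult_ar \<cdot> \<alpha> 2" using nat[of A.mult_ar] by simp
  have e: "\<alpha> 1 \<cdot> amap F A.unit_ar = amap F' A.unit_ar \<cdot> \<alpha> 0" using nat[of A.unit_ar] by simp
  have "\<alpha> 1 \<cdot> (amap F A.mult_ar \<cdot> fmult F (1, 1)) = (amap F' A.mult_ar \<cdot> fmult F' (1, 1)) \<cdot> (\<alpha> 1 \<star> \<alpha> 1)"
    using A.C.extend_right[OF m] by (simp add: mult A.C.cassoc)
  moreover have "\<alpha> 1 \<cdot> (amap F A.unit_ar \<cdot> funit F) = amap F' A.unit_ar \<cdot> funit F'"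
    using A.C.extend_right[OF e] by (simp add: unit A.C.cassoc)
  moreover have "\<alpha> 1 \<cdot> A.act_of F g = A.act_of F' g \<cdot> \<alpha> 1" if "g \<in> carrier G" for g
    using nat[of "A.group_ar g"] that by (simp add: A.act_of_def)
  ultimately show ?thesis by (simp add: gmonoid_hom_def A.mon_of_def in_hom_set)
qed

text \<open>Fullness: extending \<open>f\<close> along the coherent families leaves only naturality
  to prove. The arrows satisfying it are closed under composition and tensor product, so generators
  suffice, and the homomorphism conditions on \<open>f\<close> are naturality on these.\<close>

lemma transformation_of_gmonoid_hom:
  assumes hom: "gmonoid_hom G C (A.mon_of F) (A.act_of F) (A.mon_of F') (A.act_of F') f"
  shows "monoidal_transformation A.T C F F' (extend f) \<and> extend f 1 = f"
proof -
  have f [simp]: "f \<in> Ar C" "Dom C f = omap F 1" "Cod C f = omap F' 1"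
    and f_mult: "f \<cdot> (amap F A.mult_ar \<cdot> fmult F (1, 1)) = (amap F' A.mult_ar \<cdot> fmult F' (1, 1)) \<cdot> (f \<star> f)"
    and f_unit: "f \<cdot> (amap F A.unit_ar \<cdot> funit F) = amap F' A.unit_ar \<cdot> funit F'"
    and f_act: "\<And>g. g \<in> carrier G \<Longrightarrow> f \<cdot> A.act_of F g = A.act_of F' g \<cdot> f"
    using hom by (auto simp: gmonoid_hom_def A.mon_of_def in_hom_set)
  define \<alpha> where "\<alpha> = extend f"
  have fam: "family_map \<alpha>" unfolding \<alpha>_def by (rule family_map_extend[OF f])
  have \<alpha>_1: "\<alpha> 1 = f" unfolding \<alpha>_def by (rule extend_1[OF f])
  have \<alpha>_Ar [simp]: "\<alpha> n \<in> Ar C" "Dom C (\<alpha> n) = omap F n" "Cod C (\<alpha> n) = omap F' n" for n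
    using fam by (auto simp: family_map_def in_hom_set)
  have unit: "\<alpha> 0 \<cdot> funit F = funit F'" and mult: "\<alpha> (a + b) \<cdot> fmult F (a, b) = fmult F' (a, b) \<cdot> (\<alpha> a \<star> \<alpha> b)" for a b
    using fam by (auto simp: family_map_def)
  have mult2: "\<alpha> 2 \<cdot> fmult F (1, 1) = fmult F' (1, 1) \<cdot> (f \<star> f)" using mult[of 1 1] \<alpha>_1 by simp
  have c [simp]: "Cod C (fmult F (1, 1)) = omap F 2" "Cod C (fmult F' (1, 1)) = omap F' 2"
    using A.fam.Cod_can[of 1 1] B.fam.Cod_can[of 1 1] by simp_all
  let ?X = "\<lambda>t. \<alpha> (Cod A.T t) \<cdot> amap F t = amap F' t \<cdot> \<alpha> (Dom A.T t)"
  have Cmp: "?X (t \<cdot>\<^bsub>A.T\<^esub> s)" if st: "s \<in> Ar A.T" "t \<in> Ar A.T" "Cod A.T s = Dom A.T t" and X: "?X s" "?X t" for s t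
  proof -
    have "\<alpha> (Cod A.T t) \<cdot> (amap F t \<cdot> amap F s) = amap F' t \<cdot> (\<alpha> (Dom A.T t) \<cdot> amap F s)"
      using A.C.extend_right[OF X(2)] st by (simp add: A.C.cassoc)
    also have "\<dots> = amap F' t \<cdot> (amap F' s \<cdot> \<alpha> (Dom A.T s))" using X(1) st by simp
    finally show ?thesis using st by (simp add: A.T_Cmp_closed A.F_Cmp B.F_Cmp A.C.cassoc)
  qed
  have Tar: "?X (s \<star>\<^bsub>A.T\<^esub> t)" if st: "s \<in> Ar A.T" "t \<in> Ar A.T" and X: "?X s" "?X t" for s t
  proof -
    let ?a = "Dom A.T s" and ?b = "Cod A.T s" and ?a' = "Dom A.T t" and ?b' = "Cod A.T t"
    have st' [simp]: "s \<star>\<^bsub>A.T\<^esub> t \<in> Ar A.T" "Dom A.T (s \<star>\<^bsub>A.T\<^esub> t) = ?a + ?a'" "Cod A.T (s \<star>\<^bsub>A.T\<^esub> t) = ?b + ?b'"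
      using A.T_closed st by auto
    note [simp] = st
    have "(\<alpha> (?b + ?b') \<cdot> amap F (s \<star>\<^bsub>A.T\<^esub> t)) \<cdot> fmult F (?a, ?a') =
        \<alpha> (?b + ?b') \<cdot> (fmult F (?b, ?b') \<cdot> (amap F s \<star> amap F t))"
      by (simp add: A.C.cassoc A.F_Tar_fmult)
    also have "\<dots> = fmult F' (?b, ?b') \<cdot> ((\<alpha> ?b \<cdot> amap F s) \<star> (\<alpha> ?b' \<cdot> amap F t))"
      using A.C.extend_right[OF mult[of ?b ?b']] by (simp add: A.C.cassoc A.C.Tar_Cmp)
    also have "\<dots> = fmult F' (?b, ?b') \<cdot> ((amap F' s \<star> amap F' t) \<cdot> (\<alpha> ?a \<star> \<alpha> ?a'))"
      using X by (simp add: A.C.Tar_Cmp)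
    also have "\<dots> = amap F' (s \<star>\<^bsub>A.T\<^esub> t) \<cdot> (fmult F' (?a, ?a') \<cdot> (\<alpha> ?a \<star> \<alpha> ?a'))"
      using A.C.extend_right[OF B.F_Tar_fmult[of s t, symmetric]] by (simp add: A.C.cassoc)
    also have "\<dots> = (amap F' (s \<star>\<^bsub>A.T\<^esub> t) \<cdot> \<alpha> (?a + ?a')) \<cdot> fmult F (?a, ?a')"
      by (simp add: mult A.C.cassoc)
    finally have "\<alpha> (?b + ?b') \<cdot> amap F (s \<star>\<^bsub>A.T\<^esub> t) = amap F' (s \<star>\<^bsub>A.T\<^esub> t) \<cdot> \<alpha> (?a + ?a')"
      by (rule A.C.iso_cancel_right[of "fmult F (?a, ?a')", rotated 5]) simp_all
    then show ?thesis by simp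
  qed
  have Id: "?X (Id A.T n)" for n by (simp add: A.F_Id B.F_Id)
  have m: "?X A.mult_ar"
  proof -
    have "(f \<cdot> amap F A.mult_ar) \<cdot> fmult F (1, 1) = (amap F' A.mult_ar \<cdot> \<alpha> 2) \<cdot> fmult F (1, 1)"
      using f_mult mult2 by (simp add: A.C.cassoc)
    then have "f \<cdot> amap F A.mult_ar = amap F' A.mult_ar \<cdot> \<alpha> 2"
      by (rule A.C.iso_cancel_right[of "fmult F (1, 1)", rotated 5]) simp_all
    then show ?thesis using \<alpha>_1 by simp
  qed
  have e: "?X A.unit_ar"
  proof -
    have "(f \<cdot> amap F A.unit_ar) \<cdot> funit F = (amap F' A.unit_ar \<cdot> \<alpha> 0) \<cdot> funit F"
      using f_unit unit by (simp add: A.C.cassoc)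
    then have "f \<cdot> amap F A.unit_ar = amap F' A.unit_ar \<cdot> \<alpha> 0"
      by (rule A.C.iso_cancel_right[of "funit F", rotated 5]) simp_all
    then show ?thesis using \<alpha>_1 by simp
  qed
  have g: "?X (A.group_ar g)" if "g \<in> carrier G" for g
    using f_act[OF that] \<alpha>_1 by (simp add: A.act_of_def)
  \<comment> \<open>No hypothesis on \<open>f\<close> concerns the crossing: it is the image of the
    braiding, which is natural in \<open>C\<close>.\<close>
  have cT: "\<alpha> 2 \<cdot> amap F (A.cross_ar True) = amap F' (A.cross_ar True) \<cdot> \<alpha> 2"
  proof (rule A.C.iso_cancel_right[of "fmult F (1, 1)"])
    have "(\<alpha> 2 \<cdot> amap F (A.cross_ar True)) \<cdot> fmult F (1, 1) = \<alpha> 2 \<cdot> (fmult F (1, 1) \<cdot> Braid C (omap F 1) (omap F 1))"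
      using A.F_Braid_fmult[of 1 1] by (simp add: A.Braid_1_1_T A.C.cassoc)
    also have "\<dots> = fmult F' (1, 1) \<cdot> ((f \<star> f) \<cdot> Braid C (omap F 1) (omap F 1))"
      using A.C.extend_right[OF mult2] by (simp add: A.C.cassoc)
    also have "\<dots> = fmult F' (1, 1) \<cdot> (Braid C (omap F' 1) (omap F' 1) \<cdot> (f \<star> f))"
      using A.C.Braid_nat[of f f] by simp
    also have "\<dots> = amap F' (A.cross_ar True) \<cdot> (fmult F' (1, 1) \<cdot> (f \<star> f))"
      using A.C.extend_right[OF B.F_Braid_fmult[of 1 1, symmetric]] by (simp add: A.Braid_1_1_T A.C.cassoc)
    also have "\<dots> = (amap F' (A.cross_ar True) \<cdot> \<alpha> 2) \<cdot> fmult F (1, 1)"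
      using mult2 by (simp add: A.C.cassoc)
    finally show "(\<alpha> 2 \<cdot> amap F (A.cross_ar True)) \<cdot> fmult F (1, 1) = (amap F' (A.cross_ar True) \<cdot> \<alpha> 2) \<cdot> fmult F (1, 1)" .
  qed simp_all
  \<comment> \<open>The negative crossing is sent to the inverse of the image of the positive one,
    so its naturality follows by conjugation.\<close>
  have cF: "\<alpha> 2 \<cdot> amap F (A.cross_ar False) = amap F' (A.cross_ar False) \<cdot> \<alpha> 2"
  proof -
    have 1: "amap F (A.cross_ar True) \<cdot> amap F (A.cross_ar False) = Id C (omap F 2)"
      using A.F_Cmp[of "A.cross_ar False" "A.cross_ar True"] A.cross_ar_inverse[of True] by (simp add: A.F_Id)
    have 2: "amap F' (A.cross_ar False) \<cdot> amap F' (A.cross_ar True) = Id C (omap F' 2)"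
      using B.F_Cmp[of "A.cross_ar True" "A.cross_ar False"] A.cross_ar_inverse[of False] by (simp add: B.F_Id)
    have "\<alpha> 2 \<cdot> amap F (A.cross_ar False) =
        amap F' (A.cross_ar False) \<cdot> (amap F' (A.cross_ar True) \<cdot> (\<alpha> 2 \<cdot> amap F (A.cross_ar False)))"
      using A.C.extend_right[OF 2] by simp
    also have "\<dots> = amap F' (A.cross_ar False) \<cdot> (\<alpha> 2 \<cdot> (amap F (A.cross_ar True) \<cdot> amap F (A.cross_ar False)))"
      using A.C.extend_right[OF cT[symmetric]] by (simp add: A.C.cassoc)
    finally show ?thesis using 1 by simp
  qed
  have c: "?X (A.cross_ar e)" for e using cT cF by (cases e) simp_all
  have "?X t" if "t \<in> Ar A.T" for t
    by (rule A.T_induct[of t ?X]) (fact that Cmp Tar Id m e g c)+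
  then have "natural_transformation A.T C F F' \<alpha>"
    by (simp add: natural_transformation_def in_hom_set)
  then have "monoidal_transformation A.T C F F' \<alpha>"
    using unit mult by (simp add: monoidal_transformation_def)
  then show ?thesis using \<alpha>_1 by (simp add: \<alpha>_def)
qed

end

section \<open>The equivalence for algebras\<close>

context algebra_setup
begin

text \<open>The algebra takes the prescribed family and constraints on the nose. For tensor powers
  in a strict target this makes it a strict functor.\<close>

lemma algebra_of_gmonoid:
  assumes fam: "coherent_family C p can u" and M: "gmonoid_data G C (p 1) \<mu> \<eta> \<rho>"
    and act_cls: "\<And>n v w. v \<in> bwords n \<Longrightarrow> w \<in> bwords n \<Longrightarrow> cls n v = cls n w \<Longrightarrow>
      prob.act (coherent_family.fam_cat C p can) n v = prob.act (coherent_family.fam_cat C p can) n w"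
  obtains F :: "(nat, nat \<times> nat \<times> (nat \<Rightarrow> nat) \<times> (nat \<Rightarrow> 'g) \<times> 'j, 'o, 'm) mfunctor"
  where "braided_monoidal_functor T C F" "extensional_functor T F" "omap F = p" "\<And>a b. fmult F (a, b) = can a b"
    "funit F = u" "gmon_of F = gmonoid_ob G (p 1, \<mu>, \<eta>) \<rho>"
proof -
  interpret fam: coherent_family C p can u by fact
  interpret P: prob fam.fam_cat by (rule fam.prob_fam_cat)
  have can2 [simp]: "Cod C (can 1 1) = p 2" using fam.Cod_can[of 1 1] by simp
  have \<mu> [simp]: "\<mu> \<in> Ar C" "Dom C \<mu> = p 1 \<odot> p 1" "Cod C \<mu> = p 1"
    and \<eta> [simp]: "\<eta> \<in> Ar C" "Dom C \<eta> = Unit C" "Cod C \<eta> = p 1"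
    and assoc: "\<mu> \<cdot> (\<mu> \<star> Id C (p 1)) = \<mu> \<cdot> ((Id C (p 1) \<star> \<mu>) \<cdot> Assoc C (p 1) (p 1) (p 1))"
    and unit: "\<mu> \<cdot> (\<eta> \<star> Id C (p 1)) = LUnit C (p 1)" "\<mu> \<cdot> (Id C (p 1) \<star> \<eta>) = RUnit C (p 1)"
    using M by (auto simp: gmonoid_data_def is_monoid_def in_hom_set C.cassoc)
  \<comment> \<open>Multiplication and unit are moved to the objects \<open>p 2\<close> and
    \<open>p 0\<close> of the strictified family.\<close>
  define m where "m = \<mu> \<cdot> inv_ar C (can 1 1)"
  define e where "e = \<eta> \<cdot> inv_ar C u"
  \<comment> \<open>An endomorphism is wanted for every label; outside the carrier the identity
    commutes with multiplication and unit.\<close>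
  define r where "r g = (if g \<in> carrier G then \<rho> g else Id C (p 1))" for g
  have m [simp]: "m \<in> Ar C" "Dom C m = p 2" "Cod C m = p 1" and m\<mu>: "m \<cdot> can 1 1 = \<mu>"
    by (simp_all add: m_def C.cassoc)
  have e [simp]: "e \<in> Ar C" "Dom C e = p 0" "Cod C e = p 1" and e\<eta>: "e \<cdot> u = \<eta>"
    by (simp_all add: e_def C.cassoc)
  have r [simp]: "r g \<in> Ar C" "Dom C (r g) = p 1" "Cod C (r g) = p 1" for g
    using M by (auto simp: r_def gmonoid_data_def in_hom_set)
  have r\<mu>: "r g \<cdot> \<mu> = \<mu> \<cdot> (r g \<star> r g)" and r\<eta>: "r g \<cdot> \<eta> = \<eta>" for g
    using M by (auto simp: r_def gmonoid_data_def)
  have r_mult: "r (g \<otimes>\<^bsub>G\<^esub> h) = r g \<cdot> r h" if "g \<in> carrier G" "h \<in> carrier G" for g h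
    using M that by (simp add: r_def gmonoid_data_def)
  have r_one: "r \<one>\<^bsub>G\<^esub> = Id C (p 1)" using M by (simp add: r_def gmonoid_data_def)
  have 1: "m \<cdot> fam.ten 2 1 1 1 m (Id C (p 1)) = m \<cdot> fam.ten 1 1 2 1 (Id C (p 1)) m"
    using fam.monoid_assoc_iff[of m] assoc by (simp add: m\<mu>)
  have 2: "m \<cdot> fam.ten 0 1 1 1 e (Id C (p 1)) = Id C (p 1)"
    using fam.monoid_unit_left_iff[of m e] unit by (simp add: m\<mu> e\<eta>)
  have 3: "m \<cdot> fam.ten 1 1 0 1 (Id C (p 1)) e = Id C (p 1)"
    using fam.monoid_unit_right_iff[of m e] unit by (simp add: m\<mu> e\<eta>)
  have 4: "r g \<cdot> m = m \<cdot> fam.ten 1 1 1 1 (r g) (r g)" for g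
    using fam.monoid_hom_iff[of m "r g"] r\<mu>[of g] by (simp add: m\<mu>)
  have 5: "r g \<cdot> e = e" for g
    using fam.unit_hom_iff[of e "r g"] r\<eta>[of g] by (simp add: e\<eta>)
  interpret K: classified_functor J cls G fam.fam_cat "(2, 1, m)" "(0, 1, e)" "\<lambda>g. (1, 1, r g)"
  proof (unfold_locales, goal_cases)
    case (17 v n w)
    then show ?case by (rule act_cls)
  qed (simp_all add: 1 2 3 4 5 r_mult r_one)
  define A where "A t = snd (snd (K.F_ar t))" for t
  have A: "K.F_ar t = (Dom T t, Cod T t, A t)" "A t \<in> Ar C" "Dom C (A t) = p (Dom T t)" "Cod C (A t) = p (Cod T t)"
    if "t \<in> Ar T" for t
    using K.F_typing[OF that] unfolding A_def by (cases "K.F_ar t"; simp)+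
  have A_Id: "A (Id T n) = Id C (p n)" for n by (simp add: A_def K.F_Id)
  have A_Braid: "A (Braid T a b) = fam.br a b" for a b by (simp add: A_def K.F_Braid)
  have A_Cmp: "A (t \<cdot>\<^bsub>T\<^esub> s) = A t \<cdot> A s" if "s \<in> Ar T" "t \<in> Ar T" "Cod T s = Dom T t" for s t
    unfolding A_def[of "t \<cdot>\<^bsub>T\<^esub> s"] K.F_Cmp[OF that] A(1)[OF that(1)] A(1)[OF that(2)] by simp
  have A_Tar: "A (s \<star>\<^bsub>T\<^esub> t) = fam.ten (Dom T s) (Cod T s) (Dom T t) (Cod T t) (A s) (A t)" if "s \<in> Ar T" "t \<in> Ar T" for s t
    unfolding A_def[of "s \<star>\<^bsub>T\<^esub> t"] K.F_Tar[OF that] A(1)[OF that(1)] A(1)[OF that(2)] by simp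
  define F :: "(nat, nat \<times> nat \<times> (nat \<Rightarrow> nat) \<times> (nat \<Rightarrow> 'g) \<times> 'j, 'o, 'm) mfunctor"
    where "F = \<lparr>omap = p, amap = \<lambda>t\<in>Ar T. A t, fmult = \<lambda>(a, b). can a b, funit = u\<rparr>"
  have F [simp]: "omap F = p" "fmult F (a, b) = can a b" "funit F = u" for a b by (simp_all add: F_def)
  have F_ar [simp]: "amap F t = A t" if "t \<in> Ar T" for t using that by (simp add: F_def)
  have Braid_Ar: "Braid T a b \<in> Ar T" "Dom T (Braid T a b) = a + b" "Cod T (Braid T a b) = b + a" for a b
    by (simp_all add: Braid_T tdata_Braid)
  have "is_functor T C F"
    by (simp add: is_functor_def in_hom_set A A_Id A_Cmp T_Cmp_closed)
  moreover have "can (Cod T s) (Cod T t) \<cdot> (A s \<star> A t) = A (s \<star>\<^bsub>T\<^esub> t) \<cdot> can (Dom T s) (Dom T t)"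
    if "s \<in> Ar T" "t \<in> Ar T" for s t
    using fam.ten_can[of "A s" "Dom T s" "Cod T s" "A t" "Dom T t" "Cod T t"] A[OF that(1)] A[OF that(2)] A_Tar[OF that]
    by simp
  moreover have "can a (b + c) \<cdot> (Id C (p a) \<star> can b c) \<cdot> Assoc C (p a) (p b) (p c) =
      Id C (p (a + b + c)) \<cdot> can (a + b) c \<cdot> (can a b \<star> Id C (p c))" for a b c
    using fam.can_assoc[of a b c] by (simp add: C.cassoc add.assoc)
  moreover have "can b a \<cdot> Braid C (p a) (p b) = fam.br a b \<cdot> can a b" for a b
    by (simp add: fam.br_can)
  ultimately have "braided_monoidal_functor T C F"
    by (simp add: braided_monoidal_functor_def in_iso_set T_closed Braid_Ar A_Id A_Braid
      fam.can_unit_left fam.can_unit_right)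
  moreover have "extensional_functor T F" by (simp add: extensional_functor_def F_def)
  moreover have "gmon_of F = gmonoid_ob G (p 1, \<mu>, \<eta>) \<rho>"
  proof -
    have "A mult_ar = m" "A unit_ar = e" by (simp_all add: A_def K.F_gens)
    then have "mon_of F = (p 1, \<mu>, \<eta>)" by (simp add: mon_of_def m\<mu> e\<eta>)
    moreover have "act_of F g = \<rho> g" if g: "g \<in> carrier G" for g
    proof -
      have "A (group_ar g) = r g" using K.F_gens(3)[OF g] by (simp add: A_def)
      then show ?thesis using g by (simp add: act_of_def r_def)
    qed
    ultimately show ?thesis by (auto simp: gmon_of_def gmonoid_ob_def)
  qed
  ultimately show ?thesis using that F by blast
qed

text \<open>\<open>Q\<close> selects all algebras or the strict ones. It must hold for the algebras
  on tensor powers, since these are the witnesses of essential surjectivity; full faithfulness is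
  that transformations are determined by their value at \<open>1\<close>, where every homomorphism
  occurs.\<close>

theorem weak_equivalence_Phi:
  assumes act_cls: "\<And>p can u n v w. coherent_family C p can u \<Longrightarrow> v \<in> bwords n \<Longrightarrow> w \<in> bwords n \<Longrightarrow> cls n v = cls n w \<Longrightarrow>
      prob.act (coherent_family.fam_cat C p can) n v = prob.act (coherent_family.fam_cat C p can) n w"
    and Q: "\<And>x F. x \<in> Ob C \<Longrightarrow> omap F = C.pow x \<Longrightarrow> (\<And>a b. fmult F (a, b) = C.pow_can x a b) \<Longrightarrow>
      funit F = Id C (Unit C) \<Longrightarrow> Q F"
  shows "weak_equivalence (Alg_on Q T C) (GMon G C) Phi"
proof (rule weak_equivalenceI)
  have alg: "algebra J cls G C F" if "F \<in> Ob (Alg_on Q T C)" for F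
    using that by unfold_locales (simp add: Alg_on_simps)
  have pair: "algebra_pair J cls G C F F'" if "F \<in> Ob (Alg_on Q T C)" "F' \<in> Ob (Alg_on Q T C)" for F F'
    using alg[OF that(1)] alg[OF that(2)] by (rule algebra_pair.intro)
  have data: "gmonoid_data G C (omap F 1) (amap F mult_ar \<cdot> fmult F (1, 1)) (amap F unit_ar \<cdot> funit F) (act_of F)"
    if "F \<in> Ob (Alg_on Q T C)" for F
    by (rule algebra.gmonoid_data_of[OF alg[OF that]])
  have hom_iff: "(gmon_of F, gmon_of F', \<lambda>_. (mon_of F, mon_of F', f)) \<in> Ar (GMon G C) \<longleftrightarrow>
      gmonoid_hom G C (mon_of F) (act_of F) (mon_of F') (act_of F') f"
    if "F \<in> Ob (Alg_on Q T C)" "F' \<in> Ob (Alg_on Q T C)" for F F' f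
    unfolding gmon_of_def
    by (rule gmonoid_hom_in_GMon[OF G.is_group mon_of_def mon_of_def data[OF that(1)] data[OF that(2)]])
  have C: "monoidal_category C" by (rule C.monoidal_category_axioms)
  show cat_A: "category (Alg_on Q T C)" by (rule category_Alg_on[OF C]) simp
  show cat_G: "category (GMon G C)" by (rule category_GMon[OF G.is_group C])
  show "is_functor (Alg_on Q T C) (GMon G C) Phi"
    unfolding is_functor_def
  proof (intro conjI ballI impI)
    fix F assume F: "F \<in> Ob (Alg_on Q T C)"
    show "omap Phi F \<in> Ob (GMon G C)"
      using algebra.gmon_of_in_GMon[OF alg[OF F]] by (simp add: Phi_def)
    show "amap Phi (Id (Alg_on Q T C) F) = Id (GMon G C) (omap Phi F)"
      by (simp add: Phi_def Alg_on_simps GMon_simps gmon_of_def) (simp add: mon_of_def)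
  next
    fix t assume t: "t \<in> Ar (Alg_on Q T C)"
    obtain F F' \<alpha> where t': "t = (F, F', \<alpha>)" by (metis prod_cases3)
    have FF': "F \<in> Ob (Alg_on Q T C)" "F' \<in> Ob (Alg_on Q T C)" and \<alpha>: "monoidal_transformation T C F F' \<alpha>"
      using t unfolding t' Alg_on_simps(2) by blast+
    show "amap Phi t \<in> hom_set (GMon G C) (omap Phi (Dom (Alg_on Q T C) t)) (omap Phi (Cod (Alg_on Q T C) t))"
      using hom_iff[OF FF'] algebra_pair.gmonoid_hom_of_transformation[OF pair[OF FF'] \<alpha>]
      by (simp add: t' Phi_def Alg_on_simps(3,4) in_hom_set GMon_simps)
    fix s assume s: "s \<in> Ar (Alg_on Q T C)" "Cod (Alg_on Q T C) t = Dom (Alg_on Q T C) s"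
    obtain F'' \<beta> where s': "s = (F', F'', \<beta>)" using s(2) by (cases s) (auto simp: t' Alg_on_simps)
    show "amap Phi (s \<cdot>\<^bsub>Alg_on Q T C\<^esub> t) = amap Phi s \<cdot>\<^bsub>GMon G C\<^esub> amap Phi t"
      by (simp add: t' s' Phi_def Alg_on_simps(6) GMon_simps)
  qed
  show "f = g" if f: "f \<in> Ar (Alg_on Q T C)" and g: "g \<in> Ar (Alg_on Q T C)"
    and eq: "Dom (Alg_on Q T C) f = Dom (Alg_on Q T C) g" "Cod (Alg_on Q T C) f = Cod (Alg_on Q T C) g"
      "amap Phi f = amap Phi g" for f g
  proof -
    obtain F F' \<alpha> where f': "f = (F, F', \<alpha>)" by (metis prod_cases3)
    obtain \<beta> where g': "g = (F, F', \<beta>)" using eq(1,2) by (cases g) (auto simp: f' Alg_on_simps)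
    have FF': "F \<in> Ob (Alg_on Q T C)" "F' \<in> Ob (Alg_on Q T C)" and \<alpha>: "monoidal_transformation T C F F' \<alpha>"
      and \<beta>: "monoidal_transformation T C F F' \<beta>"
      using f g unfolding f' g' Alg_on_simps(2) by blast+
    interpret pair: algebra_pair J cls G C F F' by (rule pair[OF FF'])
    have "\<alpha> 1 = \<beta> 1" using eq(3) by (simp add: f' g' Phi_def fun_eq_iff)
    then have "\<alpha> = \<beta>"
      using pair.family_map_unique[OF pair.family_map_of_transformation[OF \<alpha>] pair.family_map_of_transformation[OF \<beta>]]
      by (simp add: fun_eq_iff)
    then show ?thesis by (simp add: f' g')
  qed
  show "\<exists>f\<in>hom_set (Alg_on Q T C) F F'. amap Phi f = g"
    if FF': "F \<in> Ob (Alg_on Q T C)" "F' \<in> Ob (Alg_on Q T C)" and g: "g \<in> hom_set (GMon G C) (omap Phi F) (omap Phi F')" for F F' g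
  proof -
    interpret pair: algebra_pair J cls G C F F' by (rule pair[OF FF'])
    obtain \<gamma> where g': "g = (gmon_of F, gmon_of F', \<gamma>)"
      using g by (cases g) (auto simp: in_hom_set Phi_def GMon_simps)
    have g_Ar: "(gmon_of F, gmon_of F', \<gamma>) \<in> Ar (GMon G C)" using g g' by (simp add: in_hom_set)
    then obtain f where f: "\<gamma> = (\<lambda>_. (mon_of F, mon_of F', f))"
      unfolding gmon_of_def by (rule GMon_ArE)
    have "gmonoid_hom G C (mon_of F) (act_of F) (mon_of F') (act_of F') f"
      using hom_iff[OF FF'] g_Ar f by simp
    from pair.transformation_of_gmonoid_hom[OF this]
    have "(F, F', pair.extend f) \<in> Ar (Alg_on Q T C)" "pair.extend f 1 = f"
      using FF' by (simp_all add: Alg_on_simps(2))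
    then show ?thesis
      by (intro bexI[of _ "(F, F', pair.extend f)"]) (simp_all add: g' f Phi_def in_hom_set Alg_on_simps(3,4))
  qed
  show "\<exists>F\<in>Ob (Alg_on Q T C). \<exists>f. f \<in> iso_set (GMon G C) (omap Phi F) H" if H: "H \<in> Ob (GMon G C)" for H
  proof -
    interpret GM: category "GMon G C" by (rule cat_G)
    obtain x \<mu> \<eta> \<rho> where H': "H = gmonoid_ob G (x, \<mu>, \<eta>) \<rho>" and M: "gmonoid_data G C x \<mu> \<eta> \<rho>"
      using GMon_ObE[OF H G.is_group] by blast
    have x: "x \<in> Ob C" using M by (simp add: gmonoid_data_def is_monoid_def)
    \<comment> \<open>The first tensor power is \<open>Unit C \<odot> x\<close>, so the monoid is
      transported along the left unitor, which then becomes the isomorphism to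
      \<open>H\<close>.\<close>
    let ?l = "LUnit C x"
    let ?y = "C.pow x 1" and ?\<mu> = "inv_ar C ?l \<cdot> (\<mu> \<cdot> (?l \<star> ?l))" and ?\<eta> = "inv_ar C ?l \<cdot> \<eta>"
      and ?\<rho> = "\<lambda>g. inv_ar C ?l \<cdot> (\<rho> g \<cdot> ?l)"
    have l: "isom C ?l" "Dom C ?l = ?y" "Cod C ?l = x" using x by (simp_all add: One_nat_def)
    note N = gmonoid_data_transport[OF C M l]
    have fam: "coherent_family C (C.pow x) (C.pow_can x) (Id C (Unit C))"
      by (rule coherent_family_pow[OF C.braided_monoidal_category_axioms x])
    obtain F :: "(nat, nat \<times> nat \<times> (nat \<Rightarrow> nat) \<times> (nat \<Rightarrow> 'g) \<times> 'j, 'o, 'm) mfunctor"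
      where F: "braided_monoidal_functor T C F" "extensional_functor T F" "omap F = C.pow x"
        "\<And>a b. fmult F (a, b) = C.pow_can x a b" "funit F = Id C (Unit C)"
        "gmon_of F = gmonoid_ob G (?y, ?\<mu>, ?\<eta>) ?\<rho>"
      using algebra_of_gmonoid[OF fam N(1) act_cls[OF fam]] by blast
    have "fmult F \<in> extensional (Ob T \<times> Ob T)" by (auto simp: extensional_def)
    then have F_Ob: "F \<in> Ob (Alg_on Q T C)" using F(1,2) Q[OF x F(3-5)] by (simp add: Alg_on_simps)
    let ?N = "(?y, ?\<mu>, ?\<eta>)" and ?M = "(x, \<mu>, \<eta>)"
    let ?f = "(gmonoid_ob G ?N ?\<rho>, gmonoid_ob G ?M \<rho>, \<lambda>_::unit. (?N, ?M, ?l))"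
      and ?g = "(gmonoid_ob G ?M \<rho>, gmonoid_ob G ?N ?\<rho>, \<lambda>_::unit. (?M, ?N, inv_ar C ?l))"
    have "?f \<in> Ar (GMon G C)" using gmonoid_hom_in_GMon[OF G.is_group HOL.refl HOL.refl N(1) M] N(2) by simp
    moreover have "?g \<in> Ar (GMon G C)" using gmonoid_hom_in_GMon[OF G.is_group HOL.refl HOL.refl M N(1)] N(3) by simp
    ultimately have "inverse_arrows (GMon G C) ?f ?g"
      using l by (intro GM.inverse_arrowsI) (simp_all add: GMon_simps)
    then have "?f \<in> iso_set (GMon G C) (omap Phi F) H"
      by (auto simp: in_iso_set GMon_simps Phi_def F(6) H' intro: GM.isomI)
    then show ?thesis using F_Ob by blast
  qed
qed

end

section \<open>Opposite algebras\<close>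

text \<open>The structure of the opposite functor: its constraints run backwards and are therefore
  the inverses.\<close>

definition hat :: "('p, 'n) bmoncat \<Rightarrow> ('o, 'm, 'p, 'n) mfunctor \<Rightarrow> ('o, 'm, 'p, 'n) mfunctor" where
  "hat C F = F\<lparr>fmult := \<lambda>ab. inv_ar C (fmult F ab), funit := inv_ar C (funit F)\<rparr>"

lemma hat_simps [simp]:
  "omap (hat C F) = omap F" "amap (hat C F) = amap F"
  "fmult (hat C F) ab = inv_ar C (fmult F ab)" "funit (hat C F) = inv_ar C (funit F)"
  by (simp_all add: hat_def)

lemma hat_op_cat: "hat (op_cat C) F = hat C F"
  by (simp add: hat_def)

lemma hat_hat:
  assumes "category C" "Ob A = UNIV" "braided_monoidal_functor A C F"
  shows "hat C (hat C F) = F"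
proof -
  interpret category C by fact
  have "inv_ar C (inv_ar C (fmult F ab)) = fmult F ab" for ab
    using assms by (cases ab) (simp add: braided_monoidal_functor_def in_iso_set)
  moreover have "inv_ar C (inv_ar C (funit F)) = funit F"
    using assms by (simp add: braided_monoidal_functor_def in_iso_set)
  ultimately show ?thesis by (cases F) (simp add: hat_def)
qed

text \<open>\<open>A\<close> is described by equations so that both \<open>T\<close> and
  \<open>op_cat T\<close> qualify. Each axiom is the inverse of the original one; for the braiding,
  invertibility of its image comes from the given inverse pair in \<open>A\<close>.\<close>

lemma braided_monoidal_functor_hat:
  fixes A :: "(nat, 'a) bmoncat" and C :: "('o, 'm) bmoncat" (structure)
  assumes "braided_monoidal_category C" and A: "Ob A = UNIV" "\<And>a b. Tob A a b = a + b" "Unit A = 0"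
      "\<And>a b c. Assoc A a b c = Id A (a + b + c)" "\<And>a. LUnit A a = Id A a" "\<And>a. RUnit A a = Id A a"
      "\<And>n. inv_ar A (Id A n) = Id A n" "\<And>a b. inverse_arrows A (Braid A a b) (inv_ar A (Braid A a b))"
      "\<And>a b. Dom A (Braid A a b) = a + b" "\<And>a b. Cod A (Braid A a b) = b + a"
    and A_Tar: "\<And>f g. f \<in> Ar A \<Longrightarrow> g \<in> Ar A \<Longrightarrow> f \<star>\<^bsub>A\<^esub> g \<in> Ar A \<and>
      Dom A (f \<star>\<^bsub>A\<^esub> g) = Dom A f + Dom A g \<and> Cod A (f \<star>\<^bsub>A\<^esub> g) = Cod A f + Cod A g"
    and F: "braided_monoidal_functor A C F"
  shows "braided_monoidal_functor (op_cat A) (op_cat C) (hat C F)"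
proof -
  interpret braided_monoidal_category C by fact
  have fF: "is_functor A C F" using F by (simp add: braided_monoidal_functor_def)
  have [simp]: "omap F n \<in> Ob C" for n using functor_Ob[OF fF] A by simp
  note [simp] = functor_Ar[OF fF] functor_Dom[OF fF] functor_Cod[OF fF]
  have fm [simp]: "isom C (fmult F (a, b))" "Dom C (fmult F (a, b)) = omap F a \<odot> omap F b"
    "Cod C (fmult F (a, b)) = omap F (a + b)" for a b
    using F A by (auto simp: braided_monoidal_functor_def in_iso_set)
  have fm_Ar [simp]: "fmult F (a, b) \<in> Ar C" for a b by (rule isom_Ar[OF fm(1)])
  have fu [simp]: "isom C (funit F)" "Dom C (funit F) = Unit C" "Cod C (funit F) = omap F 0"
    using F A by (auto simp: braided_monoidal_functor_def in_iso_set)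
  have fu_Ar [simp]: "funit F \<in> Ar C" by (rule isom_Ar[OF fu(1)])
  have F_Id: "amap F (Id A n) = Id C (omap F n)" for n using functor_Id[OF fF] A by simp
  have "is_functor (op_cat A) (op_cat C) (hat C F)"
    using fF by (auto simp: is_functor_def in_hom_set)
  moreover have "(amap F f \<star> amap F g) \<cdot> inv_ar C (fmult F (Dom A f, Dom A g)) =
      inv_ar C (fmult F (Cod A f, Cod A g)) \<cdot> amap F (f \<star>\<^bsub>A\<^esub> g)" if "f \<in> Ar A" "g \<in> Ar A" for f g
    using F that A_Tar[OF that] by (intro inv_conjugate) (simp_all add: braided_monoidal_functor_def)
  moreover have "inv_ar C (Assoc C (omap F a) (omap F b) (omap F c)) \<cdot>
      ((Id C (omap F a) \<star> inv_ar C (fmult F (b, c))) \<cdot> inv_ar C (fmult F (a, b + c))) =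
      (inv_ar C (fmult F (a, b)) \<star> Id C (omap F c)) \<cdot> inv_ar C (fmult F (a + b, c))" for a b c
  proof -
    have "fmult F (a, b + c) \<cdot> ((Id C (omap F a) \<star> fmult F (b, c)) \<cdot> Assoc C (omap F a) (omap F b) (omap F c)) =
        fmult F (a + b, c) \<cdot> (fmult F (a, b) \<star> Id C (omap F c))"
      using F A by (simp add: braided_monoidal_functor_def F_Id cassoc add.assoc)
    from arg_cong[OF this, of "inv_ar C"] show ?thesis
      by (simp add: inv_of_Cmp inv_Tar cassoc add.assoc)
  qed
  moreover have "(inv_ar C (funit F) \<star> Id C (omap F a)) \<cdot> inv_ar C (fmult F (0, a)) = inv_ar C (LUnit C (omap F a))" for a
  proof -
    have "fmult F (0, a) \<cdot> (funit F \<star> Id C (omap F a)) = LUnit C (omap F a)"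
      using F A by (simp add: braided_monoidal_functor_def F_Id)
    from arg_cong[OF this, of "inv_ar C"] show ?thesis by (simp add: inv_of_Cmp inv_Tar)
  qed
  moreover have "(Id C (omap F a) \<star> inv_ar C (funit F)) \<cdot> inv_ar C (fmult F (a, 0)) = inv_ar C (RUnit C (omap F a))" for a
  proof -
    have "fmult F (a, 0) \<cdot> (Id C (omap F a) \<star> funit F) = RUnit C (omap F a)"
      using F A by (simp add: braided_monoidal_functor_def F_Id)
    from arg_cong[OF this, of "inv_ar C"] show ?thesis by (simp add: inv_of_Cmp inv_Tar)
  qed
  moreover have "inv_ar C (Braid C (omap F a) (omap F b)) \<cdot> inv_ar C (fmult F (b, a)) =
      inv_ar C (fmult F (a, b)) \<cdot> amap F (inv_ar A (Braid A a b))" for a b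
  proof -
    let ?B = "Braid A a b" and ?B' = "inv_ar A (Braid A a b)"
    have B: "?B \<in> Ar A" "?B' \<in> Ar A" "Dom A ?B' = b + a" "Cod A ?B' = a + b"
      "?B' \<cdot>\<^bsub>A\<^esub> ?B = Id A (a + b)" "?B \<cdot>\<^bsub>A\<^esub> ?B' = Id A (b + a)"
      using A(8)[of a b] A(9,10) by (auto simp: inverse_arrows_def in_hom_set)
    have "amap F ?B' \<cdot> amap F ?B = Id C (omap F (a + b))" "amap F ?B \<cdot> amap F ?B' = Id C (omap F (b + a))"
      using functor_Cmp[OF fF, of ?B ?B'] functor_Cmp[OF fF, of ?B' ?B] B A(9,10) F_Id by simp_all
    then have inv: "inverse_arrows C (amap F ?B) (amap F ?B')"
      using B A(9,10) by (intro inverse_arrowsI) simp_all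
    have FB: "isom C (amap F ?B)" "inv_ar C (amap F ?B) = amap F ?B'"
      using inv isomI inv_ar_eq by blast+
    have "fmult F (b, a) \<cdot> Braid C (omap F a) (omap F b) = amap F ?B \<cdot> fmult F (a, b)"
      using F A by (simp add: braided_monoidal_functor_def)
    from arg_cong[OF this, of "inv_ar C"] show ?thesis
      using B A(9,10) FB by (simp add: inv_of_Cmp)
  qed
  ultimately show ?thesis
    using A by (simp add: braided_monoidal_functor_def in_iso_set F_Id add.assoc)
qed

text \<open>Inverting twice restores the structure isomorphisms at objects of \<open>C\<close>, and
  the functor axioms look at no others.\<close>

lemma braided_monoidal_functor_op_op:
  assumes "braided_monoidal_category C" and F: "braided_monoidal_functor A (op_cat (op_cat C)) F"
  shows "braided_monoidal_functor A C F"
proof -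
  interpret braided_monoidal_category C by fact
  have iso: "iso_set (op_cat (op_cat C)) a b = iso_set C a b" "hom_set (op_cat (op_cat C)) a b = hom_set C a b" for a b
    by (auto simp: in_iso_set)
  have fF: "is_functor A C F"
    using F by (simp add: braided_monoidal_functor_def is_functor_def iso)
  note [simp] = functor_Ob[OF fF]
  show ?thesis
    using F fF unfolding braided_monoidal_functor_def iso by simp
qed

context strand_group
begin

text \<open>An equality of records, since every natural number is an object and hence no value of a
  structure map is left unspecified.\<close>

lemma op_op_T: "op_cat (op_cat T) = T"
proof -
  have "inv_ar T (inv_ar T (Braid T a b)) = Braid T a b" for a b
  proof -
    have "Braid T a b = tarr (a + b) (a + b) (\<lambda>_. 1) (block_word a b) (\<lambda>_. \<one>\<^bsub>G\<^esub>)"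
      by (simp add: Braid_T add.commute)
    then show ?thesis using block_word_bwords[of a b] by (simp add: inv_ar_word)
  qed
  then show ?thesis
    by (intro bmoncat.equality) (simp_all add: inv_Id_T fun_eq_iff)
qed

lemma Braid_Ar_T: "Braid T a b \<in> Ar T" "Dom T (Braid T a b) = a + b" "Cod T (Braid T a b) = b + a"
  by (simp_all add: Braid_T tdata_Braid)

lemma hat_functor_iff:
  assumes C: "braided_monoidal_category C"
  shows "braided_monoidal_functor (op_cat T) C F \<Longrightarrow> braided_monoidal_functor T (op_cat C) (hat C F)"
    and "braided_monoidal_functor T (op_cat C) F \<Longrightarrow> braided_monoidal_functor (op_cat T) C (hat C F)"
proof -
  have inv: "inverse_arrows T (inv_ar T (Braid T a b)) (inv_ar T (inv_ar T (Braid T a b)))" for a b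
    using inverse_arrows_Braid_T[of a b] arg_cong[OF op_op_T, of "\<lambda>X. Braid X a b"] Braid_Ar_T[of a b]
    by (auto simp: inverse_arrows_def in_hom_set)
  have inv_typing: "Dom T (inv_ar T (Braid T a b)) = b + a" "Cod T (inv_ar T (Braid T a b)) = a + b" for a b
    using inverse_arrows_Braid_T[of a b] Braid_Ar_T[of a b] by (auto simp: inverse_arrows_def in_hom_set)
  show "braided_monoidal_functor T (op_cat C) (hat C F)" if F: "braided_monoidal_functor (op_cat T) C F"
  proof -
    have "braided_monoidal_functor (op_cat (op_cat T)) (op_cat C) (hat C F)"
      by (rule braided_monoidal_functor_hat[OF C _ _ _ _ _ _ _ _ _ _ _ F])
        (simp_all add: inv_Id_T inv inv_typing T_closed)
    then show ?thesis by (simp add: op_op_T)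
  qed
  show "braided_monoidal_functor (op_cat T) C (hat C F)" if F: "braided_monoidal_functor T (op_cat C) F"
  proof -
    have "braided_monoidal_functor (op_cat T) (op_cat (op_cat C)) (hat (op_cat C) F)"
      by (rule braided_monoidal_functor_hat[OF braided_monoidal_category_op_cat[OF C] _ _ _ _ _ _ _ _ _ _ _ F])
        (simp_all add: inv_Id_T inverse_arrows_Braid_T Braid_Ar_T T_closed)
    then show ?thesis
      unfolding hat_op_cat by (rule braided_monoidal_functor_op_op[OF C])
  qed
qed

text \<open>Components stay the same but point the other way in the opposite target. The conditions
  on unit and multiplication are rearranged by the invertible constraints.\<close>

lemma hat_transformation_iff:
  fixes C :: "('o, 'm) bmoncat" (structure)
  assumes "braided_monoidal_category C"
    and F: "braided_monoidal_functor (op_cat T) C F" and F': "braided_monoidal_functor (op_cat T) C F'"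
  shows "monoidal_transformation (op_cat T) C F F' \<alpha> \<longleftrightarrow> monoidal_transformation T (op_cat C) (hat C F') (hat C F) \<alpha>"
proof -
  interpret braided_monoidal_category C by fact
  have nat: "natural_transformation (op_cat T) C F F' \<alpha> \<longleftrightarrow> natural_transformation T (op_cat C) (hat C F') (hat C F) \<alpha>"
    by (auto simp: natural_transformation_def)
  have Ob: "omap F n \<in> Ob C" "omap F' n \<in> Ob C" for n
    using F F' by (auto simp: braided_monoidal_functor_def is_functor_def)
  have fm: "isom C (fmult F (a, b))" "Dom C (fmult F (a, b)) = omap F a \<odot> omap F b"
    "Cod C (fmult F (a, b)) = omap F (a + b)" "isom C (fmult F' (a, b))"
    "Dom C (fmult F' (a, b)) = omap F' a \<odot> omap F' b" "Cod C (fmult F' (a, b)) = omap F' (a + b)" for a b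
    using F F' by (auto simp: braided_monoidal_functor_def in_iso_set)
  have fu: "isom C (funit F)" "Dom C (funit F) = Unit C" "Cod C (funit F) = omap F 0"
    "isom C (funit F')" "Dom C (funit F') = Unit C" "Cod C (funit F') = omap F' 0"
    using F F' by (auto simp: braided_monoidal_functor_def in_iso_set)
  note [simp] = Ob fm fu isom_Ar[OF fm(1)] isom_Ar[OF fm(4)] isom_Ar[OF fu(1)] isom_Ar[OF fu(4)]
  have unit: "\<alpha> 0 \<cdot> funit F = funit F' \<longleftrightarrow> inv_ar C (funit F') \<cdot> \<alpha> 0 = inv_ar C (funit F)"
    if [simp]: "\<alpha> 0 \<in> Ar C" "Dom C (\<alpha> 0) = omap F 0" "Cod C (\<alpha> 0) = omap F' 0"
  proof
    assume eq: "\<alpha> 0 \<cdot> funit F = funit F'"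
    then have "\<alpha> 0 = funit F' \<cdot> inv_ar C (funit F)"
      using extend_right[OF eq, of "inv_ar C (funit F)"] by simp
    then show "inv_ar C (funit F') \<cdot> \<alpha> 0 = inv_ar C (funit F)" by simp
  next
    assume eq: "inv_ar C (funit F') \<cdot> \<alpha> 0 = inv_ar C (funit F)"
    have "\<alpha> 0 \<cdot> funit F = funit F' \<cdot> ((inv_ar C (funit F') \<cdot> \<alpha> 0) \<cdot> funit F)"
      by (simp add: cassoc)
    then show "\<alpha> 0 \<cdot> funit F = funit F'" by (simp add: eq)
  qed
  have mult: "\<alpha> (a + b) \<cdot> fmult F (a, b) = fmult F' (a, b) \<cdot> (\<alpha> a \<star> \<alpha> b) \<longleftrightarrow>
      inv_ar C (fmult F' (a, b)) \<cdot> \<alpha> (a + b) = (\<alpha> a \<star> \<alpha> b) \<cdot> inv_ar C (fmult F (a, b))"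
    if \<alpha> [simp]: "\<And>n. \<alpha> n \<in> Ar C" "\<And>n. Dom C (\<alpha> n) = omap F n" "\<And>n. Cod C (\<alpha> n) = omap F' n" for a b
  proof
    assume "\<alpha> (a + b) \<cdot> fmult F (a, b) = fmult F' (a, b) \<cdot> (\<alpha> a \<star> \<alpha> b)"
    then show "inv_ar C (fmult F' (a, b)) \<cdot> \<alpha> (a + b) = (\<alpha> a \<star> \<alpha> b) \<cdot> inv_ar C (fmult F (a, b))"
      using inv_conjugate[of "fmult F (a, b)" "fmult F' (a, b)" "\<alpha> a \<star> \<alpha> b" "\<alpha> (a + b)"] by simp
  next
    assume eq: "inv_ar C (fmult F' (a, b)) \<cdot> \<alpha> (a + b) = (\<alpha> a \<star> \<alpha> b) \<cdot> inv_ar C (fmult F (a, b))"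
    have "\<alpha> (a + b) \<cdot> fmult F (a, b) = fmult F' (a, b) \<cdot> ((inv_ar C (fmult F' (a, b)) \<cdot> \<alpha> (a + b)) \<cdot> fmult F (a, b))"
      by (simp add: cassoc)
    then show "\<alpha> (a + b) \<cdot> fmult F (a, b) = fmult F' (a, b) \<cdot> (\<alpha> a \<star> \<alpha> b)"
      unfolding eq by (simp add: cassoc)
  qed
  show ?thesis
  proof (cases "natural_transformation (op_cat T) C F F' \<alpha>")
    case True
    then have "\<alpha> n \<in> Ar C" "Dom C (\<alpha> n) = omap F n" "Cod C (\<alpha> n) = omap F' n" for n
      by (auto simp: natural_transformation_def in_hom_set)
    then show ?thesis using True nat unit mult by (simp add: monoidal_transformation_def)
  next
    case False
    then show ?thesis using nat by (simp add: monoidal_transformation_def)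
  qed
qed

definition Psi where
  "Psi C = \<lparr>omap = hat C, amap = (\<lambda>(F, F', \<alpha>). (hat C F', hat C F, \<alpha>))\<rparr>"

text \<open>\<open>hat\<close> is undone by applying it again and reverses transformations, hence
  the opposite on the right-hand side.\<close>

lemma weak_equivalence_Psi:
  fixes C :: "('o, 'm) bmoncat"
  assumes C: "braided_monoidal_category C"
    and Q: "\<And>F. braided_monoidal_functor (op_cat T) C F \<Longrightarrow> Q F \<longleftrightarrow> Q' (hat C F)"
  shows "weak_equivalence (Alg_on Q (op_cat T) C) (cat_op (Alg_on Q' T (op_cat C))) (Psi C)"
proof (rule weak_equivalence_isoI)
  interpret braided_monoidal_category C by fact
  have mC: "monoidal_category C" by (rule monoidal_category_axioms)
  have cC: "category C" by (rule category_axioms)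
  have mC': "monoidal_category (op_cat C)" by (rule monoidal_category_op_cat[OF mC])
  have cC': "category (op_cat C)" using mC' by (simp add: monoidal_category_def)
  let ?A = "Alg_on Q (op_cat T) C" and ?B = "Alg_on Q' T (op_cat C)"
  have ext: "extensional_functor (op_cat T) F \<longleftrightarrow> extensional_functor T (hat C F)" for F :: "(nat, nat \<times> nat \<times> (nat \<Rightarrow> nat) \<times> (nat \<Rightarrow> 'g) \<times> 'j, 'o, 'm) mfunctor"
    by (simp add: extensional_functor_def)
  have Ob_A: "F \<in> Ob ?A \<longleftrightarrow> braided_monoidal_functor (op_cat T) C F \<and> Q F \<and> extensional_functor (op_cat T) F" for F
    by (auto simp: Alg_on_simps extensional_def)
  have Ob_B: "F \<in> Ob ?B \<longleftrightarrow> braided_monoidal_functor T (op_cat C) F \<and> Q' F \<and> extensional_functor T F" for F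
    by (auto simp: Alg_on_simps extensional_def)
  have hat_Ob: "hat C F \<in> Ob ?B" if "F \<in> Ob ?A" for F
  proof -
    have F: "braided_monoidal_functor (op_cat T) C F" "Q F" "extensional_functor (op_cat T) F"
      using that unfolding Ob_A by blast+
    have "Q' (hat C F)" using Q[OF F(1)] F(2) by blast
    then show ?thesis unfolding Ob_B using hat_functor_iff(1)[OF C F(1)] ext[of F] F(3) by blast
  qed
  have onto: "\<exists>F\<in>Ob ?A. hat C F = F'" if F': "F' \<in> Ob ?B" for F'
  proof -
    have F'b: "braided_monoidal_functor T (op_cat C) F'" using F' by (simp add: Ob_B)
    have hh: "hat C (hat C F') = F'" using hat_hat[OF cC' _ F'b] by (simp add: hat_op_cat)
    have "braided_monoidal_functor (op_cat T) C (hat C F')" by (rule hat_functor_iff(2)[OF C F'b])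
    then have "hat C F' \<in> Ob ?A" using F' Q[of "hat C F'"] ext[of "hat C F'"] hh by (simp add: Ob_A Ob_B)
    then show ?thesis using hh by blast
  qed
  have Ar_iff: "(F, F', \<alpha>) \<in> Ar ?A \<longleftrightarrow> (hat C F', hat C F, \<alpha>) \<in> Ar ?B" if "F \<in> Ob ?A" "F' \<in> Ob ?A" for F F' \<alpha>
    using that hat_Ob[OF that(1)] hat_Ob[OF that(2)] hat_transformation_iff[OF C, of F F' \<alpha>]
    unfolding Alg_on_simps(2) by (simp add: Ob_A)
  show "category ?A" by (rule category_Alg_on[OF mC]) simp
  have cB: "category ?B" by (rule category_Alg_on[OF mC']) simp
  then show "category (cat_op ?B)" by (rule category.category_cat_op)
  show "is_functor ?A (cat_op ?B) (Psi C)"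
    unfolding is_functor_def
  proof (intro conjI ballI impI)
    fix F assume F: "F \<in> Ob ?A"
    show "omap (Psi C) F \<in> Ob (cat_op ?B)" using hat_Ob[OF F] by (simp add: Psi_def)
    show "amap (Psi C) (Id ?A F) = Id (cat_op ?B) (omap (Psi C) F)"
      by (simp add: Psi_def Alg_on_simps)
  next
    fix t assume t: "t \<in> Ar ?A"
    obtain F F' \<alpha> where t': "t = (F, F', \<alpha>)" by (metis prod_cases3)
    have FF': "F \<in> Ob ?A" "F' \<in> Ob ?A" using t unfolding t' Alg_on_simps(2) by blast+
    show "amap (Psi C) t \<in> hom_set (cat_op ?B) (omap (Psi C) (Dom ?A t)) (omap (Psi C) (Cod ?A t))"
      using Ar_iff[OF FF'] t by (simp add: t' Psi_def Alg_on_simps(3,4) in_hom_set)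
    fix s assume s: "s \<in> Ar ?A" "Cod ?A t = Dom ?A s"
    obtain F'' \<beta> where s': "s = (F', F'', \<beta>)" using s(2) by (cases s) (auto simp: t' Alg_on_simps)
    show "amap (Psi C) (s \<cdot>\<^bsub>?A\<^esub> t) = amap (Psi C) s \<cdot>\<^bsub>cat_op ?B\<^esub> amap (Psi C) t"
      by (simp add: t' s' Psi_def Alg_on_simps(6))
  qed
  show "f = g" if "f \<in> Ar ?A" "g \<in> Ar ?A" "Dom ?A f = Dom ?A g" "Cod ?A f = Cod ?A g" "amap (Psi C) f = amap (Psi C) g" for f g
    using that by (cases f; cases g) (simp add: Psi_def Alg_on_simps(3,4))
  show "\<exists>f\<in>hom_set ?A F F'. amap (Psi C) f = g"
    if FF': "F \<in> Ob ?A" "F' \<in> Ob ?A" and g: "g \<in> hom_set (cat_op ?B) (omap (Psi C) F) (omap (Psi C) F')" for F F' g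
  proof -
    obtain \<alpha> where g': "g = (hat C F', hat C F, \<alpha>)"
      using g by (cases g) (auto simp: in_hom_set Psi_def Alg_on_simps(3,4))
    then have "(F, F', \<alpha>) \<in> Ar ?A" using g Ar_iff[OF FF'] by (simp add: in_hom_set)
    then show ?thesis
      by (intro bexI[of _ "(F, F', \<alpha>)"]) (simp_all add: g' Psi_def in_hom_set Alg_on_simps(3,4))
  qed
  show "\<exists>F\<in>Ob ?A. omap (Psi C) F = F'" if "F' \<in> Ob (cat_op ?B)" for F'
    using onto[of F'] that by (simp add: Psi_def)
qed

end


section \<open>Comonoids\<close>

text \<open>The comonoid axioms place associator and unitors on one side; moving these isomorphisms
  across yields the monoid axioms of the opposite.\<close>

lemma is_comonoid_iff:
  fixes C :: "('o, 'm) bmoncat" (structure)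
  assumes "monoidal_category C"
  shows "is_comonoid C (x, \<delta>, \<epsilon>) \<longleftrightarrow> is_monoid (op_cat C) (x, \<delta>, \<epsilon>)"
proof (cases "x \<in> Ob C \<and> \<delta> \<in> hom_set C x (x \<odot> x) \<and> \<epsilon> \<in> hom_set C x (Unit C)")
  case True
  interpret monoidal_category C by fact
  have [simp]: "x \<in> Ob C" "\<delta> \<in> Ar C" "Dom C \<delta> = x" "Cod C \<delta> = x \<odot> x" "\<epsilon> \<in> Ar C" "Dom C \<epsilon> = x" "Cod C \<epsilon> = Unit C"
    using True by (auto simp: in_hom_set)
  have move: "l \<cdot> f = g \<longleftrightarrow> f = inv_ar C l \<cdot> g"
    if "isom C l" "f \<in> Ar C" "g \<in> Ar C" "Cod C f = Dom C l" "Cod C g = Cod C l" for l f g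
    using that by auto
  have 1: "Assoc C x x x \<cdot> ((\<delta> \<star> Id C x) \<cdot> \<delta>) = (Id C x \<star> \<delta>) \<cdot> \<delta> \<longleftrightarrow>
      (\<delta> \<star> Id C x) \<cdot> \<delta> = inv_ar C (Assoc C x x x) \<cdot> ((Id C x \<star> \<delta>) \<cdot> \<delta>)"
    by (rule move) simp_all
  have 2: "LUnit C x \<cdot> ((\<epsilon> \<star> Id C x) \<cdot> \<delta>) = Id C x \<longleftrightarrow> (\<epsilon> \<star> Id C x) \<cdot> \<delta> = inv_ar C (LUnit C x) \<cdot> Id C x"
    by (rule move) simp_all
  have 3: "RUnit C x \<cdot> ((Id C x \<star> \<epsilon>) \<cdot> \<delta>) = Id C x \<longleftrightarrow> (Id C x \<star> \<epsilon>) \<cdot> \<delta> = inv_ar C (RUnit C x) \<cdot> Id C x"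
    by (rule move) simp_all
  show ?thesis using 1 2 3 True by (simp add: is_comonoid_def is_monoid_def cassoc)
qed (auto simp: is_comonoid_def is_monoid_def)

section \<open>The category of comonoids\<close>

lemma Comon_simps:
  "M \<in> Ob (Comon C) \<longleftrightarrow> is_comonoid C M"
  "((x, \<delta>, \<epsilon>), (x', \<delta>', \<epsilon>'), f) \<in> Ar (Comon C) \<longleftrightarrow> is_comonoid C (x, \<delta>, \<epsilon>) \<and> is_comonoid C (x', \<delta>', \<epsilon>') \<and>
     f \<in> hom_set C x x' \<and> \<delta>' \<cdot>\<^bsub>C\<^esub> f = (f \<star>\<^bsub>C\<^esub> f) \<cdot>\<^bsub>C\<^esub> \<delta> \<and> \<epsilon>' \<cdot>\<^bsub>C\<^esub> f = \<epsilon>"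
  "Dom (Comon C) (M, M', f) = M" "Cod (Comon C) (M, M', f) = M'" "Id (Comon C) M = (M, M, Id C (fst M))"
  "(M', M'', g) \<cdot>\<^bsub>Comon C\<^esub> (M, N, f) = (M, M'', g \<cdot>\<^bsub>C\<^esub> f)"
  by (auto simp: Comon_def)

lemma Comon_Ar_iff:
  assumes "monoidal_category C"
  shows "(M, M', f) \<in> Ar (Comon C) \<longleftrightarrow> (M', M, f) \<in> Ar (Mon (op_cat C))"
  by (cases M; cases M') (auto simp: Comon_simps Mon_simps is_comonoid_iff[OF assms])

text \<open>Up to exchanging the recorded source and target of each arrow this is the opposite of
  \<open>Mon (op_cat C)\<close>, whose category axioms are transferred.\<close>

lemma category_Comon:
  assumes "monoidal_category C"
  shows "category (Comon C)"
proof -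
  interpret M: category "Mon (op_cat C)" by (intro category_Mon monoidal_category_op_cat assms)
  have Ob: "Ob (Comon C) = Ob (Mon (op_cat C))"
    using is_comonoid_iff[OF assms] by (auto simp: Comon_simps Mon_simps)
  have hom: "(M, M', f) \<in> hom_set (Comon C) a b \<longleftrightarrow> (M', M, f) \<in> hom_set (Mon (op_cat C)) b a" for M M' f a b
    by (auto simp: in_hom_set Comon_Ar_iff[OF assms] Comon_simps(3,4) Mon_simps(3,4))
  show ?thesis
  proof (unfold_locales, goal_cases)
    case (1 f)
    then show ?case using M.Cod_Ob[of "(fst (snd f), fst f, snd (snd f))"]
      by (cases f) (simp add: Comon_Ar_iff[OF assms] Ob Comon_simps(3) Mon_simps(4))
  next
    case (2 f)
    then show ?case using M.Dom_Ob[of "(fst (snd f), fst f, snd (snd f))"]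
      by (cases f) (simp add: Comon_Ar_iff[OF assms] Ob Comon_simps(4) Mon_simps(3))
  next
    case (3 a)
    then show ?case using M.Id_hom[of a] by (simp add: Ob Comon_simps(5) Mon_simps(5) hom)
  next
    case (4 f a b g c)
    then show ?case
      using M.Cmp_hom[of "(fst (snd g), fst g, snd (snd g))" c b "(fst (snd f), fst f, snd (snd f))" a]
      by (cases f; cases g) (simp add: hom Comon_simps(6) Mon_simps(6))
  next
    case (5 f a b)
    then show ?case
      using M.Id_Cmp[of "(fst (snd f), fst f, snd (snd f))" b a]
      by (cases f) (auto simp: Comon_simps(3-) Mon_simps(3-) in_hom_set Comon_Ar_iff[OF assms])
  next
    case (6 f a b)
    then show ?case
      using M.Cmp_Id[of "(fst (snd f), fst f, snd (snd f))" b a]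
      by (cases f) (auto simp: Comon_simps(3-) Mon_simps(3-) in_hom_set Comon_Ar_iff[OF assms])
  next
    case (7 f a b g c h d)
    then show ?case
      using M.Cmp_assoc[of "(fst (snd h), fst h, snd (snd h))" d c "(fst (snd g), fst g, snd (snd g))" b
        "(fst (snd f), fst f, snd (snd f))" a]
      by (cases f; cases g; cases h) (simp add: hom Comon_simps(6) Mon_simps(6))
  qed
qed


lemma gmonoid_data_cong:
  assumes "group G" "\<And>g. g \<in> carrier G \<Longrightarrow> \<rho> g = \<rho>' g"
  shows "gmonoid_data G C x \<mu> \<eta> \<rho> \<longleftrightarrow> gmonoid_data G C x \<mu> \<eta> \<rho>'"
proof -
  interpret group G by fact
  show ?thesis using assms(2) by (simp add: gmonoid_data_def)
qed

lemma gmonoid_ob_cong: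
  "(\<And>g. g \<in> carrier G \<Longrightarrow> \<rho> g = \<rho>' g) \<Longrightarrow> gmonoid_ob G M \<rho> = gmonoid_ob G M \<rho>'"
  by (auto simp: gmonoid_ob_def)

context group
begin

lemma ball_inv: "(\<forall>g\<in>carrier G. X (inv g)) \<longleftrightarrow> (\<forall>g\<in>carrier G. X g)"
  by (metis inv_closed inv_inv)

text \<open>A left action on a comonoid is a right action on the monoid in the opposite category, which
  the inversion of the group turns into a left one.\<close>

lemma gmonoid_ob_in_GComon:
  assumes "monoidal_category C"
  shows "gmonoid_ob G (x, \<delta>, \<epsilon>) \<rho> \<in> Ob (GComon G C) \<longleftrightarrow> gmonoid_data G (op_cat C) x \<delta> \<epsilon> (\<lambda>g. \<rho> (inv g))"
proof -
  let ?X = "\<lambda>g. \<rho> g \<in> hom_set C x x \<and> \<delta> \<cdot>\<^bsub>C\<^esub> \<rho> g = (\<rho> g \<star>\<^bsub>C\<^esub> \<rho> g) \<cdot>\<^bsub>C\<^esub> \<delta> \<and> \<epsilon> \<cdot>\<^bsub>C\<^esub> \<rho> g = \<epsilon>"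
  have "gmonoid_ob G (x, \<delta>, \<epsilon>) \<rho> \<in> Ob (GComon G C) \<longleftrightarrow> is_comonoid C (x, \<delta>, \<epsilon>) \<and> (\<forall>g\<in>carrier G. ?X g) \<and>
      \<rho> \<one> = Id C x \<and> (\<forall>g\<in>carrier G. \<forall>h\<in>carrier G. \<rho> (g \<otimes> h) = \<rho> g \<cdot>\<^bsub>C\<^esub> \<rho> h)"
    by (auto simp: GComon_def functor_category_simps is_functor_def extensional_functor_def gmonoid_ob_def
      in_hom_set Comon_simps)
  moreover have "(\<forall>g\<in>carrier G. \<forall>h\<in>carrier G. \<rho> (g \<otimes> h) = \<rho> g \<cdot>\<^bsub>C\<^esub> \<rho> h) \<longleftrightarrow>
      (\<forall>g\<in>carrier G. \<forall>h\<in>carrier G. \<rho> (inv (g \<otimes> h)) = \<rho> (inv h) \<cdot>\<^bsub>C\<^esub> \<rho> (inv g))"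
  proof
    assume *: "\<forall>g\<in>carrier G. \<forall>h\<in>carrier G. \<rho> (g \<otimes> h) = \<rho> g \<cdot>\<^bsub>C\<^esub> \<rho> h"
    then show "\<forall>g\<in>carrier G. \<forall>h\<in>carrier G. \<rho> (inv (g \<otimes> h)) = \<rho> (inv h) \<cdot>\<^bsub>C\<^esub> \<rho> (inv g)"
      by (simp add: inv_mult_group)
  next
    assume *: "\<forall>g\<in>carrier G. \<forall>h\<in>carrier G. \<rho> (inv (g \<otimes> h)) = \<rho> (inv h) \<cdot>\<^bsub>C\<^esub> \<rho> (inv g)"
    show "\<forall>g\<in>carrier G. \<forall>h\<in>carrier G. \<rho> (g \<otimes> h) = \<rho> g \<cdot>\<^bsub>C\<^esub> \<rho> h"
    proof (intro ballI)
      fix g h assume gh: "g \<in> carrier G" "h \<in> carrier G"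
      then have "\<rho> (inv (inv h \<otimes> inv g)) = \<rho> (inv (inv g)) \<cdot>\<^bsub>C\<^esub> \<rho> (inv (inv h))"
        using * by simp
      then show "\<rho> (g \<otimes> h) = \<rho> g \<cdot>\<^bsub>C\<^esub> \<rho> h" using gh by (simp add: inv_mult_group)
    qed
  qed
  ultimately show ?thesis
    unfolding gmonoid_data_def is_comonoid_iff[OF assms] ball_inv[of ?X, symmetric] by (simp add: conj_assoc)
qed

section \<open>Comparing actions on comonoids with actions on opposite monoids\<close>

definition Theta_ob where
  "Theta_ob H = \<lparr>omap = omap H, amap = \<lambda>g\<in>carrier G. amap H (inv g)\<rparr>"

definition Theta where
  "Theta = \<lparr>omap = Theta_ob, amap = (\<lambda>(H, H', \<alpha>). (Theta_ob H', Theta_ob H,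
     \<lambda>_::unit. (fst (snd (\<alpha> ())), fst (\<alpha> ()), snd (snd (\<alpha> ())))))\<rparr>"

lemma Theta_gmonoid_ob: "Theta_ob (gmonoid_ob G M \<rho>) = gmonoid_ob G M (\<lambda>g. \<rho> (inv g))"
  by (auto simp: Theta_ob_def gmonoid_ob_def)

lemma Theta_Ar_iff:
  assumes C: "monoidal_category C"
    and M: "gmonoid_ob G M \<rho> \<in> Ob (GMon G (op_cat C))" "gmonoid_ob G M' \<rho>' \<in> Ob (GMon G (op_cat C))"
    and M': "gmonoid_ob G M (\<lambda>g. \<rho> (inv g)) \<in> Ob (GComon G C)" "gmonoid_ob G M' (\<lambda>g. \<rho>' (inv g)) \<in> Ob (GComon G C)"
  shows "(gmonoid_ob G M' (\<lambda>g. \<rho>' (inv g)), gmonoid_ob G M (\<lambda>g. \<rho> (inv g)), \<lambda>_. (M', M, f)) \<in> Ar (GComon G C) \<longleftrightarrow>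
    (gmonoid_ob G M \<rho>, gmonoid_ob G M' \<rho>', \<lambda>_. (M, M', f)) \<in> Ar (GMon G (op_cat C))"
proof -
  have "(gmonoid_ob G M' (\<lambda>g. \<rho>' (inv g)), gmonoid_ob G M (\<lambda>g. \<rho> (inv g)), \<lambda>_. (M', M, f)) \<in> Ar (GComon G C) \<longleftrightarrow>
      (M', M, f) \<in> Ar (Comon C) \<and> (\<forall>g\<in>carrier G. f \<cdot>\<^bsub>C\<^esub> \<rho>' (inv g) = \<rho> (inv g) \<cdot>\<^bsub>C\<^esub> f)"
    using M' by (simp add: GComon_def functor_category_simps(2) natural_transformation_def)
      (auto simp: gmonoid_ob_def in_hom_set Comon_simps(3-))
  also have "\<dots> \<longleftrightarrow> (M, M', f) \<in> Ar (Mon (op_cat C)) \<and> (\<forall>g\<in>carrier G. f \<cdot>\<^bsub>C\<^esub> \<rho>' g = \<rho> g \<cdot>\<^bsub>C\<^esub> f)"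
    unfolding Comon_Ar_iff[OF C] ball_inv[of "\<lambda>g. f \<cdot>\<^bsub>C\<^esub> \<rho>' g = \<rho> g \<cdot>\<^bsub>C\<^esub> f"] ..
  also have "\<dots> \<longleftrightarrow> (gmonoid_ob G M \<rho>, gmonoid_ob G M' \<rho>', \<lambda>_. (M, M', f)) \<in> Ar (GMon G (op_cat C))"
    using M by (simp add: GMon_def functor_category_simps(2) natural_transformation_def)
      (auto simp: gmonoid_ob_def in_hom_set Mon_simps(3-))
  finally show ?thesis .
qed

lemma GComon_simps:
  "Dom (GComon G C) (H, H', \<alpha>) = H" "Cod (GComon G C) (H, H', \<alpha>) = H'"
  "Id (GComon G C) (gmonoid_ob G M \<rho>) = (gmonoid_ob G M \<rho>, gmonoid_ob G M \<rho>, \<lambda>_. (M, M, Id C (fst M)))"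
  "(H', H'', \<lambda>_. (M', M'', g)) \<cdot>\<^bsub>GComon G C\<^esub> (H, K, \<lambda>_. (M, N, f)) = (H, H'', \<lambda>_. (M, M'', g \<cdot>\<^bsub>C\<^esub> f))"
  by (auto simp: GComon_def functor_category_simps gmonoid_ob_def Comon_simps fun_eq_iff)

lemma GComon_ObE:
  assumes "H \<in> Ob (GComon G C)"
  obtains M \<rho> where "H = gmonoid_ob G M \<rho>"
proof -
  have H: "is_functor (one_object_category G) (Comon C) H" "amap H \<in> extensional (carrier G)"
    using assms by (auto simp: GComon_def functor_category_simps extensional_functor_def)
  define M where "M = omap H ()"
  define \<rho> where "\<rho> g = snd (snd (amap H g))" for g
  have "amap H g = (M, M, \<rho> g)" if "g \<in> carrier G" for g
  proof -
    have "amap H g \<in> hom_set (Comon C) M M" using H(1) that by (auto simp: is_functor_def M_def)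
    then show ?thesis by (cases "amap H g") (auto simp: \<rho>_def in_hom_set Comon_simps)
  qed
  then have "amap H = (\<lambda>g\<in>carrier G. (M, M, \<rho> g))"
    using H(2) by (intro extensionalityI[OF H(2)]) auto
  moreover have "omap H = (\<lambda>_. M)" by (auto simp: fun_eq_iff M_def)
  ultimately have "H = gmonoid_ob G M \<rho>" by (cases H) (simp add: gmonoid_ob_def)
  then show ?thesis by (rule that)
qed

lemma GComon_ArE:
  assumes "(gmonoid_ob G M \<rho>, gmonoid_ob G M' \<rho>', \<alpha>) \<in> Ar (GComon G C)"
  obtains f where "\<alpha> = (\<lambda>_. (M, M', f))"
proof -
  have "\<alpha> () \<in> hom_set (Comon C) M M'"
    using assms by (auto simp: GComon_def functor_category_simps natural_transformation_def gmonoid_ob_def)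
  then obtain f where "\<alpha> () = (M, M', f)" by (cases "\<alpha> ()") (auto simp: in_hom_set Comon_simps(3,4))
  then show ?thesis by (intro that[of f]) (auto simp: fun_eq_iff)
qed

text \<open>Inversion of group elements is an involution that reverses products; combined with the
  reversal of homomorphisms it gives a bijection on objects and on arrows.\<close>

lemma weak_equivalence_Theta:
  assumes C: "monoidal_category C"
  shows "weak_equivalence (cat_op (GMon G (op_cat C))) (GComon G C) Theta"
proof (rule weak_equivalence_isoI)
  let ?A = "GMon G (op_cat C)" and ?B = "GComon G C"
  have cA: "category ?A" by (rule category_GMon[OF is_group monoidal_category_op_cat[OF C]])
  then show "category (cat_op ?A)" by (rule category.category_cat_op)
  show "category ?B"
    unfolding GComon_def by (intro category_functor_category category_one_object category_Comon C is_group)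
  have Ob: "gmonoid_ob G M \<rho> \<in> Ob ?A \<longleftrightarrow> gmonoid_ob G M (\<lambda>g. \<rho> (inv g)) \<in> Ob ?B" for M \<rho>
  proof -
    obtain x \<delta> \<epsilon> where M: "M = (x, \<delta>, \<epsilon>)" by (metis prod_cases3)
    show ?thesis
      unfolding M gmonoid_ob_in_GMon[OF is_group] gmonoid_ob_in_GComon[OF C]
      by (rule gmonoid_data_cong[OF is_group]) simp
  qed
  have ObA: "\<exists>M \<rho>. H = gmonoid_ob G M \<rho>" if "H \<in> Ob ?A" for H
    using GMon_ObE[OF that is_group] by metis
  show "is_functor (cat_op ?A) ?B Theta"
    unfolding is_functor_def
  proof (intro conjI ballI impI)
    fix H assume H: "H \<in> Ob (cat_op ?A)"
    then obtain M \<rho> where H': "H = gmonoid_ob G M \<rho>" using ObA unfolding cat_op_simps(1) by blast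
    show "omap Theta H \<in> Ob ?B" using H Ob[of M \<rho>] by (simp add: Theta_def H' Theta_gmonoid_ob)
    show "amap Theta (Id (cat_op ?A) H) = Id ?B (omap Theta H)"
      by (simp add: Theta_def H' Theta_gmonoid_ob GMon_simps GComon_simps)
  next
    fix t assume t: "t \<in> Ar (cat_op ?A)"
    obtain H H' \<alpha> where t': "t = (H, H', \<alpha>)" by (metis prod_cases3)
    have HH': "H \<in> Ob ?A" "H' \<in> Ob ?A" using t by (auto simp: t' GMon_def functor_category_simps(2))
    obtain M \<rho> M' \<rho>' where H: "H = gmonoid_ob G M \<rho>" "H' = gmonoid_ob G M' \<rho>'" using ObA HH' by metis
    obtain f where f: "\<alpha> = (\<lambda>_. (M, M', f))" using t GMon_ArE unfolding t' H cat_op_simps by blast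
    have Ob': "gmonoid_ob G M (\<lambda>g. \<rho> (inv g)) \<in> Ob ?B" "gmonoid_ob G M' (\<lambda>g. \<rho>' (inv g)) \<in> Ob ?B"
      using HH' Ob unfolding H by blast+
    show "amap Theta t \<in> hom_set ?B (omap Theta (Dom (cat_op ?A) t)) (omap Theta (Cod (cat_op ?A) t))"
      using t Theta_Ar_iff[OF C HH'[unfolded H] Ob', of f]
      by (simp add: t' H f Theta_def Theta_gmonoid_ob in_hom_set GMon_simps GComon_simps)
    fix s assume s: "s \<in> Ar (cat_op ?A)" "Cod (cat_op ?A) t = Dom (cat_op ?A) s"
    obtain H'' \<beta> where s': "s = (H'', H, \<beta>)" using s(2) by (cases s) (auto simp: t' GMon_simps)
    have "H'' \<in> Ob ?A" using s(1) by (auto simp: s' GMon_def functor_category_simps(2))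
    then obtain M'' \<rho>'' where H'': "H'' = gmonoid_ob G M'' \<rho>''" using ObA by metis
    obtain g where g: "\<beta> = (\<lambda>_. (M'', M, g))" using s(1) GMon_ArE unfolding s' H H'' cat_op_simps by blast
    show "amap Theta (s \<cdot>\<^bsub>cat_op ?A\<^esub> t) = amap Theta s \<cdot>\<^bsub>?B\<^esub> amap Theta t"
      by (simp add: t' s' f g Theta_def GMon_simps GComon_simps)
  qed
  show "f = g" if "f \<in> Ar (cat_op ?A)" "g \<in> Ar (cat_op ?A)" and fg: "Dom (cat_op ?A) f = Dom (cat_op ?A) g"
    "Cod (cat_op ?A) f = Cod (cat_op ?A) g" "amap Theta f = amap Theta g" for f g
  proof -
    obtain H H' \<alpha> where f: "f = (H, H', \<alpha>)" by (metis prod_cases3)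
    obtain \<beta> where g: "g = (H, H', \<beta>)" using fg(1,2) by (cases g) (auto simp: f GMon_simps)
    have "\<alpha> () = \<beta> ()" using fg(3) by (simp add: f g Theta_def fun_eq_iff prod_eq_iff)
    then show ?thesis by (simp add: f g fun_eq_iff)
  qed
  show "\<exists>f\<in>hom_set (cat_op ?A) H H'. amap Theta f = g"
    if HH': "H \<in> Ob (cat_op ?A)" "H' \<in> Ob (cat_op ?A)" and g: "g \<in> hom_set ?B (omap Theta H) (omap Theta H')" for H H' g
  proof -
    obtain M \<rho> M' \<rho>' where H: "H = gmonoid_ob G M \<rho>" "H' = gmonoid_ob G M' \<rho>'" using ObA HH' by (metis cat_op_simps(1))
    have ob: "gmonoid_ob G M \<rho> \<in> Ob ?A" "gmonoid_ob G M' \<rho>' \<in> Ob ?A" using HH' H by simp_all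
    have ob': "gmonoid_ob G M (\<lambda>g. \<rho> (inv g)) \<in> Ob ?B" "gmonoid_ob G M' (\<lambda>g. \<rho>' (inv g)) \<in> Ob ?B"
      using ob Ob by blast+
    obtain \<alpha> where g': "g = (gmonoid_ob G M (\<lambda>g. \<rho> (inv g)), gmonoid_ob G M' (\<lambda>g. \<rho>' (inv g)), \<alpha>)"
      using g by (cases g) (auto simp: in_hom_set Theta_def H Theta_gmonoid_ob GComon_simps)
    have g_Ar: "g \<in> Ar ?B" using g by (simp add: in_hom_set)
    obtain f where f: "\<alpha> = (\<lambda>_. (M, M', f))" using GComon_ArE[OF g_Ar[unfolded g']] by blast
    have "(H', H, \<lambda>_. (M', M, f)) \<in> Ar ?A"
      using Theta_Ar_iff[OF C ob(2,1) ob'(2,1), of f] g_Ar by (simp add: g' f H)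
    then show ?thesis
      by (intro bexI[of _ "(H', H, \<lambda>_. (M', M, f))"])
        (simp_all add: in_hom_set g' f Theta_def H Theta_gmonoid_ob GMon_simps)
  qed
  show "\<exists>H\<in>Ob (cat_op ?A). omap Theta H = K" if K: "K \<in> Ob ?B" for K
  proof -
    obtain M \<rho> where K': "K = gmonoid_ob G M \<rho>" using GComon_ObE[OF K] by metis
    have eq: "gmonoid_ob G M (\<lambda>g. \<rho> (inv (inv g))) = gmonoid_ob G M \<rho>" by (rule gmonoid_ob_cong) simp
    have "gmonoid_ob G M (\<lambda>g. \<rho> (inv g)) \<in> Ob (cat_op ?A)" using Ob[of M "\<lambda>g. \<rho> (inv g)"] K K' eq by simp
    then show ?thesis using eq K' by (intro bexI[of _ "gmonoid_ob G M (\<lambda>g. \<rho> (inv g))"]) (simp_all add: Theta_def Theta_gmonoid_ob)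
  qed
qed

end


section \<open>The four equivalences\<close>

text \<open>The single property of a target on which the choice between permutations and braids has
  an influence, quantified over all coherent families.\<close>

definition realizable :: "(nat \<Rightarrow> bword \<Rightarrow> 'j) \<Rightarrow> ('o, 'm) bmoncat \<Rightarrow> bool" where
  "realizable cls C \<longleftrightarrow> (\<forall>p can u n v w. coherent_family C p can u \<longrightarrow> v \<in> bwords n \<longrightarrow> w \<in> bwords n \<longrightarrow>
     cls n v = cls n w \<longrightarrow>
     prob.act (coherent_family.fam_cat C p can) n v = prob.act (coherent_family.fam_cat C p can) n w)"

lemma realizable_braid: "realizable bclass C"
  unfolding realizable_def
proof (intro allI impI)
  fix p :: "nat \<Rightarrow> 'a" and can u n v w
  assume fam: "coherent_family C p can u" and "v \<in> bwords n" "w \<in> bwords n" "bclass n v = bclass n w"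
  then have "braid_eq n v w" by (intro bclass_eqD)
  then show "prob.act (coherent_family.fam_cat C p can) n v = prob.act (coherent_family.fam_cat C p can) n w"
    using prob.act_braid_eq[OF coherent_family.prob_fam_cat[OF fam]] by blast
qed

text \<open>Coxeter's presentation reduces equal permutations to braid relations and sign changes;
  the latter leave the action unchanged because the braiding of \<open>p 1\<close> with itself is an
  involution.\<close>

lemma realizable_perm:
  fixes C :: "('o, 'm) bmoncat" (structure)
  assumes "symmetric_monoidal_category C"
  shows "realizable (\<lambda>n. word_perm) C"
  unfolding realizable_def
proof (intro allI impI)
  fix p :: "nat \<Rightarrow> 'o" and can u n v w
  assume "coherent_family C p can u" and vw: "v \<in> bwords n" "w \<in> bwords n" "word_perm v = word_perm w"
  then interpret fam: coherent_family C p can u by simp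
  interpret sym: symmetric_monoidal_category C by fact
  have "fam.br 1 1 \<cdot> fam.br 1 1 = can 1 1 \<cdot> ((Braid C (p 1) (p 1) \<cdot> Braid C (p 1) (p 1)) \<cdot> inv_ar C (can 1 1))"
    by (simp add: fam.br_def fam.cassoc)
  also have "\<dots> = Id C (p 2)" using sym.symmetry[of "p 1" "p 1"] fam.Cod_can[of 1 1] by simp
  finally have "Braid fam.fam_cat 1 1 \<cdot>\<^bsub>fam.fam_cat\<^esub> Braid fam.fam_cat 1 1 = Id fam.fam_cat 2" by simp
  then show "prob.act fam.fam_cat n v = prob.act fam.fam_cat n w"
    by (rule prob.act_sym_eq[OF fam.prob_fam_cat _ word_perm_eq_imp_sym_eq[OF vw]])
qed

context strand_group
begin

lemma algebra_setup_T: "braided_monoidal_category C \<Longrightarrow> algebra_setup J cls G C"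
  by (intro algebra_setup.intro strand_group_axioms)

lemma equivalent_Alg_on:
  fixes C :: "('o, 'm) bmoncat"
  assumes C: "braided_monoidal_category C" and "realizable cls C"
    and Q: "\<And>x F. x \<in> Ob C \<Longrightarrow> omap F = monoidal_category.pow C x \<Longrightarrow>
      (\<And>a b. fmult F (a, b) = monoidal_category.pow_can C x a b) \<Longrightarrow> funit F = Id C (Unit C) \<Longrightarrow> Q F"
  shows "weak_equivalence (Alg_on Q T C) (GMon G C) (algebra_setup.Phi cls G C)"
proof -
  interpret algebra_setup J cls G C by (rule algebra_setup_T[OF C])
  have "prob.act (coherent_family.fam_cat C p can) n v = prob.act (coherent_family.fam_cat C p can) n w"
    if "coherent_family C p can u" "v \<in> bwords n" "w \<in> bwords n" "cls n v = cls n w" for p can u n v w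
    using assms(2) that unfolding realizable_def by blast
  note act = this
  show ?thesis by (rule weak_equivalence_Phi, erule (3) act) (rule Q)
qed

lemma strict_functor_pow:
  fixes C :: "('o, 'm) bmoncat"
  assumes C: "braided_monoidal_category C" and strict: "strict_monoidal C" and x: "x \<in> Ob C"
    and F: "omap F = monoidal_category.pow C x" "\<And>a b. fmult F (a, b) = monoidal_category.pow_can C x a b"
      "funit F = Id C (Unit C)"
  shows "strict_functor T C F"
proof -
  interpret braided_monoidal_category C by fact
  show ?thesis using strict_pow[OF strict x] F by (simp add: strict_functor_def)
qed

theorem equivalent_Alg:
  assumes "braided_monoidal_category C" "realizable cls C"
  shows "equivalent_categories (Alg T C) (GMon G C)"
  unfolding Alg_def using assms by (intro weak_equivalence_imp_equivalent[OF equivalent_Alg_on]) auto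

theorem equivalent_strict_Alg:
  assumes "braided_monoidal_category C" "realizable cls C" "strict_monoidal C"
  shows "equivalent_categories (strict_Alg T C) (GMon G C)"
  unfolding strict_Alg_def
  using assms by (intro weak_equivalence_imp_equivalent[OF equivalent_Alg_on] strict_functor_pow) auto

text \<open>Algebras of the opposite are the opposite of algebras in \<open>op_cat C\<close>, hence
  of monoids with action there, and these are comonoids with action in \<open>C\<close>: two
  reversals that cancel.\<close>

lemma equivalent_Alg_on_op:
  assumes C: "braided_monoidal_category C"
    and Q: "\<And>F. braided_monoidal_functor (op_cat T) C F \<Longrightarrow> Q F \<longleftrightarrow> Q' (hat C F)"
    and weq: "weak_equivalence (Alg_on Q' T (op_cat C)) (GMon G (op_cat C)) K"
  shows "equivalent_categories (Alg_on Q (op_cat T) C) (GComon G C)"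
proof -
  have "monoidal_category C" using C by (simp add: braided_monoidal_category_def)
  then have "weak_equivalence (cat_op (GMon G (op_cat C))) (GComon G C) G.Theta"
    by (rule G.weak_equivalence_Theta)
  moreover have "weak_equivalence (Alg_on Q (op_cat T) C) (cat_op (Alg_on Q' T (op_cat C))) (Psi C)"
    using C Q by (rule weak_equivalence_Psi)
  ultimately show ?thesis
    by (rule weak_equivalence_imp_equivalent[OF weak_equivalence_comp[OF
      weak_equivalence_comp[OF _ weak_equivalence_op[OF weq]]], rotated])
qed

theorem equivalent_Alg_op:
  assumes C: "braided_monoidal_category C" and "realizable cls (op_cat C)"
  shows "equivalent_categories (Alg (op_cat T) C) (GComon G C)"
  unfolding Alg_def
  by (rule equivalent_Alg_on_op[OF C _ equivalent_Alg_on[OF braided_monoidal_category_op_cat[OF C] assms(2)]]) auto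

theorem equivalent_strict_Alg_op:
  assumes C: "braided_monoidal_category C" and R: "realizable cls (op_cat C)" and strict: "strict_monoidal C"
  shows "equivalent_categories (strict_Alg (op_cat T) C) (GComon G C)"
  unfolding strict_Alg_def
proof (rule equivalent_Alg_on_op[OF C])
  interpret braided_monoidal_category C by fact
  show "weak_equivalence (Alg_on (strict_functor T (op_cat C)) T (op_cat C)) (GMon G (op_cat C))
      (algebra_setup.Phi cls G (op_cat C))"
    by (intro equivalent_Alg_on braided_monoidal_category_op_cat[OF C] R strict_functor_pow
      strict_monoidal_op_cat[OF monoidal_category_axioms strict]) simp_all
  \<comment> \<open>Strictness survives the passage to opposites because the inverse of an identity
    is that identity.\<close>
  show "strict_functor (op_cat T) C F \<longleftrightarrow> strict_functor T (op_cat C) (hat C F)"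
    if F: "braided_monoidal_functor (op_cat T) C F" for F
  proof -
    have ob: "omap F n \<in> Ob C" for n using F by (simp add: braided_monoidal_functor_def is_functor_def)
    have inv_iff: "inv_ar C f = Id C a \<longleftrightarrow> f = Id C a" if "isom C f" "a \<in> Ob C" for f a
      using that by (metis inv_Id inv_inv)
    have "isom C (fmult F (a, b))" "isom C (funit F)" for a b
      using F by (auto simp: braided_monoidal_functor_def in_iso_set)
    then show ?thesis by (simp add: strict_functor_def inv_iff ob)
  qed
qed

end

theorem proposition4p1:
  fixes S :: "('o, 'm) bmoncat" and B :: "('p, 'n) bmoncat" and G :: "'g monoid"
  assumes "symmetric_monoidal_category S" and "braided_monoidal_category B" and "group G"
  shows
    "equivalent_categories (Alg (DPG G) S) (GMon G S) \<and>
     equivalent_categories (Alg (DBG G) B) (GMon G B) \<and>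
     equivalent_categories (Alg (op_cat (DPG G)) S) (GComon G S) \<and>
     equivalent_categories (Alg (op_cat (DBG G)) B) (GComon G B) \<and>
     (strict_monoidal S \<longrightarrow>
        equivalent_categories (strict_Alg (DPG G) S) (GMon G S) \<and>
        equivalent_categories (strict_Alg (op_cat (DPG G)) S) (GComon G S)) \<and>
     (strict_monoidal B \<longrightarrow>
        equivalent_categories (strict_Alg (DBG G) B) (GMon G B) \<and>
        equivalent_categories (strict_Alg (op_cat (DBG G)) B) (GComon G B))"
proof -
  interpret P: strand_group perm_strands "\<lambda>n. word_perm" G
    by (intro strand_group.intro perm.strand_family_axioms assms(3))
  interpret Q: strand_group braid_strands bclass G
    by (intro strand_group.intro braid.strand_family_axioms assms(3))
  have S: "braided_monoidal_category S"
    using assms(1) by (simp add: symmetric_monoidal_category_def)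
  \<comment> \<open>For comonoids the strands act in the opposite of the target, which is again
    symmetric.\<close>
  note perm = realizable_perm[OF assms(1)] realizable_perm[OF symmetric_monoidal_category_op_cat[OF assms(1)]]
  show ?thesis
    using P.equivalent_Alg[OF S perm(1)] P.equivalent_Alg_op[OF S perm(2)]
      P.equivalent_strict_Alg[OF S perm(1)] P.equivalent_strict_Alg_op[OF S perm(2)]
      Q.equivalent_Alg[OF assms(2) realizable_braid] Q.equivalent_Alg_op[OF assms(2) realizable_braid]
      Q.equivalent_strict_Alg[OF assms(2) realizable_braid] Q.equivalent_strict_Alg_op[OF assms(2) realizable_braid]
    by blast
qed

end
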